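(* The following decision problem is $\mathrm{NP}$-complete (under polynomial-time many-one reductions): given a formula $F$, decide whether $F$ is provable in $\mathbf{CL5}^-$.
   Context: Formulas: built from (non-logical) atoms, taken from a countably infinite set, using $\neg$, $\wedge$, $\vee$, where $\neg$ may be applied only to atoms (no logical constants). For a compound formula $F$, $\neg F$ abbreviates the De Morgan dual: $\neg\neg P$ is $P$, $\neg(A\wedge B)$ is $\neg A\vee\neg B$, $\neg(A\vee B)$ is $\neg A\wedge\neg B$. Cirquents: for $k\ge 0$, a $k$-ary cirquent is a pair $C=(\mathrm{St},\mathrm{Pl})$ where the pool $\mathrm{Pl}=\langle F_1,\dots,F_k\rangle$ is a sequence of formulas (repetitions allowed; each occurrence is called an oformula) and the structure $\mathrm{St}=\langle\Gamma_1,\dots,\Gamma_m\rangle$, $m\ge 0$, is a sequence of subsets of $\{1,\dots,k\}$ (repetitions allowed; each occurrence is called an ogroup). Ogroup $\Gamma_j$ contains oformula $F_i$ (there is an arc between them) iff $i\in\Gamma_j$. Two oformulas (or ogroups) are adjacent if they are consecutive in the pool (or structure). Merging two adjacent ogroups $\Gamma,\Delta$ means replacing them by the single ogroup $\Gamma\cup\Delta$. Merging two adjacent oformulas $F,G$ into $H$ means replacing them by the single oformula $H$, which is contained in exactly those ogroups that contained $F$ or $G$. The rules of $\mathbf{CL5}^-$ are: (A) Axioms (no premises): the empty cirquent (empty pool and empty structure); and, for any formula $F$, the identity axiom, i.e. the cirquent with pool $\langle\neg F,F\rangle$ and structure $\langle\{1,2\}\rangle$. (M) Mix (two premises): the conclusion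 is obtained by placing the two premises side by side (concatenating pools and structures, keeping arcs). (E) Exchange (one premise): swap two adjacent oformulas (preserving all arcs), or swap two adjacent ogroups (preserving all arcs). (W) Weakening (one premise): ogroup weakening adds one new arc between an existing ogroup and an existing oformula; pool weakening inserts a new oformula (contained in no ogroup) at any position of the pool. ($\vee$) $\vee$-introduction (one premise): merge two adjacent oformulas $F$ and $G$ ($G$ immediately after $F$) into $F\vee G$. ($\wedge$) $\wedge$-introduction (one premise): the premise has adjacent oformulas $F$, $G$ ($G$ immediately after $F$) such that no ogroup contains both, every ogroup containing $F$ is immediately followed by an ogroup containing $G$, and every ogroup containing $G$ is immediately preceded by an ogroup containing $F$; the conclusion is obtained by merging each ogroup containing $F$ with the ogroup containing $G$ that immediately follows it, and then merging $F$ and $G$ into $F\wedge G$. A $\mathbf{CL5}^-$ proof of a cirquent $C$ is a (finite) tree of cirquents with root $C$ in which each node follows from its children by one of the rules above. A formula $F$ is provable in $\mathbf{CL5}^-$ if there is a proof of the cirquent with pool $\langle F\rangle$ and structure $\langle\{1\}\rangle$. Formulas are encoded as strings over a finite alphabet in a standard way. *)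

theory Defs
  imports "HOL-Combinatorics.Transposition" "HOL-Computational_Algebra.Polynomial"
begin

section \<open>Formulas\<close>

text \<open>Atoms are natural numbers, and negation occurs only in literals.\<close>

datatype formula =
    Atom nat
  | NegAtom nat
  | Conj formula formula
  | Disj formula formula

fun neg :: "formula \<Rightarrow> formula" where
  "neg (Atom a) = NegAtom a"
| "neg (NegAtom a) = Atom a"
| "neg (Conj A B) = Disj (neg A) (neg B)"
| "neg (Disj A B) = Conj (neg A) (neg B)"


section \<open>Cirquents and the calculus CL5 without duplication\<close>

text \<open>
  A cirquent is a pair of its structure (the sequence of ogroups) and its pool (the sequence of
  oformulas). The oformulas of a pool of length \<open>k\<close> are numbered from \<open>0\<close>, so that ogroups are
  subsets of \<open>{..<k}\<close>. All cirquents generated by the rules below satisfy this constraint.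
\<close>

type_synonym ogroup = "nat set"
type_synonym cirquent = "ogroup list \<times> formula list"

definition shift_from :: "nat \<Rightarrow> nat \<Rightarrow> nat" where
  "shift_from n i = (if i < n then i else Suc i)"

text \<open>Renumbering of the pool when the oformulas number \<open>n\<close> and \<open>Suc n\<close> are merged.\<close>

definition collapse :: "nat \<Rightarrow> nat \<Rightarrow> nat" where
  "collapse n i = (if i \<le> n then i else i - 1)"

text \<open>Merge each ogroup containing the oformula number \<open>n\<close> with the ogroup right after it.\<close>

fun merge_ogroups :: "nat \<Rightarrow> ogroup list \<Rightarrow> ogroup list" where
  "merge_ogroups n (\<Gamma> # \<Delta> # S) =
     (if n \<in> \<Gamma> then (\<Gamma> \<union> \<Delta>) # merge_ogroups n S else \<Gamma> # merge_ogroups n (\<Delta> # S))"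
| "merge_ogroups n [\<Gamma>] = [\<Gamma>]"
| "merge_ogroups n [] = []"

inductive CL5m :: "cirquent \<Rightarrow> bool" where
  empty_axiom: "CL5m ([], [])"
| identity_axiom: "CL5m ([{0, 1}], [neg F, F])"
| mix: "CL5m (S, P) \<Longrightarrow> CL5m (T, Q) \<Longrightarrow> CL5m (S @ map (image (\<lambda>i. length P + i)) T, P @ Q)"
| oformula_exchange:
    "CL5m (S, P @ [F, G] @ Q) \<Longrightarrow>
     CL5m (map (image (transpose (length P) (Suc (length P)))) S, P @ [G, F] @ Q)"
| ogroup_exchange: "CL5m (S @ [\<Gamma>, \<Delta>] @ T, P) \<Longrightarrow> CL5m (S @ [\<Delta>, \<Gamma>] @ T, P)"
| ogroup_weakening:
    "CL5m (S @ [\<Gamma>] @ T, P) \<Longrightarrow> i < length P \<Longrightarrow> i \<notin> \<Gamma> \<Longrightarrow> CL5m (S @ [insert i \<Gamma>] @ T, P)"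
| pool_weakening:
    "CL5m (S, P @ Q) \<Longrightarrow> CL5m (map (image (shift_from (length P))) S, P @ [F] @ Q)"
| disj_intro:
    "CL5m (S, P @ [F, G] @ Q) \<Longrightarrow>
     CL5m (map (image (collapse (length P))) S, P @ [Disj F G] @ Q)"
| conj_intro:
    "CL5m (S, P @ [F, G] @ Q) \<Longrightarrow> n = length P \<Longrightarrow>
     (\<And>\<Gamma>. \<Gamma> \<in> set S \<Longrightarrow> \<not> (n \<in> \<Gamma> \<and> Suc n \<in> \<Gamma>)) \<Longrightarrow>
     (\<And>j. j < length S \<Longrightarrow> n \<in> S ! j \<Longrightarrow> Suc j < length S \<and> Suc n \<in> S ! Suc j) \<Longrightarrow>
     (\<And>j. j < length S \<Longrightarrow> Suc n \<in> S ! j \<Longrightarrow> 0 < j \<and> n \<in> S ! (j - 1)) \<Longrightarrow>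
     CL5m (map (image (collapse n)) (merge_ogroups n S), P @ [Conj F G] @ Q)"

definition CL5m_provable :: "formula \<Rightarrow> bool" where
  "CL5m_provable F \<longleftrightarrow> CL5m ([{0}], [F])"


section \<open>Encoding of formulas\<close>

text \<open>
  Formulas are written in Polish notation over the six-letter alphabet \<open>{..<6}\<close>: \<open>0\<close> and \<open>1\<close> are
  binary digits, \<open>2\<close> opens the name of an atom (its index in binary, most significant digit
  first), and \<open>3\<close>, \<open>4\<close>, \<open>5\<close> are negation, conjunction and disjunction.
\<close>

fun binary :: "nat \<Rightarrow> nat list" where
  "binary n = (if n < 2 then [n] else binary (n div 2) @ [n mod 2])"

declare binary.simps [simp del]

fun encode :: "formula \<Rightarrow> nat list" where
  "encode (Atom a) = 2 # binary a"
| "encode (NegAtom a) = 3 # 2 # binary a"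
| "encode (Conj A B) = 4 # encode A @ encode B"
| "encode (Disj A B) = 5 # encode A @ encode B"


section \<open>Multi-tape Turing machines\<close>

text \<open>
  Tapes are infinite in both directions. The states are \<open>{..<states M}\<close> with start state \<open>0\<close>, and
  the tape symbols are \<open>{..<symbols M}\<close> with blank \<open>0\<close>. The machine halts when its transition
  function is undefined.
\<close>

datatype move = Left | Stay | Right

record tm =
  tapes :: nat
  states :: nat
  symbols :: nat
  delta :: "nat \<Rightarrow> nat list \<Rightarrow> (nat \<times> (nat \<times> move) list) option"

definition wf_tm :: "tm \<Rightarrow> bool" where
  "wf_tm M \<longleftrightarrow> 0 < tapes M \<and> 0 < states M \<and> 0 < symbols M \<and>
     (\<forall>q ss q' as. q < states M \<and> length ss = tapes M \<and> set ss \<subseteq> {..<symbols M} \<and>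
        delta M q ss = Some (q', as) \<longrightarrow>
        q' < states M \<and> length as = tapes M \<and> (\<forall>(s, d) \<in> set as. s < symbols M))"

text \<open>A tape consists of its contents and the position of its head.\<close>

type_synonym tape = "(int \<Rightarrow> nat) \<times> int"
type_synonym config = "nat \<times> tape list"

fun offset :: "move \<Rightarrow> int" where
  "offset Left = - 1"
| "offset Stay = 0"
| "offset Right = 1"

fun act :: "tape \<Rightarrow> nat \<times> move \<Rightarrow> tape" where
  "act (t, h) (s, d) = (t(h := s), h + offset d)"

definition next_action :: "tm \<Rightarrow> config \<Rightarrow> (nat \<times> (nat \<times> move) list) option" where
  "next_action M c = delta M (fst c) (map (\<lambda>(t, h). t h) (snd c))"

definition halted :: "tm \<Rightarrow> config \<Rightarrow> bool" where
  "halted M c \<longleftrightarrow> next_action M c = None"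

text \<open>A halted configuration is left unchanged.\<close>

definition step :: "tm \<Rightarrow> config \<Rightarrow> config" where
  "step M c = (case next_action M c of
      None \<Rightarrow> c
    | Some (q, as) \<Rightarrow> (q, map2 act (snd c) as))"

text \<open>As \<open>0\<close> is the blank, the letter \<open>a\<close> of a string is written on a tape as the symbol \<open>Suc a\<close>.\<close>

definition contents :: "nat list \<Rightarrow> int \<Rightarrow> nat" where
  "contents x i = (if 0 \<le> i \<and> i < int (length x) then Suc (x ! nat i) else 0)"

definition init :: "tm \<Rightarrow> nat list \<Rightarrow> config" where
  "init M x = (0, (contents x, 0) # replicate (tapes M - 1) (contents [], 0))"


section \<open>NP-completeness\<close>

text \<open>
  Without loss of generality a finite alphabet is \<open>{..<n}\<close> for some \<open>n\<close>; accordingly, the number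
  \<open>n\<close> of letters is a parameter of the following notions. The input is on the first tape, and the
  output is on the last one.
\<close>

definition poly_time_computable :: "nat \<Rightarrow> (nat list \<Rightarrow> nat list) \<Rightarrow> bool" where
  "poly_time_computable n f \<longleftrightarrow>
     (\<exists>M (p :: nat poly). wf_tm M \<and> n < symbols M \<and>
        (\<forall>x \<in> lists {..<n}.
           let c = (step M ^^ poly p (length x)) (init M x)
           in halted M c \<and> fst (last (snd c)) = contents (f x)))"

definition in_P :: "nat \<Rightarrow> nat list set \<Rightarrow> bool" where
  "in_P n A \<longleftrightarrow> A \<subseteq> lists {..<n} \<and> poly_time_computable n (\<lambda>x. if x \<in> A then [1] else [0])"

text \<open>
  NP is defined by polynomial-time verifiable certificates of polynomial length. The letter \<open>n\<close>,
  which does not belong to the alphabet of \<open>A\<close>, separates the input from its certificate.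
\<close>

definition in_NP :: "nat \<Rightarrow> nat list set \<Rightarrow> bool" where
  "in_NP n A \<longleftrightarrow> A \<subseteq> lists {..<n} \<and>
     (\<exists>m B (p :: nat poly). in_P m B \<and>
        (\<forall>x \<in> lists {..<n}. x \<in> A \<longleftrightarrow>
           (\<exists>y \<in> lists {..<m}. length y \<le> poly p (length x) \<and> x @ [n] @ y \<in> B)))"

definition poly_reducible :: "nat \<Rightarrow> nat list set \<Rightarrow> nat \<Rightarrow> nat list set \<Rightarrow> bool" where
  "poly_reducible n A m B \<longleftrightarrow>
     (\<exists>f. poly_time_computable n f \<and>
        (\<forall>x \<in> lists {..<n}. f x \<in> lists {..<m} \<and> (x \<in> A \<longleftrightarrow> f x \<in> B)))"

definition NP_hard :: "nat \<Rightarrow> nat list set \<Rightarrow> bool" where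
  "NP_hard m B \<longleftrightarrow> (\<forall>n A. in_NP n A \<longrightarrow> poly_reducible n A m B)"

definition NP_complete :: "nat \<Rightarrow> nat list set \<Rightarrow> bool" where
  "NP_complete m B \<longleftrightarrow> in_NP m B \<and> NP_hard m B"

end

theory Submission
  imports Defs
begin

text \<open>
  Without contraction, an oformula is used at most once, so a proof pairs every occurrence of an atom
  with at most one occurrence of its negation. Membership in NP: a proof can be rearranged so that it
  is determined by this pairing, the order in which the conjunctions are introduced, and the side to
  which each identity axiom goes at each conjunction. These data have polynomial size, and their
  correctness is a first-order property with quantifiers over positions in the formula.

  Hardness: a computation of a nondeterministic machine is a solution of constraints on variables
  with a polynomial number of values. The formula \<open>\<not> x \<or> (x \<and> \<not> p\<^sub>1) \<or> \<dots> \<or> (x \<and> \<not> p\<^sub>k)\<close> chooses the value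
  of a variable, because \<open>\<not> x\<close> can be paired with only one \<open>x\<close> and then only one \<open>\<not> p\<^sub>i\<close>, repeated as often
  as needed, is available for proving the constraints. Both directions obtain polynomial time from
  programs with loops over stacks, which multi-tape machines simulate with one tape per stack.
\<close>

text \<open>The obstacle is that introducing a conjunction merges pairs of ogroups all over the
  cirquent, so a proof does not decompose along the formula. It does decompose along its identity
  axioms: distinct ogroups have disjoint nonempty sets of axioms above them, and going upwards
  through a conjunction only splits such sets in two. This is why a rank for each conjunction and a
  value for each axiom and rank determine a proof. Rules are never permuted inside a given proof;
  instead, the cirquents that have such a description are shown to be closed under all rules.

  The same invariant carries a truth condition: under every valuation of the labels of literals,
  each ogroup contains a true oformula. Extracting a solution from a proof of a choice formula rests
  on this condition and on the distinctness of labels. In the other direction, the choice formulas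
  are proved with cirquents whose only ogroup contains everything, that is, in a sequent calculus
  with weakening and without contraction.

  No running time is calculated for a particular algorithm: functions are composed from operations
  that preserve polynomial time.\<close>

section \<open>Stack programs on Turing machines\<close>

text \<open>
  In \<open>IfTop r s p q\<close> the symbol \<open>0\<close> stands for the empty stack. \<open>Put\<close> has no rule in \<open>exec\<close>: it is
  the second step of \<open>Push\<close> on a Turing machine, after the movement of the head.
\<close>

datatype prog =
    Skip
  | Push nat nat
  | Put nat nat
  | Pop nat
  | Seq prog prog
  | IfTop nat nat prog prog
  | Loop nat prog

type_synonym store = "nat \<Rightarrow> nat list"

fun top_symbol :: "nat list \<Rightarrow> nat" where
  "top_symbol [] = 0"
| "top_symbol (a # _) = Suc a"

inductive exec :: "prog \<Rightarrow> store \<Rightarrow> nat \<Rightarrow> store \<Rightarrow> bool" where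
  skip: "exec Skip \<sigma> 1 \<sigma>"
| push: "exec (Push r a) \<sigma> 2 (\<sigma>(r := a # \<sigma> r))"
| pop: "exec (Pop r) \<sigma> 1 (\<sigma>(r := tl (\<sigma> r)))"
| seq: "exec p \<sigma> t \<sigma>' \<Longrightarrow> exec q \<sigma>' u \<sigma>'' \<Longrightarrow> exec (Seq p q) \<sigma> (Suc (t + u)) \<sigma>''"
| if_true: "top_symbol (\<sigma> r) = s \<Longrightarrow> exec p \<sigma> t \<sigma>' \<Longrightarrow> exec (IfTop r s p q) \<sigma> (Suc t) \<sigma>'"
| if_false: "top_symbol (\<sigma> r) \<noteq> s \<Longrightarrow> exec q \<sigma> t \<sigma>' \<Longrightarrow> exec (IfTop r s p q) \<sigma> (Suc t) \<sigma>'"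
| loop_end: "\<sigma> r = [] \<Longrightarrow> exec (Loop r p) \<sigma> 1 \<sigma>"
| loop_step: "\<sigma> r \<noteq> [] \<Longrightarrow> exec p \<sigma> t \<sigma>' \<Longrightarrow> exec (Loop r p) \<sigma>' u \<sigma>'' \<Longrightarrow>
    exec (Loop r p) \<sigma> (Suc (t + u)) \<sigma>''"

text \<open>
  The register \<open>0\<close> is stored from right to left, so that the input word, whose first letter is
  under the head, is a stack with its first letter on top. All other stacks grow to the right.
\<close>

definition dirn :: "nat \<Rightarrow> int" where "dirn r = (if r = 0 then - 1 else 1)"
definition fwd :: "nat \<Rightarrow> move" where "fwd r = (if r = 0 then Left else Right)"
definition bwd :: "nat \<Rightarrow> move" where "bwd r = (if r = 0 then Right else Left)"

text \<open>\<open>b\<close> is the cell of the bottom element, and the head stands on the top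
  element. For an empty stack the head is one cell before \<open>b\<close>; this cell is blank,
  which is how emptiness is recognised.\<close>

definition stack_tape :: "int \<Rightarrow> int \<Rightarrow> nat list \<Rightarrow> tape" where
  "stack_tape d b xs =
     ((\<lambda>i. if 0 \<le> d * (i - b) \<and> d * (i - b) < int (length xs)
           then Suc (rev xs ! nat (d * (i - b))) else 0), b + d * (int (length xs) - 1))"

definition rd :: "tape \<Rightarrow> nat" where "rd \<tau> = fst \<tau> (snd \<tau>)"

lemma rd_stack_tape: "d = 1 \<or> d = - 1 \<Longrightarrow> rd (stack_tape d b xs) = top_symbol xs"
  by (cases xs) (auto simp: rd_def stack_tape_def nth_append algebra_simps)

lemma dirn_cases: "dirn r = 1 \<or> dirn r = - 1" by (simp add: dirn_def)

lemma act_rd_Stay: "act \<tau> (rd \<tau>, Stay) = \<tau>"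
  by (cases \<tau>) (auto simp: rd_def)

lemma act_rd: "act \<tau> (rd \<tau>, m) = (fst \<tau>, snd \<tau> + offset m)"
  by (cases \<tau>) (simp add: rd_def)

lemma offset_fwd: "offset (fwd r) = dirn r" by (simp add: fwd_def dirn_def)
lemma offset_bwd: "offset (bwd r) = - dirn r" by (simp add: bwd_def dirn_def)

text \<open>A machine writes before it moves, but the new letter belongs on the cell beyond the old
  top. Hence two actions: rewrite the old top while moving, then write without moving.\<close>

lemma act_push:
  "act (act (stack_tape (dirn r) b xs) (rd (stack_tape (dirn r) b xs), fwd r)) (Suc a, Stay)
   = stack_tape (dirn r) b (a # xs)"
proof -
  define d where "d = dirn r"
  have d: "d = 1 \<or> d = - 1" unfolding d_def by (rule dirn_cases)
  have eq: "i = b + d * int (length xs) \<longleftrightarrow> d * (i - b) = int (length xs)" for i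
    using d by auto
  have head: "b + d * (int (length xs) - 1) + d = b + d * int (length xs)"
    by (simp add: algebra_simps)
  have cell: "(if k = int (length xs) then Suc a
      else if 0 \<le> k \<and> k < int (length xs)
           then Suc (rev xs ! nat (k)) else 0) =
    (if 0 \<le> k \<and> k < int (length (a # xs))
           then Suc (rev (a # xs) ! nat (k)) else 0)" for k :: int
    by (auto simp: nth_append)
  show ?thesis
    unfolding act_rd stack_tape_def d_def[symmetric] fst_conv snd_conv offset_fwd head
    by (simp only: act.simps offset.simps fun_upd_def eq cell) (simp add: algebra_simps)
qed

lemma act_pop:
  assumes "xs \<noteq> []"
  shows "act (stack_tape (dirn r) b xs) (0, bwd r) = stack_tape (dirn r) b (tl xs)"
proof -
  obtain y ys where xs: "xs = y # ys" using assms by (cases xs) auto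
  have d: "dirn r = 1 \<or> dirn r = - 1" by (rule dirn_cases)
  show ?thesis
    unfolding stack_tape_def xs using d
    by (elim disjE) (auto simp: offset_bwd fun_eq_iff nth_append)
qed

text \<open>The control state of the machine is the list of the programs that remain to be executed.\<close>

fun nxt :: "prog list \<Rightarrow> (nat \<Rightarrow> nat) \<Rightarrow> (prog list \<times> (nat \<Rightarrow> nat \<times> move)) option" where
  "nxt [] ss = None"
| "nxt (Skip # ks) ss = Some (ks, \<lambda>r. (ss r, Stay))"
| "nxt (Push r a # ks) ss = Some (Put r a # ks, (\<lambda>r. (ss r, Stay))(r := (ss r, fwd r)))"
| "nxt (Put r a # ks) ss = Some (ks, (\<lambda>r. (ss r, Stay))(r := (Suc a, Stay)))"
| "nxt (Pop r # ks) ss =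
     Some (ks, (\<lambda>r. (ss r, Stay))(r := (if ss r = 0 then (ss r, Stay) else (0, bwd r))))"
| "nxt (Seq p q # ks) ss = Some (p # q # ks, \<lambda>r. (ss r, Stay))"
| "nxt (IfTop r s p q # ks) ss = Some ((if ss r = s then p else q) # ks, \<lambda>r. (ss r, Stay))"
| "nxt (Loop r p # ks) ss = Some (if ss r = 0 then ks else p # Loop r p # ks, \<lambda>r. (ss r, Stay))"

text \<open>The continuations that can arise while \<open>p\<close> runs on top of
  \<open>ks\<close>. A loop returns to the same continuation after each round, so the set follows
  the syntax and is finite; this makes the number of states of the machine finite.\<close>

fun conts :: "prog \<Rightarrow> prog list \<Rightarrow> prog list set" where
  "conts Skip ks = {Skip # ks}"
| "conts (Push r a) ks = {Push r a # ks, Put r a # ks}"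
| "conts (Put r a) ks = {Put r a # ks}"
| "conts (Pop r) ks = {Pop r # ks}"
| "conts (Seq p q) ks = insert (Seq p q # ks) (conts p (q # ks) \<union> conts q ks)"
| "conts (IfTop r s p q) ks = insert (IfTop r s p q # ks) (conts p ks \<union> conts q ks)"
| "conts (Loop r p) ks = insert (Loop r p # ks) (conts p (Loop r p # ks))"

lemma finite_conts: "finite (conts p ks)"
  by (induction p arbitrary: ks) auto

lemma Cons_in_conts: "p # ks \<in> conts p ks"
  by (cases p) auto

lemma conts_closed:
  "ks' \<in> conts p ks \<Longrightarrow> nxt ks' ss = Some (ks'', as) \<Longrightarrow> ks'' \<in> insert ks (conts p ks)"
proof (induction p arbitrary: ks)
  case (Seq p q)
  then show ?case using Cons_in_conts[of p "q # ks"] Cons_in_conts[of q ks]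
    by (auto split: if_splits)
next
  case (IfTop r s p q)
  then show ?case using Cons_in_conts[of p ks] Cons_in_conts[of q ks]
    by (auto split: if_splits)
next
  case (Loop r p)
  then show ?case using Cons_in_conts[of p "Loop r p # ks"]
    by (auto split: if_splits)
qed auto

text \<open>One number bounds both the registers and the written letters, so it determines the
  number of tapes as well as the tape alphabet.\<close>

fun below :: "nat \<Rightarrow> prog \<Rightarrow> bool" where
  "below B Skip = True"
| "below B (Push r a) = (r < B \<and> a < B)"
| "below B (Put r a) = (r < B \<and> a < B)"
| "below B (Pop r) = (r < B)"
| "below B (Seq p q) = (below B p \<and> below B q)"
| "below B (IfTop r s p q) = (r < B \<and> below B p \<and> below B q)"
| "below B (Loop r p) = (r < B \<and> below B p)"

lemma below_mono: "below B p \<Longrightarrow> B \<le> C \<Longrightarrow> below C p"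
  by (induction p) auto

lemma ex_below: "\<exists>B. below B p"
proof (induction p)
  case (Push r a) show ?case by (rule exI[of _ "Suc (r + a)"]) simp
next
  case (Put r a) show ?case by (rule exI[of _ "Suc (r + a)"]) simp
next
  case (Seq p q)
  then obtain B C where "below B p" "below C q" by blast
  then have "below (B + C) p" "below (B + C) q" by (auto elim: below_mono)
  then show ?case by auto
next
  case (IfTop r s p q)
  then obtain B C where "below B p" "below C q" by blast
  then have "below (Suc (B + C + r)) p" "below (Suc (B + C + r)) q" by (auto elim: below_mono)
  then show ?case by (intro exI[of _ "Suc (B + C + r)"]) auto
next
  case (Loop r p)
  then obtain B where "below B p" by blast
  then have "below (Suc (B + r)) p" by (auto elim: below_mono)
  then show ?case by (intro exI[of _ "Suc (B + r)"]) auto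
qed auto

lemma below_conts:
  "ks' \<in> conts p ks \<Longrightarrow> below B p \<Longrightarrow> list_all (below B) ks \<Longrightarrow> list_all (below B) ks'"
  by (induction p arbitrary: ks) auto

lemma funpow_Suc_right: "(f ^^ Suc t) c = (f ^^ t) (f c)"
  by (simp add: funpow_swap1)

lemma funpow_add_apply: "(f ^^ (t + u)) c = (f ^^ u) ((f ^^ t) c)"
  by (simp add: add.commute[of t u] funpow_add)

lemma stack_tape_input: "stack_tape (- 1) (int (length x) - 1) x = (contents x, 0)"
proof -
  have "rev x ! nat (int (length x) - 1 - i) = x ! nat i" if "0 \<le> i" "i < int (length x)" for i
  proof -
    have "nat (int (length x) - 1 - i) < length x" using that by linarith
    moreover have "length x - Suc (nat (int (length x) - 1 - i)) = nat i" using that by linarith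
    ultimately show ?thesis by (simp add: rev_nth)
  qed
  then show ?thesis by (auto simp: stack_tape_def contents_def fun_eq_iff)
qed

lemma stack_tape_Nil: "stack_tape 1 0 [] = (contents [], - 1)"
  by (auto simp: stack_tape_def contents_def fun_eq_iff)

section \<open>The Turing machine that executes a program\<close>

locale stack_machine =
  fixes p :: prog and B n :: nat
  assumes B2: "2 \<le> B" and belowB: "below B p"
begin

text \<open>The order of the tapes: register \<open>0\<close> holds the input and comes first,
  register \<open>1\<close> holds the output and comes last.\<close>

definition regs :: "nat list" where "regs = 0 # [2..<B] @ [1]"

lemma set_regs: "set regs = {..<B}" using B2 by (auto simp: regs_def)

definition Q :: "prog list set" where "Q = insert [] (conts p [])"

lemma finite_Q: "finite Q" by (simp add: Q_def finite_conts)

definition enc :: "prog list \<Rightarrow> nat" where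
  "enc = (SOME f. bij_betw f Q {..<card Q})"

lemma bij_enc: "bij_betw enc Q {..<card Q}"
  unfolding enc_def
  using someI_ex[OF ex_bij_betw_finite_nat[OF finite_Q]] by (simp add: atLeast0LessThan)

definition dec :: "nat \<Rightarrow> prog list" where "dec = inv_into Q enc"

lemma dec_enc: "ks \<in> Q \<Longrightarrow> dec (enc ks) = ks"
  unfolding dec_def by (rule bij_betw_inv_into_left[OF bij_enc])

lemma enc_less: "ks \<in> Q \<Longrightarrow> enc ks < card Q"
  using bij_betwE[OF bij_enc] by simp

lemma dec_in: "q < card Q \<Longrightarrow> dec q \<in> Q"
  unfolding dec_def using bij_betwE[OF bij_betw_inv_into[OF bij_enc]] by simp

definition readf :: "nat list \<Rightarrow> nat \<Rightarrow> nat" where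
  "readf ss r = (if r < B then the (map_of (zip regs ss) r) else 0)"

lemma readf_map: "readf (map f regs) = (\<lambda>r. if r < B then f r else 0)"
  by (auto simp: readf_def map_of_zip_map set_regs fun_eq_iff)

text \<open>State \<open>0\<close> is an extra start state. The heads start on cell
  \<open>0\<close>, but the head of an empty stack that grows to the right belongs one cell before
  its bottom; the first step moves all heads except that of the input there.\<close>

definition M :: tm where
  "M = \<lparr>tapes = length regs, states = Suc (card Q), symbols = Suc (B + n),
     delta = (\<lambda>q ss. if q = 0
        then Some (Suc (enc [p]), map (\<lambda>r. (readf ss r, if r = 0 then Stay else Left)) regs)
        else case nxt (dec (q - 1)) (readf ss) of None \<Rightarrow> None
          | Some (ks, as) \<Rightarrow> Some (Suc (enc ks), map as regs))\<rparr>"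

lemma symbols_M: "n < symbols M" by (simp add: M_def)

lemma start_in_Q: "[p] \<in> Q" by (simp add: Q_def Cons_in_conts)

lemma Q_closed: "ks \<in> Q \<Longrightarrow> nxt ks ss = Some (ks', as) \<Longrightarrow> ks' \<in> Q"
  unfolding Q_def using conts_closed[of ks p "[]"] by auto

lemma Q_below: "ks \<in> Q \<Longrightarrow> list_all (below B) ks"
  unfolding Q_def using below_conts[of ks p "[]" B] belowB by auto

lemma nxt_symbols:
  assumes "nxt ks ss = Some (ks', as)" "list_all (below B) ks" "\<And>r. ss r < C" "B < C"
  shows "fst (as r) < C"
  using assms
  by (induction ks ss rule: nxt.induct) (auto simp: fun_upd_def split: if_splits)

lemma readf_less:
  assumes "length ss = length regs" "set ss \<subseteq> {..<C}" "0 < C"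
  shows "readf ss r < C"
proof (cases "r < B")
  case True
  then have "r \<in> set regs" by (simp add: set_regs)
  then obtain y where y: "map_of (zip regs ss) r = Some y"
    using assms(1) by (metis map_of_zip_is_Some)
  then have "y \<in> set ss" by (meson map_of_SomeD set_zip_rightD)
  then show ?thesis using True y assms(2) by (auto simp: readf_def)
qed (use assms in \<open>auto simp: readf_def\<close>)

lemma wf_M: "wf_tm M"
proof -
  have reg: "0 < length regs" by (simp add: regs_def)
  have main: "q' < Suc (card Q) \<and> length as = length regs \<and> (\<forall>(s, d)\<in>set as. s < Suc (B + n))"
    if q: "q < Suc (card Q)" and l: "length ss = length regs" and s: "set ss \<subseteq> {..<Suc (B + n)}"
      and d: "delta M q ss = Some (q', as)" for q ss q' as
  proof (cases "q = 0")
    case True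
    then show ?thesis using d enc_less[OF start_in_Q] readf_less[OF l s]
      by (auto simp: M_def)
  next
    case False
    then have dq: "dec (q - 1) \<in> Q" using q by (intro dec_in) auto
    from d False obtain ks bs where ks: "nxt (dec (q - 1)) (readf ss) = Some (ks, bs)"
      "q' = Suc (enc ks)" "as = map bs regs"
      by (auto simp: M_def split: option.splits)
    have "fst (bs r) < Suc (B + n)" for r
      by (rule nxt_symbols[OF ks(1) Q_below[OF dq]]) (use readf_less[OF l s] in auto)
    then show ?thesis using ks enc_less[OF Q_closed[OF dq ks(1)]] by (auto simp: prod.split_sel_asm case_prod_beta)
  qed
  have "tapes M = length regs" "states M = Suc (card Q)" "symbols M = Suc (B + n)"
    by (simp_all add: M_def)
  then show ?thesis unfolding wf_tm_def
    by (simp only: zero_less_Suc reg simp_thms) (use main in blast)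
qed

lemma step_M:
  assumes "ks \<in> Q"
  shows "step M (Suc (enc ks), map \<tau> regs) =
    (case nxt ks (\<lambda>r. if r < B then rd (\<tau> r) else 0) of
       None \<Rightarrow> (Suc (enc ks), map \<tau> regs)
     | Some (ks', as) \<Rightarrow> (Suc (enc ks'), map (\<lambda>r. act (\<tau> r) (as r)) regs))"
proof -
  have reads: "map (\<lambda>(t, h). t h) (map \<tau> regs) = map (\<lambda>r. rd (\<tau> r)) regs"
    by (simp add: rd_def case_prod_beta)
  have "next_action M (Suc (enc ks), map \<tau> regs) =
     (case nxt ks (\<lambda>r. if r < B then rd (\<tau> r) else 0) of None \<Rightarrow> None
          | Some (ks, as) \<Rightarrow> Some (Suc (enc ks), map as regs))"
    unfolding next_action_def snd_conv fst_conv reads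
    by (simp add: M_def dec_enc[OF assms] readf_map cong: if_cong)
  then show ?thesis
    by (auto simp: step_def map2_map_map split: option.splits)
qed

definition tapes_of :: "(nat \<Rightarrow> int) \<Rightarrow> store \<Rightarrow> nat \<Rightarrow> tape" where
  "tapes_of b \<sigma> r = stack_tape (dirn r) (b r) (\<sigma> r)"

lemma rd_tapes_of: "rd (tapes_of b \<sigma> r) = top_symbol (\<sigma> r)"
  by (simp add: tapes_of_def rd_stack_tape dirn_cases)

lemma top_symbol_0: "top_symbol xs = 0 \<longleftrightarrow> xs = []" by (cases xs) auto

lemma step_silent:
  assumes "ks \<in> Q"
    "nxt ks (\<lambda>r. if r < B then top_symbol (\<sigma> r) else 0) =
       Some (ks', \<lambda>r. (if r < B then top_symbol (\<sigma> r) else 0, Stay))"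
  shows "step M (Suc (enc ks), map (tapes_of b \<sigma>) regs) = (Suc (enc ks'), map (tapes_of b \<sigma>) regs)"
proof -
  have "act (tapes_of b \<sigma> r) (if r < B then top_symbol (\<sigma> r) else 0, Stay) = tapes_of b \<sigma> r" if "r < B" for r
    using that act_rd_Stay[of "tapes_of b \<sigma> r"] by (simp add: rd_tapes_of)
  then show ?thesis
    by (simp add: step_M[OF assms(1)] rd_tapes_of assms(2) set_regs cong: if_cong)
qed

text \<open>The times in \<open>exec\<close> are chosen to be exact numbers of machine steps, so
  that simulations compose by addition. As \<open>ks\<close> is arbitrary, the induction hypothesis
  covers a program inside a sequence or a loop.\<close>

lemma exec_sim:
  assumes "exec p' \<sigma> t \<sigma>'" "below B p'" "insert ks (conts p' ks) \<subseteq> Q"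
  shows "(step M ^^ t) (Suc (enc (p' # ks)), map (tapes_of b \<sigma>) regs) =
         (Suc (enc ks), map (tapes_of b \<sigma>') regs)"
  using assms
proof (induction arbitrary: ks rule: exec.induct)
  case (skip \<sigma>)
  then show ?case by (simp add: step_silent)
next
  case (push r a \<sigma>)
  have q: "Push r a # ks \<in> Q" "Put r a # ks \<in> Q" and r: "r < B" using push by auto
  let ?\<tau> = "\<lambda>r'. act (tapes_of b \<sigma> r') (if r' = r then (top_symbol (\<sigma> r), fwd r) else (top_symbol (\<sigma> r'), Stay))"
  have 1: "step M (Suc (enc (Push r a # ks)), map (tapes_of b \<sigma>) regs) = (Suc (enc (Put r a # ks)), map ?\<tau> regs)"
    using r by (simp add: step_M[OF q(1)] rd_tapes_of set_regs cong: if_cong)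
  have s': "act (tapes_of b \<sigma> r') (top_symbol (\<sigma> r'), Stay) = tapes_of b \<sigma> r'" for r'
    using act_rd_Stay[of "tapes_of b \<sigma> r'"] by (simp add: rd_tapes_of)
  have 2: "step M (Suc (enc (Put r a # ks)), map ?\<tau> regs) = (Suc (enc ks), map (tapes_of b (\<sigma>(r := a # \<sigma> r))) regs)"
    using r act_push[of r "b r" "\<sigma> r" a]
    by (simp add: step_M[OF q(2)] set_regs s' rd_tapes_of cong: if_cong)
      (simp add: tapes_of_def rd_stack_tape dirn_cases)
  show ?case using 1 2 by (simp only: numeral_2_eq_2 funpow_Suc_right funpow_0)
next
  case (pop r \<sigma>)
  have q: "Pop r # ks \<in> Q" and r: "r < B" using pop by auto
  have s': "act (tapes_of b \<sigma> r') (top_symbol (\<sigma> r'), Stay) = tapes_of b \<sigma> r'" for r'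
    using act_rd_Stay[of "tapes_of b \<sigma> r'"] by (simp add: rd_tapes_of)
  have upd: "tapes_of b (\<sigma>(r := tl (\<sigma> r))) r' =
      (if r' = r then stack_tape (dirn r) (b r) (tl (\<sigma> r)) else tapes_of b \<sigma> r')" for r'
    by (simp add: tapes_of_def)
  have "act (tapes_of b \<sigma> r) (if top_symbol (\<sigma> r) = 0 then (top_symbol (\<sigma> r), Stay) else (0, bwd r))
     = stack_tape (dirn r) (b r) (tl (\<sigma> r))"
    using act_pop[of "\<sigma> r" r "b r"] s'[of r] by (auto simp: top_symbol_0 tapes_of_def)
  then show ?case
    using r by (auto simp: step_M[OF q] rd_tapes_of upd set_regs s' simp del: fun_upd_apply cong: if_cong)
      (auto simp: fun_upd_def s')
next
  case (seq p \<sigma> t \<sigma>' q u \<sigma>'')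
  have q: "Seq p q # ks \<in> Q" using seq by auto
  have "step M (Suc (enc (Seq p q # ks)), map (tapes_of b \<sigma>) regs) = (Suc (enc (p # q # ks)), map (tapes_of b \<sigma>) regs)"
    using q by (simp add: step_silent)
  moreover have "(step M ^^ t) (Suc (enc (p # q # ks)), map (tapes_of b \<sigma>) regs) = (Suc (enc (q # ks)), map (tapes_of b \<sigma>') regs)"
    using seq.prems Cons_in_conts[of q ks] by (intro seq.IH) auto
  moreover have "(step M ^^ u) (Suc (enc (q # ks)), map (tapes_of b \<sigma>') regs) = (Suc (enc ks), map (tapes_of b \<sigma>'') regs)"
    using seq.prems by (intro seq.IH) auto
  ultimately show ?case by (simp only: funpow_Suc_right funpow_add_apply)
next
  case (if_true \<sigma> r s p t \<sigma>' q)
  have q: "IfTop r s p q # ks \<in> Q" using if_true by auto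
  have "step M (Suc (enc (IfTop r s p q # ks)), map (tapes_of b \<sigma>) regs) = (Suc (enc (p # ks)), map (tapes_of b \<sigma>) regs)"
    using q if_true by (simp add: step_silent)
  moreover have "(step M ^^ t) (Suc (enc (p # ks)), map (tapes_of b \<sigma>) regs) = (Suc (enc ks), map (tapes_of b \<sigma>') regs)"
    using if_true.prems by (intro if_true.IH) auto
  ultimately show ?case by (simp only: funpow_Suc_right)
next
  case (if_false \<sigma> r s q t \<sigma>' p)
  have q: "IfTop r s p q # ks \<in> Q" using if_false by auto
  have "step M (Suc (enc (IfTop r s p q # ks)), map (tapes_of b \<sigma>) regs) = (Suc (enc (q # ks)), map (tapes_of b \<sigma>) regs)"
    using q if_false by (simp add: step_silent)
  moreover have "(step M ^^ t) (Suc (enc (q # ks)), map (tapes_of b \<sigma>) regs) = (Suc (enc ks), map (tapes_of b \<sigma>') regs)"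
    using if_false.prems by (intro if_false.IH) auto
  ultimately show ?case by (simp only: funpow_Suc_right)
next
  case (loop_end \<sigma> r p)
  then show ?case by (simp add: step_silent)
next
  case (loop_step \<sigma> r p t \<sigma>' u \<sigma>'')
  have q: "Loop r p # ks \<in> Q" using loop_step by auto
  have "step M (Suc (enc (Loop r p # ks)), map (tapes_of b \<sigma>) regs) = (Suc (enc (p # Loop r p # ks)), map (tapes_of b \<sigma>) regs)"
    using q loop_step by (simp add: step_silent top_symbol_0)
  moreover have "(step M ^^ t) (Suc (enc (p # Loop r p # ks)), map (tapes_of b \<sigma>) regs) = (Suc (enc (Loop r p # ks)), map (tapes_of b \<sigma>') regs)"
    using loop_step.prems by (intro loop_step.IH) auto
  moreover have "(step M ^^ u) (Suc (enc (Loop r p # ks)), map (tapes_of b \<sigma>') regs) = (Suc (enc ks), map (tapes_of b \<sigma>'') regs)"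
    using loop_step.prems by (intro loop_step.IH) auto
  ultimately show ?case by (simp only: funpow_Suc_right funpow_add_apply)
qed

lemma halted_end: "halted M (Suc (enc []), map \<tau> regs)"
  by (simp add: halted_def next_action_def M_def dec_enc Q_def)

lemma step_halted: "halted N c \<Longrightarrow> (step N ^^ k) c = c"
  by (induction k) (auto simp: halted_def step_def)

text \<open>One step is added for the initial movement of the heads. After that the machine has
  halted, so every later time will do. The output is reversed because the top of its stack is the
  rightmost letter on the tape.\<close>

lemma run:
  assumes "exec p ((\<lambda>_. [])(0 := x)) t \<sigma>" "Suc t \<le> k"
  shows "halted M ((step M ^^ k) (init M x)) \<and>
    fst (last (snd ((step M ^^ k) (init M x)))) = contents (rev (\<sigma> 1))"
proof -
  \<comment> \<open>The input starts in cell \<open>0\<close> with its first letter as the top, so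
    the bottom of its stack is its last cell.\<close>
  define b :: "nat \<Rightarrow> int" where "b r = (if r = 0 then int (length x) - 1 else 0)" for r
  let ?\<sigma> = "(\<lambda>_. [])(0 := x)"
  let ?\<tau> = "\<lambda>r. if r = 0 then (contents x, 0) else (contents [], 0)"
  have "map ?\<tau> ([2..<B] @ [1]) = map (\<lambda>_. (contents [], 0)) ([2..<B] @ [1])"
    by (rule map_cong) auto
  then have "map ?\<tau> ([2..<B] @ [1]) = replicate (Suc (B - 2)) (contents [], 0)"
    by (simp only: map_replicate_const) simp
  from this[symmetric] have i: "init M x = (0, map ?\<tau> regs)"
    by (simp add: init_def M_def regs_def)
  have reads: "map (\<lambda>(t, h). t h) (map ?\<tau> regs) = map (\<lambda>r. rd (?\<tau> r)) regs"
    by (simp add: rd_def case_prod_beta)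
  have na: "next_action M (init M x) = Some (Suc (enc [p]),
      map (\<lambda>r. (if r < B then rd (?\<tau> r) else 0, if r = 0 then Stay else Left)) regs)"
    unfolding i next_action_def snd_conv fst_conv reads by (simp add: M_def readf_map cong: if_cong)
  have "step M (init M x) = (Suc (enc [p]), map (tapes_of b ?\<sigma>) regs)"
    unfolding step_def na option.case prod.case
    unfolding i snd_conv map2_map_map
    by (auto simp: tapes_of_def b_def dirn_def stack_tape_input stack_tape_Nil set_regs rd_def contents_def fun_eq_iff)
  moreover have "(step M ^^ t) (Suc (enc [p]), map (tapes_of b ?\<sigma>) regs) = (Suc (enc []), map (tapes_of b \<sigma>) regs)"
    using assms(1) belowB by (intro exec_sim) (auto simp: Q_def)
  ultimately have "(step M ^^ Suc t) (init M x) = (Suc (enc []), map (tapes_of b \<sigma>) regs)"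
    by (simp only: funpow_Suc_right)
  then have "(step M ^^ (Suc t + (k - Suc t))) (init M x) = (Suc (enc []), map (tapes_of b \<sigma>) regs)"
    by (simp only: funpow_add_apply step_halted[OF halted_end])
  then have k: "(step M ^^ k) (init M x) = (Suc (enc []), map (tapes_of b \<sigma>) regs)"
    using assms(2) by simp
  have "last (map (tapes_of b \<sigma>) regs) = tapes_of b \<sigma> 1"
    by (simp add: regs_def)
  then show ?thesis
    by (simp only: k halted_end snd_conv)
       (auto simp: tapes_of_def stack_tape_def b_def dirn_def contents_def fun_eq_iff)
qed

end

section \<open>Polynomial running times of programs\<close>

theorem poly_time_computableI:
  assumes "\<And>x. x \<in> lists {..<n} \<Longrightarrow>
    \<exists>t \<le> (length x + 2) ^ c. \<exists>\<sigma>. exec p ((\<lambda>_. [])(0 := x)) t \<sigma> \<and> \<sigma> 1 = rev (f x)"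
  shows "poly_time_computable n f"
proof -
  obtain B0 where "below B0 p" using ex_below by blast
  then have b: "below (B0 + 2) p" by (rule below_mono) simp
  interpret stack_machine p "B0 + 2" n by standard (use b in auto)
  define q :: "nat poly" where "q = [:2, 1:] ^ c + 1"
  have q: "poly q k = (k + 2) ^ c + 1" for k by (simp add: q_def add.commute)
  have "let c = (step M ^^ poly q (length x)) (init M x)
           in halted M c \<and> fst (last (snd c)) = contents (f x)" if "x \<in> lists {..<n}" for x
  proof -
    from assms[OF that] obtain t \<sigma> where t: "t \<le> (length x + 2) ^ c"
      "exec p ((\<lambda>_. [])(0 := x)) t \<sigma>" "\<sigma> 1 = rev (f x)" by blast
    show ?thesis using run[OF t(2), of "poly q (length x)"] t by (simp add: q)
  qed
  moreover have "n < symbols M" by (rule symbols_M)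
  ultimately show ?thesis unfolding poly_time_computable_def
    by (intro exI[of _ M] exI[of _ q]) (use wf_M in auto)
qed

text \<open>Time is measured by the exponent of a base \<open>B\<close> that is at least
  \<open>2\<close>. Constants, sums and products of times then turn into additions to the exponent,
  and no polynomials have to be carried along.\<close>

definition runs :: "prog \<Rightarrow> store \<Rightarrow> nat \<Rightarrow> nat \<Rightarrow> store \<Rightarrow> bool" where
  "runs p \<sigma> B c \<sigma>' \<longleftrightarrow> (\<exists>t \<le> B ^ c. exec p \<sigma> t \<sigma>')"

lemma runs_mono: "runs p \<sigma> B c \<sigma>' \<Longrightarrow> 2 \<le> B \<Longrightarrow> c \<le> d \<Longrightarrow> runs p \<sigma> B d \<sigma>'"
  unfolding runs_def by (elim exE conjE, intro exI conjI)
    (auto intro: order_trans power_increasing)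

text \<open>Each of \<open>1\<close>, \<open>t\<close> and \<open>u\<close> is at most
  \<open>B ^ (a + b)\<close>, and \<open>4 \<le> B * B\<close>. So one sequential composition costs
  \<open>2\<close> in the exponent.\<close>

lemma Suc_add_pow:
  assumes "2 \<le> (B::nat)" "t \<le> B ^ a" "u \<le> B ^ b"
  shows "Suc (t + u) \<le> B ^ (a + b + 2)"
proof -
  have "B ^ a \<le> B ^ (a + b)" "B ^ b \<le> B ^ (a + b)" "1 \<le> B ^ (a + b)"
    using assms(1) by (auto intro: power_increasing)
  then have "Suc (t + u) \<le> 4 * B ^ (a + b)" using assms by linarith
  also have "\<dots> \<le> (B * B) * B ^ (a + b)"
    using mult_le_mono[OF assms(1) assms(1)] by (intro mult_le_mono1) simp
  finally show ?thesis by (simp add: power_add power2_eq_square ac_simps)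
qed

lemma runs_skip: "2 \<le> B \<Longrightarrow> runs Skip \<sigma> B 1 \<sigma>"
  unfolding runs_def by (intro exI[of _ 1] conjI exec.skip) simp

lemma runs_push: "2 \<le> B \<Longrightarrow> \<sigma>' = \<sigma>(r := a # \<sigma> r) \<Longrightarrow> runs (Push r a) \<sigma> B 1 \<sigma>'"
  unfolding runs_def by (simp del: fun_upd_apply) (intro exI[of _ 2] conjI exec.push)

lemma runs_pop: "2 \<le> B \<Longrightarrow> \<sigma>' = \<sigma>(r := tl (\<sigma> r)) \<Longrightarrow> runs (Pop r) \<sigma> B 1 \<sigma>'"
  unfolding runs_def by (simp del: fun_upd_apply) (intro exI[of _ 1] conjI exec.pop, simp)

lemma runs_seq:
  "runs p \<sigma> B a \<sigma>' \<Longrightarrow> runs q \<sigma>' B b \<sigma>'' \<Longrightarrow> 2 \<le> B \<Longrightarrow> runs (Seq p q) \<sigma> B (a + b + 2) \<sigma>''"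
  unfolding runs_def using Suc_add_pow exec.seq by blast

lemma Suc_pow: "2 \<le> (B::nat) \<Longrightarrow> t \<le> B ^ a \<Longrightarrow> Suc t \<le> B ^ (a + 2)"
  using Suc_add_pow[of B t a 0 0] by simp

lemma runs_if_true:
  "top_symbol (\<sigma> r) = s \<Longrightarrow> runs p \<sigma> B a \<sigma>' \<Longrightarrow> 2 \<le> B \<Longrightarrow> runs (IfTop r s p q) \<sigma> B (a + 2) \<sigma>'"
  unfolding runs_def using exec.if_true Suc_pow by blast

lemma runs_if_false:
  "top_symbol (\<sigma> r) \<noteq> s \<Longrightarrow> runs q \<sigma> B a \<sigma>' \<Longrightarrow> 2 \<le> B \<Longrightarrow> runs (IfTop r s p q) \<sigma> B (a + 2) \<sigma>'"
  unfolding runs_def using exec.if_false Suc_pow by blast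

lemma exec_loop:
  assumes "\<And>i. i < k \<Longrightarrow> \<sigma>s i r \<noteq> [] \<and> (\<exists>t \<le> T. exec p (\<sigma>s i) t (\<sigma>s (Suc i)))" "\<sigma>s k r = []"
  shows "\<exists>t \<le> Suc (k * Suc T). exec (Loop r p) (\<sigma>s 0) t (\<sigma>s k)"
  using assms
proof (induction k arbitrary: \<sigma>s)
  case 0
  then show ?case using exec.loop_end by fastforce
next
  case (Suc k)
  obtain t where t: "t \<le> T" "exec p (\<sigma>s 0) t (\<sigma>s 1)" "\<sigma>s 0 r \<noteq> []"
    using Suc.prems(1)[of 0] by auto
  obtain u where u: "u \<le> Suc (k * Suc T)" "exec (Loop r p) (\<sigma>s 1) u (\<sigma>s (Suc k))"
    using Suc.IH[of "\<lambda>i. \<sigma>s (Suc i)"] Suc.prems by auto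
  have "exec (Loop r p) (\<sigma>s 0) (Suc (t + u)) (\<sigma>s (Suc k))"
    by (rule exec.loop_step[OF t(3,2) u(2)])
  moreover have "Suc (t + u) \<le> Suc (Suc k * Suc T)" using t u by simp
  ultimately show ?case by blast
qed

text \<open>The sequence \<open>\<sigma>s\<close> of stores between the rounds plays the role of a
  loop invariant. Both the number of rounds and the time of a round are powers of the same
  \<open>B\<close>, so nested loops keep their bounds.\<close>

lemma runs_loop:
  assumes B: "2 \<le> B" and k: "k \<le> B ^ b"
    and step: "\<And>i. i < k \<Longrightarrow> \<sigma>s i r \<noteq> [] \<and> runs p (\<sigma>s i) B a (\<sigma>s (Suc i))"
    and fin: "\<sigma>s k r = []" and \<sigma>: "\<sigma> = \<sigma>s 0" and \<sigma>': "\<sigma>' = \<sigma>s k"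
  shows "runs (Loop r p) \<sigma> B (a + b + 4) \<sigma>'"
proof -
  obtain t where t: "t \<le> Suc (k * Suc (B ^ a))" "exec (Loop r p) \<sigma> t \<sigma>'"
    using exec_loop[of k \<sigma>s r "B ^ a" p] step fin unfolding \<sigma> \<sigma>' runs_def by blast
  have "Suc (B ^ a) \<le> B ^ (a + 2)" by (rule Suc_pow[OF B order_refl])
  then have "k * Suc (B ^ a) \<le> B ^ b * B ^ (a + 2)" using k by (rule mult_le_mono[rotated])
  also have "\<dots> = B ^ (a + b + 2)" by (simp add: power_add ac_simps)
  finally have "Suc (k * Suc (B ^ a)) \<le> B ^ (a + b + 2 + 2)" by (rule Suc_pow[OF B])
  then have "t \<le> B ^ (a + b + 4)" using t(1) by (simp only: add.assoc) (simp add: numeral_eq_Suc)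
  then show ?thesis using t unfolding runs_def by blast
qed

text \<open>A step pushes at most one letter. Hence a time bound for a program is also a size bound
  for its output, and a loop over that output needs no separate estimate.\<close>

lemma exec_length: "exec p \<sigma> t \<sigma>' \<Longrightarrow> length (\<sigma>' r) \<le> length (\<sigma> r) + t"
  by (induction rule: exec.induct) (auto simp: le_diff_conv)

section \<open>Programs for functions of several numbers\<close>

definition frame :: "nat list \<Rightarrow> nat \<Rightarrow> nat \<Rightarrow> bool" where
  "frame ls out s \<longleftrightarrow> 2 < s \<and> out < s \<and> out \<noteq> 0 \<and> out \<noteq> 2 \<and> out \<notin> set ls \<and>
     (\<forall>l \<in> set ls. l < s \<and> l \<noteq> 0 \<and> l \<noteq> 2)"

definition ready :: "('e \<Rightarrow> nat list) \<Rightarrow> ('e \<Rightarrow> nat) list \<Rightarrow> nat list \<Rightarrow> nat \<Rightarrow> 'e \<Rightarrow> store \<Rightarrow> bool" where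
  "ready X vs ls s e \<sigma> \<longleftrightarrow> \<sigma> 0 = X e \<and> \<sigma> 2 = [] \<and> map \<sigma> ls = map (\<lambda>v. replicate (v e) 0) vs \<and>
     (\<forall>r \<ge> s. \<sigma> r = [])"

definition bounded_by :: "nat \<Rightarrow> ('e \<Rightarrow> nat list) \<Rightarrow> ('e \<Rightarrow> nat) list \<Rightarrow> 'e \<Rightarrow> bool" where
  "bounded_by B X vs e \<longleftrightarrow> 2 \<le> B \<and> length (X e) \<le> B \<and> (\<forall>v \<in> set vs. v e \<le> B)"

text \<open>
  A program for \<open>f\<close> finds the word \<open>X e\<close> in the register \<open>0\<close> and the numbers \<open>v e\<close> in unary notation
  in the registers \<open>ls\<close>; it appends \<open>f e\<close> to the register \<open>out\<close>, may use the register \<open>2\<close> and all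
  registers from \<open>s\<close> on as scratch space, and leaves the other registers unchanged.
\<close>

definition emit_spec where
  "emit_spec n X vs f ls out s p c \<longleftrightarrow>
     (\<forall>e \<sigma> B. ready X vs ls s e \<sigma> \<longrightarrow> X e \<in> lists {..<n} \<longrightarrow> 2 \<le> B \<longrightarrow> bounded_by B X vs e \<longrightarrow>
        runs p \<sigma> B c (\<sigma>(out := rev (f e) @ \<sigma> out)))"

text \<open>A program is required for every layout of registers, so that each construction can move
  its parts to fresh scratch registers. The exponent may depend on the layout but not on the
  environment \<open>e\<close>, from which the input word and the numerical variables are
  obtained.\<close>

definition emits :: "nat \<Rightarrow> ('e \<Rightarrow> nat list) \<Rightarrow> ('e \<Rightarrow> nat) list \<Rightarrow> ('e \<Rightarrow> nat list) \<Rightarrow> bool" where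
  "emits n X vs f \<longleftrightarrow> (\<forall>ls out s. frame ls out s \<and> length ls = length vs \<longrightarrow>
     (\<exists>p c. emit_spec n X vs f ls out s p c))"

definition num :: "nat \<Rightarrow> ('e \<Rightarrow> nat list) \<Rightarrow> ('e \<Rightarrow> nat) list \<Rightarrow> ('e \<Rightarrow> nat) \<Rightarrow> bool" where
  "num n X vs g \<longleftrightarrow> emits n X vs (\<lambda>e. replicate (g e) 0)"

lemma emit_specD:
  "emit_spec n X vs f ls out s p c \<Longrightarrow> ready X vs ls s e \<sigma> \<Longrightarrow> X e \<in> lists {..<n} \<Longrightarrow>
   bounded_by B X vs e \<Longrightarrow> \<sigma>' = \<sigma>(out := rev (f e) @ \<sigma> out) \<Longrightarrow> runs p \<sigma> B c \<sigma>'"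
  unfolding emit_spec_def bounded_by_def by blast

lemma emitsI:
  assumes "\<And>ls out s. frame ls out s \<Longrightarrow> length ls = length vs \<Longrightarrow>
    \<exists>p c. \<forall>e \<sigma> B. ready X vs ls s e \<sigma> \<longrightarrow> X e \<in> lists {..<n} \<longrightarrow> 2 \<le> B \<longrightarrow> bounded_by B X vs e \<longrightarrow>
        runs p \<sigma> B c (\<sigma>(out := rev (f e) @ \<sigma> out))"
  shows "emits n X vs f"
  using assms unfolding emits_def emit_spec_def by blast

lemma emitsE:
  assumes "emits n X vs f" "frame ls out s" "length ls = length vs"
  obtains p c where "emit_spec n X vs f ls out s p c"
  using assms unfolding emits_def by blast

lemma emit_spec_length:
  assumes "emit_spec n X vs f ls out s p c" "ready X vs ls s e \<sigma>" "X e \<in> lists {..<n}"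
    "bounded_by B X vs e" "\<sigma> out = []"
  shows "length (f e) \<le> B ^ c"
proof -
  obtain t where "t \<le> B ^ c" "exec p \<sigma> t (\<sigma>(out := rev (f e) @ \<sigma> out))"
    using emit_specD[OF assms(1-4) refl] unfolding runs_def by blast
  with exec_length[OF this(2), of out] show ?thesis using assms(5) by simp
qed

lemma ready_out: "frame ls out s \<Longrightarrow> ready X vs ls s e \<sigma> \<Longrightarrow> ready X vs ls s e (\<sigma>(out := w))"
  unfolding ready_def frame_def by auto

lemma ready_frame:
  "frame ls out s \<Longrightarrow> ready X vs ls s e \<sigma> \<Longrightarrow> s \<le> s' \<Longrightarrow>
   (\<And>r. r < s \<Longrightarrow> r \<noteq> out \<Longrightarrow> \<tau> r = \<sigma> r) \<Longrightarrow> (\<And>r. s' \<le> r \<Longrightarrow> \<tau> r = []) \<Longrightarrow> ready X vs ls s' e \<tau>"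
  unfolding ready_def frame_def by (auto intro!: map_cong elim!: trans[rotated])

lemma frame_scratch: "frame ls out s \<Longrightarrow> s \<le> s1 \<Longrightarrow> s1 < s' \<Longrightarrow> frame ls s1 s'"
  unfolding frame_def by auto

lemma readyD: "ready X vs ls s e \<sigma> \<Longrightarrow> s \<le> r \<Longrightarrow> \<sigma> r = []"
  unfolding ready_def by auto

section \<open>Elementary programs, concatenation loops and branching\<close>

lemma emits_Nil: "emits n X vs (\<lambda>e. [])"
  by (rule emitsI) (auto intro!: exI[of _ Skip] exI[of _ 1] runs_skip)

lemma emits_letter: "emits n X vs (\<lambda>e. [a])"
  by (rule emitsI) (auto intro!: exI[of _ "Push _ a"] exI[of _ 1] runs_push)

lemma emits_append:
  assumes "emits n X vs f" "emits n X vs g"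
  shows "emits n X vs (\<lambda>e. f e @ g e)"
proof (rule emitsI)
  fix ls out s assume fr: "frame ls out s" "length ls = length vs"
  obtain p c where p: "emit_spec n X vs f ls out s p c" by (rule emitsE[OF assms(1) fr])
  obtain q d where q: "emit_spec n X vs g ls out s q d" by (rule emitsE[OF assms(2) fr])
  show "\<exists>p c. \<forall>e \<sigma> B. ready X vs ls s e \<sigma> \<longrightarrow> X e \<in> lists {..<n} \<longrightarrow> 2 \<le> B \<longrightarrow> bounded_by B X vs e \<longrightarrow>
        runs p \<sigma> B c (\<sigma>(out := rev (f e @ g e) @ \<sigma> out))"
    apply (intro exI[of _ "Seq p q"] exI[of _ "c + d + 2"] allI impI)
    apply (rule runs_seq)
      apply (erule (2) emit_specD[OF p, OF _ _ _ refl])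
     apply (rule emit_specD[OF q ready_out[OF fr(1)]], assumption+)
     apply simp_all
    done
qed

text \<open>Counting down a register destroys it. So its content is first moved to a scratch
  register, and then restored while it is copied to the output.\<close>

lemma num_var:
  assumes "v \<in> set vs"
  shows "num n X vs v"
  unfolding num_def
proof (rule emitsI)
  fix ls out s assume fr: "frame ls out s" and len: "length ls = length vs"
  obtain j where j: "j < length vs" "vs ! j = v" using assms by (auto simp: in_set_conv_nth)
  define l where "l = ls ! j"
  have l: "l \<in> set ls" using j len by (auto simp: l_def)
  then have neq: "l \<noteq> s" "out \<noteq> s" "l \<noteq> out" "s \<noteq> l" "s \<noteq> out" "out \<noteq> l" using fr by (auto simp: frame_def)
  let ?p = "Seq (Loop l (Seq (Pop l) (Push s 0))) (Loop s (Seq (Pop s) (Seq (Push l 0) (Push out 0))))"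
  show "\<exists>p c. \<forall>e \<sigma> B. ready X vs ls s e \<sigma> \<longrightarrow> X e \<in> lists {..<n} \<longrightarrow> 2 \<le> B \<longrightarrow> bounded_by B X vs e \<longrightarrow>
        runs p \<sigma> B c (\<sigma>(out := rev (replicate (v e) 0) @ \<sigma> out))"
  proof (intro exI allI impI)
    fix e \<sigma> B assume r: "ready X vs ls s e \<sigma>" and B: "2 \<le> B" and b: "bounded_by B X vs e"
    have lv: "\<sigma> l = replicate (v e) 0"
    proof -
      have "map \<sigma> ls ! j = map (\<lambda>v. replicate (v e) 0) vs ! j" using r by (simp add: ready_def)
      then show ?thesis using j len by (simp add: l_def)
    qed
    have s0: "\<sigma> s = []" by (rule readyD[OF r order_refl])
    have k: "v e \<le> B ^ 1" using b assms by (simp add: bounded_by_def)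
    show "runs ?p \<sigma> B ((1 + 1 + 2 + 1 + 4) + ((1 + (1 + 1 + 2) + 2) + 1 + 4) + 2)
        (\<sigma>(out := rev (replicate (v e) 0) @ \<sigma> out))"
    proof (rule runs_seq[OF _ _ B])
      show "runs (Loop l (Seq (Pop l) (Push s 0))) \<sigma> B (1 + 1 + 2 + 1 + 4) (\<sigma>(l := [], s := replicate (v e) 0))"
        apply (rule runs_loop[OF B k, where \<sigma>s = "\<lambda>i. \<sigma>(l := replicate (v e - i) 0, s := replicate i 0)"])
        subgoal for i
          by (rule conjI, use neq in simp, rule runs_seq[OF runs_pop[OF B refl] runs_push[OF B] B])
            (use neq in \<open>auto simp: fun_eq_iff\<close>)
        using neq lv s0 by (auto simp: fun_eq_iff)
      show "runs (Loop s (Seq (Pop s) (Seq (Push l 0) (Push out 0)))) (\<sigma>(l := [], s := replicate (v e) 0)) B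
         ((1 + (1 + 1 + 2) + 2) + 1 + 4) (\<sigma>(out := rev (replicate (v e) 0) @ \<sigma> out))"
        apply (rule runs_loop[OF B k, where \<sigma>s = "\<lambda>i. \<sigma>(l := replicate i 0, s := replicate (v e - i) 0, out := replicate i 0 @ \<sigma> out)"])
        subgoal for i
          by (rule conjI, use neq in simp, rule runs_seq[OF runs_pop[OF B refl] runs_seq[OF runs_push[OF B refl] runs_push[OF B] B] B])
            (use neq in \<open>auto simp: fun_eq_iff\<close>)
        using neq lv s0 by (auto simp: fun_eq_iff)
    qed
  qed
qed

text \<open>This loop is behind the sums, bounded quantifiers and iterated connectives below. Its
  body is a function on pairs \<open>(e, i)\<close>, for which the loop counter is one more
  variable. Register \<open>s\<close> holds the number of remaining rounds and register
  \<open>s + 1\<close> the counter.\<close>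

lemma emits_concat:
  fixes h :: "'e \<Rightarrow> nat \<Rightarrow> nat list"
  assumes g: "num n X vs g"
    and h: "emits n (\<lambda>p. X (fst p)) (map (\<lambda>v p. v (fst p)) vs @ [snd]) (\<lambda>p. h (fst p) (snd p))"
  shows "emits n X vs (\<lambda>e. concat (map (h e) [0..<g e]))"
proof (rule emitsI)
  fix ls out s assume fr: "frame ls out s" and len: "length ls = length vs"
  have fs: "frame ls s (s + 2)" by (rule frame_scratch[OF fr]) auto
  obtain pg cg where pg: "emit_spec n X vs (\<lambda>e. replicate (g e) 0) ls s (s + 2) pg cg"
    using emitsE[OF g[unfolded num_def] fs len] by blast
  have fr': "frame (ls @ [s + 1]) out (s + 2)" using fr by (auto simp: frame_def)
  obtain ph ch where ph: "emit_spec n (\<lambda>p. X (fst p)) (map (\<lambda>v p. v (fst p)) vs @ [snd])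
      (\<lambda>p. h (fst p) (snd p)) (ls @ [s + 1]) out (s + 2) ph ch"
    using emitsE[OF h fr'] len by auto
  have neq: "out \<noteq> s" "s \<noteq> out" "out \<noteq> Suc s" "Suc s \<noteq> out" using fr by (auto simp: frame_def)
  let ?p = "Seq pg (Seq (Loop s (Seq (Pop s) (Seq ph (Push (s + 1) 0)))) (Loop (s + 1) (Pop (s + 1))))"
  show "\<exists>p c. \<forall>e \<sigma> B. ready X vs ls s e \<sigma> \<longrightarrow> X e \<in> lists {..<n} \<longrightarrow> 2 \<le> B \<longrightarrow> bounded_by B X vs e \<longrightarrow>
        runs p \<sigma> B c (\<sigma>(out := rev (concat (map (h e) [0..<g e])) @ \<sigma> out))"
  proof (intro exI allI impI)
    fix e \<sigma> B
    assume r: "ready X vs ls s e \<sigma>" and x: "X e \<in> lists {..<n}" and B: "2 \<le> B"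
      and b: "bounded_by B X vs e"
    have r2: "ready X vs ls (s + 2) e \<sigma>"
      by (rule ready_frame[OF fr r]) (use readyD[OF r] in auto)
    have s0: "\<sigma> s = []" "\<sigma> (Suc s) = []" using readyD[OF r] by auto
    have k: "g e \<le> B ^ cg" using emit_spec_length[OF pg r2 x b s0(1)] by simp
    \<comment> \<open>The counter may exceed \<open>B\<close>, so the body is run with the larger
      base \<open>B ^ (cg + 1)\<close>; in terms of \<open>B\<close> this multiplies its exponent by
      \<open>cg + 1\<close>. The \<open>1\<close> makes the base at least \<open>B\<close> even if
      \<open>cg = 0\<close>.\<close>
    have k': "g e \<le> B ^ (cg + 1)" using k B by (simp add: trans_le_add1 mult_2 order_trans[OF k])
    have B'': "B \<le> B ^ (cg + 1)"
      using B power_increasing[of 1 "cg + 1" B] by auto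
    have B': "2 \<le> B ^ (cg + 1)" "B \<le> B ^ (cg + 1)"
      using order_trans[OF B B''] B'' .
    let ?\<sigma> = "\<lambda>i. \<sigma>(s := replicate (g e - i) 0, s + 1 := replicate i 0,
        out := rev (concat (map (h e) [0..<i])) @ \<sigma> out)"
    show "runs ?p \<sigma> B (cg + (((1 + ((cg + 1) * ch + 1 + 2) + 2) + cg + 4) + (1 + cg + 4) + 2) + 2)
       (\<sigma>(out := rev (concat (map (h e) [0..<g e])) @ \<sigma> out))"
    proof (rule runs_seq[OF _ runs_seq[OF _ _ B] B])
      show "runs pg \<sigma> B cg (\<sigma>(s := replicate (g e) 0))"
        by (rule emit_specD[OF pg r2 x b]) (simp add: s0)
      show "runs (Loop s (Seq (Pop s) (Seq ph (Push (s + 1) 0)))) (\<sigma>(s := replicate (g e) 0)) B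
         ((1 + ((cg + 1) * ch + 1 + 2) + 2) + cg + 4) (?\<sigma> (g e))"
      proof (rule runs_loop[OF B k, where \<sigma>s = ?\<sigma>])
        fix i assume i: "i < g e"
        have "ready (\<lambda>p. X (fst p)) (map (\<lambda>v p. v (fst p)) vs @ [snd]) (ls @ [s + 1]) (s + 2) (e, i)
           ((?\<sigma> i)(s := tl (?\<sigma> i s)))"
        proof -
          have "map ((?\<sigma> i)(s := tl (?\<sigma> i s))) ls = map \<sigma> ls"
            by (rule map_cong) (use fr in \<open>auto simp: frame_def\<close>)
          then show ?thesis using r fr readyD[OF r] neq unfolding ready_def frame_def by (auto simp: comp_def)
        qed
        moreover have "bounded_by (B ^ (cg + 1)) (\<lambda>p. X (fst p)) (map (\<lambda>v p. v (fst p)) vs @ [snd]) (e, i)"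
          using b B' i k' unfolding bounded_by_def by (auto intro: order_trans)
        ultimately have "runs ph ((?\<sigma> i)(s := tl (?\<sigma> i s))) (B ^ (cg + 1)) ch
           ((?\<sigma> i)(s := tl (?\<sigma> i s), out := rev (h e i) @ ?\<sigma> i out))"
          using x neq by (intro emit_specD[OF ph]) auto
        then have ph': "runs ph ((?\<sigma> i)(s := tl (?\<sigma> i s))) B ((cg + 1) * ch)
           ((?\<sigma> i)(s := tl (?\<sigma> i s), out := rev (h e i) @ ?\<sigma> i out))"
          unfolding runs_def power_mult by simp
        show "?\<sigma> i s \<noteq> [] \<and> runs (Seq (Pop s) (Seq ph (Push (s + 1) 0))) (?\<sigma> i) B
            (1 + ((cg + 1) * ch + 1 + 2) + 2) (?\<sigma> (Suc i))"
          by (rule conjI, use neq i in simp, rule runs_seq[OF runs_pop[OF B refl] runs_seq[OF ph' runs_push[OF B] B] B])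
            (use neq in \<open>auto simp: fun_eq_iff\<close>)
      qed (use neq s0 in \<open>auto simp: fun_eq_iff\<close>)
      show "runs (Loop (s + 1) (Pop (s + 1))) (?\<sigma> (g e)) B (1 + cg + 4)
         (\<sigma>(out := rev (concat (map (h e) [0..<g e])) @ \<sigma> out))"
        by (rule runs_loop[OF B k, where \<sigma>s = "\<lambda>i. \<sigma>(s + 1 := replicate (g e - i) 0,
            out := rev (concat (map (h e) [0..<g e])) @ \<sigma> out)"])
          (use neq s0 in \<open>auto simp: fun_eq_iff intro!: runs_pop[OF B, simplified]\<close>)
    qed
  qed
qed

lemma emits_if:
  assumes g: "num n X vs g" and f1: "emits n X vs f1" and f2: "emits n X vs f2"
  shows "emits n X vs (\<lambda>e. if g e = 0 then f1 e else f2 e)"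
proof (rule emitsI)
  fix ls out s assume fr: "frame ls out s" and len: "length ls = length vs"
  have fs: "frame ls s (s + 1)" by (rule frame_scratch[OF fr]) auto
  obtain pg cg where pg: "emit_spec n X vs (\<lambda>e. replicate (g e) 0) ls s (s + 1) pg cg"
    using emitsE[OF g[unfolded num_def] fs len] by blast
  obtain p1 c1 where p1: "emit_spec n X vs f1 ls out s p1 c1" by (rule emitsE[OF f1 fr len])
  obtain p2 c2 where p2: "emit_spec n X vs f2 ls out s p2 c2" by (rule emitsE[OF f2 fr len])
  have neq: "out \<noteq> s" "s \<noteq> out" using fr by (auto simp: frame_def)
  let ?p = "Seq pg (IfTop s 0 p1 (Seq (Loop s (Pop s)) p2))"
  let ?c = "cg + (c1 + (1 + cg + 4 + c2 + 2) + 2) + 2"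
  show "\<exists>p c. \<forall>e \<sigma> B. ready X vs ls s e \<sigma> \<longrightarrow> X e \<in> lists {..<n} \<longrightarrow> 2 \<le> B \<longrightarrow> bounded_by B X vs e \<longrightarrow>
        runs p \<sigma> B c (\<sigma>(out := rev (if g e = 0 then f1 e else f2 e) @ \<sigma> out))"
  proof (rule exI[of _ ?p], rule exI[of _ ?c], intro allI impI)
    fix e \<sigma> B
    assume r: "ready X vs ls s e \<sigma>" and x: "X e \<in> lists {..<n}" and B: "2 \<le> B"
      and b: "bounded_by B X vs e"
    have r2: "ready X vs ls (s + 1) e \<sigma>"
      by (rule ready_frame[OF fr r]) (use readyD[OF r] in auto)
    have s0: "\<sigma> s = []" using readyD[OF r] by auto
    have k: "g e \<le> B ^ cg" using emit_spec_length[OF pg r2 x b s0(1)] by simp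
    have 1: "runs pg \<sigma> B cg (\<sigma>(s := replicate (g e) 0))"
      by (rule emit_specD[OF pg r2 x b]) (simp add: s0)
    show "runs ?p \<sigma> B ?c (\<sigma>(out := rev (if g e = 0 then f1 e else f2 e) @ \<sigma> out))"
    proof (cases "g e = 0")
      case True
      have "\<sigma>(s := replicate (g e) 0) = \<sigma>" using True s0 by auto
      with 1 have 1: "runs pg \<sigma> B cg \<sigma>" by simp
      have "runs (IfTop s 0 p1 (Seq (Loop s (Pop s)) p2)) \<sigma> B (c1 + 2) (\<sigma>(out := rev (f1 e) @ \<sigma> out))"
        by (rule runs_if_true[OF _ emit_specD[OF p1 r x b refl] B]) (simp add: s0)
      then have "runs ?p \<sigma> B (cg + (c1 + 2) + 2) (\<sigma>(out := rev (f1 e) @ \<sigma> out))"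
        by (rule runs_seq[OF 1 _ B])
      then show ?thesis using True B by (auto elim!: runs_mono)
    next
      case False
      have "runs (Loop s (Pop s)) (\<sigma>(s := replicate (g e) 0)) B (1 + cg + 4) \<sigma>"
        by (rule runs_loop[OF B k, where \<sigma>s = "\<lambda>i. \<sigma>(s := replicate (g e - i) 0)"])
          (use s0 in \<open>auto simp: fun_eq_iff intro!: runs_pop[OF B, simplified]\<close>)
      then have "runs (IfTop s 0 p1 (Seq (Loop s (Pop s)) p2)) (\<sigma>(s := replicate (g e) 0)) B
          ((1 + cg + 4 + c2 + 2) + 2) (\<sigma>(out := rev (f2 e) @ \<sigma> out))"
        by (intro runs_if_false[OF _ runs_seq[OF _ emit_specD[OF p2 r x b refl] B] B])
          (use False in \<open>auto simp: neq0_conv gr0_conv_Suc\<close>)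
      then have "runs ?p \<sigma> B (cg + ((1 + cg + 4 + c2 + 2) + 2) + 2) (\<sigma>(out := rev (f2 e) @ \<sigma> out))"
        by (rule runs_seq[OF 1 _ B])
      then show ?thesis using False B by (auto elim!: runs_mono)
    qed
  qed
qed

text \<open>\<open>Pop\<close> leaves an empty stack unchanged, so popping two stacks in parallel
  yields truncated subtraction.\<close>

lemma num_diff:
  assumes f: "num n X vs f" and g: "num n X vs g"
  shows "num n X vs (\<lambda>e. f e - g e)"
  unfolding num_def
proof (rule emitsI)
  fix ls out s assume fr: "frame ls out s" and len: "length ls = length vs"
  have fs: "frame ls s (s + 2)" "frame ls (s + 1) (s + 2)" by (rule frame_scratch[OF fr]; simp)+
  obtain pf cf where pf: "emit_spec n X vs (\<lambda>e. replicate (f e) 0) ls (s + 1) (s + 2) pf cf"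
    using emitsE[OF f[unfolded num_def] fs(2) len] by blast
  obtain pg cg where pg: "emit_spec n X vs (\<lambda>e. replicate (g e) 0) ls s (s + 2) pg cg"
    using emitsE[OF g[unfolded num_def] fs(1) len] by blast
  have neq: "out \<noteq> s" "s \<noteq> out" "out \<noteq> Suc s" "Suc s \<noteq> out" using fr by (auto simp: frame_def)
  let ?p = "Seq pg (Seq pf (Seq (Loop s (Seq (Pop s) (Pop (s + 1))))
     (Loop (s + 1) (Seq (Pop (s + 1)) (Push out 0)))))"
  show "\<exists>p c. \<forall>e \<sigma> B. ready X vs ls s e \<sigma> \<longrightarrow> X e \<in> lists {..<n} \<longrightarrow> 2 \<le> B \<longrightarrow> bounded_by B X vs e \<longrightarrow>
        runs p \<sigma> B c (\<sigma>(out := rev (replicate (f e - g e) 0) @ \<sigma> out))"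
  proof (intro exI allI impI)
    fix e \<sigma> B
    assume r: "ready X vs ls s e \<sigma>" and x: "X e \<in> lists {..<n}" and B: "2 \<le> B"
      and b: "bounded_by B X vs e"
    have r2: "ready X vs ls (s + 2) e \<sigma>"
      by (rule ready_frame[OF fr r]) (use readyD[OF r] in auto)
    have s0: "\<sigma> s = []" "\<sigma> (Suc s) = []" using readyD[OF r] by auto
    have kg: "g e \<le> B ^ cg" using emit_spec_length[OF pg r2 x b s0(1)] by simp
    have "f e \<le> B ^ cf" using emit_spec_length[OF pf r2 x b] s0(2) by simp
    then have kd: "f e - g e \<le> B ^ cf" by simp
    have 1: "runs pg \<sigma> B cg (\<sigma>(s := replicate (g e) 0))"
      by (rule emit_specD[OF pg r2 x b]) (simp add: s0)
    have 2: "runs pf (\<sigma>(s := replicate (g e) 0)) B cf (\<sigma>(s := replicate (g e) 0, s + 1 := replicate (f e) 0))"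
      by (rule emit_specD[OF pf ready_out[OF fs(1) r2] x b]) (simp add: s0)
    have 3: "runs (Loop s (Seq (Pop s) (Pop (s + 1)))) (\<sigma>(s := replicate (g e) 0, s + 1 := replicate (f e) 0)) B
        (1 + 1 + 2 + cg + 4) (\<sigma>(s + 1 := replicate (f e - g e) 0))"
      apply (rule runs_loop[OF B kg, where \<sigma>s = "\<lambda>i. \<sigma>(s := replicate (g e - i) 0, s + 1 := replicate (f e - i) 0)"])
      subgoal for i
        by (rule conjI, simp, rule runs_seq[OF runs_pop[OF B refl] runs_pop[OF B] B])
          (auto simp: fun_eq_iff)
      using s0 by (auto simp: fun_eq_iff)
    have 4: "runs (Loop (s + 1) (Seq (Pop (s + 1)) (Push out 0))) (\<sigma>(s + 1 := replicate (f e - g e) 0)) B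
        (1 + 1 + 2 + cf + 4) (\<sigma>(out := rev (replicate (f e - g e) 0) @ \<sigma> out))"
      apply (rule runs_loop[OF B kd, where \<sigma>s = "\<lambda>i. \<sigma>(s + 1 := replicate (f e - g e - i) 0, out := replicate i 0 @ \<sigma> out)"])
      subgoal for i
        by (rule conjI, use neq in simp, rule runs_seq[OF runs_pop[OF B refl] runs_push[OF B] B])
          (use neq in \<open>auto simp: fun_eq_iff\<close>)
      using s0 neq by (auto simp: fun_eq_iff)
    show "runs ?p \<sigma> B (cg + (cf + ((1 + 1 + 2 + cg + 4) + (1 + 1 + 2 + cf + 4) + 2) + 2) + 2)
       (\<sigma>(out := rev (replicate (f e - g e) 0) @ \<sigma> out))"
      by (rule runs_seq[OF 1 runs_seq[OF 2 runs_seq[OF 3 4 B] B] B])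
  qed
qed

text \<open>A pushed letter is fixed by the program text, so a letter that has been read can be
  moved only by a case distinction over all letters below \<open>k\<close>.\<close>

fun transfer :: "nat \<Rightarrow> nat \<Rightarrow> nat \<Rightarrow> prog" where
  "transfer 0 a b = Skip"
| "transfer (Suc k) a b = IfTop a (Suc k) (Seq (Push b k) (Pop a)) (transfer k a b)"

lemma runs_transfer:
  assumes B: "2 \<le> B" and ab: "a \<noteq> b" and k: "\<sigma> a \<noteq> [] \<Longrightarrow> hd (\<sigma> a) < k"
  shows "runs (transfer k a b) \<sigma> B (2 * k + 6)
    (if \<sigma> a = [] then \<sigma> else \<sigma>(a := tl (\<sigma> a), b := hd (\<sigma> a) # \<sigma> b))"
  using k
proof (induction k)
  case 0
  then show ?case using runs_mono[OF runs_skip[OF B] B, of 6] by auto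
next
  case (Suc k)
  show ?case
  proof (cases "top_symbol (\<sigma> a) = Suc k")
    case True
    then obtain ys where ys: "\<sigma> a = k # ys" by (cases "\<sigma> a") auto
    have "runs (Seq (Push b k) (Pop a)) \<sigma> B (1 + 1 + 2) (\<sigma>(a := tl (\<sigma> a), b := hd (\<sigma> a) # \<sigma> b))"
      by (rule runs_seq[OF runs_push[OF B refl] runs_pop[OF B] B]) (use ab ys in \<open>auto simp: fun_eq_iff\<close>)
    then have "runs (transfer (Suc k) a b) \<sigma> B (1 + 1 + 2 + 2) (\<sigma>(a := tl (\<sigma> a), b := hd (\<sigma> a) # \<sigma> b))"
      unfolding transfer.simps by (rule runs_if_true[of \<sigma> a, OF True _ B])
    from runs_mono[OF this B, of "2 * Suc k + 6"] show ?thesis using ys by (simp del: fun_upd_apply)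
  next
    case False
    then have "\<sigma> a \<noteq> [] \<Longrightarrow> hd (\<sigma> a) < k" using Suc.prems by (cases "\<sigma> a") (auto simp: less_Suc_eq)
    from runs_if_false[OF False Suc.IH[OF this] B] show ?thesis by simp
  qed
qed

lemma runs_transfer_input:
  assumes B: "2 \<le> B" and "x \<in> lists {..<n}" "a \<noteq> b" "\<sigma> a = drop i x"
  shows "runs (transfer n a b) \<sigma> B (2 * n + 6) (\<sigma>(a := drop (Suc i) x, b := rev (take 1 (drop i x)) @ \<sigma> b))"
proof -
  have "hd (\<sigma> a) < n" if "\<sigma> a \<noteq> []"
  proof -
    have "hd (drop i x) \<in> set x" using that assms(4) by (metis hd_in_set in_set_dropD)
    then show ?thesis using assms by auto
  qed
  from runs_transfer[of B a b \<sigma> n, OF B assms(3) this] have *: "runs (transfer n a b) \<sigma> B (2 * n + 6)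
     (if \<sigma> a = [] then \<sigma> else \<sigma>(a := tl (\<sigma> a), b := hd (\<sigma> a) # \<sigma> b))" .
  show ?thesis
  proof (cases "drop i x")
    case Nil
    then show ?thesis using * assms by (auto simp: fun_upd_idem)
  next
    case (Cons y ys)
    moreover then have "drop (Suc i) x = ys" by (metis drop_Suc list.sel(3) tl_drop)
    ultimately show ?thesis using * assms by auto
  qed
qed

lemma num_length_input: "num n X vs (\<lambda>e. length (X e))"
  unfolding num_def
proof (rule emitsI)
  fix ls out s assume fr: "frame ls out s" and len: "length ls = length vs"
  have neq: "out \<noteq> 0" "out \<noteq> 2" "0 \<noteq> out" "2 \<noteq> out" using fr by (auto simp: frame_def)
  let ?p = "Seq (Loop 0 (transfer n 0 2)) (Loop 2 (Seq (transfer n 2 0) (Push out 0)))"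
  show "\<exists>p c. \<forall>e \<sigma> B. ready X vs ls s e \<sigma> \<longrightarrow> X e \<in> lists {..<n} \<longrightarrow> 2 \<le> B \<longrightarrow> bounded_by B X vs e \<longrightarrow>
        runs p \<sigma> B c (\<sigma>(out := rev (replicate (length (X e)) 0) @ \<sigma> out))"
  proof (intro exI allI impI)
    fix e \<sigma> B
    assume r: "ready X vs ls s e \<sigma>" and x: "X e \<in> lists {..<n}" and B: "2 \<le> B"
      and b: "bounded_by B X vs e"
    have \<sigma>: "\<sigma> 0 = X e" "\<sigma> 2 = []" using r by (auto simp: ready_def)
    have k: "length (X e) \<le> B ^ 1" using b by (simp add: bounded_by_def)
    have 1: "runs (Loop 0 (transfer n 0 2)) \<sigma> B (2 * n + 6 + 1 + 4) (\<sigma>(0 := [], 2 := rev (X e)))"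
      apply (rule runs_loop[OF B k, where \<sigma>s = "\<lambda>i. \<sigma>(0 := drop i (X e), 2 := rev (take i (X e)))"])
      subgoal for i
        using runs_transfer_input[OF B x, of 0 2 "\<sigma>(0 := drop i (X e), 2 := rev (take i (X e)))" i]
        by (simp add: take_Suc_conv_app_nth drop_Suc take_Suc hd_drop_conv_nth fun_upd_twist)
      using \<sigma> by (auto simp: fun_eq_iff)
    have x': "rev (X e) \<in> lists {..<n}" using x by auto
    have 2: "runs (Loop 2 (Seq (transfer n 2 0) (Push out 0))) (\<sigma>(0 := [], 2 := rev (X e))) B (2 * n + 6 + 1 + 2 + 1 + 4)
       (\<sigma>(out := rev (replicate (length (X e)) 0) @ \<sigma> out))"
      apply (rule runs_loop[OF B k, where \<sigma>s = "\<lambda>i. \<sigma>(0 := rev (take i (rev (X e))), 2 := drop i (rev (X e)), out := replicate i 0 @ \<sigma> out)"])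
      subgoal for i
        apply (rule conjI)
        using neq apply simp
        apply (rule runs_seq[OF runs_transfer_input[OF B x', where i = i] runs_push[OF B] B])
        using neq by (auto simp: fun_eq_iff take_Suc_conv_app_nth take_Suc hd_drop_conv_nth)
      using \<sigma> neq by (auto simp: fun_eq_iff)
    show "runs ?p \<sigma> B ((2 * n + 6 + 1 + 4) + (2 * n + 6 + 1 + 2 + 1 + 4) + 2)
       (\<sigma>(out := rev (replicate (length (X e)) 0) @ \<sigma> out))"
      by (rule runs_seq[OF 1 2 B])
  qed
qed

text \<open>The first \<open>g e\<close> letters are moved to register \<open>2\<close>, which
  brings the letter in question to the top of register \<open>0\<close>, and are moved back after
  the test. If the word is too short, an empty stack is tested and the answer is
  \<open>0\<close>.\<close>

lemma num_letter:
  assumes g: "num n X vs g"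
  shows "num n X vs (\<lambda>e. if g e < length (X e) \<and> X e ! g e = a then 1 else 0)"
  unfolding num_def
proof (rule emitsI)
  fix ls out s assume fr: "frame ls out s" and len: "length ls = length vs"
  have fs: "frame ls s (s + 1)" by (rule frame_scratch[OF fr]) auto
  obtain pg cg where pg: "emit_spec n X vs (\<lambda>e. replicate (g e) 0) ls s (s + 1) pg cg"
    using emitsE[OF g[unfolded num_def] fs len] by blast
  have neq: "out \<noteq> 0" "out \<noteq> 2" "0 \<noteq> out" "2 \<noteq> out" "s \<noteq> 0" "s \<noteq> 2" "0 < s" "2 < s" "2 \<noteq> s"
    "out \<noteq> s" "s \<noteq> out" using fr by (auto simp: frame_def)
  let ?p = "Seq pg (Seq (Loop s (Seq (Pop s) (transfer n 0 2)))
     (Seq (IfTop 0 (Suc a) (Push out 0) Skip) (Loop 2 (transfer n 2 0))))"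
  show "\<exists>p c. \<forall>e \<sigma> B. ready X vs ls s e \<sigma> \<longrightarrow> X e \<in> lists {..<n} \<longrightarrow> 2 \<le> B \<longrightarrow> bounded_by B X vs e \<longrightarrow>
        runs p \<sigma> B c (\<sigma>(out := rev (replicate (if g e < length (X e) \<and> X e ! g e = a then 1 else 0) 0) @ \<sigma> out))"
  proof (intro exI allI impI)
    fix e \<sigma> B
    assume r: "ready X vs ls s e \<sigma>" and x: "X e \<in> lists {..<n}" and B: "2 \<le> B"
      and b: "bounded_by B X vs e"
    have r2: "ready X vs ls (s + 1) e \<sigma>"
      by (rule ready_frame[OF fr r]) (use readyD[OF r] in auto)
    have \<sigma>: "\<sigma> 0 = X e" "\<sigma> 2 = []" using r by (auto simp: ready_def)
    have s0: "\<sigma> s = []" using readyD[OF r] by auto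
    have k: "g e \<le> B ^ cg" using emit_spec_length[OF pg r2 x b s0(1)] by simp
    define y where "y = take (g e) (X e)"
    define o' where "o' = replicate (if g e < length (X e) \<and> X e ! g e = a then 1 else 0 :: nat) (0 :: nat) @ \<sigma> out"
    have ky: "length (rev y) \<le> B ^ 1" using b by (simp add: bounded_by_def y_def min.coboundedI1)
    have y': "rev y \<in> lists {..<n}" using x set_take_subset[of "g e" "X e"] unfolding y_def by fastforce
    have 1: "runs pg \<sigma> B cg (\<sigma>(s := replicate (g e) 0))"
      by (rule emit_specD[OF pg r2 x b]) (simp add: s0)
    have 2: "runs (Loop s (Seq (Pop s) (transfer n 0 2))) (\<sigma>(s := replicate (g e) 0)) B
       (1 + (2 * n + 6) + 2 + cg + 4) (\<sigma>(0 := drop (g e) (X e), 2 := rev y))"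
      apply (rule runs_loop[OF B k, where \<sigma>s = "\<lambda>i. \<sigma>(s := replicate (g e - i) 0, 0 := drop i (X e), 2 := rev (take i (X e)))"])
      subgoal for i
        apply (rule conjI)
        using neq apply simp
        apply (rule back_subst[of "runs _ _ _ _"])
         apply (rule runs_seq[OF runs_pop[OF B refl] runs_transfer_input[OF B x, where i = i] B])
        using neq apply simp_all
        apply (cases "i < length (X e)")
         apply (auto simp: fun_eq_iff take_Suc_conv_app_nth take_Suc hd_drop_conv_nth)
        done
      using \<sigma> neq s0 by (auto simp: fun_eq_iff y_def)
    have 3: "runs (IfTop 0 (Suc a) (Push out 0) Skip) (\<sigma>(0 := drop (g e) (X e), 2 := rev y)) B (1 + 2)
       (\<sigma>(0 := drop (g e) (X e), 2 := rev y, out := o'))"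
    proof (cases "g e < length (X e) \<and> X e ! g e = a")
      case True
      then have "drop (g e) (X e) = a # drop (Suc (g e)) (X e)" by (metis Cons_nth_drop_Suc)
      then show ?thesis using True neq
        by (intro runs_if_true[OF _ runs_push[OF B] B]) (auto simp: o'_def fun_eq_iff)
    next
      case False
      then have "top_symbol (drop (g e) (X e)) \<noteq> Suc a"
        by (cases "g e < length (X e)") (auto simp: Cons_nth_drop_Suc[symmetric])
      moreover have "\<sigma>(0 := drop (g e) (X e), 2 := rev y, out := o') = \<sigma>(0 := drop (g e) (X e), 2 := rev y)"
        using False neq by (auto simp: o'_def fun_eq_iff)
      ultimately show ?thesis using neq runs_if_false[OF _ runs_skip[OF B] B] by simp
    qed
    have 4: "runs (Loop 2 (transfer n 2 0)) (\<sigma>(0 := drop (g e) (X e), 2 := rev y, out := o')) B (2 * n + 6 + 1 + 4)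
       (\<sigma>(out := o'))"
      apply (rule runs_loop[OF B ky, where \<sigma>s = "\<lambda>i. \<sigma>(0 := rev (take i (rev y)) @ drop (g e) (X e), 2 := drop i (rev y), out := o')"])
      subgoal for i
        apply (rule conjI)
        using neq apply simp
        apply (rule back_subst[of "runs _ _ _ _"])
         apply (rule runs_transfer_input[OF B y', where i = i])
        using neq apply simp_all
        apply (auto simp: fun_eq_iff take_Suc_conv_app_nth take_Suc hd_drop_conv_nth)
        done
      using \<sigma> neq by (auto simp: fun_eq_iff y_def)
    have "runs ?p \<sigma> B (cg + ((1 + (2 * n + 6) + 2 + cg + 4) + ((1 + 2) + (2 * n + 6 + 1 + 4) + 2) + 2) + 2) (\<sigma>(out := o'))"
      by (rule runs_seq[OF 1 runs_seq[OF 2 runs_seq[OF 3 4 B] B] B])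
    then show "runs ?p \<sigma> B (cg + ((1 + (2 * n + 6) + 2 + cg + 4) + ((1 + 2) + (2 * n + 6 + 1 + 4) + 2) + 2) + 2)
      (\<sigma>(out := rev (replicate (if g e < length (X e) \<and> X e ! g e = a then 1 else 0) 0) @ \<sigma> out))"
      unfolding o'_def by simp
  qed
qed

lemma num_length:
  assumes f: "emits n X vs f"
  shows "num n X vs (\<lambda>e. length (f e))"
  unfolding num_def
proof (rule emitsI)
  fix ls out s assume fr: "frame ls out s" and len: "length ls = length vs"
  have fs: "frame ls s (s + 1)" by (rule frame_scratch[OF fr]) auto
  obtain pf cf where pf: "emit_spec n X vs f ls s (s + 1) pf cf"
    using emitsE[OF f fs len] by blast
  have neq: "out \<noteq> s" "s \<noteq> out" using fr by (auto simp: frame_def)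
  let ?p = "Seq pf (Loop s (Seq (Pop s) (Push out 0)))"
  show "\<exists>p c. \<forall>e \<sigma> B. ready X vs ls s e \<sigma> \<longrightarrow> X e \<in> lists {..<n} \<longrightarrow> 2 \<le> B \<longrightarrow> bounded_by B X vs e \<longrightarrow>
        runs p \<sigma> B c (\<sigma>(out := rev (replicate (length (f e)) 0) @ \<sigma> out))"
  proof (intro exI allI impI)
    fix e \<sigma> B
    assume r: "ready X vs ls s e \<sigma>" and x: "X e \<in> lists {..<n}" and B: "2 \<le> B"
      and b: "bounded_by B X vs e"
    have r2: "ready X vs ls (s + 1) e \<sigma>"
      by (rule ready_frame[OF fr r]) (use readyD[OF r] in auto)
    have s0: "\<sigma> s = []" using readyD[OF r] by auto
    have k: "length (f e) \<le> B ^ cf" using emit_spec_length[OF pf r2 x b s0(1)] by simp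
    have 1: "runs pf \<sigma> B cf (\<sigma>(s := rev (f e)))"
      by (rule emit_specD[OF pf r2 x b]) (simp add: s0)
    have 2: "runs (Loop s (Seq (Pop s) (Push out 0))) (\<sigma>(s := rev (f e))) B
        (1 + 1 + 2 + cf + 4) (\<sigma>(out := rev (replicate (length (f e)) 0) @ \<sigma> out))"
      apply (rule runs_loop[OF B k, where \<sigma>s = "\<lambda>i. \<sigma>(s := drop i (rev (f e)), out := replicate i 0 @ \<sigma> out)"])
      subgoal for i
        by (rule conjI, use neq in simp, rule runs_seq[OF runs_pop[OF B refl] runs_push[OF B] B])
          (use neq in \<open>auto simp: fun_eq_iff drop_Suc tl_drop\<close>)
      using s0 neq by (auto simp: fun_eq_iff)
    show "runs ?p \<sigma> B (cf + (1 + 1 + 2 + cf + 4) + 2)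
       (\<sigma>(out := rev (replicate (length (f e)) 0) @ \<sigma> out))"
      by (rule runs_seq[OF 1 2 B])
  qed
qed

theorem poly_time_computable_emits:
  assumes "emits n (\<lambda>x. x) [] f"
  shows "poly_time_computable n f"
proof -
  have "frame [] 1 3" by (simp add: frame_def)
  then obtain p c where p: "emit_spec n (\<lambda>x. x) [] f [] 1 3 p c"
    using emitsE[OF assms] by (metis list.size(3))
  show ?thesis
  proof (rule poly_time_computableI)
    fix x :: "nat list" assume x: "x \<in> lists {..<n}"
    have "runs p ((\<lambda>_. [])(0 := x)) (length x + 2) c (((\<lambda>_. [])(0 := x))(1 := rev (f x)))"
      by (rule emit_specD[OF p _ x]) (auto simp: ready_def bounded_by_def fun_eq_iff)
    then show "\<exists>t\<le>(length x + 2) ^ c. \<exists>\<sigma>. exec p ((\<lambda>_. [])(0 := x)) t \<sigma> \<and> \<sigma> 1 = rev (f x)"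
      unfolding runs_def by (metis fun_upd_same)
  qed
qed

section \<open>Closure properties\<close>

definition decidable :: "nat \<Rightarrow> ('e \<Rightarrow> nat list) \<Rightarrow> ('e \<Rightarrow> nat) list \<Rightarrow> ('e \<Rightarrow> bool) \<Rightarrow> bool" where
  "decidable n X vs P \<longleftrightarrow> num n X vs (\<lambda>e. if P e then 1 else 0)"

lemma num_0: "num n X vs (\<lambda>e. 0)"
  unfolding num_def using emits_Nil by simp

lemma num_1: "num n X vs (\<lambda>e. 1)"
  unfolding num_def using emits_letter by simp

lemma num_add: "num n X vs f \<Longrightarrow> num n X vs g \<Longrightarrow> num n X vs (\<lambda>e. f e + g e)"
  unfolding num_def replicate_add by (rule emits_append)

lemma num_sum:
  assumes "num n X vs g" "num n (\<lambda>p. X (fst p)) (map (\<lambda>v p. v (fst p)) vs @ [snd]) (\<lambda>p. h (fst p) (snd p))"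
  shows "num n X vs (\<lambda>e. \<Sum>i<g e. h e i)"
proof -
  have "concat (map (\<lambda>i. replicate (h e i) 0) [0..<k]) = replicate (\<Sum>i<k. h e i) (0::nat)" for e k
    by (induction k) (auto simp: replicate_add)
  then show ?thesis
    using emits_concat[OF assms(1), of "\<lambda>e i. replicate (h e i) 0"] assms(2)
    unfolding num_def by simp
qed

lemma num_const: "num n X vs (\<lambda>e. k)"
proof (induction k)
  case (Suc k)
  then show ?case using num_add[OF num_1 Suc] by simp
qed (rule num_0)

lemma emits_if_decidable:
  assumes "decidable n X vs P" "emits n X vs f" "emits n X vs g"
  shows "emits n X vs (\<lambda>e. if P e then f e else g e)"
proof -
  have "(\<lambda>e. if P e then f e else g e) = (\<lambda>e. if (if P e then 1 else 0 :: nat) = 0 then g e else f e)"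
    by auto
  then show ?thesis using emits_if[OF assms(1)[unfolded decidable_def] assms(3,2)] by simp
qed

lemma num_if:
  assumes "decidable n X vs P" "num n X vs f" "num n X vs g"
  shows "num n X vs (\<lambda>e. if P e then f e else g e)"
  using emits_if_decidable[OF assms(1) assms(2,3)[unfolded num_def]] unfolding num_def
  by (simp add: if_distrib[of "\<lambda>k. replicate k 0"] cong: if_cong)

lemma decidable_less:
  assumes "num n X vs f" "num n X vs g"
  shows "decidable n X vs (\<lambda>e. f e < g e)"
proof -
  have "num n X vs (\<lambda>e. 1 - (1 - (g e - f e)))"
    by (intro num_diff assms num_1)
  moreover have "(\<lambda>e. 1 - (1 - (g e - f e))) = (\<lambda>e. if f e < g e then 1 else 0)" by auto
  ultimately show ?thesis unfolding decidable_def by simp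
qed

lemma decidable_not:
  assumes "decidable n X vs P"
  shows "decidable n X vs (\<lambda>e. \<not> P e)"
proof -
  have "(\<lambda>e. if \<not> P e then 1 else 0 :: nat) = (\<lambda>e. if P e then 0 else 1)" by auto
  then show ?thesis using num_if[OF assms num_0 num_1] unfolding decidable_def by simp
qed

lemma decidable_const: "decidable n X vs (\<lambda>e. b)"
  by (cases b) (simp_all add: decidable_def num_0 num_1[simplified])

lemma decidable_and:
  assumes "decidable n X vs P" "decidable n X vs Q"
  shows "decidable n X vs (\<lambda>e. P e \<and> Q e)"
proof -
  have "(\<lambda>e. if P e \<and> Q e then 1 else 0 :: nat) = (\<lambda>e. if P e then if Q e then 1 else 0 else 0)"
    by auto
  then show ?thesis using num_if[OF assms(1) assms(2)[unfolded decidable_def] num_0]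
    unfolding decidable_def by simp
qed

lemma decidable_or:
  assumes "decidable n X vs P" "decidable n X vs Q"
  shows "decidable n X vs (\<lambda>e. P e \<or> Q e)"
  using decidable_not[OF decidable_and[OF assms[THEN decidable_not]]] by simp

lemma decidable_imp:
  assumes "decidable n X vs P" "decidable n X vs Q"
  shows "decidable n X vs (\<lambda>e. P e \<longrightarrow> Q e)"
  using decidable_or[OF decidable_not[OF assms(1)] assms(2)] by simp

lemma decidable_iff:
  assumes "decidable n X vs P" "decidable n X vs Q"
  shows "decidable n X vs (\<lambda>e. P e \<longleftrightarrow> Q e)"
proof -
  have "(\<lambda>e. P e \<longleftrightarrow> Q e) = (\<lambda>e. (P e \<longrightarrow> Q e) \<and> (Q e \<longrightarrow> P e))" by auto
  then show ?thesis using decidable_and[OF decidable_imp[OF assms] decidable_imp[OF assms(2,1)]] by simp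
qed

lemma decidable_le:
  assumes "num n X vs f" "num n X vs g"
  shows "decidable n X vs (\<lambda>e. f e \<le> g e)"
  using decidable_not[OF decidable_less[OF assms(2,1)]] by (simp add: not_less)

lemma decidable_eq:
  assumes "num n X vs f" "num n X vs g"
  shows "decidable n X vs (\<lambda>e. f e = g e)"
  using decidable_and[OF decidable_le[OF assms] decidable_le[OF assms(2,1)]] by (simp add: eq_iff[of "f _"])

text \<open>A bounded existential quantifier is a positive sum of characteristic values, so it
  inherits polynomial time from the summation loop.\<close>

lemma decidable_ex:
  assumes "num n X vs g"
    "decidable n (\<lambda>p. X (fst p)) (map (\<lambda>v p. v (fst p)) vs @ [snd]) (\<lambda>p. P (fst p) (snd p))"
  shows "decidable n X vs (\<lambda>e. \<exists>i<g e. P e i)"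
proof -
  have "num n X vs (\<lambda>e. \<Sum>i<g e. if P e i then 1 else 0)"
    by (rule num_sum[OF assms(1) assms(2)[unfolded decidable_def]])
  from decidable_less[OF num_0 this]
  have "decidable n X vs (\<lambda>e. 0 < (\<Sum>i<g e. if P e i then 1 else 0 :: nat))" .
  moreover have "0 < (\<Sum>i<g e. if P e i then 1 else 0 :: nat) \<longleftrightarrow> (\<exists>i<g e. P e i)" for e
  proof -
    have "(\<Sum>i<g e. if P e i then 1 else 0 :: nat) = 0 \<longleftrightarrow> (\<forall>i<g e. \<not> P e i)"
      by auto
    then show ?thesis by (metis bot_nat_0.not_eq_extremum)
  qed
  ultimately show ?thesis by simp
qed

lemma decidable_all:
  assumes "num n X vs g"
    "decidable n (\<lambda>p. X (fst p)) (map (\<lambda>v p. v (fst p)) vs @ [snd]) (\<lambda>p. P (fst p) (snd p))"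
  shows "decidable n X vs (\<lambda>e. \<forall>i<g e. P e i)"
  using decidable_not[OF decidable_ex[OF assms(1) decidable_not[OF assms(2)]]] by simp

lemma decidable_letter:
  "num n X vs g \<Longrightarrow> decidable n X vs (\<lambda>e. g e < length (X e) \<and> X e ! g e = a)"
  unfolding decidable_def by (rule num_letter)

lemma emits_lift:
  assumes "emits n X vs f"
  shows "emits n (\<lambda>p. X (fst p)) (map (\<lambda>v p. v (fst p)) vs @ [snd]) (\<lambda>p. f (fst p))"
proof (rule emitsI)
  fix ls :: "nat list" and out s
  assume fr: "frame ls out s" and len: "length ls = length (map (\<lambda>v p. v (fst p)) vs @ [snd])"
  then obtain ks l where ls: "ls = ks @ [l]" "length ks = length vs" by (cases ls rule: rev_cases) auto
  have "frame ks out s" using fr by (auto simp: frame_def ls)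
  then obtain p c where p: "emit_spec n X vs f ks out s p c" using emitsE[OF assms _ ls(2)] by blast
  show "\<exists>p c. \<forall>e \<sigma> B. ready (\<lambda>p. X (fst p)) (map (\<lambda>v p. v (fst p)) vs @ [snd]) ls s e \<sigma> \<longrightarrow>
      X (fst e) \<in> lists {..<n} \<longrightarrow> 2 \<le> B \<longrightarrow>
      bounded_by B (\<lambda>p. X (fst p)) (map (\<lambda>v p. v (fst p)) vs @ [snd]) e \<longrightarrow>
        runs p \<sigma> B c (\<sigma>(out := rev (f (fst e)) @ \<sigma> out))"
  proof (intro exI allI impI)
    fix e :: "'a \<times> nat" and \<sigma> B
    assume a: "ready (\<lambda>p. X (fst p)) (map (\<lambda>v p. v (fst p)) vs @ [snd]) ls s e \<sigma>" "X (fst e) \<in> lists {..<n}"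
      "bounded_by B (\<lambda>p. X (fst p)) (map (\<lambda>v p. v (fst p)) vs @ [snd]) e"
    show "runs p \<sigma> B c (\<sigma>(out := rev (f (fst e)) @ \<sigma> out))"
      by (rule emit_specD[OF p _ a(2) _ refl])
        (use a(1,3) in \<open>auto simp: ready_def ls bounded_by_def comp_def\<close>)
  qed
qed

lemma num_mult:
  assumes "num n X vs f" "num n X vs g"
  shows "num n X vs (\<lambda>e. f e * g e)"
  using num_sum[OF assms(1), of "\<lambda>e i. g e"] emits_lift[OF assms(2)[unfolded num_def]]
  by (simp add: num_def)

lemma num_poly: "num n X vs g \<Longrightarrow> num n X vs (\<lambda>e. poly q (g e))"
  by (induction q) (auto intro!: num_add num_mult num_const)

section \<open>Cirquents with a labelled pool\<close>

text \<open>The side condition of conjunction introduction, rewritten along the recursion of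
  \<open>merge_ogroups\<close> so that one induction handles both.\<close>

fun paired :: "nat \<Rightarrow> nat set list \<Rightarrow> bool" where
  "paired n (\<Gamma> # \<Delta> # S) = (if n \<in> \<Gamma> then Suc n \<notin> \<Gamma> \<and> n \<notin> \<Delta> \<and> Suc n \<in> \<Delta> \<and> paired n S
     else Suc n \<notin> \<Gamma> \<and> paired n (\<Delta> # S))"
| "paired n [\<Gamma>] = (n \<notin> \<Gamma> \<and> Suc n \<notin> \<Gamma>)"
| "paired n [] = True"

lemma pairedI:
  assumes "\<And>\<Gamma>. \<Gamma> \<in> set S \<Longrightarrow> \<not> (n \<in> \<Gamma> \<and> Suc n \<in> \<Gamma>)"
    "\<And>j. j < length S \<Longrightarrow> n \<in> S ! j \<Longrightarrow> Suc j < length S \<and> Suc n \<in> S ! Suc j"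
    "\<And>j. j < length S \<Longrightarrow> Suc n \<in> S ! j \<Longrightarrow> 0 < j \<and> n \<in> S ! (j - 1)"
  shows "paired n S"
  using assms
proof (induction n S rule: paired.induct)
  case (1 n \<Gamma> \<Delta> S)
  show ?case
  proof (cases "n \<in> \<Gamma>")
    case True
    have d: "Suc n \<in> \<Delta>" using 1(4)[of 0] True by simp
    then have nd: "n \<notin> \<Delta>" "Suc n \<notin> \<Gamma>" using 1(3) True by auto
    have "paired n S"
    proof (rule 1(1)[OF True])
      fix j assume j: "j < length S"
      show "n \<in> S ! j \<Longrightarrow> Suc j < length S \<and> Suc n \<in> S ! Suc j" using 1(4)[of "Suc (Suc j)"] j by simp
      show "Suc n \<in> S ! j \<Longrightarrow> 0 < j \<and> n \<in> S ! (j - 1)"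
        using 1(5)[of "Suc (Suc j)"] j nd by (cases j) auto
    qed (use 1(3) in auto)
    then show ?thesis using True d nd by simp
  next
    case False
    have nd: "Suc n \<notin> \<Gamma>" using 1(5)[of 0] by auto
    have "paired n (\<Delta> # S)"
    proof (rule 1(2)[OF False])
      fix j assume j: "j < length (\<Delta> # S)"
      show "n \<in> (\<Delta> # S) ! j \<Longrightarrow> Suc j < length (\<Delta> # S) \<and> Suc n \<in> (\<Delta> # S) ! Suc j"
        using 1(4)[of "Suc j"] j by simp
      show "Suc n \<in> (\<Delta> # S) ! j \<Longrightarrow> 0 < j \<and> n \<in> (\<Delta> # S) ! (j - 1)"
        using 1(5)[of "Suc j"] j False by (cases j) auto
    qed (use 1(3) in auto)
    then show ?thesis using False nd by simp
  qed
next
  case (2 n \<Gamma>)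
  then show ?case by fastforce
qed simp

lemma pairedD:
  assumes "paired n S"
  shows "(\<forall>\<Gamma> \<in> set S. \<not> (n \<in> \<Gamma> \<and> Suc n \<in> \<Gamma>)) \<and>
    (\<forall>j < length S. n \<in> S ! j \<longrightarrow> Suc j < length S \<and> Suc n \<in> S ! Suc j) \<and>
    (\<forall>j < length S. Suc n \<in> S ! j \<longrightarrow> 0 < j \<and> n \<in> S ! (j - 1))"
  using assms
proof (induction n S rule: paired.induct)
  case (1 n \<Gamma> \<Delta> S)
  show ?case
  proof (cases "n \<in> \<Gamma>")
    case True
    then have *: "Suc n \<notin> \<Gamma>" "n \<notin> \<Delta>" "Suc n \<in> \<Delta>" "paired n S" using 1(3) by auto
    note IH = 1(1)[OF True *(4)]
    have next_in: "Suc i < length S \<and> Suc n \<in> S ! Suc i"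
      if "i < length S" "n \<in> S ! i" for i using IH that by blast
    have prev_in: "0 < i \<and> n \<in> S ! (i - 1)"
      if "i < length S" "Suc n \<in> S ! i" for i using IH that by blast
    have "Suc j < length (\<Gamma> # \<Delta> # S) \<and> Suc n \<in> (\<Gamma> # \<Delta> # S) ! Suc j"
      if "j < length (\<Gamma> # \<Delta> # S)" "n \<in> (\<Gamma> # \<Delta> # S) ! j" for j
    proof -
      consider "j = 0" | "j = 1" | i where "j = Suc (Suc i)" by (metis One_nat_def not0_implies_Suc)
      then show ?thesis
      proof cases
        case 3
        then show ?thesis using that next_in[of i] by simp
      qed (use that * in simp_all)
    qed
    moreover have "0 < j \<and> n \<in> (\<Gamma> # \<Delta> # S) ! (j - 1)"
      if "j < length (\<Gamma> # \<Delta> # S)" "Suc n \<in> (\<Gamma> # \<Delta> # S) ! j" for j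
    proof -
      consider "j = 0" | "j = 1" | i where "j = Suc (Suc i)" by (metis One_nat_def not0_implies_Suc)
      then show ?thesis
      proof cases
        case 3
        then have "0 < i \<and> n \<in> S ! (i - 1)" using that prev_in[of i] by simp
        then show ?thesis using 3 by (cases i) auto
      qed (use that * True in auto)
    qed
    moreover have "\<forall>\<Theta> \<in> set (\<Gamma> # \<Delta> # S). \<not> (n \<in> \<Theta> \<and> Suc n \<in> \<Theta>)"
      using * conjunct1[OF IH] by simp
    ultimately show ?thesis by blast
  next
    case False
    then have *: "Suc n \<notin> \<Gamma>" "paired n (\<Delta> # S)" using 1(3) by auto
    note IH = 1(2)[OF False *(2)]
    have next_in: "Suc i < length (\<Delta> # S) \<and> Suc n \<in> (\<Delta> # S) ! Suc i"
      if "i < length (\<Delta> # S)" "n \<in> (\<Delta> # S) ! i" for i using IH that by blast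
    have prev_in: "0 < i \<and> n \<in> (\<Delta> # S) ! (i - 1)"
      if "i < length (\<Delta> # S)" "Suc n \<in> (\<Delta> # S) ! i" for i using IH that by blast
    have "Suc j < length (\<Gamma> # \<Delta> # S) \<and> Suc n \<in> (\<Gamma> # \<Delta> # S) ! Suc j"
      if "j < length (\<Gamma> # \<Delta> # S)" "n \<in> (\<Gamma> # \<Delta> # S) ! j" for j
    proof (cases j)
      case (Suc i)
      then have "Suc i < length (\<Delta> # S) \<and> Suc n \<in> (\<Delta> # S) ! Suc i" using that next_in[of i] by simp
      then show ?thesis using Suc by simp
    qed (use that False in simp)
    moreover have "0 < j \<and> n \<in> (\<Gamma> # \<Delta> # S) ! (j - 1)"
      if "j < length (\<Gamma> # \<Delta> # S)" "Suc n \<in> (\<Gamma> # \<Delta> # S) ! j" for j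
    proof (cases j)
      case (Suc i)
      then have "0 < i \<and> n \<in> (\<Delta> # S) ! (i - 1)" using that prev_in[of i] by simp
      then show ?thesis using Suc by (cases i) auto
    qed (use that * in auto)
    moreover have "\<forall>\<Theta> \<in> set (\<Gamma> # \<Delta> # S). \<not> (n \<in> \<Theta> \<and> Suc n \<in> \<Theta>)"
      using * conjunct1[OF IH] by simp
    ultimately show ?thesis by blast
  qed
qed auto

section \<open>Ogroups as predicates on the entries of the pool\<close>

definition arcs :: "('a \<Rightarrow> bool) \<Rightarrow> 'a list \<Rightarrow> nat set" where
  "arcs g P = {i. i < length P \<and> g (P ! i)}"

lemma arcs_Nil [simp]: "arcs g [] = {}"
  by (simp add: arcs_def)

lemma arcs_Cons: "arcs g (x # P) = (if g x then {0} else {}) \<union> Suc ` arcs g P"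
proof -
  have "i \<in> arcs g (x # P) \<longleftrightarrow> i \<in> (if g x then {0} else {}) \<union> Suc ` arcs g P" for i
    by (cases i) (auto simp: arcs_def)
  then show ?thesis by blast
qed

lemma arcs_append: "arcs g (P @ Q) = arcs g P \<union> (\<lambda>i. length P + i) ` arcs g Q"
  by (induction P) (auto simp: arcs_Cons image_Un image_image)

lemma arcs_less: "i \<in> arcs g P \<Longrightarrow> i < length P"
  by (simp add: arcs_def)

lemma arcs_map: "arcs g (map f P) = arcs (\<lambda>x. g (f x)) P"
  by (auto simp: arcs_def)

text \<open>The renumberings in the rules are what a predicate on entries undergoes by itself when
  the pool changes, here for exchange, below for insertion and merging. So ogroups given by
  predicates never have to be renumbered.\<close>

lemma arcs_swap:
  "transpose (length P) (Suc (length P)) ` arcs g (P @ [a, b] @ Q) = arcs g (P @ [b, a] @ Q)"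
proof -
  have *: "transpose (length P) (Suc (length P)) ` arcs g P = arcs g P"
    by (rule trans[OF image_cong[OF refl, where g = "\<lambda>i. i"]])
      (auto dest!: arcs_less simp: transpose_def)
  show ?thesis
    by (simp only: arcs_append image_Un * image_image)
      (auto simp: arcs_Cons transpose_def image_iff)
qed

lemma arcs_insert:
  "arcs g (P @ [x] @ Q) = shift_from (length P) ` arcs g (P @ Q) \<union> (if g x then {length P} else {})"
proof -
  have *: "shift_from (length P) ` arcs g P = arcs g P"
    by (rule trans[OF image_cong[OF refl, where g = "\<lambda>i. i"]])
      (auto dest!: arcs_less simp: shift_from_def)
  show ?thesis
    by (simp only: arcs_append image_Un * image_image)
      (auto simp: arcs_Cons shift_from_def image_iff)
qed

lemma arcs_collapse:
  assumes "g c \<longleftrightarrow> g a \<or> g b"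
  shows "collapse (length P) ` arcs g (P @ [a, b] @ Q) = arcs g (P @ [c] @ Q)"
proof -
  have *: "collapse (length P) ` arcs g P = arcs g P"
    by (rule trans[OF image_cong[OF refl, where g = "\<lambda>i. i"]])
      (auto dest!: arcs_less simp: collapse_def)
  show ?thesis
    using assms by (simp only: arcs_append image_Un * image_image)
      (auto simp: arcs_Cons collapse_def image_iff)
qed

text \<open>Adjacent transpositions generate all permutations: the entries of \<open>Q\<close> are
  put in place one by one, each being moved to the left past its predecessors.\<close>

lemma swap_closed_mset:
  assumes swap: "\<And>P a b Q. R (P @ [a, b] @ Q) \<Longrightarrow> R (P @ [b, a] @ Q)"
    and "mset P = mset Q" "R P"
  shows "R Q"
proof -
  have front: "R (pre @ P1 @ a # P2) \<Longrightarrow> R (pre @ a # P1 @ P2)" for pre P1 P2 :: "'a list" and a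
  proof (induction P1 arbitrary: P2 rule: rev_induct)
    case (snoc b P1)
    have "R ((pre @ P1) @ [a, b] @ P2)" using swap[of "pre @ P1" b a P2] snoc.prems by simp
    then show ?case using snoc.IH[of "b # P2"] by simp
  qed simp
  have "R (pre @ P) \<Longrightarrow> mset P = mset Q \<Longrightarrow> R (pre @ Q)" for pre
  proof (induction Q arbitrary: pre P)
    case (Cons a Q)
    then obtain P1 P2 where P: "P = P1 @ a # P2"
      by (metis list.set_intros(1) set_mset_mset split_list)
    then have "R ((pre @ [a]) @ P1 @ P2)" using front Cons.prems by simp
    moreover have "mset (P1 @ P2) = mset Q" using Cons.prems(2) P by simp
    ultimately have "R ((pre @ [a]) @ Q)" by (rule Cons.IH)
    then show ?case by simp
  qed simp
  from this[of "[]"] show ?thesis using assms by simp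
qed

lemma lessThan_2: "{..<Suc (Suc 0)} = {0, Suc 0}"
  by auto

text \<open>Closure under the rules, with the identity axiom for atoms only and apart from ogroup
  exchange. There are two instances: \<open>CL5m\<close> itself, for constructing proofs, and the
  set of cirquents with a certificate, for analysing proofs.\<close>

locale calculus =
  fixes I :: "cirquent \<Rightarrow> bool"
  assumes empty: "I ([], [])"
    and atomic: "I ([{0, 1}], [NegAtom a, Atom a])"
    and mix: "I (S, P) \<Longrightarrow> I (T, Q) \<Longrightarrow> I (S @ map (image (\<lambda>i. length P + i)) T, P @ Q)"
    and exchange: "I (S, P @ [F, G] @ Q) \<Longrightarrow>
      I (map (image (transpose (length P) (Suc (length P)))) S, P @ [G, F] @ Q)"
    and weaken: "I (S @ [\<Gamma>] @ T, P) \<Longrightarrow> i < length P \<Longrightarrow> i \<notin> \<Gamma> \<Longrightarrow> I (S @ [insert i \<Gamma>] @ T, P)"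
    and insert_formula: "I (S, P @ Q) \<Longrightarrow> I (map (image (shift_from (length P))) S, P @ [F] @ Q)"
    and disj: "I (S, P @ [F, G] @ Q) \<Longrightarrow>
      I (map (image (collapse (length P))) S, P @ [Disj F G] @ Q)"
    and conj: "I (S, P @ [F, G] @ Q) \<Longrightarrow> paired (length P) S \<Longrightarrow>
      I (map (image (collapse (length P))) (merge_ogroups (length P) S), P @ [Conj F G] @ Q)"
begin

lemma weaken_subset:
  assumes "I (S @ [\<Gamma>] @ T, P)" "\<Gamma> \<subseteq> \<Delta>" "\<Delta> \<subseteq> {..<length P}"
  shows "I (S @ [\<Delta>] @ T, P)"
proof -
  have "I (S @ [\<Gamma> \<union> X] @ T, P)" if "finite X" "X \<subseteq> {..<length P}" for X
    using that
  proof (induction X)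
    case (insert i X)
    then show ?case using weaken[of S "\<Gamma> \<union> X" T P i]
      by (cases "i \<in> \<Gamma>") (auto simp: insert_absorb)
  qed (use assms in auto)
  from this[of \<Delta>] assms show ?thesis by (simp add: finite_subset Un_absorb1)
qed

lemma weaken_all:
  assumes "list_all2 (\<lambda>\<Gamma> \<Delta>. \<Gamma> \<subseteq> \<Delta> \<and> \<Delta> \<subseteq> {..<length P}) S T" "I (pre @ S, P)"
  shows "I (pre @ T, P)"
  using assms
proof (induction arbitrary: pre rule: list_all2_induct)
  case (Cons \<Gamma> S \<Delta> T)
  then have "I ((pre @ [\<Delta>]) @ S, P)" using weaken_subset[of pre \<Gamma> S P \<Delta>] by simp
  then have "I ((pre @ [\<Delta>]) @ T, P)" by (rule Cons.IH)
  then show ?case by simp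
qed

text \<open>
  The entries of the pool carry arbitrary labels, of which \<open>er\<close> yields the formulas, and an ogroup
  is given by a predicate on labels. So exchange becomes invariance under permutations of the pool.
\<close>

definition derives :: "('a \<Rightarrow> formula) \<Rightarrow> ('a \<Rightarrow> bool) list \<Rightarrow> 'a list \<Rightarrow> bool" where
  "derives er gs P \<longleftrightarrow> I (map (\<lambda>g. arcs g P) gs, map er P)"

lemma derives_perm: "mset P = mset Q \<Longrightarrow> derives er gs P \<Longrightarrow> derives er gs Q"
proof (rule swap_closed_mset[of "derives er gs"])
  fix P a b Q assume "derives er gs (P @ [a, b] @ Q)"
  from exchange[OF this[unfolded derives_def map_append list.map]]
  show "derives er gs (P @ [b, a] @ Q)" unfolding derives_def
    by (simp add: comp_def arcs_swap[simplified])
qed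

lemma derives_weaken:
  assumes "list_all2 (\<lambda>g h. \<forall>x \<in> set P. g x \<longrightarrow> h x) gs hs" "derives er gs P"
  shows "derives er hs P"
proof -
  have "list_all2 (\<lambda>\<Gamma> \<Delta>. \<Gamma> \<subseteq> \<Delta> \<and> \<Delta> \<subseteq> {..<length (map er P)}) (map (\<lambda>g. arcs g P) gs) (map (\<lambda>g. arcs g P) hs)"
    using assms(1) by (auto simp: list_all2_map1 list_all2_map2 arcs_def elim!: list_all2_mono)
  from weaken_all[OF this, of "[]"] show ?thesis using assms(2) by (simp add: derives_def)
qed

lemma derives_mix:
  assumes "derives er gs P" "derives er hs Q" "\<And>g x. g \<in> set gs \<Longrightarrow> x \<in> set Q \<Longrightarrow> \<not> g x"
    "\<And>h x. h \<in> set hs \<Longrightarrow> x \<in> set P \<Longrightarrow> \<not> h x"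
  shows "derives er (gs @ hs) (P @ Q)"
proof -
  have "arcs g Q = {}" if "g \<in> set gs" for g using assms(3)[OF that] by (auto simp: arcs_def)
  moreover have "arcs h P = {}" if "h \<in> set hs" for h using assms(4)[OF that] by (auto simp: arcs_def)
  ultimately show ?thesis
    using mix[OF assms(1,2)[unfolded derives_def]] by (simp add: derives_def arcs_append comp_def cong: map_cong)
qed

lemma derives_insert:
  assumes "derives er gs P" "\<And>g. g \<in> set gs \<Longrightarrow> \<not> g x"
  shows "derives er gs (x # P)"
proof -
  have eq: "map (\<lambda>g. arcs g (x # P)) gs = map (image (shift_from 0)) (map (\<lambda>g. arcs g P) gs)"
    using assms(2) arcs_insert[of _ "[]" x P] by auto
  show ?thesis
    using insert_formula[of "map (\<lambda>g. arcs g P) gs" "[]" "map er P" "er x"] assms(1)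
    unfolding derives_def eq by simp
qed

lemma derives_disj:
  assumes "derives er gs (a # b # P)" "er c = Disj (er a) (er b)" "\<And>g. g \<in> set gs \<Longrightarrow> g c \<longleftrightarrow> g a \<or> g b"
  shows "derives er gs (c # P)"
proof -
  have eq: "map (\<lambda>g. arcs g (c # P)) gs = map (image (collapse 0)) (map (\<lambda>g. arcs g (a # b # P)) gs)"
  proof -
    have "collapse 0 ` arcs g (a # b # P) = arcs g (c # P)" if "g \<in> set gs" for g
      using assms(3)[OF that] arcs_collapse[of g c a b "[]" P] by simp
    then show ?thesis by simp
  qed
  show ?thesis
    using disj[of "map (\<lambda>g. arcs g (a # b # P)) gs" "[]" "er a" "er b" "map er P"] assms(1,2)
    unfolding derives_def eq by simp
qed

text \<open>
  In a conjunction introduction each ogroup comes either from one ogroup, which contains neither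
  conjunct, or from two.
\<close>

fun expand :: "(('a \<Rightarrow> bool) \<times> ('a \<Rightarrow> bool) option) list \<Rightarrow> ('a \<Rightarrow> bool) list" where
  "expand [] = []"
| "expand ((g, None) # ps) = g # expand ps"
| "expand ((g, Some h) # ps) = g # h # expand ps"

fun splits :: "'a \<Rightarrow> 'a \<Rightarrow> 'a \<Rightarrow> 'a list \<Rightarrow> ('a \<Rightarrow> bool) \<times> ('a \<Rightarrow> bool) option \<Rightarrow> ('a \<Rightarrow> bool) \<Rightarrow> bool" where
  "splits a b c P (g, None) k \<longleftrightarrow> \<not> g a \<and> \<not> g b \<and> \<not> k c \<and> (\<forall>x \<in> set P. k x \<longleftrightarrow> g x)"
| "splits a b c P (g, Some h) k \<longleftrightarrow> g a \<and> \<not> g b \<and> \<not> h a \<and> h b \<and> k c \<and> (\<forall>x \<in> set P. k x \<longleftrightarrow> g x \<or> h x)"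

lemma paired_Cons: "0 \<notin> \<Gamma> \<Longrightarrow> Suc 0 \<notin> \<Gamma> \<Longrightarrow> paired 0 (\<Gamma> # S) \<longleftrightarrow> paired 0 S"
  by (cases S) auto

lemma merge_Cons: "n \<notin> \<Gamma> \<Longrightarrow> merge_ogroups n (\<Gamma> # S) = \<Gamma> # merge_ogroups n S"
  by (cases S) auto

lemma arcs_cong: "(\<And>x. x \<in> set P \<Longrightarrow> g x \<longleftrightarrow> h x) \<Longrightarrow> arcs g P = arcs h P"
  by (auto simp: arcs_def)

lemma collapse_0 [simp]: "collapse 0 0 = 0" "collapse 0 (Suc i) = i"
  by (simp_all add: collapse_def)

lemma arcs_or: "arcs (\<lambda>x. g x \<or> h x) P = arcs g P \<union> arcs h P"
  by (auto simp: arcs_def)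

text \<open>As labelled pools may be permuted freely, both conjuncts can be assumed to be at the
  front, and the renumbering of the rule occurs only for \<open>n = 0\<close>.\<close>

lemma derives_conj:
  assumes derives: "derives er (expand ps) (a # b # P)" and er: "er c = Conj (er a) (er b)"
    and ps: "list_all2 (splits a b c P) ps ks"
  shows "derives er ks (c # P)"
proof -
  let ?A = "\<lambda>g. arcs g (a # b # P)"
  have "paired 0 (map ?A (expand ps)) \<and>
    map (image (collapse 0)) (merge_ogroups 0 (map ?A (expand ps))) = map (\<lambda>k. arcs k (c # P)) ks"
    using ps
  proof (induction rule: list_all2_induct)
    case (Cons p ps k ks)
    obtain g h where p: "p = (g, h)" by (cases p)
    show ?case
    proof (cases h)
      case None
      have g: "0 \<notin> ?A g" "Suc 0 \<notin> ?A g" using Cons p None by (auto simp: arcs_def)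
      have "collapse 0 ` ?A g = arcs k (c # P)"
        using Cons.hyps(1) arcs_cong[of P k g] unfolding p None
        by (simp add: arcs_Cons image_image)
      then show ?thesis using Cons.IH g by (simp add: p None paired_Cons merge_Cons)
    next
      case (Some h')
      have g: "0 \<in> ?A g" "Suc 0 \<notin> ?A g" "0 \<notin> ?A h'" "Suc 0 \<in> ?A h'"
        using Cons p Some by (auto simp: arcs_def)
      have "collapse 0 ` (?A g \<union> ?A h') = arcs k (c # P)"
        using Cons.hyps(1) arcs_cong[of P k "\<lambda>x. g x \<or> h' x"] unfolding p Some
        by (auto simp: arcs_Cons image_Un image_image arcs_or)
      then show ?thesis using Cons.IH g by (simp add: p Some)
    qed
  qed simp
  then show ?thesis
    using conj[of "map ?A (expand ps)" "[]" "er a" "er b" "map er P"] derives er by (simp add: derives_def)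
qed

lemma derives_map: "derives er gs (map f P) \<longleftrightarrow> derives (\<lambda>x. er (f x)) (map (\<lambda>g x. g (f x)) gs) P"
  by (simp add: derives_def arcs_map comp_def)

text \<open>A cirquent whose only ogroup contains the whole pool behaves like a one-sided sequent,
  and the rules below are those of affine logic: split contexts, weakening, no contraction.\<close>

definition sequent :: "formula list \<Rightarrow> bool" where
  "sequent P \<longleftrightarrow> I ([{..<length P}], P)"

lemma sequent_N: "sequent P \<longleftrightarrow> derives (\<lambda>x. x) [\<lambda>_. True] P"
  by (simp add: sequent_def derives_def arcs_def lessThan_def)

text \<open>Tags distinguish equal formulas that come from different places. Predicates on tags can
  thus describe ogroups that contain only a part of the pool.\<close>

lemma sequent_tag: "sequent P \<longleftrightarrow> derives snd [\<lambda>_. True] (map (Pair t) P)"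
  by (simp add: sequent_N derives_map)

lemma sequent_perm: "mset P = mset Q \<Longrightarrow> sequent P \<Longrightarrow> sequent Q"
  unfolding sequent_N by (rule derives_perm)

lemma sequent_weaken:
  assumes "sequent P" shows "sequent (F # P)"
proof -
  have "derives snd [fst] (map (Pair True) P)"
    using assms unfolding sequent_tag[of P True] by (rule derives_weaken[rotated]) auto
  then have "derives snd [fst] ((False, F) # map (Pair True) P)" by (rule derives_insert) auto
  then have "derives snd [\<lambda>_. True] ((False, F) # map (Pair True) P)" by (rule derives_weaken[rotated]) auto
  then show ?thesis unfolding sequent_N
    using derives_map[of "\<lambda>x. x" "[\<lambda>_. True]" snd "(False, F) # map (Pair True) P"] by (simp add: comp_def)
qed

lemma sequent_weaken_append: "sequent P \<Longrightarrow> sequent (Q @ P)"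
  by (induction Q) (auto intro: sequent_weaken)

lemma sequent_weaken_mset:
  assumes "sequent P" "mset P \<subseteq># mset Q" shows "sequent Q"
proof -
  obtain R where "mset Q = mset P + R" using assms(2) by (metis subset_mset.less_eqE)
  moreover obtain xs where "mset xs = R" by (metis ex_mset)
  ultimately have "mset (xs @ P) = mset Q" by simp
  then show ?thesis using sequent_perm sequent_weaken_append assms(1) by blast
qed

lemma sequent_disj: "sequent (F # G # P) \<Longrightarrow> sequent (Disj F G # P)"
  unfolding sequent_tag[of _ "()"] by (auto elim!: derives_disj)

text \<open>Mix puts the premises side by side and thereby makes their ogroups adjacent, as required
  for merging them. The tags \<open>0\<close> and \<open>1\<close> tell the two contexts apart, and
  \<open>2\<close> marks the conjunction.\<close>

lemma sequent_conj:
  assumes "sequent (F # P)" "sequent (G # Q)"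
  shows "sequent (Conj F G # P @ Q)"
proof -
  have "derives snd [\<lambda>x. fst x = 0] (map (Pair (0::nat)) (F # P))"
    using assms(1) unfolding sequent_tag[of _ "0::nat"] by (rule derives_weaken[rotated]) auto
  moreover have "derives snd [\<lambda>x. fst x = 1] (map (Pair (1::nat)) (G # Q))"
    using assms(2) unfolding sequent_tag[of _ "1::nat"] by (rule derives_weaken[rotated]) auto
  ultimately have "derives snd ([\<lambda>x. fst x = 0] @ [\<lambda>x. fst x = 1]) (map (Pair (0::nat)) (F # P) @ map (Pair (1::nat)) (G # Q))"
    by (rule derives_mix) auto
  then have pair: "derives snd ([\<lambda>x. fst x = 0] @ [\<lambda>x. fst x = 1]) ((0::nat, F) # (1::nat, G) # map (Pair (0::nat)) P @ map (Pair (1::nat)) Q)"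
    by (rule derives_perm[rotated]) simp
  have "derives snd [\<lambda>_. True] ((2::nat, Conj F G) # map (Pair (0::nat)) P @ map (Pair (1::nat)) Q)"
    by (rule derives_conj[where ps = "[(\<lambda>x. fst x = 0, Some (\<lambda>x. fst x = 1))]" and a = "(0, F)" and b = "(1, G)"])
      (use pair in auto)
  then show ?thesis unfolding sequent_N
    using derives_map[of "\<lambda>x. x" "[\<lambda>_. True]" snd "(2::nat, Conj F G) # map (Pair (0::nat)) P @ map (Pair (1::nat)) Q"]
    by (simp add: comp_def)
qed

text \<open>Compound identity axioms are derivable from atomic ones. This is why a certificate has
  to pair only literals.\<close>

lemma sequent_identity: "sequent [neg F, F]"
proof (induction F)
  case (Atom a)
  show ?case using atomic[of a] by (simp add: sequent_def lessThan_2)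
next
  case (NegAtom a)
  have "sequent [NegAtom a, Atom a]" using atomic[of a] by (simp add: sequent_def lessThan_2)
  then show ?case by (rule sequent_perm[rotated]) simp
next
  case (Conj A B)
  have "sequent [A, neg A]" by (rule sequent_perm[OF _ Conj(1)]) simp
  moreover have "sequent [B, neg B]" by (rule sequent_perm[OF _ Conj(2)]) simp
  ultimately have "sequent (Conj A B # [neg A] @ [neg B])" by (rule sequent_conj)
  then have "sequent [neg A, neg B, Conj A B]" by (rule sequent_perm[rotated]) simp
  then show ?case using sequent_disj by simp
next
  case (Disj A B)
  have "sequent (Conj (neg A) (neg B) # [A] @ [B])" by (rule sequent_conj[OF Disj])
  then have "sequent [A, B, Conj (neg A) (neg B)]" by (rule sequent_perm[rotated]) simp
  then have "sequent [Disj A B, Conj (neg A) (neg B)]" by (rule sequent_disj)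
  then show ?case by (rule sequent_perm[rotated]) simp
qed

end

interpretation CL5: calculus CL5m
proof
  fix a show "CL5m ([{0, 1}], [NegAtom a, Atom a])" using identity_axiom[of "Atom a"] by simp
next
  fix S P F G Q assume "CL5m (S, P @ [F, G] @ Q)" and p: "paired (length P) S"
  then show "CL5m (map (image (collapse (length P))) (merge_ogroups (length P) S), P @ [Conj F G] @ Q)"
    using pairedD[OF p] by (intro conj_intro) auto
qed (use CL5m.intros in auto)

lemma (in calculus) contains_CL5m:
  assumes ogroup_exchange: "\<And>S \<Gamma> \<Delta> T P. I (S @ [\<Gamma>, \<Delta>] @ T, P) \<Longrightarrow> I (S @ [\<Delta>, \<Gamma>] @ T, P)"
    and "CL5m C"
  shows "I C"
  using assms(2)
proof (induction rule: CL5m.induct)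
  case (identity_axiom F)
  show ?case using sequent_identity[of F] by (simp add: sequent_def lessThan_2)
next
  case (conj_intro S P F G Q n)
  have "paired n S" by (rule pairedI) (use conj_intro.hyps in auto)
  then show ?case using conj[OF conj_intro.IH] conj_intro.hyps(2) by simp
qed (simp_all add: empty mix exchange[simplified] weaken[simplified] insert_formula[simplified] disj[simplified] ogroup_exchange[simplified])

section \<open>Certificates of provability\<close>

text \<open>Literals carry labels, conjunctions carry ranks. One function \<open>\<sigma>\<close>
  translates labels into atoms in the whole pool, so literals with the same label have the same
  atom, while occurrences of the same atom may have different labels.\<close>

datatype lformula =
    LAtom nat
  | LNeg nat
  | LConj nat lformula lformula
  | LDisj lformula lformula

fun erase :: "(nat \<Rightarrow> nat) \<Rightarrow> lformula \<Rightarrow> formula" where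
  "erase \<sigma> (LAtom l) = Atom (\<sigma> l)"
| "erase \<sigma> (LNeg l) = NegAtom (\<sigma> l)"
| "erase \<sigma> (LConj r A B) = Conj (erase \<sigma> A) (erase \<sigma> B)"
| "erase \<sigma> (LDisj A B) = Disj (erase \<sigma> A) (erase \<sigma> B)"

fun posl :: "lformula \<Rightarrow> nat list" where
  "posl (LAtom l) = [l]"
| "posl (LNeg l) = []"
| "posl (LConj r A B) = posl A @ posl B"
| "posl (LDisj A B) = posl A @ posl B"

fun negl :: "lformula \<Rightarrow> nat list" where
  "negl (LAtom l) = []"
| "negl (LNeg l) = [l]"
| "negl (LConj r A B) = negl A @ negl B"
| "negl (LDisj A B) = negl A @ negl B"

definition labs :: "lformula \<Rightarrow> nat set" where
  "labs x = set (posl x) \<union> set (negl x)"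

fun ranks :: "lformula \<Rightarrow> nat list" where
  "ranks (LAtom l) = []"
| "ranks (LNeg l) = []"
| "ranks (LConj r A B) = r # ranks A @ ranks B"
| "ranks (LDisj A B) = ranks A @ ranks B"

text \<open>Ranks decrease inwards because, read upwards, an inner conjunction becomes accessible
  only after the outer one has been split.\<close>

fun heap :: "lformula \<Rightarrow> bool" where
  "heap (LAtom l) = True"
| "heap (LNeg l) = True"
| "heap (LConj r A B) = ((\<forall>s \<in> set (ranks A) \<union> set (ranks B). s < r) \<and> heap A \<and> heap B)"
| "heap (LDisj A B) = (heap A \<and> heap B)"

text \<open>An axiom with a literal in a conjunct goes to the half of this conjunct; in particular,
  no axiom in \<open>L\<close> links the two conjuncts of a conjunction. Labels outside
  \<open>L\<close> do not stand for axioms and are not constrained.\<close>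

fun follows :: "(nat \<Rightarrow> nat \<Rightarrow> nat) \<Rightarrow> nat set \<Rightarrow> lformula \<Rightarrow> bool" where
  "follows D L (LAtom l) = True"
| "follows D L (LNeg l) = True"
| "follows D L (LConj r A B) = ((\<forall>l \<in> L \<inter> labs A. D l r = 1) \<and> (\<forall>l \<in> L \<inter> labs B. D l r = 2) \<and>
     follows D L A \<and> follows D L B)"
| "follows D L (LDisj A B) = (follows D L A \<and> follows D L B)"

text \<open>Axioms of a block are still in the same ogroup when rank \<open>r\<close> is reached if
  their values agree at all larger ranks. The condition says that a half of such an ogroup is never
  left without a counterpart: conjunction introduction merges pairs of ogroups.\<close>

definition split_closed :: "(nat \<Rightarrow> nat \<Rightarrow> nat) \<Rightarrow> nat \<Rightarrow> nat set \<Rightarrow> bool" where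
  "split_closed D R \<beta> \<longleftrightarrow> (\<forall>l \<in> \<beta>. \<forall>r < R.
     (D l r = 1 \<longrightarrow> (\<exists>k \<in> \<beta>. (\<forall>s. r < s \<and> s < R \<longrightarrow> D k s = D l s) \<and> D k r = 2)) \<and>
     (D l r = 2 \<longrightarrow> (\<exists>k \<in> \<beta>. (\<forall>s. r < s \<and> s < R \<longrightarrow> D k s = D l s) \<and> D k r = 1)))"

definition block :: "(nat \<Rightarrow> nat \<Rightarrow> nat) \<Rightarrow> lformula list \<Rightarrow> nat \<Rightarrow> nat set \<Rightarrow> bool" where
  "block D P R \<beta> \<longleftrightarrow> \<beta> \<noteq> {} \<and> split_closed D R \<beta> \<and>
     (\<forall>l \<in> \<beta>. (\<exists>x \<in> set P. l \<in> set (posl x)) \<and> (\<exists>x \<in> set P. l \<in> set (negl x)))"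

text \<open>
  A label that occurs in a block stands for an identity axiom, which pairs its positive with its
  negative occurrence, and a block is the set of the axioms above an ogroup. Read from the
  conclusion upwards, a proof splits the conjunctions in the order of decreasing rank, and
  \<open>D l r\<close> records which half (\<open>1\<close> or \<open>2\<close>) of its ogroup the axiom \<open>l\<close> belongs to when the
  conjunction of rank \<open>r\<close> is split; any other value means that the conjunction is not in this ogroup.
\<close>

definition certificate :: "(nat \<Rightarrow> nat \<Rightarrow> nat) \<Rightarrow> lformula list \<Rightarrow> nat set list \<Rightarrow> nat \<Rightarrow> bool" where
  "certificate D P Bs R \<longleftrightarrow>
     distinct (concat (map posl P)) \<and> distinct (concat (map negl P)) \<and> distinct (concat (map ranks P)) \<and>
     (\<forall>x \<in> set P. heap x \<and> (\<forall>r \<in> set (ranks x). r < R) \<and> follows D (\<Union> (set Bs)) x) \<and>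
     sorted_wrt (\<lambda>\<beta> \<gamma>. \<beta> \<inter> \<gamma> = {}) Bs \<and> (\<forall>\<beta> \<in> set Bs. block D P R \<beta>)"

definition touches :: "nat set \<Rightarrow> lformula \<Rightarrow> bool" where
  "touches \<beta> x \<longleftrightarrow> labs x \<inter> \<beta> \<noteq> {}"

section \<open>From certificates to proofs\<close>

lemma labs_simps [simp]:
  "labs (LAtom l) = {l}" "labs (LNeg l) = {l}" "labs (LConj r A B) = labs A \<union> labs B"
  "labs (LDisj A B) = labs A \<union> labs B"
  by (auto simp: labs_def)

lemma distinct_concat_perm:
  assumes "mset P = mset Q"
  shows "distinct (concat (map f P)) \<longleftrightarrow> distinct (concat (map f Q))"
proof -
  have "mset (concat (map f P)) = (\<Sum>x\<in>#mset P. mset (f x))" for P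
    by (induction P) simp_all
  then show ?thesis using assms by (intro mset_eq_imp_distinct_iff) simp
qed

lemma certificate_perm:
  assumes "mset P = mset Q" "certificate D P Bs R"
  shows "certificate D Q Bs R"
proof -
  have "set P = set Q" using assms(1) by (rule mset_eq_setD)
  moreover note distinct_concat_perm[OF assms(1), of posl] distinct_concat_perm[OF assms(1), of negl]
    distinct_concat_perm[OF assms(1), of ranks]
  ultimately show ?thesis using assms(2) unfolding certificate_def block_def by simp
qed

lemma follows_mono: "follows D L x \<Longrightarrow> K \<subseteq> L \<Longrightarrow> follows D K x"
  by (induction x) auto

lemma occurs: "posl x \<noteq> [] \<or> negl x \<noteq> []"
  by (induction x) auto

lemma linear_distinct:
  "distinct (concat (map posl P)) \<Longrightarrow> distinct (concat (map negl P)) \<Longrightarrow> distinct P"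
proof (induction P)
  case (Cons x P)
  have "x \<notin> set P"
  proof
    assume "x \<in> set P"
    then have "set (posl x) \<subseteq> set (concat (map posl P))" "set (negl x) \<subseteq> set (concat (map negl P))" by auto
    moreover have "set (posl x) \<inter> set (concat (map posl P)) = {}" "set (negl x) \<inter> set (concat (map negl P)) = {}"
      using Cons.prems by auto
    ultimately show False using occurs[of x] by (metis inf.orderE set_empty)
  qed
  then show ?case using Cons by auto
qed simp

lemma certificate_distinct: "certificate D P Bs R \<Longrightarrow> distinct P"
  unfolding certificate_def using linear_distinct by blast

text \<open>Once the highest rank \<open>r\<close> has been processed, the axioms with the same
  value at \<open>r\<close> form an ogroup of their own. The counterpart of an axiom at a rank
  \<open>s < r\<close> agrees with it at all ranks above \<open>s\<close>, hence also at
  \<open>r\<close>, and so lies in the same class.\<close>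

lemma block_class:
  assumes "block D P (Suc r) \<beta>" "l \<in> \<beta>"
  shows "block D P r {k \<in> \<beta>. D k r = D l r}"
proof -
  have sc: "split_closed D (Suc r) \<beta>" using assms(1) by (simp add: block_def)
  have "split_closed D r {k \<in> \<beta>. D k r = D l r}"
    unfolding split_closed_def
  proof (intro ballI allI impI conjI)
    fix k s assume k: "k \<in> {k \<in> \<beta>. D k r = D l r}" and s: "s < r"
    { assume "D k s = 1"
      then obtain j where "j \<in> \<beta>" "\<forall>t. s < t \<and> t < Suc r \<longrightarrow> D j t = D k t" "D j s = 2"
        using sc k s unfolding split_closed_def by (metis (lifting) less_Suc_eq mem_Collect_eq)
      then show "\<exists>j \<in> {k \<in> \<beta>. D k r = D l r}. (\<forall>t. s < t \<and> t < r \<longrightarrow> D j t = D k t) \<and> D j s = 2"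
        using k s by (intro bexI[of _ j]) auto }
    { assume "D k s = 2"
      then obtain j where "j \<in> \<beta>" "\<forall>t. s < t \<and> t < Suc r \<longrightarrow> D j t = D k t" "D j s = 1"
        using sc k s unfolding split_closed_def by (metis (lifting) less_Suc_eq mem_Collect_eq)
      then show "\<exists>j \<in> {k \<in> \<beta>. D k r = D l r}. (\<forall>t. s < t \<and> t < r \<longrightarrow> D j t = D k t) \<and> D j s = 1"
        using k s by (intro bexI[of _ j]) auto }
  qed
  then show ?thesis using assms by (auto simp: block_def)
qed

lemma block_conj: "block D (LConj q A B # P) R \<beta> \<longleftrightarrow> block D (A # B # P) R \<beta>"
proof -
  have "(\<exists>x \<in> set (LConj q A B # P). l \<in> set (posl x)) \<longleftrightarrow> (\<exists>x \<in> set (A # B # P). l \<in> set (posl x))"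
    "(\<exists>x \<in> set (LConj q A B # P). l \<in> set (negl x)) \<longleftrightarrow> (\<exists>x \<in> set (A # B # P). l \<in> set (negl x))" for l
    by auto
  then show ?thesis unfolding block_def by simp
qed

text \<open>When only literals remain, one link per block suffices: its identity axiom provides the
  ogroup, and weakening provides all further arcs and literals. Disjoint blocks use different links,
  so the axioms can be mixed.\<close>

lemma derives_literals:
  assumes "distinct P" "sorted_wrt (\<lambda>\<beta> \<gamma>. \<beta> \<inter> \<gamma> = {}) Bs"
    "\<forall>\<beta> \<in> set Bs. \<exists>l \<in> \<beta>. LAtom l \<in> set P \<and> LNeg l \<in> set P"
  shows "CL5.derives (erase \<sigma>) (map touches Bs) P"
  using assms
proof (induction Bs arbitrary: P)
  case Nil
  have "CL5.derives (erase \<sigma>) [] P"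
  proof (induction P)
    case (Cons x P)
    then show ?case by (rule CL5.derives_insert) simp
  qed (simp add: CL5.derives_def CL5.empty)
  then show ?case by simp
next
  case (Cons \<beta> Bs)
  obtain l where l: "l \<in> \<beta>" "LAtom l \<in> set P" "LNeg l \<in> set P" using Cons.prems by auto
  define P' where "P' = remove1 (LNeg l) (remove1 (LAtom l) P)"
  have perm: "mset P = mset ([LNeg l, LAtom l] @ P')"
  proof -
    have "LNeg l \<in> set (remove1 (LAtom l) P)" using l(3) by simp
    then have "mset (remove1 (LAtom l) P) = add_mset (LNeg l) (mset P')"
      unfolding P'_def by (metis insert_DiffM mset_remove1 set_mset_mset)
    moreover have "mset P = add_mset (LAtom l) (mset (remove1 (LAtom l) P))"
      using l(2) by (metis insert_DiffM mset_remove1 set_mset_mset)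
    ultimately show ?thesis by (simp only: append.simps mset.simps add_mset_commute)
  qed
  have set': "set P' = set P - {LAtom l, LNeg l}"
    using set_remove1_eq[OF Cons.prems(1)] set_remove1_eq[OF distinct_remove1[OF Cons.prems(1)]]
    unfolding P'_def by blast
  have fresh: "l \<notin> \<gamma>" if "\<gamma> \<in> set Bs" for \<gamma>
    using l(1) Cons.prems(2) that by auto
  have "CL5.derives (erase \<sigma>) (map touches Bs) P'"
  proof (rule Cons.IH)
    show "distinct P'" using Cons.prems(1) by (simp add: P'_def)
    show "\<forall>\<beta> \<in> set Bs. \<exists>l \<in> \<beta>. LAtom l \<in> set P' \<and> LNeg l \<in> set P'"
    proof
      fix \<gamma> assume \<gamma>: "\<gamma> \<in> set Bs"
      then obtain k where "k \<in> \<gamma>" "LAtom k \<in> set P" "LNeg k \<in> set P" using Cons.prems(3) by auto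
      moreover then have "k \<noteq> l" using \<gamma> l Cons.prems(2) by auto
      ultimately show "\<exists>l \<in> \<gamma>. LAtom l \<in> set P' \<and> LNeg l \<in> set P'" by (auto simp: set')
    qed
  qed (use Cons.prems in auto)
  moreover have "CL5.derives (erase \<sigma>) [\<lambda>x. x = LNeg l \<or> x = LAtom l] [LNeg l, LAtom l]"
    using CL5.atomic[of "\<sigma> l"] by (simp add: CL5.derives_def arcs_Cons insert_commute)
  ultimately have "CL5.derives (erase \<sigma>) ([\<lambda>x. x = LNeg l \<or> x = LAtom l] @ map touches Bs) ([LNeg l, LAtom l] @ P')"
    using fresh by (intro CL5.derives_mix) (auto simp: set' touches_def)
  then have "CL5.derives (erase \<sigma>) (map touches (\<beta> # Bs)) ([LNeg l, LAtom l] @ P')"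
    using l by (elim CL5.derives_weaken[rotated]) (auto simp: touches_def intro!: list.rel_refl)
  then show ?case by (rule CL5.derives_perm[OF perm[symmetric]])
qed

fun blocks :: "nat set \<times> nat set option \<Rightarrow> nat set list" where
  "blocks (\<beta>, None) = [\<beta>]"
| "blocks (\<beta>, Some \<gamma>) = [\<beta>, \<gamma>]"

text \<open>If some axiom of the block has a value other than \<open>1\<close> and \<open>2\<close>
  at \<open>r\<close>, then its class alone is kept; by \<open>follows\<close> it avoids both
  conjuncts. If the block does not touch the conjunction at all, any class will do. Otherwise all
  values are \<open>1\<close> or \<open>2\<close>, and \<open>split_closed\<close> makes both halves
  nonempty.\<close>

lemma split_block:
  assumes b: "block D (LConj r A B # P) (Suc r) \<beta>" and f: "follows D \<beta> (LConj r A B)"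
  obtains \<gamma> where "\<gamma> \<subseteq> \<beta>" "block D (A # B # P) r \<gamma>" "\<not> touches \<gamma> (LConj r A B)"
  | \<gamma> \<delta> where "\<gamma> \<subseteq> \<beta>" "\<delta> \<subseteq> \<beta>" "\<gamma> \<inter> \<delta> = {}" "block D (A # B # P) r \<gamma>" "block D (A # B # P) r \<delta>"
     "\<not> touches \<gamma> B" "\<not> touches \<delta> A" "touches \<beta> (LConj r A B)"
proof -
  have b': "block D (A # B # P) (Suc r) \<beta>" using b by (simp add: block_conj)
  have A: "D l r = 1" if "l \<in> \<beta>" "l \<in> labs A" for l using f that by auto
  have B: "D l r = 2" if "l \<in> \<beta>" "l \<in> labs B" for l using f that by auto
  consider (none) l where "l \<in> \<beta>" "D l r \<noteq> 1" "D l r \<noteq> 2"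
    | (away) "\<not> touches \<beta> (LConj r A B)"
    | (both) "\<forall>l \<in> \<beta>. D l r = 1 \<or> D l r = 2" "touches \<beta> (LConj r A B)" by blast
  then show ?thesis
  proof cases
    case none
    show ?thesis
      by (rule that(1)[OF _ block_class[OF b' none(1)]]) (use none A B in \<open>auto simp: touches_def\<close>)
  next
    case away
    obtain l where l: "l \<in> \<beta>" using b by (auto simp: block_def)
    show ?thesis
      by (rule that(1)[OF _ block_class[OF b' l]]) (use away in \<open>auto simp: touches_def\<close>)
  next
    case both
    then obtain l where l: "l \<in> \<beta>" by (auto simp: touches_def)
    have "split_closed D (Suc r) \<beta>" using b by (simp add: block_def)
    then have sc: "(D l r = 1 \<longrightarrow> (\<exists>k \<in> \<beta>. D k r = 2)) \<and> (D l r = 2 \<longrightarrow> (\<exists>k \<in> \<beta>. D k r = 1))"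
      using l unfolding split_closed_def by blast
    obtain j k where jk: "j \<in> \<beta>" "D j r = 1" "k \<in> \<beta>" "D k r = 2"
      using sc l both(1) by metis
    show ?thesis
      by (rule that(2)[OF _ _ _ block_class[OF b' jk(1)] block_class[OF b' jk(3)] _ _ both(2)])
        (use jk A B in \<open>auto simp: touches_def\<close>)
  qed
qed

text \<open>Read upwards: disjunctions are decomposed as soon as they are accessible, since their
  rule has no side condition, and then the conjunction of the highest rank is split in all ogroups
  at once. The measure contains \<open>R\<close> because a block may have to be reduced at a rank
  that no conjunction carries.\<close>

lemma certificate_sound: "certificate D P Bs R \<Longrightarrow> CL5.derives (erase \<sigma>) (map touches Bs) P"
proof (induction "R + sum_list (map size P)" arbitrary: R P Bs rule: less_induct)
  case less
  note cert = less.prems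
  consider (disj) A B where "LDisj A B \<in> set P"
    | (zero) "\<And>A B. LDisj A B \<notin> set P" "R = 0"
    | (conj) r A B where "R = Suc r" "LConj r A B \<in> set P"
    | (skip) r where "\<And>A B. LDisj A B \<notin> set P" "R = Suc r" "\<And>A B. LConj r A B \<notin> set P"
    by (cases R) blast+
  then show ?case
  proof cases
    case disj
    define P' where "P' = remove1 (LDisj A B) P"
    have perm: "mset P = mset (LDisj A B # P')" using disj by (simp add: P'_def)
    have "certificate D (LDisj A B # P') Bs R" by (rule certificate_perm[OF perm cert])
    then have "certificate D (A # B # P') Bs R"
      unfolding certificate_def block_def by (auto simp: ball_Un)
    moreover have "sum_list (map size P) = sum_list (map size (LDisj A B # P'))"
      using perm by (metis mset_map sum_mset_sum_list)
    ultimately have "CL5.derives (erase \<sigma>) (map touches Bs) (A # B # P')" by (intro less.hyps) auto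
    then have "CL5.derives (erase \<sigma>) (map touches Bs) (LDisj A B # P')"
      by (rule CL5.derives_disj) (auto simp: touches_def)
    then show ?thesis by (rule CL5.derives_perm[OF perm[symmetric]])
  next
    case zero
    have lit: "\<exists>l. x = LAtom l \<or> x = LNeg l" if "x \<in> set P" for x
    proof -
      have "\<forall>r \<in> set (ranks x). r < 0" using that zero(2) cert unfolding certificate_def by blast
      then show ?thesis using that zero(1) by (cases x) auto
    qed
    show ?thesis
    proof (rule derives_literals[OF certificate_distinct[OF cert]])
      show "\<forall>\<beta> \<in> set Bs. \<exists>l \<in> \<beta>. LAtom l \<in> set P \<and> LNeg l \<in> set P"
      proof
        fix \<beta> assume "\<beta> \<in> set Bs"
        then have "block D P R \<beta>" using cert by (simp add: certificate_def)
        then obtain l x y where "l \<in> \<beta>" "x \<in> set P" "l \<in> set (posl x)" "y \<in> set P" "l \<in> set (negl y)"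
          unfolding block_def by (metis ex_in_conv)
        moreover then have "x = LAtom l" "y = LNeg l" using lit[of x] lit[of y] by auto
        ultimately show "\<exists>l \<in> \<beta>. LAtom l \<in> set P \<and> LNeg l \<in> set P" by auto
      qed
    qed (use cert in \<open>simp add: certificate_def\<close>)
  next
    case conj
    define c where "c = LConj r A B"
    define P' where "P' = remove1 c P"
    have perm: "mset P = mset (c # P')" using conj by (simp add: P'_def c_def)
    have cert': "certificate D (c # P') Bs (Suc r)" using certificate_perm[OF perm cert] conj by simp
    define good where "good \<beta> p \<longleftrightarrow> (case p of
        (\<gamma>, None) \<Rightarrow> \<gamma> \<subseteq> \<beta> \<and> block D (A # B # P') r \<gamma> \<and> \<not> touches \<gamma> c
      | (\<gamma>, Some \<delta>) \<Rightarrow> \<gamma> \<subseteq> \<beta> \<and> \<delta> \<subseteq> \<beta> \<and> \<gamma> \<inter> \<delta> = {} \<and> block D (A # B # P') r \<gamma> \<and> block D (A # B # P') r \<delta> \<and>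
          \<not> touches \<gamma> B \<and> \<not> touches \<delta> A \<and> touches \<beta> c)" for \<beta> p
    have "\<exists>p. good \<beta> p" if \<beta>: "\<beta> \<in> set Bs" for \<beta>
    proof -
      have "block D (c # P') (Suc r) \<beta>" "follows D \<beta> c"
        using cert' \<beta> by (auto simp: certificate_def elim: follows_mono)
      then show ?thesis unfolding c_def
        by (rule split_block) (rule exI[of _ "(_, None)"], simp add: good_def c_def,
          rule exI[of _ "(_, Some _)"], simp add: good_def c_def)
    qed
    then obtain pc where pc: "\<And>\<beta>. \<beta> \<in> set Bs \<Longrightarrow> good \<beta> (pc \<beta>)" by metis
    define Bs' where "Bs' = concat (map (\<lambda>\<beta>. blocks (pc \<beta>)) Bs)"
    have sub: "\<gamma> \<subseteq> \<beta> \<and> block D (A # B # P') r \<gamma>" if "\<beta> \<in> set Bs" "\<gamma> \<in> set (blocks (pc \<beta>))" for \<beta> \<gamma>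
      using pc[OF that(1)] that(2) by (cases "pc \<beta>" rule: blocks.cases) (auto simp: good_def)
    have "sorted_wrt (\<lambda>\<beta> \<gamma>. \<beta> \<inter> \<gamma> = {}) Cs \<Longrightarrow> set Cs \<subseteq> set Bs \<Longrightarrow>
        sorted_wrt (\<lambda>\<beta> \<gamma>. \<beta> \<inter> \<gamma> = {}) (concat (map (\<lambda>\<beta>. blocks (pc \<beta>)) Cs))" for Cs
    proof (induction Cs)
      case (Cons \<beta> Cs)
      have "sorted_wrt (\<lambda>\<beta> \<gamma>. \<beta> \<inter> \<gamma> = {}) (blocks (pc \<beta>))"
        using pc[of \<beta>] Cons.prems by (cases "pc \<beta>" rule: blocks.cases) (auto simp: good_def)
      moreover have "\<gamma> \<inter> \<delta> = {}" if "\<gamma> \<in> set (blocks (pc \<beta>))" "\<epsilon> \<in> set Cs" "\<delta> \<in> set (blocks (pc \<epsilon>))" for \<gamma> \<delta> \<epsilon>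
      proof -
        have "\<epsilon> \<in> set Bs" "\<beta> \<in> set Bs" "\<beta> \<inter> \<epsilon> = {}" using that(2) Cons.prems by auto
        moreover have "\<gamma> \<subseteq> \<beta>" "\<delta> \<subseteq> \<epsilon>" using sub[OF _ that(1)] sub[OF _ that(3)] calculation by blast+
        ultimately show ?thesis by blast
      qed
      ultimately show ?case using Cons by (auto simp: sorted_wrt_append)
    qed simp
    then have sorted': "sorted_wrt (\<lambda>\<beta> \<gamma>. \<beta> \<inter> \<gamma> = {}) Bs'"
      using cert' unfolding Bs'_def certificate_def by blast
    have Bs': "\<Union> (set Bs') \<subseteq> \<Union> (set Bs)" "\<forall>\<gamma> \<in> set Bs'. block D (A # B # P') r \<gamma>"
      using sub by (auto simp: Bs'_def)
    have "\<forall>x \<in> set (A # B # P'). heap x \<and> (\<forall>q \<in> set (ranks x). q < r) \<and> follows D (\<Union> (set Bs')) x"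
    proof -
      have "q < r" if "x \<in> set P'" "q \<in> set (ranks x)" for x q
      proof -
        have "q < Suc r" "q \<noteq> r" using cert' that by (auto simp: certificate_def c_def)
        then show ?thesis by simp
      qed
      then show ?thesis using cert' Bs'(1) unfolding certificate_def c_def
        by (auto elim!: follows_mono)
    qed
    then have "certificate D (A # B # P') Bs' r"
      using cert' sorted' Bs'(2) unfolding certificate_def c_def by auto
    moreover have "sum_list (map size P) = sum_list (map size (c # P'))"
      using perm by (metis mset_map sum_mset_sum_list)
    ultimately have N: "CL5.derives (erase \<sigma>) (map touches Bs') (A # B # P')"
      using conj by (intro less.hyps) (auto simp: c_def)
    \<comment> \<open>The conjunction rule demands that both ogroups contain their conjuncts, even
      if no axiom of the respective half occurs there. The missing arcs are added by weakening
      before the rule is applied.\<close>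
    define lift where "lift p = (case p of (\<gamma>, None) \<Rightarrow> (touches \<gamma>, None)
      | (\<gamma>, Some \<delta>) \<Rightarrow> (\<lambda>x. x = A \<or> touches \<gamma> x, Some (\<lambda>x. x = B \<or> touches \<delta> x)))" for p
    define kk where "kk p = (case p of (\<gamma>, None) \<Rightarrow> touches \<gamma>
      | (\<gamma>, Some \<delta>) \<Rightarrow> (\<lambda>x. x = c \<or> touches \<gamma> x \<or> touches \<delta> x))" for p
    have "distinct (A # B # P')"
      by (rule linear_distinct) (use cert' in \<open>auto simp: certificate_def c_def\<close>)
    moreover have "c \<notin> set P'" using certificate_distinct[OF cert'] by simp
    ultimately have neq: "A \<noteq> B" "A \<notin> set P'" "B \<notin> set P'" "c \<notin> set P'" by auto
    have "list_all2 (\<lambda>g h. \<forall>x \<in> set (A # B # P'). g x \<longrightarrow> h x) (map touches (concat (map (\<lambda>\<beta>. blocks (pc \<beta>)) Cs)))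
       (CL5.expand (map (\<lambda>\<beta>. lift (pc \<beta>)) Cs))" for Cs
    proof (induction Cs)
      case (Cons \<beta> Cs)
      then show ?case by (cases "pc \<beta>" rule: blocks.cases) (simp_all add: lift_def)
    qed simp
    from CL5.derives_weaken[OF this N[unfolded Bs'_def]]
    have N1: "CL5.derives (erase \<sigma>) (CL5.expand (map (\<lambda>\<beta>. lift (pc \<beta>)) Bs)) (A # B # P')" .
    have "list_all2 (CL5.splits A B c P') (map (\<lambda>\<beta>. lift (pc \<beta>)) Bs) (map (\<lambda>\<beta>. kk (pc \<beta>)) Bs)"
    proof -
      have "CL5.splits A B c P' (lift (pc \<beta>)) (kk (pc \<beta>))" if "\<beta> \<in> set Bs" for \<beta>
        using pc[OF that] neq
        by (cases "pc \<beta>" rule: blocks.cases) (auto simp: lift_def kk_def good_def touches_def c_def)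
      then show ?thesis by (simp add: list_all2_map1 list_all2_map2 list.rel_refl_strong)
    qed
    from CL5.derives_conj[OF N1 _ this] have "CL5.derives (erase \<sigma>) (map (\<lambda>\<beta>. kk (pc \<beta>)) Bs) (c # P')"
      by (simp add: c_def)
    moreover have "list_all2 (\<lambda>g h. \<forall>x \<in> set (c # P'). g x \<longrightarrow> h x) (map (\<lambda>\<beta>. kk (pc \<beta>)) Bs) (map touches Bs)"
    proof -
      have "\<forall>x \<in> set (c # P'). kk (pc \<beta>) x \<longrightarrow> touches \<beta> x" if "\<beta> \<in> set Bs" for \<beta>
        using pc[OF that] neq
        by (cases "pc \<beta>" rule: blocks.cases) (auto simp: kk_def good_def touches_def)
      then show ?thesis by (simp add: list_all2_map1 list_all2_map2 list.rel_refl_strong)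
    qed
    ultimately have "CL5.derives (erase \<sigma>) (map touches Bs) (c # P')" by (rule CL5.derives_weaken[rotated])
    then show ?thesis by (rule CL5.derives_perm[OF perm[symmetric]])
  next
    \<comment> \<open>No conjunction has rank \<open>r\<close>. One class at \<open>r\<close> is
      kept from each block, and the arcs lost in this way are recovered by weakening.\<close>
    case skip
    have "q < r" if "x \<in> set P" "q \<in> set (ranks x)" for x q
    proof (cases x)
      case (LConj s A B)
      then have "s < Suc r" "s \<noteq> r" "q = s \<or> q < s" using that skip cert by (auto simp: certificate_def)
      then show ?thesis by auto
    qed (use that skip in auto)
    moreover have sub: "\<exists>\<gamma>. \<gamma> \<subseteq> \<beta> \<and> block D P r \<gamma>" if "\<beta> \<in> set Bs" for \<beta>
    proof -
      have "block D P (Suc r) \<beta>" using cert that skip by (simp add: certificate_def)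
      moreover then obtain l where "l \<in> \<beta>" by (auto simp: block_def)
      ultimately show ?thesis
        by (intro exI[of _ "{k \<in> \<beta>. D k r = D l r}"] conjI block_class) auto
    qed
    have "\<exists>f. \<forall>\<beta> \<in> set Bs. f \<beta> \<subseteq> \<beta> \<and> block D P r (f \<beta>)"
      by (rule bchoice, rule ballI, rule sub)
    then obtain f where f': "\<forall>\<beta> \<in> set Bs. f \<beta> \<subseteq> \<beta> \<and> block D P r (f \<beta>)" by (rule exE)
    note f = bspec[OF f']
    have "sorted_wrt (\<lambda>\<beta> \<gamma>. \<beta> \<inter> \<gamma> = {}) (map f Bs)"
    proof -
      have "sorted_wrt (\<lambda>\<beta> \<gamma>. \<beta> \<inter> \<gamma> = {}) Bs" using cert by (simp add: certificate_def)
      then show ?thesis unfolding sorted_wrt_map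
        by (rule sorted_wrt_mono_rel[rotated]) (meson disjoint_iff f subsetD)
    qed
    moreover have "\<Union> (set (map f Bs)) \<subseteq> \<Union> (set Bs)" using f by auto
    ultimately have "certificate D P (map f Bs) r"
      using cert f unfolding certificate_def by (auto elim!: follows_mono)
    then have "CL5.derives (erase \<sigma>) (map touches (map f Bs)) P" using skip by (intro less.hyps) auto
    moreover have "list_all2 (\<lambda>g h. \<forall>x \<in> set P. g x \<longrightarrow> h x) (map touches (map f Bs)) (map touches Bs)"
      using f by (auto simp: list_all2_map1 list_all2_map2 touches_def intro!: list.rel_refl_strong)
    ultimately show ?thesis by (rule CL5.derives_weaken[rotated])
  qed
qed

lemma certificate_provable:
  assumes "certificate D [x] [L] R"
  shows "CL5m_provable (erase \<sigma> x)"
proof -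
  have "touches L x" using assms unfolding certificate_def block_def touches_def labs_def by auto
  then show ?thesis
    using certificate_sound[OF assms, of \<sigma>] by (simp add: CL5.derives_def CL5m_provable_def arcs_Cons)
qed

text \<open>Valuations assign truth values to labels instead of atoms: two occurrences of the same
  atom vary independently unless they share a label.\<close>

fun holds :: "(nat \<Rightarrow> bool) \<Rightarrow> lformula \<Rightarrow> bool" where
  "holds v (LAtom l) = v l"
| "holds v (LNeg l) = (\<not> v l)"
| "holds v (LConj r A B) = (holds v A \<and> holds v B)"
| "holds v (LDisj A B) = (holds v A \<or> holds v B)"

section \<open>Relabelling and juxtaposing certificates\<close>

fun relabel :: "(nat \<Rightarrow> nat) \<Rightarrow> (nat \<Rightarrow> nat) \<Rightarrow> lformula \<Rightarrow> lformula" where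
  "relabel f g (LAtom l) = LAtom (f l)"
| "relabel f g (LNeg l) = LNeg (f l)"
| "relabel f g (LConj r A B) = LConj (g r) (relabel f g A) (relabel f g B)"
| "relabel f g (LDisj A B) = LDisj (relabel f g A) (relabel f g B)"

lemma posl_relabel: "posl (relabel f g x) = map f (posl x)" by (induction x) auto
lemma negl_relabel: "negl (relabel f g x) = map f (negl x)" by (induction x) auto
lemma ranks_relabel: "ranks (relabel f g x) = map g (ranks x)" by (induction x) auto
lemma labs_relabel: "labs (relabel f g x) = f ` labs x"
  by (auto simp: labs_def posl_relabel negl_relabel)
lemma holds_relabel: "holds v (relabel f g x) = holds (\<lambda>l. v (f l)) x" by (induction x) auto
lemma heap_relabel: "strict_mono g \<Longrightarrow> heap x \<Longrightarrow> heap (relabel f g x)"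
  by (induction x) (auto simp: ranks_relabel strict_mono_less)
lemma erase_relabel: "(\<And>l. \<sigma>' (f l) = \<sigma> l) \<Longrightarrow> erase \<sigma>' (relabel f g x) = erase \<sigma> x"
  by (induction x) auto

lemma touches_relabel: "inj f \<Longrightarrow> touches (f ` \<beta>) (relabel f g x) = touches \<beta> x"
  by (simp add: touches_def labs_relabel image_Int[symmetric])

lemma follows_empty: "follows D {} x"
  by (induction x) auto

lemma follows_local: "follows D K x \<Longrightarrow> L \<inter> labs x \<subseteq> K \<Longrightarrow> follows D L x"
  by (induction x) auto

lemma follows_relabel:
  "inj f \<Longrightarrow> (\<And>l r. l \<in> L \<Longrightarrow> r \<in> set (ranks x) \<Longrightarrow> D' (f l) (g r) = D l r) \<Longrightarrow> follows D L x \<Longrightarrow>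
   follows D' (f ` L) (relabel f g x)"
  by (induction x) (auto simp: labs_relabel inj_image_mem_iff dest: injD)

lemma follows_cong:
  "(\<And>l r. r \<in> set (ranks x) \<Longrightarrow> D' l r = D l r) \<Longrightarrow> follows D' L x \<longleftrightarrow> follows D L x"
  by (induction x) auto

text \<open>In a juxtaposition the labels of the left part become even and those of the right part
  odd, and the ranks on the right are put above those on the left. The value \<open>0\<close> at the
  ranks of the other part records that its conjunctions are not in the ogroup.\<close>

definition mixD :: "nat \<Rightarrow> (nat \<Rightarrow> nat \<Rightarrow> nat) \<Rightarrow> (nat \<Rightarrow> nat \<Rightarrow> nat) \<Rightarrow> nat \<Rightarrow> nat \<Rightarrow> nat" where
  "mixD R D E l r = (if even l then (if r < R then D (l div 2) r else 0)
     else if r < R then 0 else E (l div 2) (r - R))"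

definition mixl :: "lformula \<Rightarrow> lformula" where "mixl = relabel (\<lambda>l. 2 * l) (\<lambda>r. r)"
definition mixr :: "nat \<Rightarrow> lformula \<Rightarrow> lformula" where "mixr R = relabel (\<lambda>l. Suc (2 * l)) (\<lambda>r. R + r)"

lemma inj_mix: "inj (\<lambda>l::nat. 2 * l)" "inj (\<lambda>l::nat. Suc (2 * l))"
  by (auto intro: injI)

lemma labs_mixl: "l \<in> labs (mixl x) \<Longrightarrow> even l" by (auto simp: mixl_def labs_relabel)
lemma labs_mixr: "l \<in> labs (mixr R x) \<Longrightarrow> odd l" by (auto simp: mixr_def labs_relabel)

lemma split_closed_mixl:
  assumes "split_closed D R \<beta>"
  shows "split_closed (mixD R D E) (R + R') ((\<lambda>l. 2 * l) ` \<beta>)"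
  unfolding split_closed_def
proof (intro ballI allI impI)
  fix l' r assume "l' \<in> (\<lambda>l. 2 * l) ` \<beta>" and r: "r < R + R'"
  then obtain l where l: "l \<in> \<beta>" "l' = 2 * l" by auto
  have *: "(\<exists>k' \<in> (\<lambda>l. 2 * l) ` \<beta>. (\<forall>s. r < s \<and> s < R + R' \<longrightarrow> mixD R D E k' s = mixD R D E l' s) \<and> mixD R D E k' r = j)"
    if "\<exists>k \<in> \<beta>. (\<forall>s. r < s \<and> s < R \<longrightarrow> D k s = D l s) \<and> D k r = j" "r < R" for j
    using that l by (auto simp: mixD_def)
  show "(mixD R D E l' r = 1 \<longrightarrow> (\<exists>k \<in> (\<lambda>l. 2 * l) ` \<beta>. (\<forall>s. r < s \<and> s < R + R' \<longrightarrow> mixD R D E k s = mixD R D E l' s) \<and> mixD R D E k r = 2)) \<and>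
     (mixD R D E l' r = 2 \<longrightarrow> (\<exists>k \<in> (\<lambda>l. 2 * l) ` \<beta>. (\<forall>s. r < s \<and> s < R + R' \<longrightarrow> mixD R D E k s = mixD R D E l' s) \<and> mixD R D E k r = 1))"
  proof (cases "r < R")
    case True
    have eq: "mixD R D E l' r = D l r" using l True by (simp add: mixD_def)
    have sc: "D l r = 1 \<Longrightarrow> \<exists>k \<in> \<beta>. (\<forall>s. r < s \<and> s < R \<longrightarrow> D k s = D l s) \<and> D k r = 2"
      "D l r = 2 \<Longrightarrow> \<exists>k \<in> \<beta>. (\<forall>s. r < s \<and> s < R \<longrightarrow> D k s = D l s) \<and> D k r = 1"
      using assms l(1) True unfolding split_closed_def by blast+
    show ?thesis unfolding eq by (intro conjI impI *[OF _ True] sc)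
  qed (use l in \<open>auto simp: mixD_def\<close>)
qed

lemma split_closed_mixr:
  assumes "split_closed E R' \<beta>"
  shows "split_closed (mixD R D E) (R + R') ((\<lambda>l. Suc (2 * l)) ` \<beta>)"
  unfolding split_closed_def
proof (intro ballI allI impI)
  fix l' r assume "l' \<in> (\<lambda>l. Suc (2 * l)) ` \<beta>" and r: "r < R + R'"
  then obtain l where l: "l \<in> \<beta>" "l' = Suc (2 * l)" by auto
  have *: "(\<exists>k' \<in> (\<lambda>l. Suc (2 * l)) ` \<beta>. (\<forall>s. r < s \<and> s < R + R' \<longrightarrow> mixD R D E k' s = mixD R D E l' s) \<and> mixD R D E k' r = j)"
    if "\<exists>k \<in> \<beta>. (\<forall>s. r - R < s \<and> s < R' \<longrightarrow> E k s = E l s) \<and> E k (r - R) = j" "R \<le> r" for j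
  proof -
    from that(1) obtain k where k: "k \<in> \<beta>" "\<forall>s. r - R < s \<and> s < R' \<longrightarrow> E k s = E l s" "E k (r - R) = j" by blast
    have "mixD R D E (Suc (2 * k)) s = mixD R D E l' s" if "r < s" "s < R + R'" for s
    proof -
      have "r - R < s - R \<and> s - R < R'" using that \<open>R \<le> r\<close> by linarith
      then show ?thesis using k(2) l by (simp add: mixD_def)
    qed
    then show ?thesis using k \<open>R \<le> r\<close> by (intro bexI[of _ "Suc (2 * k)"]) (auto simp: mixD_def)
  qed
  show "(mixD R D E l' r = 1 \<longrightarrow> (\<exists>k \<in> (\<lambda>l. Suc (2 * l)) ` \<beta>. (\<forall>s. r < s \<and> s < R + R' \<longrightarrow> mixD R D E k s = mixD R D E l' s) \<and> mixD R D E k r = 2)) \<and>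
     (mixD R D E l' r = 2 \<longrightarrow> (\<exists>k \<in> (\<lambda>l. Suc (2 * l)) ` \<beta>. (\<forall>s. r < s \<and> s < R + R' \<longrightarrow> mixD R D E k s = mixD R D E l' s) \<and> mixD R D E k r = 1))"
  proof (cases "R \<le> r")
    case True
    have eq: "mixD R D E l' r = E l (r - R)" using l True by (simp add: mixD_def)
    have "r - R < R'" using r True by linarith
    then have sc: "E l (r - R) = 1 \<Longrightarrow> \<exists>k \<in> \<beta>. (\<forall>s. r - R < s \<and> s < R' \<longrightarrow> E k s = E l s) \<and> E k (r - R) = 2"
      "E l (r - R) = 2 \<Longrightarrow> \<exists>k \<in> \<beta>. (\<forall>s. r - R < s \<and> s < R' \<longrightarrow> E k s = E l s) \<and> E k (r - R) = 1"
      using assms l(1) unfolding split_closed_def by blast+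
    show ?thesis unfolding eq by (intro conjI impI *[OF _ True] sc)
  qed (use l in \<open>auto simp: mixD_def\<close>)
qed

lemma certificate_mix:
  assumes P: "certificate D P Bs R" and Q: "certificate E Q Cs R'"
  shows "certificate (mixD R D E) (map mixl P @ map (mixr R) Q)
    (map (image (\<lambda>l. 2 * l)) Bs @ map (image (\<lambda>l. Suc (2 * l))) Cs) (R + R')"
proof -
  have cm: "concat (map (\<lambda>x. map h (k x)) xs) = map h (concat (map k xs))" for h :: "nat \<Rightarrow> nat" and k xs
    by (simp add: map_concat comp_def)
  have pos: "concat (map posl (map mixl P @ map (mixr R) Q)) =
      map (\<lambda>l. 2 * l) (concat (map posl P)) @ map (\<lambda>l. Suc (2 * l)) (concat (map posl Q))"
    by (simp add: comp_def mixl_def mixr_def posl_relabel cm)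
  have neg: "concat (map negl (map mixl P @ map (mixr R) Q)) =
      map (\<lambda>l. 2 * l) (concat (map negl P)) @ map (\<lambda>l. Suc (2 * l)) (concat (map negl Q))"
    by (simp add: comp_def mixl_def mixr_def negl_relabel cm)
  have rk: "concat (map ranks (map mixl P @ map (mixr R) Q)) =
      concat (map ranks P) @ map (\<lambda>r. R + r) (concat (map ranks Q))"
    by (simp add: comp_def mixl_def mixr_def ranks_relabel cm[of "\<lambda>r. R + r"])
  have par: "2 * a \<noteq> Suc (2 * b)" for a b :: nat by presburger
  have 1: "distinct (concat (map posl (map mixl P @ map (mixr R) Q)))"
    unfolding pos using P Q par by (auto simp: certificate_def distinct_map inj_on_def)
  have 2: "distinct (concat (map negl (map mixl P @ map (mixr R) Q)))"
    unfolding neg using P Q par by (auto simp: certificate_def distinct_map inj_on_def)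
  have "r < R" if "r \<in> set (concat (map ranks P))" for r using P that by (auto simp: certificate_def)
  then have 3: "distinct (concat (map ranks (map mixl P @ map (mixr R) Q)))"
    unfolding rk using P Q by (fastforce simp: certificate_def distinct_map inj_on_def)
  let ?Bs = "map (image (\<lambda>l. 2 * l)) Bs @ map (image (\<lambda>l. Suc (2 * l))) Cs"
  have 4: "heap x \<and> (\<forall>r \<in> set (ranks x). r < R + R') \<and> follows (mixD R D E) (\<Union> (set ?Bs)) x"
    if "x \<in> set (map mixl P @ map (mixr R) Q)" for x
  proof -
    from that consider y where "y \<in> set P" "x = mixl y" | y where "y \<in> set Q" "x = mixr R y" by auto
    then show ?thesis
    proof cases
      case 1
      have y: "heap y" "\<forall>r \<in> set (ranks y). r < R" "follows D (\<Union> (set Bs)) y"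
        using P 1(1) by (auto simp: certificate_def)
      have "follows (mixD R D E) ((\<lambda>l. 2 * l) ` \<Union> (set Bs)) x" unfolding 1(2) mixl_def
        by (rule follows_relabel[OF inj_mix(1) _ y(3)]) (use y(2) in \<open>auto simp: mixD_def\<close>)
      then have "follows (mixD R D E) (\<Union> (set ?Bs)) x"
        by (rule follows_local) (auto simp: 1(2) dest!: labs_mixl)
      then show ?thesis using y 1(2) by (auto simp: mixl_def ranks_relabel intro!: heap_relabel strict_monoI)
    next
      case 2
      have y: "heap y" "\<forall>r \<in> set (ranks y). r < R'" "follows E (\<Union> (set Cs)) y"
        using Q 2(1) by (auto simp: certificate_def)
      have "follows (mixD R D E) ((\<lambda>l. Suc (2 * l)) ` \<Union> (set Cs)) x" unfolding 2(2) mixr_def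
        by (rule follows_relabel[OF inj_mix(2) _ y(3)]) (use y(2) in \<open>auto simp: mixD_def\<close>)
      then have "follows (mixD R D E) (\<Union> (set ?Bs)) x"
        by (rule follows_local) (auto simp: 2(2) dest!: labs_mixr)
      then show ?thesis using y 2(2) by (auto simp: mixr_def ranks_relabel intro!: heap_relabel strict_monoI)
    qed
  qed
  have 5: "sorted_wrt (\<lambda>\<beta> \<gamma>. \<beta> \<inter> \<gamma> = {}) ?Bs"
  proof -
    have d: "f ` \<beta> \<inter> f ` \<gamma> = {}" if "inj f" "\<beta> \<inter> \<gamma> = {}" for f :: "nat \<Rightarrow> nat" and \<beta> \<gamma>
      using that by (metis image_Int image_empty)
    have BC: "sorted_wrt (\<lambda>\<beta> \<gamma>. \<beta> \<inter> \<gamma> = {}) Bs" "sorted_wrt (\<lambda>\<beta> \<gamma>. \<beta> \<inter> \<gamma> = {}) Cs"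
      using P Q by (auto simp: certificate_def)
    have "sorted_wrt (\<lambda>\<beta> \<gamma>. (\<lambda>l. 2 * l) ` \<beta> \<inter> (\<lambda>l. 2 * l) ` \<gamma> = {}) Bs"
      "sorted_wrt (\<lambda>\<beta> \<gamma>. (\<lambda>l. Suc (2 * l)) ` \<beta> \<inter> (\<lambda>l. Suc (2 * l)) ` \<gamma> = {}) Cs"
      by (rule sorted_wrt_mono_rel[OF _ BC(1)], intro d inj_mix, assumption,
          rule sorted_wrt_mono_rel[OF _ BC(2)], intro d inj_mix, assumption)
    then show ?thesis using par by (auto simp: sorted_wrt_append sorted_wrt_map) 
  qed
  have 6: "block (mixD R D E) (map mixl P @ map (mixr R) Q) (R + R') \<beta>" if "\<beta> \<in> set ?Bs" for \<beta>
  proof -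
    from that consider \<gamma> where "\<gamma> \<in> set Bs" "\<beta> = (\<lambda>l. 2 * l) ` \<gamma>"
      | \<gamma> where "\<gamma> \<in> set Cs" "\<beta> = (\<lambda>l. Suc (2 * l)) ` \<gamma>" by auto
    then show ?thesis
    proof cases
      case 1
      then have "block D P R \<gamma>" using P by (simp add: certificate_def)
      moreover have "\<exists>x \<in> set (map mixl P @ map (mixr R) Q). 2 * l \<in> set (posl x)"
        if "\<exists>x \<in> set P. l \<in> set (posl x)" for l
        using that by (auto simp: mixl_def posl_relabel bex_Un)
      moreover have "\<exists>x \<in> set (map mixl P @ map (mixr R) Q). 2 * l \<in> set (negl x)"
        if "\<exists>x \<in> set P. l \<in> set (negl x)" for l
        using that by (auto simp: mixl_def negl_relabel bex_Un)
      ultimately show ?thesis unfolding block_def 1(2) ball_simps(9)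
        by (simp only: image_is_empty split_closed_mixl simp_thms) blast
    next
      case 2
      then have "block E Q R' \<gamma>" using Q by (simp add: certificate_def)
      moreover have "\<exists>x \<in> set (map mixl P @ map (mixr R) Q). Suc (2 * l) \<in> set (posl x)"
        if "\<exists>x \<in> set Q. l \<in> set (posl x)" for l
        using that by (auto simp: mixr_def posl_relabel bex_Un)
      moreover have "\<exists>x \<in> set (map mixl P @ map (mixr R) Q). Suc (2 * l) \<in> set (negl x)"
        if "\<exists>x \<in> set Q. l \<in> set (negl x)" for l
        using that by (auto simp: mixr_def negl_relabel bex_Un)
      ultimately show ?thesis unfolding block_def 2(2) ball_simps(9)
        by (simp only: image_is_empty split_closed_mixr simp_thms) blast
    qed
  qed
  show ?thesis unfolding certificate_def using 1 2 3 4 5 6 by blast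
qed

definition rank_count :: "lformula list \<Rightarrow> nat" where
  "rank_count P = length (concat (map ranks P))"

lemma rank_count_append [simp]: "rank_count (P @ Q) = rank_count P + rank_count Q"
  by (simp add: rank_count_def)

lemma rank_count_Cons [simp]: "rank_count (x # P) = length (ranks x) + rank_count P"
  by (simp add: rank_count_def)

lemma rank_count_Nil [simp]: "rank_count [] = 0"
  by (simp add: rank_count_def)

lemma rank_count_mix [simp]: "rank_count (map mixl P) = rank_count P" "rank_count (map (mixr R) P) = rank_count P"
  by (induction P) (simp_all add: mixl_def mixr_def ranks_relabel)

text \<open>A formula that enters by pool weakening takes part in no axiom, but its literals and
  conjunctions still need distinct labels and ranks. The empty list of blocks expresses
  this.\<close>

lemma certificate_labelled: "\<exists>\<sigma> x. erase \<sigma> x = F \<and> certificate (\<lambda>_ _. 0) [x] [] (length (ranks x))"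
proof (induction F)
  case (Atom a)
  show ?case by (rule exI[of _ "\<lambda>_. a"], rule exI[of _ "LAtom 0"]) (simp add: certificate_def)
next
  case (NegAtom a)
  show ?case by (rule exI[of _ "\<lambda>_. a"], rule exI[of _ "LNeg 0"]) (simp add: certificate_def)
next
  case (Conj F G)
  then obtain \<sigma> x \<tau> y where x: "erase \<sigma> x = F" "certificate (\<lambda>_ _. 0) [x] [] (length (ranks x))"
    and y: "erase \<tau> y = G" "certificate (\<lambda>_ _. 0) [y] [] (length (ranks y))" by blast
  let ?R = "length (ranks x)"
  let ?z = "LConj (?R + length (ranks y)) (mixl x) (mixr ?R y)"
  let ?\<rho> = "\<lambda>l. if even l then \<sigma> (l div 2) else \<tau> (l div 2)"
  have "certificate (mixD ?R (\<lambda>_ _. 0) (\<lambda>_ _. 0)) [mixl x, mixr ?R y] [] (?R + length (ranks y))"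
    using certificate_mix[OF x(2) y(2)] by simp
  then have "certificate (\<lambda>_ _. 0) [?z] [] (length (ranks ?z))"
    by (auto simp: certificate_def mixl_def mixr_def ranks_relabel follows_empty)
  moreover have "erase ?\<rho> ?z = Conj F G"
    using x(1) y(1) by (simp add: mixl_def mixr_def erase_relabel[of _ _ \<sigma>] erase_relabel[of _ _ \<tau>])
  ultimately show ?case by blast
next
  case (Disj F G)
  then obtain \<sigma> x \<tau> y where x: "erase \<sigma> x = F" "certificate (\<lambda>_ _. 0) [x] [] (length (ranks x))"
    and y: "erase \<tau> y = G" "certificate (\<lambda>_ _. 0) [y] [] (length (ranks y))" by blast
  let ?R = "length (ranks x)"
  let ?z = "LDisj (mixl x) (mixr ?R y)"
  let ?\<rho> = "\<lambda>l. if even l then \<sigma> (l div 2) else \<tau> (l div 2)"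
  have "certificate (mixD ?R (\<lambda>_ _. 0) (\<lambda>_ _. 0)) [mixl x, mixr ?R y] [] (?R + length (ranks y))"
    using certificate_mix[OF x(2) y(2)] by simp
  then have "certificate (\<lambda>_ _. 0) [?z] [] (length (ranks ?z))"
    by (auto simp: certificate_def mixl_def mixr_def ranks_relabel follows_empty)
  moreover have "erase ?\<rho> ?z = Disj F G"
    using x(1) y(1) by (simp add: mixl_def mixr_def erase_relabel[of _ _ \<sigma>] erase_relabel[of _ _ \<tau>])
  ultimately show ?case by blast
qed

fun merge_blocks :: "nat \<Rightarrow> nat set list \<Rightarrow> nat set list \<Rightarrow> nat set list" where
  "merge_blocks n (\<Gamma> # \<Delta> # S) (\<beta> # \<gamma> # Bs) =
     (if n \<in> \<Gamma> then (\<beta> \<union> \<gamma>) # merge_blocks n S Bs else \<beta> # merge_blocks n (\<Delta> # S) (\<gamma> # Bs))"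
| "merge_blocks n S Bs = Bs"

lemma merge_blocks_list_all2:
  assumes "list_all2 Q S Bs" "paired n S"
    and single: "\<And>\<Gamma> \<beta>. Q \<Gamma> \<beta> \<Longrightarrow> n \<notin> \<Gamma> \<Longrightarrow> Suc n \<notin> \<Gamma> \<Longrightarrow> Q' \<Gamma> \<beta>"
    and pair: "\<And>\<Gamma> \<Delta> \<beta> \<gamma>. Q \<Gamma> \<beta> \<Longrightarrow> Q \<Delta> \<gamma> \<Longrightarrow> n \<in> \<Gamma> \<Longrightarrow> Suc n \<notin> \<Gamma> \<Longrightarrow> n \<notin> \<Delta> \<Longrightarrow> Suc n \<in> \<Delta> \<Longrightarrow>
      \<beta> \<inter> \<gamma> = {} \<Longrightarrow> Q' (\<Gamma> \<union> \<Delta>) (\<beta> \<union> \<gamma>)"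
    and "sorted_wrt (\<lambda>\<beta> \<gamma>. \<beta> \<inter> \<gamma> = {}) Bs"
  shows "list_all2 Q' (merge_ogroups n S) (merge_blocks n S Bs)"
  using assms
proof (induction n S Bs rule: merge_blocks.induct)
  case (1 n \<Gamma> \<Delta> S \<beta> \<gamma> Bs)
  note single = 1(5) and pair = 1(6)
  show ?case
  proof (cases "n \<in> \<Gamma>")
    case True
    have "Q' (\<Gamma> \<union> \<Delta>) (\<beta> \<union> \<gamma>)" by (rule pair) (use 1(3,4,7) True in auto)
    moreover have "list_all2 Q' (merge_ogroups n S) (merge_blocks n S Bs)"
      by (rule 1(1)[OF True _ _ single pair]) (use 1(3,4,7) True in auto)
    ultimately show ?thesis using True by simp
  next
    case False
    have "Q' \<Gamma> \<beta>" by (rule single) (use 1(3,4,7) False in auto)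
    moreover have "list_all2 Q' (merge_ogroups n (\<Delta> # S)) (merge_blocks n (\<Delta> # S) (\<gamma> # Bs))"
      by (rule 1(2)[OF False _ _ single pair]) (use 1(3,4,7) False in auto)
    ultimately show ?thesis using False by simp
  qed
qed (auto simp: list_all2_Cons1 list_all2_Cons2)

lemma merge_blocks_Union: "\<Union> (set (merge_blocks n S Bs)) = \<Union> (set Bs)"
  by (induction n S Bs rule: merge_blocks.induct) auto

lemma merge_blocks_disjoint:
  "sorted_wrt (\<lambda>\<beta> \<gamma>. \<beta> \<inter> \<gamma> = {}) Bs \<Longrightarrow> sorted_wrt (\<lambda>\<beta> \<gamma>. \<beta> \<inter> \<gamma> = {}) (merge_blocks n S Bs)"
proof (induction n S Bs rule: merge_blocks.induct)
  case (1 n \<Gamma> \<Delta> S \<beta> \<gamma> Bs)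
  have "\<delta> \<inter> \<epsilon> = {}" if "\<epsilon> \<in> set (merge_blocks n S' Cs)" "\<forall>\<eta> \<in> set Cs. \<delta> \<inter> \<eta> = {}" for \<delta> \<epsilon> S' Cs
    using that merge_blocks_Union[of n S' Cs] by blast
  note * = this
  show ?case
  proof (cases "n \<in> \<Gamma>")
    case True
    have "\<forall>\<eta> \<in> set Bs. (\<beta> \<union> \<gamma>) \<inter> \<eta> = {}" using 1(3) by auto
    then have "(\<beta> \<union> \<gamma>) \<inter> \<epsilon> = {}" if "\<epsilon> \<in> set (merge_blocks n S Bs)" for \<epsilon>
      by (rule *[OF that])
    moreover have "sorted_wrt (\<lambda>\<beta> \<gamma>. \<beta> \<inter> \<gamma> = {}) (merge_blocks n S Bs)"
      using 1(3) by (intro 1(1)[OF True]) simp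
    ultimately show ?thesis using True by simp
  next
    case False
    have "\<forall>\<eta> \<in> set (\<gamma> # Bs). \<beta> \<inter> \<eta> = {}" using 1(3) by auto
    then have "\<beta> \<inter> \<epsilon> = {}" if "\<epsilon> \<in> set (merge_blocks n (\<Delta> # S) (\<gamma> # Bs))" for \<epsilon>
      by (rule *[OF that])
    moreover have "sorted_wrt (\<lambda>\<beta> \<gamma>. \<beta> \<inter> \<gamma> = {}) (merge_blocks n (\<Delta> # S) (\<gamma> # Bs))"
      using 1(3) by (intro 1(2)[OF False]) simp
    ultimately show ?thesis using False by simp
  qed
qed auto

text \<open>The invariant that ties an ogroup to its block. The inclusion of arcs makes the axioms
  of a conjunct lie in ogroups that contain this conjunct, which yields \<open>follows\<close> at
  the next conjunction. The truth condition turns a provable formula into a tautology in its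
  labels.\<close>

definition good :: "lformula list \<Rightarrow> nat set \<Rightarrow> nat set \<Rightarrow> bool" where
  "good P \<Gamma> \<beta> \<longleftrightarrow> arcs (touches \<beta>) P \<subseteq> \<Gamma> \<and> (\<forall>v. \<Gamma> \<inter> arcs (holds v) P \<noteq> {})"

lemma good_image:
  assumes "good P \<Gamma> \<beta>" "arcs (touches \<beta>) Q \<subseteq> \<pi> ` arcs (touches \<beta>) P"
    "\<And>v. \<pi> ` arcs (holds v) P \<subseteq> arcs (holds v) Q"
  shows "good Q (\<pi> ` \<Gamma>) \<beta>"
  using assms unfolding good_def by blast

text \<open>The bound on the ranks is the number of conjunctions in the pool, which therefore is the
  free rank for the next conjunction.\<close>

definition certified :: "cirquent \<Rightarrow> bool" where
  "certified C \<longleftrightarrow> (\<exists>\<sigma> D P Bs. map (erase \<sigma>) P = snd C \<and> certificate D P Bs (rank_count P) \<and>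
     list_all2 (good P) (fst C) Bs)"

lemma certifiedI:
  "map (erase \<sigma>) P = Q \<Longrightarrow> certificate D P Bs (rank_count P) \<Longrightarrow> list_all2 (good P) S Bs \<Longrightarrow> certified (S, Q)"
  unfolding certified_def by auto

lemma certifiedE:
  assumes "certified (S, Q)"
  obtains \<sigma> D P Bs where "map (erase \<sigma>) P = Q" "certificate D P Bs (rank_count P)" "list_all2 (good P) S Bs"
  using assms unfolding certified_def by auto

section \<open>The certified cirquents are closed under the rules\<close>

lemma touches_mixl: "touches ((\<lambda>l. 2 * l) ` \<beta>) (mixl x) = touches \<beta> x"
  "\<not> touches ((\<lambda>l. Suc (2 * l)) ` \<beta>) (mixl x)"
  by (simp_all add: mixl_def touches_relabel inj_mix) (auto simp: touches_def labs_relabel, presburger)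

lemma touches_mixr: "touches ((\<lambda>l. Suc (2 * l)) ` \<beta>) (mixr R x) = touches \<beta> x"
  "\<not> touches ((\<lambda>l. 2 * l) ` \<beta>) (mixr R x)"
  by (simp_all add: mixr_def touches_relabel inj_mix) (auto simp: touches_def labs_relabel, presburger)

lemma arcs_False: "arcs (\<lambda>_. False) P = {}"
  by (simp add: arcs_def)

lemma good_mixl:
  assumes "good P \<Gamma> \<beta>"
  shows "good (map mixl P @ map (mixr R) Q) \<Gamma> ((\<lambda>l. 2 * l) ` \<beta>)"
proof -
  have "arcs (touches ((\<lambda>l. 2 * l) ` \<beta>)) (map mixl P @ map (mixr R) Q) = arcs (touches \<beta>) P"
    by (simp add: arcs_append arcs_map touches_mixl touches_mixr arcs_False)
  moreover have "arcs (holds (\<lambda>l. v (2 * l))) P \<subseteq> arcs (holds v) (map mixl P @ map (mixr R) Q)" for v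
    by (simp add: arcs_append arcs_map) (simp add: mixl_def holds_relabel)
  ultimately show ?thesis using assms unfolding good_def by blast
qed

lemma good_mixr:
  assumes "good Q \<Gamma> \<beta>"
  shows "good (map mixl P @ map (mixr R) Q) ((\<lambda>i. length P + i) ` \<Gamma>) ((\<lambda>l. Suc (2 * l)) ` \<beta>)"
proof -
  have "arcs (touches ((\<lambda>l. Suc (2 * l)) ` \<beta>)) (map mixl P @ map (mixr R) Q) = (\<lambda>i. length P + i) ` arcs (touches \<beta>) Q"
    by (simp add: arcs_append arcs_map touches_mixl touches_mixr arcs_False)
  moreover have "(\<lambda>i. length P + i) ` arcs (holds (\<lambda>l. v (Suc (2 * l)))) Q \<subseteq> arcs (holds v) (map mixl P @ map (mixr R) Q)" for v
    by (simp add: arcs_append arcs_map) (simp add: mixr_def holds_relabel)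
  ultimately show ?thesis using assms unfolding good_def by blast
qed

lemma certified_mix:
  assumes "certified (S, P)" "certified (T, Q)"
  shows "certified (S @ map (image (\<lambda>i. length P + i)) T, P @ Q)"
proof -
  obtain \<sigma> D P' Bs where P: "map (erase \<sigma>) P' = P" "certificate D P' Bs (rank_count P')" "list_all2 (good P') S Bs"
    by (rule certifiedE[OF assms(1)])
  obtain \<tau> E Q' Cs where Q: "map (erase \<tau>) Q' = Q" "certificate E Q' Cs (rank_count Q')" "list_all2 (good Q') T Cs"
    by (rule certifiedE[OF assms(2)])
  let ?R = "rank_count P'"
  let ?\<rho> = "\<lambda>l. if even l then \<sigma> (l div 2) else \<tau> (l div 2)"
  have len: "length P = length P'" using P(1) by auto
  show ?thesis
  proof (rule certifiedI)
    show "map (erase ?\<rho>) (map mixl P' @ map (mixr ?R) Q') = P @ Q"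
      using P(1) Q(1) by (auto simp: mixl_def mixr_def erase_relabel[of _ _ \<sigma>] erase_relabel[of _ _ \<tau>])
    show "certificate (mixD ?R D E) (map mixl P' @ map (mixr ?R) Q')
        (map (image (\<lambda>l. 2 * l)) Bs @ map (image (\<lambda>l. Suc (2 * l))) Cs) (rank_count (map mixl P' @ map (mixr ?R) Q'))"
      using certificate_mix[OF P(2) Q(2)] by simp
    show "list_all2 (good (map mixl P' @ map (mixr ?R) Q')) (S @ map (image (\<lambda>i. length P + i)) T)
        (map (image (\<lambda>l. 2 * l)) Bs @ map (image (\<lambda>l. Suc (2 * l))) Cs)"
      by (rule list_all2_appendI)
        (use P(3) Q(3) in \<open>auto simp: list_all2_map1 list_all2_map2 len elim!: list_all2_mono intro!: good_mixl good_mixr\<close>)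
  qed
qed

lemma rank_count_perm: "mset P = mset Q \<Longrightarrow> rank_count P = rank_count Q"
proof -
  assume "mset P = mset Q"
  moreover have "rank_count P = (\<Sum>x\<in>#mset P. length (ranks x))" for P by (induction P) simp_all
  ultimately show ?thesis by simp
qed

lemma certified_exchange:
  assumes "certified (S, P @ [F, G] @ Q)"
  shows "certified (map (image (transpose (length P) (Suc (length P)))) S, P @ [G, F] @ Q)"
proof -
  obtain \<sigma> D X Bs where X: "map (erase \<sigma>) X = P @ [F, G] @ Q" "certificate D X Bs (rank_count X)" "list_all2 (good X) S Bs"
    by (rule certifiedE[OF assms])
  obtain P' a b Q' where P': "X = P' @ [a, b] @ Q'" "map (erase \<sigma>) P' = P" "erase \<sigma> a = F" "erase \<sigma> b = G"
    "map (erase \<sigma>) Q' = Q" using X(1) by (auto simp: map_eq_append_conv Cons_eq_append_conv)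
  have perm: "mset X = mset (P' @ [b, a] @ Q')" by (simp add: P'(1))
  have len: "length P = length P'" using P' by auto
  show ?thesis
  proof (rule certifiedI)
    show "map (erase \<sigma>) (P' @ [b, a] @ Q') = P @ [G, F] @ Q" using P' by simp
    show "certificate D (P' @ [b, a] @ Q') Bs (rank_count (P' @ [b, a] @ Q'))"
      using certificate_perm[OF perm X(2)] rank_count_perm[OF perm] by simp
    show "list_all2 (good (P' @ [b, a] @ Q')) (map (image (transpose (length P) (Suc (length P)))) S) Bs"
      unfolding list_all2_map1 len using X(3)
      by (rule list_all2_mono) (rule good_image, assumption, unfold P'(1) arcs_swap, (rule order_refl)+)
  qed
qed

lemma certified_weaken:
  assumes "certified (S @ [\<Gamma>] @ T, P)"
  shows "certified (S @ [insert i \<Gamma>] @ T, P)"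
proof -
  obtain \<sigma> D X Bs where X: "map (erase \<sigma>) X = P" "certificate D X Bs (rank_count X)" "list_all2 (good X) (S @ [\<Gamma>] @ T) Bs"
    by (rule certifiedE[OF assms])
  have "good X (insert i \<Gamma>) \<beta>" if "good X \<Gamma> \<beta>" for \<beta> using that by (auto simp: good_def)
  moreover obtain B1 \<beta> B2 where "Bs = B1 @ [\<beta>] @ B2" "list_all2 (good X) S B1" "good X \<Gamma> \<beta>"
    "list_all2 (good X) T B2" using X(3) by (auto simp: list_all2_append1 list_all2_Cons1)
  ultimately have "list_all2 (good X) (S @ [insert i \<Gamma>] @ T) Bs"
    by (auto intro!: list_all2_appendI)
  then show ?thesis by (rule certifiedI[OF X(1,2)])
qed

lemma rank_count_relabel: "rank_count (map (relabel f g) P) = rank_count P"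
  by (induction P) (simp_all add: ranks_relabel)

text \<open>The new formula, certified without blocks, is mixed in on the right and then permuted to
  its place.\<close>

lemma certified_insert_formula:
  assumes "certified (S, P @ Q)"
  shows "certified (map (image (shift_from (length P))) S, P @ [F] @ Q)"
proof -
  obtain \<sigma> D X Bs where X: "map (erase \<sigma>) X = P @ Q" "certificate D X Bs (rank_count X)" "list_all2 (good X) S Bs"
    by (rule certifiedE[OF assms])
  obtain P' Q' where P': "X = P' @ Q'" "map (erase \<sigma>) P' = P" "map (erase \<sigma>) Q' = Q"
    using X(1) by (auto simp: map_eq_append_conv)
  obtain \<tau> x where x: "erase \<tau> x = F" "certificate (\<lambda>_ _. 0) [x] [] (length (ranks x))"
    using certificate_labelled by blast
  let ?R = "rank_count X"
  let ?\<rho> = "\<lambda>l. if even l then \<sigma> (l div 2) else \<tau> (l div 2)"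
  let ?Y = "map mixl P' @ [mixr ?R x] @ map mixl Q'"
  have perm: "mset (map mixl X @ map (mixr ?R) [x]) = mset ?Y" by (simp add: P'(1))
  have len: "length P = length (map mixl P')" using P' by auto
  have X': "map mixl P' @ map mixl Q' = map mixl X" by (simp add: P'(1))
  show ?thesis
  proof (rule certifiedI)
    show "map (erase ?\<rho>) ?Y = P @ [F] @ Q"
      using P' x(1) by (auto simp: mixl_def mixr_def erase_relabel[of _ _ \<sigma>] erase_relabel[of _ _ \<tau>])
    show "certificate (mixD ?R D (\<lambda>_ _. 0)) ?Y (map (image (\<lambda>l. 2 * l)) Bs) (rank_count ?Y)"
      using certificate_perm[OF perm certificate_mix[OF X(2) x(2)]]
      by (simp add: P'(1) mixl_def mixr_def ranks_relabel rank_count_relabel ac_simps)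
    have "good ?Y (shift_from (length P) ` \<Gamma>) ((\<lambda>l. 2 * l) ` \<beta>)" if "good X \<Gamma> \<beta>" for \<Gamma> \<beta>
    proof -
      have "arcs (touches ((\<lambda>l. 2 * l) ` \<beta>)) ?Y = shift_from (length P) ` arcs (touches \<beta>) X"
        unfolding arcs_insert len X' arcs_map by (simp add: touches_mixl touches_mixr)
      moreover have "shift_from (length P) ` arcs (holds (\<lambda>l. v (2 * l))) X \<subseteq> arcs (holds v) ?Y" for v
        unfolding arcs_insert len X' arcs_map by (auto simp: mixl_def holds_relabel)
      ultimately show ?thesis using that unfolding good_def by blast
    qed
    then show "list_all2 (good ?Y) (map (image (shift_from (length P))) S) (map (image (\<lambda>l. 2 * l)) Bs)"
      unfolding list_all2_map1 list_all2_map2 using X(3) by (auto elim!: list_all2_mono)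
  qed
qed

lemma certified_disj:
  assumes "certified (S, P @ [F, G] @ Q)"
  shows "certified (map (image (collapse (length P))) S, P @ [Disj F G] @ Q)"
proof -
  obtain \<sigma> D X Bs where X: "map (erase \<sigma>) X = P @ [F, G] @ Q" "certificate D X Bs (rank_count X)" "list_all2 (good X) S Bs"
    by (rule certifiedE[OF assms])
  obtain P' a b Q' where P': "X = P' @ [a, b] @ Q'" "map (erase \<sigma>) P' = P" "erase \<sigma> a = F" "erase \<sigma> b = G"
    "map (erase \<sigma>) Q' = Q" using X(1) by (auto simp: map_eq_append_conv Cons_eq_append_conv)
  have len: "length P = length P'" using P' by auto
  let ?Y = "P' @ [LDisj a b] @ Q'"
  have occ: "(\<exists>x \<in> set X. l \<in> set (posl x)) \<longleftrightarrow> (\<exists>x \<in> set ?Y. l \<in> set (posl x))"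
    "(\<exists>x \<in> set X. l \<in> set (negl x)) \<longleftrightarrow> (\<exists>x \<in> set ?Y. l \<in> set (negl x))" for l
    by (auto simp: P'(1))
  have flat: "concat (map posl X) = concat (map posl ?Y)" "concat (map negl X) = concat (map negl ?Y)"
    "concat (map ranks X) = concat (map ranks ?Y)" by (simp_all add: P'(1))
  show ?thesis
  proof (rule certifiedI)
    show "map (erase \<sigma>) ?Y = P @ [Disj F G] @ Q" using P' by simp
    have "\<forall>x \<in> set ?Y. heap x \<and> (\<forall>r \<in> set (ranks x). r < rank_count X) \<and> follows D (\<Union> (set Bs)) x"
      using X(2) unfolding certificate_def P'(1) by auto
    then show "certificate D ?Y Bs (rank_count ?Y)"
      using X(2) unfolding certificate_def block_def rank_count_def occ flat by blast
    have d: "touches \<beta> (LDisj a b) \<longleftrightarrow> touches \<beta> a \<or> touches \<beta> b" for \<beta> by (auto simp: touches_def)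
    show "list_all2 (good ?Y) (map (image (collapse (length P))) S) Bs"
      unfolding list_all2_map1 len using X(3)
      by (rule list_all2_mono) (rule good_image, assumption, unfold P'(1),
        subst arcs_collapse[of "touches _" "LDisj a b"], rule d, rule order_refl, subst arcs_collapse[of "holds _" "LDisj a b"], simp, rule order_refl)
  qed
qed

lemma block_index_unique:
  assumes "sorted_wrt (\<lambda>\<beta> \<gamma>. \<beta> \<inter> \<gamma> = {}) Bs" "i < length Bs" "j < length Bs" "l \<in> Bs ! i" "l \<in> Bs ! j"
  shows "i = j"
proof (rule ccontr)
  assume "i \<noteq> j"
  then have "Bs ! i \<inter> Bs ! j = {}"
    using assms(1-3) sorted_wrt_nth_less[OF assms(1), of i j] sorted_wrt_nth_less[OF assms(1), of j i]
    by (metis Int_commute linorder_neqE_nat)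
  then show False using assms(4,5) by blast
qed

lemma arcs_collapse_other:
  assumes "i \<in> arcs g (P @ [a, b] @ Q)" "i \<noteq> length P" "i \<noteq> Suc (length P)"
  shows "collapse (length P) i \<in> arcs g (P @ [c] @ Q)"
proof -
  consider "i < length P" | k where "i = Suc (Suc (length P + k))"
    using assms(2,3) by (metis Suc_lessI add_Suc_right less_imp_Suc_add linorder_neqE_nat)
  then show ?thesis using assms(1) by cases (auto simp: arcs_def collapse_def nth_append)
qed

text \<open>The new conjunction is the first to be split from below, so it gets the highest rank
  \<open>R\<close>. At this rank the axioms above an ogroup with the left conjunct get the value
  \<open>1\<close>, those above an ogroup with the right conjunct the value \<open>2\<close>, and
  all others \<open>0\<close>.\<close>

lemma certified_conj:
  assumes C: "certified (S, P @ [F, G] @ Q)" and paired: "paired (length P) S"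
  shows "certified (map (image (collapse (length P))) (merge_ogroups (length P) S), P @ [Conj F G] @ Q)"
proof -
  obtain \<sigma> D X Bs where X: "map (erase \<sigma>) X = P @ [F, G] @ Q" "certificate D X Bs (rank_count X)" "list_all2 (good X) S Bs"
    by (rule certifiedE[OF C])
  obtain P' a b Q' where P': "X = P' @ [a, b] @ Q'" "map (erase \<sigma>) P' = P" "erase \<sigma> a = F" "erase \<sigma> b = G"
    "map (erase \<sigma>) Q' = Q" using X(1) by (auto simp: map_eq_append_conv Cons_eq_append_conv)
  define n where "n = length P"
  define R where "R = rank_count X"
  define c where "c = LConj R a b"
  define Y where "Y = P' @ [c] @ Q'"
  have len: "length P' = n" using P' by (auto simp: n_def)
  have lenS: "length S = length Bs" using X(3) by (rule list_all2_lengthD)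
  have dis: "sorted_wrt (\<lambda>\<beta> \<gamma>. \<beta> \<inter> \<gamma> = {}) Bs" using X(2) by (simp add: certificate_def)
  define half where "half l = (if \<exists>i < length S. l \<in> Bs ! i \<and> n \<in> S ! i then 1
     else if \<exists>i < length S. l \<in> Bs ! i \<and> Suc n \<in> S ! i then 2 else 0 :: nat)" for l
  define D' where "D' l r = (if r = R then half l else D l r)" for l r
  have half: "half l = (if n \<in> S ! i then 1 else if Suc n \<in> S ! i then 2 else 0)"
    if "i < length S" "l \<in> Bs ! i" for i l
  proof -
    have u: "\<And>j. j < length S \<Longrightarrow> l \<in> Bs ! j \<Longrightarrow> j = i"
      using block_index_unique[OF dis] that lenS by metis
    then have "(\<exists>j < length S. l \<in> Bs ! j \<and> k \<in> S ! j) \<longleftrightarrow> k \<in> S ! i" for k using that by blast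
    then show ?thesis by (simp add: half_def)
  qed
  have both: "\<not> (n \<in> S ! i \<and> Suc n \<in> S ! i)" if "i < length S" for i
    using pairedD[OF paired] that by (simp add: n_def)
  have good_i: "good X (S ! i) (Bs ! i)" if "i < length S" for i
    using X(3) that by (simp add: list_all2_conv_all_nth)
  have Xn: "n < length X" "X ! n = a" "Suc n < length X" "X ! Suc n = b"
    using len by (auto simp: P'(1) nth_append)
  \<comment> \<open>By the arc condition of \<open>good\<close>, the ogroup of an axiom that occurs
    in a conjunct contains this conjunct, and by the side condition of the rule it does not contain
    the other one.\<close>
  have ab: "l \<in> labs a \<Longrightarrow> half l = 1" "l \<in> labs b \<Longrightarrow> half l = 2" if l: "l \<in> \<Union> (set Bs)" for l
  proof -
    obtain i where i: "i < length S" "l \<in> Bs ! i" using l lenS by (auto simp: in_set_conv_nth)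
    have sub: "arcs (touches (Bs ! i)) X \<subseteq> S ! i" using good_i[OF i(1)] by (simp add: good_def)
    { assume "l \<in> labs a"
      then have "n \<in> S ! i" using sub i(2) Xn by (auto simp: arcs_def touches_def)
      then show "half l = 1" using half[OF i] by simp }
    { assume "l \<in> labs b"
      then have "Suc n \<in> S ! i" using sub i(2) Xn by (auto simp: arcs_def touches_def)
      then show "half l = 2" using half[OF i] both[OF i(1)] by auto }
  qed
  define Cs where "Cs = merge_blocks n S Bs"
  have Cs: "\<Union> (set Cs) = \<Union> (set Bs)" "sorted_wrt (\<lambda>\<beta> \<gamma>. \<beta> \<inter> \<gamma> = {}) Cs"
    using merge_blocks_Union merge_blocks_disjoint[OF dis] by (auto simp: Cs_def)
  have occ: "(\<exists>x \<in> set X. l \<in> set (posl x)) \<longleftrightarrow> (\<exists>x \<in> set Y. l \<in> set (posl x))"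
    "(\<exists>x \<in> set X. l \<in> set (negl x)) \<longleftrightarrow> (\<exists>x \<in> set Y. l \<in> set (negl x))" for l
    by (auto simp: P'(1) Y_def c_def)
  have Yn: "n < length Y" "Y ! n = c" using len by (auto simp: Y_def nth_append)
  have arcsY: "collapse n ` arcs (touches \<beta>) X = arcs (touches \<beta>) Y" for \<beta>
    unfolding P'(1) Y_def len[symmetric] by (rule arcs_collapse) (auto simp: touches_def c_def)
  have other: "collapse n i \<in> arcs g Y" if "i \<in> arcs g X" "i \<noteq> n" "i \<noteq> Suc n" for g i
    using that unfolding P'(1) Y_def len[symmetric] by (rule arcs_collapse_other)
  define q where "q \<Gamma> \<beta> \<longleftrightarrow> good X \<Gamma> \<beta> \<and> block D X R \<beta> \<and>
     (\<forall>l \<in> \<beta>. half l = (if n \<in> \<Gamma> then 1 else if Suc n \<in> \<Gamma> then 2 else 0))" for \<Gamma> \<beta>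
  define q' where "q' \<Gamma> \<beta> \<longleftrightarrow> good Y (collapse n ` \<Gamma>) \<beta> \<and> block D' Y (Suc R) \<beta>" for \<Gamma> \<beta>
  have qS: "list_all2 q S Bs"
    using X(2,3) half lenS by (auto simp: list_all2_conv_all_nth q_def certificate_def R_def)
  have single: "q' \<Gamma> \<beta>" if q: "q \<Gamma> \<beta>" and n: "n \<notin> \<Gamma>" "Suc n \<notin> \<Gamma>" for \<Gamma> \<beta>
  proof -
    have g: "good X \<Gamma> \<beta>" "block D X R \<beta>" "\<And>l. l \<in> \<beta> \<Longrightarrow> half l = 0" using q n by (auto simp: q_def)
    have "arcs (touches \<beta>) Y \<subseteq> collapse n ` \<Gamma>"
      using g(1) unfolding arcsY[symmetric] good_def by blast
    moreover have "collapse n ` \<Gamma> \<inter> arcs (holds v) Y \<noteq> {}" for v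
    proof -
      obtain i where "i \<in> \<Gamma>" "i \<in> arcs (holds v) X" using g(1) by (auto simp: good_def)
      moreover then have "i \<noteq> n" "i \<noteq> Suc n" using n by auto
      ultimately show ?thesis using other by blast
    qed
    moreover have "split_closed D' (Suc R) \<beta>"
    proof -
      have "split_closed D R \<beta>" using g(2) by (simp add: block_def)
      then show ?thesis using g(3) unfolding split_closed_def D'_def
        by (auto simp: less_Suc_eq) (metis+)?
    qed
    ultimately show ?thesis using g(2) unfolding q'_def good_def block_def occ by blast
  qed
  have pair: "q' (\<Gamma> \<union> \<Delta>) (\<beta> \<union> \<gamma>)"
    if q: "q \<Gamma> \<beta>" "q \<Delta> \<gamma>" and n: "n \<in> \<Gamma>" "Suc n \<notin> \<Gamma>" "n \<notin> \<Delta>" "Suc n \<in> \<Delta>" for \<Gamma> \<Delta> \<beta> \<gamma>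
  proof -
    have g: "good X \<Gamma> \<beta>" "block D X R \<beta>" "\<And>l. l \<in> \<beta> \<Longrightarrow> half l = 1"
      and h: "good X \<Delta> \<gamma>" "block D X R \<gamma>" "\<And>l. l \<in> \<gamma> \<Longrightarrow> half l = 2" using q n by (auto simp: q_def)
    have "arcs (touches (\<beta> \<union> \<gamma>)) Y \<subseteq> collapse n ` (\<Gamma> \<union> \<Delta>)"
    proof -
      have "arcs (touches (\<beta> \<union> \<gamma>)) X = arcs (touches \<beta>) X \<union> arcs (touches \<gamma>) X"
        by (auto simp: arcs_def touches_def)
      then show ?thesis using g(1) h(1) unfolding arcsY[symmetric] good_def by blast
    qed
    \<comment> \<open>Under \<open>v\<close>, both merged ogroups have a true entry. If these are
      the two conjuncts, then the conjunction is true; otherwise a true entry other than the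
      conjuncts survives the merging.\<close>
    moreover have "collapse n ` (\<Gamma> \<union> \<Delta>) \<inter> arcs (holds v) Y \<noteq> {}" for v
    proof -
      obtain i j where ij: "i \<in> \<Gamma>" "i \<in> arcs (holds v) X" "j \<in> \<Delta>" "j \<in> arcs (holds v) X"
        using g(1) h(1) unfolding good_def by blast
      show ?thesis
      proof (cases "i = n \<and> j = Suc n")
        case True
        then have "holds v c" using ij Xn by (auto simp: arcs_def c_def)
        then have "n \<in> arcs (holds v) Y" using Yn by (simp add: arcs_def)
        moreover have "collapse n n = n" by (simp add: collapse_def)
        ultimately show ?thesis using n(1) by (metis IntI UnI1 empty_iff image_eqI)
      next
        case False
        then have "(i \<noteq> n \<and> i \<noteq> Suc n) \<or> (j \<noteq> n \<and> j \<noteq> Suc n)" using ij n by auto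
        then show ?thesis using ij other by blast
      qed
    qed
    moreover have "split_closed D' (Suc R) (\<beta> \<union> \<gamma>)"
    proof -
      \<comment> \<open>Below \<open>R\<close> every old block provides the required counterparts as
        before. The axioms of one old block have the same value at \<open>R\<close>, so the
        agreement extends to this rank.\<close>
      have *: "(\<forall>l \<in> \<delta>. \<forall>r < R. (D' l r = 1 \<longrightarrow> (\<exists>k \<in> \<delta>. (\<forall>s. r < s \<and> s < Suc R \<longrightarrow> D' k s = D' l s) \<and> D' k r = 2)) \<and>
          (D' l r = 2 \<longrightarrow> (\<exists>k \<in> \<delta>. (\<forall>s. r < s \<and> s < Suc R \<longrightarrow> D' k s = D' l s) \<and> D' k r = 1)))"
        if "split_closed D R \<delta>" "\<forall>l \<in> \<delta>. half l = j" for \<delta> j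
        using that unfolding split_closed_def D'_def by (auto simp: less_Suc_eq) (metis+)?
      have ne: "split_closed D R \<beta>" "split_closed D R \<gamma>" "\<beta> \<noteq> {}" "\<gamma> \<noteq> {}" using g(2) h(2) by (auto simp: block_def)
      have "\<forall>l \<in> \<beta>. half l = 1" "\<forall>l \<in> \<gamma>. half l = 2" using g(3) h(3) by auto
      note s = *[OF ne(1) this(1)] *[OF ne(2) this(2)] ne(3,4)
      show ?thesis unfolding split_closed_def
      proof (intro ballI allI impI)
        fix l r assume l: "l \<in> \<beta> \<union> \<gamma>" and r: "r < Suc R"
        show "(D' l r = 1 \<longrightarrow> (\<exists>k \<in> \<beta> \<union> \<gamma>. (\<forall>s. r < s \<and> s < Suc R \<longrightarrow> D' k s = D' l s) \<and> D' k r = 2)) \<and>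
          (D' l r = 2 \<longrightarrow> (\<exists>k \<in> \<beta> \<union> \<gamma>. (\<forall>s. r < s \<and> s < Suc R \<longrightarrow> D' k s = D' l s) \<and> D' k r = 1))"
        proof (cases "r = R")
          \<comment> \<open>At the new rank, each half is the counterpart of the other: both old
            blocks are nonempty, and there is no rank above \<open>R\<close> at which agreement
            would be required.\<close>
          case True
          obtain j k where "j \<in> \<beta>" "k \<in> \<gamma>" using s(3,4) by auto
          then show ?thesis using True g(3) h(3) by (auto simp: D'_def)
        next
          case False
          then have "r < R" using r by simp
          from l show ?thesis
          proof
            assume "l \<in> \<beta>"
            from s(1)[THEN bspec, OF this, THEN spec, THEN mp, OF \<open>r < R\<close>]
            show ?thesis by blast
          next
            assume "l \<in> \<gamma>"
            from s(2)[THEN bspec, OF this, THEN spec, THEN mp, OF \<open>r < R\<close>]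
            show ?thesis by blast
          qed
        qed
      qed
    qed
    ultimately show ?thesis using g(2) h(2) unfolding q'_def good_def block_def occ by blast
  qed
  have q': "list_all2 q' (merge_ogroups n S) Cs"
    unfolding Cs_def by (rule merge_blocks_list_all2[of q, OF qS paired[folded n_def] _ _ dis])
      (erule single pair; assumption)+
  show ?thesis
  proof (rule certifiedI)
    show "map (erase \<sigma>) Y = P @ [Conj F G] @ Q" using P' by (simp add: Y_def c_def)
    have RY: "rank_count Y = Suc R" by (simp add: Y_def c_def R_def P'(1))
    have flat: "concat (map posl X) = concat (map posl Y)" "concat (map negl X) = concat (map negl Y)"
      by (simp_all add: P'(1) Y_def c_def)
    have "R \<notin> set (ranks x)" if "x \<in> set X" for x
      using X(2) that by (auto simp: certificate_def R_def)
    then have "distinct (concat (map ranks Y))"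
      using X(2) unfolding certificate_def P'(1) Y_def c_def by auto
    moreover have "heap x \<and> (\<forall>r \<in> set (ranks x). r < Suc R) \<and> follows D' (\<Union> (set Cs)) x" if "x \<in> set Y" for x
    proof -
      have old: "heap x \<and> (\<forall>r \<in> set (ranks x). r < R) \<and> follows D' (\<Union> (set Cs)) x" if "x \<in> set X" for x
      proof -
        have x: "heap x" "\<forall>r \<in> set (ranks x). r < R" "follows D (\<Union> (set Bs)) x"
          using X(2) that by (auto simp: certificate_def R_def)
        moreover have "D' l r = D l r" if "r \<in> set (ranks x)" for l r using x(2) that by (auto simp: D'_def)
        ultimately show ?thesis using follows_cong[of x D' D] Cs(1) by simp
      qed
      have "a \<in> set X" "b \<in> set X" by (auto simp: P'(1))
      then have "heap c \<and> (\<forall>r \<in> set (ranks c). r < Suc R) \<and> follows D' (\<Union> (set Cs)) c"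
        using old[of a] old[of b] ab Cs(1) by (auto simp: c_def D'_def less_Suc_eq)
      moreover have "x = c \<or> x \<in> set X" using that by (auto simp: Y_def P'(1))
      ultimately show ?thesis using old[of x] by (auto simp: less_Suc_eq)
    qed
    moreover have "block D' Y (Suc R) \<beta>" if "\<beta> \<in> set Cs" for \<beta>
      using q' that unfolding list_all2_conv_all_nth q'_def by (metis in_set_conv_nth)
    ultimately show "certificate D' Y Cs (rank_count Y)"
      using X(2) Cs(2) unfolding certificate_def flat RY by blast
    show "list_all2 (good Y) (map (image (collapse (length P))) (merge_ogroups (length P) S)) Cs"
      unfolding list_all2_map1 n_def[symmetric] using q' by (rule list_all2_mono) (simp add: q'_def)
  qed
qed

lemma certified_ogroup_exchange:
  assumes "certified (S @ [\<Gamma>, \<Delta>] @ T, P)"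
  shows "certified (S @ [\<Delta>, \<Gamma>] @ T, P)"
proof -
  obtain \<sigma> D X Bs where X: "map (erase \<sigma>) X = P" "certificate D X Bs (rank_count X)" "list_all2 (good X) (S @ [\<Gamma>, \<Delta>] @ T) Bs"
    by (rule certifiedE[OF assms])
  obtain B1 \<beta> \<gamma> B2 where B: "Bs = B1 @ [\<beta>, \<gamma>] @ B2" "list_all2 (good X) S B1" "good X \<Gamma> \<beta>" "good X \<Delta> \<gamma>" "list_all2 (good X) T B2"
    using X(3) by (auto simp: list_all2_append1 list_all2_Cons1)
  let ?Bs = "B1 @ [\<gamma>, \<beta>] @ B2"
  have "set ?Bs = set Bs" by (auto simp: B(1))
  moreover have "sorted_wrt (\<lambda>\<beta> \<gamma>. \<beta> \<inter> \<gamma> = {}) ?Bs"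
    using X(2) unfolding certificate_def B(1) by (auto simp: sorted_wrt_append)
  ultimately have "certificate D X ?Bs (rank_count X)" using X(2) unfolding certificate_def by simp
  moreover have "list_all2 (good X) (S @ [\<Delta>, \<Gamma>] @ T) ?Bs" using B by (auto intro!: list_all2_appendI)
  ultimately show ?thesis by (rule certifiedI[OF X(1)])
qed

interpretation certified: calculus certified
proof
  show "certified ([], [])"
    by (rule certifiedI[of undefined "[]" _ undefined "[]"]) (auto simp: certificate_def)
next
  fix a
  have "block (\<lambda>_ _. 0) [LNeg 0, LAtom 0] 0 {0}" by (simp add: block_def split_closed_def)
  then show "certified ([{0, 1}], [NegAtom a, Atom a])"
    by (intro certifiedI[of "\<lambda>_. a" "[LNeg 0, LAtom 0]" _ "\<lambda>_ _. 0" "[{0}]"])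
      (auto simp: certificate_def good_def arcs_Cons)
qed (rule certified_mix certified_exchange certified_weaken certified_insert_formula certified_disj certified_conj, assumption+)+

text \<open>The certificate serves membership in NP; truth under all valuations of labels serves
  hardness.\<close>

theorem provable_certificate:
  assumes "CL5m_provable F"
  obtains \<sigma> D x L where "erase \<sigma> x = F" "certificate D [x] [L] (length (ranks x))" "\<And>v. holds v x"
proof -
  have "certified ([{0}], [F])"
    using certified.contains_CL5m[OF certified_ogroup_exchange] assms by (simp add: CL5m_provable_def)
  then obtain \<sigma> D P Bs where P: "map (erase \<sigma>) P = [F]" "certificate D P Bs (rank_count P)" "list_all2 (good P) [{0}] Bs"
    by (rule certifiedE)
  then obtain x L where x: "P = [x]" "Bs = [L]" by (auto simp: list_all2_Cons1)
  have "holds v x" for v using P(3) by (auto simp: x good_def arcs_Cons split: if_splits)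
  then show ?thesis using that P x by auto
qed

section \<open>Membership in NP\<close>

lemma binary_simps: "n < 2 \<Longrightarrow> binary n = [n]" "2 \<le> n \<Longrightarrow> binary n = binary (n div 2) @ [n mod 2]"
  by (subst binary.simps, simp)+

lemma binary_not_Nil: "binary n \<noteq> []"
  by (subst binary.simps) simp

lemma binary_digits: "d \<in> set (binary n) \<Longrightarrow> d = 0 \<or> d = 1"
  by (induction n rule: binary.induct) (metis (no_types, lifting) binary_simps One_nat_def Un_iff empty_iff
    less_2_cases list.set(1,2) not_less set_append insert_iff mod_less_divisor pos2)

lemma binary_leading: "hd (binary n) = 1 \<or> length (binary n) = 1"
proof (induction n rule: binary.induct)
  case (1 n)
  show ?case
  proof (cases "n < 2")
    case False
    then have n: "binary n = binary (n div 2) @ [n mod 2]" by (simp add: binary_simps)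
    have "hd (binary (n div 2)) = 1"
    proof (cases "n div 2 < 2")
      case True
      then have "n div 2 = 1" using False by linarith
      then show ?thesis by (simp add: binary_simps)
    next
      case ge: False
      then have "binary (n div 2) = binary (n div 2 div 2) @ [n div 2 mod 2]" by (simp add: binary_simps)
      then have "length (binary (n div 2)) \<noteq> 1" using binary_not_Nil[of "n div 2 div 2"] by simp
      then show ?thesis using 1 False by blast
    qed
    then show ?thesis using n binary_not_Nil[of "n div 2"] by simp
  qed (simp add: binary_simps)
qed

text \<open>Absence of a leading zero, except in a single digit, characterises the numerals. So
  names of atoms can be recognised letter by letter, and no number has to be evaluated.\<close>

lemma ex_binary:
  "ds \<noteq> [] \<Longrightarrow> \<forall>d \<in> set ds. d = 0 \<or> d = 1 \<Longrightarrow> hd ds = 1 \<or> length ds = 1 \<Longrightarrow> \<exists>a. binary a = ds"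
proof (induction ds rule: rev_induct)
  case (snoc d ds)
  show ?case
  proof (cases "ds = []")
    case True
    then show ?thesis using snoc.prems by (intro exI[of _ d]) (auto simp: binary_simps)
  next
    case False
    then have "hd ds = 1" using snoc.prems by auto
    moreover then obtain a where a: "binary a = ds" using snoc False by auto
    moreover have "hd (binary 0) = 0" by (simp add: binary_simps)
    ultimately have "a \<noteq> 0" by (metis zero_neq_one)
    then have "binary (2 * a + d) = binary ((2 * a + d) div 2) @ [(2 * a + d) mod 2]"
      by (intro binary_simps) simp
    moreover have "(2 * a + d) div 2 = a" "(2 * a + d) mod 2 = d" using snoc.prems(2) by auto
    ultimately show ?thesis using a by metis
  qed
qed simp

lemma encode_letters: "encode F \<in> lists {..<6}"
proof -
  have "binary a \<in> lists {..<6}" for a using binary_digits[of _ a] by fastforce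
  then show ?thesis by (induction F) auto
qed

definition slice :: "nat list \<Rightarrow> nat \<Rightarrow> nat \<Rightarrow> nat list" where
  "slice x p e = take (e - p) (drop p x)"

lemma slice_Cons: "p < e \<Longrightarrow> e \<le> length x \<Longrightarrow> slice x p e = x ! p # slice x (Suc p) e"
  by (simp add: slice_def Cons_nth_drop_Suc[symmetric] take_Cons')

lemma slice_append: "p \<le> q \<Longrightarrow> q \<le> e \<Longrightarrow> slice x p e = slice x p q @ slice x q e"
proof -
  assume "p \<le> q" "q \<le> e"
  then have "e - p = (q - p) + (e - q)" "drop q x = drop (q - p) (drop p x)" by simp_all
  then show ?thesis unfolding slice_def by (metis take_add)
qed

lemma nth_slice: "e \<le> length x \<Longrightarrow> i < e - p \<Longrightarrow> slice x p e ! i = x ! (p + i)"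
  by (simp add: slice_def)

lemma length_slice: "e \<le> length x \<Longrightarrow> length (slice x p e) = e - p"
  by (simp add: slice_def)

text \<open>
  A certificate for the provability of the formula \<open>x\<close> consists of five binary relations on the
  positions in \<open>x\<close>: \<open>Y 0 p e\<close> says that a subformula extends from \<open>p\<close> to \<open>e\<close> (exclusively),
  \<open>Y 1 r u\<close> that the conjunction at \<open>u\<close> has rank \<open>r\<close>, \<open>Y 2 p q\<close> that the literals at \<open>p\<close> and \<open>q\<close>
  form an identity axiom; this axiom is named \<open>p\<close>, and \<open>Y 3\<close> and \<open>Y 4\<close> tell its half.
  \<open>A i a\<close> says that \<open>a\<close> is the letter at \<open>i\<close>.
\<close>

definition number :: "(nat \<Rightarrow> nat \<Rightarrow> bool) \<Rightarrow> nat \<Rightarrow> nat \<Rightarrow> bool" where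
  "number A s e \<longleftrightarrow> s < e \<and> (\<forall>i < e. s \<le> i \<longrightarrow> A i 0 \<or> A i 1) \<and> (A s 1 \<or> e = s + 1)"

text \<open>Each start has a unique end, and each interval is a literal or a connective followed by
  two intervals. Intervals that do not belong to the parse of the whole word are not excluded,
  provided that they satisfy the same conditions.\<close>

definition check_parse where
  "check_parse A K Y \<longleftrightarrow> Y 0 0 K \<and>
    (\<forall>p < K + 1. \<forall>e < K + 1. Y 0 p e \<longrightarrow> p < e \<and>
      (\<forall>e' < K + 1. Y 0 p e' \<longrightarrow> e = e') \<and>
      ((A p 2 \<and> number A (p + 1) e) \<or> (A p 3 \<and> A (p + 1) 2 \<and> number A (p + 2) e) \<or>
       ((A p 4 \<or> A p 5) \<and> (\<exists>q < K + 1. Y 0 (p + 1) q \<and> Y 0 q e))))"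

text \<open>The counterpart of \<open>heap\<close> and of the distinctness of ranks. Several ranks
  for one conjunction do no harm, as any of them can be chosen; different conjunctions must not
  share one.\<close>

definition check_ranks where
  "check_ranks A K Y \<longleftrightarrow>
    (\<forall>r < K + 1. \<forall>u < K + 1. \<forall>u' < K + 1. Y 1 r u \<and> Y 1 r u' \<longrightarrow> u = u') \<and>
    (\<forall>u < K + 1. \<forall>e < K + 1. Y 0 u e \<and> A u 4 \<longrightarrow>
      (\<exists>r < K + 1. Y 1 r u) \<and>
      (\<forall>r < K + 1. \<forall>u' < K + 1. \<forall>r' < K + 1. Y 1 r u \<and> u < u' \<and> u' < e \<and> Y 1 r' u' \<longrightarrow> r' < r))"

text \<open>The letter \<open>2\<close> occurs in negative literals too, so it must be ensured that
  the letter before \<open>p\<close> is not the negation sign of a parsed literal. The names at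
  \<open>p\<close> and \<open>q\<close> are compared by length, where the \<open>1\<close> accounts
  for the negation sign, and digit by digit.\<close>

definition check_links where
  "check_links A K Y \<longleftrightarrow> (\<exists>p < K + 1. \<exists>q < K + 1. Y 2 p q) \<and>
    (\<forall>p < K + 1. \<forall>q < K + 1. Y 2 p q \<longrightarrow>
      A p 2 \<and> A q 3 \<and> \<not> (\<exists>e < K + 1. 0 < p \<and> Y 0 (p - 1) e \<and> A (p - 1) 3) \<and>
      (\<forall>q' < K + 1. Y 2 p q' \<longrightarrow> q = q') \<and> (\<forall>p' < K + 1. Y 2 p' q \<longrightarrow> p = p') \<and>
      (\<forall>e < K + 1. \<forall>e' < K + 1. Y 0 p e \<and> Y 0 q e' \<longrightarrow> e' + p = q + e + 1 \<and>
        (\<forall>i < K + 1. p + 1 + i < e \<longrightarrow> (A (p + 1 + i) 1 \<longleftrightarrow> A (q + 2 + i) 1))))"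

text \<open>The counterpart of \<open>follows\<close>, with \<open>m\<close> as the border between
  the two conjuncts. The values of \<open>D\<close> are encoded as follows: \<open>Y 3\<close> means
  \<open>1\<close>, \<open>Y 4\<close> without \<open>Y 3\<close> means \<open>2\<close>, and
  neither means another value.\<close>

definition check_sides where
  "check_sides A K Y \<longleftrightarrow>
    (\<forall>u < K + 1. \<forall>m < K + 1. \<forall>e < K + 1. \<forall>r < K + 1. \<forall>p < K + 1. \<forall>q < K + 1.
      Y 0 u e \<and> A u 4 \<and> Y 0 (u + 1) m \<and> Y 0 m e \<and> Y 1 r u \<and> Y 2 p q \<longrightarrow>
      ((u < p \<and> p < m) \<or> (u < q \<and> q < m) \<longrightarrow> Y 3 p r) \<and>
      ((m \<le> p \<and> p < e) \<or> (m \<le> q \<and> q < e) \<longrightarrow> \<not> Y 3 p r \<and> Y 4 p r))"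

text \<open>The counterpart of \<open>split_closed\<close>. Agreement in both relations
  \<open>Y 3\<close> and \<open>Y 4\<close> implies equal values of \<open>D\<close>.\<close>

definition check_split where
  "check_split A K Y \<longleftrightarrow>
    (\<forall>p < K + 1. \<forall>q < K + 1. \<forall>r < K + 1. Y 2 p q \<longrightarrow>
      (Y 3 p r \<longrightarrow> (\<exists>p' < K + 1. \<exists>q' < K + 1. Y 2 p' q' \<and> \<not> Y 3 p' r \<and> Y 4 p' r \<and>
        (\<forall>s < K + 1. r < s \<longrightarrow> (Y 3 p s \<longleftrightarrow> Y 3 p' s) \<and> (Y 4 p s \<longleftrightarrow> Y 4 p' s)))) \<and>
      (\<not> Y 3 p r \<and> Y 4 p r \<longrightarrow> (\<exists>p' < K + 1. \<exists>q' < K + 1. Y 2 p' q' \<and> Y 3 p' r \<and>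
        (\<forall>s < K + 1. r < s \<longrightarrow> (Y 3 p s \<longleftrightarrow> Y 3 p' s) \<and> (Y 4 p s \<longleftrightarrow> Y 4 p' s)))))"

definition check :: "(nat \<Rightarrow> nat \<Rightarrow> bool) \<Rightarrow> nat \<Rightarrow> (nat \<Rightarrow> nat \<Rightarrow> nat \<Rightarrow> bool) \<Rightarrow> bool" where
  "check A K Y \<longleftrightarrow> check_parse A K Y \<and> check_ranks A K Y \<and> check_links A K Y \<and>
     check_sides A K Y \<and> check_split A K Y"

section \<open>A successful check yields a provable formula\<close>

lemma number_slice:
  assumes "number (\<lambda>i a. i < length x \<and> x ! i = a) s e"
  shows "e \<le> length x \<and> (\<exists>a. binary a = slice x s e)"
proof -
  have s: "s < e" and d: "\<And>i. i < e \<Longrightarrow> s \<le> i \<Longrightarrow> i < length x \<and> (x ! i = 0 \<or> x ! i = 1)"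
    and l: "x ! s = 1 \<or> e = s + 1" using assms by (auto simp: number_def)
  have "e - 1 < length x" using d[of "e - 1"] s by simp
  then have e: "e \<le> length x" using s by linarith
  have "\<exists>a. binary a = slice x s e"
  proof (rule ex_binary)
    have "length (slice x s e) = e - s" using e by (rule length_slice)
    then show "slice x s e \<noteq> []" using s by auto
    show "\<forall>v \<in> set (slice x s e). v = 0 \<or> v = 1"
    proof
      fix v assume "v \<in> set (slice x s e)"
      then obtain i where "i < e - s" "v = x ! (s + i)"
        using e by (auto simp: in_set_conv_nth length_slice nth_slice)
      then show "v = 0 \<or> v = 1" using d[of "s + i"] by simp
    qed
    show "hd (slice x s e) = 1 \<or> length (slice x s e) = 1"
      using l s e by (auto simp: slice_Cons length_slice)
  qed
  then show ?thesis using e by blast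
qed

text \<open>A labelled formula is built by recursion along the intervals, and the conditions of the
  check become the clauses of \<open>certificate\<close> for the single block \<open>L\<close> of
  all linked positions.\<close>

lemma check_sound:
  assumes chk: "check (\<lambda>i a. i < length x \<and> x ! i = a) (length x) Y"
  shows "\<exists>F. encode F = x \<and> CL5m_provable F"
proof -
  define K where "K = length x"
  define A where "A i a \<longleftrightarrow> i < length x \<and> x ! i = a" for i a
  have chk': "check_parse A K Y" "check_ranks A K Y" "check_links A K Y" "check_sides A K Y" "check_split A K Y"
    using chk unfolding check_def K_def A_def by auto
  define L where "L = {p. p \<le> K \<and> (\<exists>q \<le> K. Y 2 p q)}"
  define D where "D p r = (if Y 3 p r then 1 else if Y 4 p r then 2 else 0 :: nat)" for p r
  \<comment> \<open>A positive literal is labelled by its position. A linked negative literal takes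
    over the label of its partner, and an unlinked one gets a label above all positions.\<close>
  define nlab where "nlab q = (if \<exists>p \<le> K. Y 2 p q then SOME p. p \<le> K \<and> Y 2 p q else K + 1 + q)" for q
  \<comment> \<open>The atom of a label is decoded from the name found in the word. Labels above
    \<open>K\<close> belong to unlinked negative literals, whose names start after two letters
    instead of one.\<close>
  define \<sigma> where "\<sigma> l = (if l \<le> K then SOME a. \<exists>e \<le> K. Y 0 l e \<and> binary a = slice x (l + 1) e
     else SOME a. \<exists>e \<le> K. Y 0 (l - (K + 1)) e \<and> binary a = slice x (l - (K + 1) + 2) e)" for l
  have parse: "p < e" "\<And>e'. e' \<le> K \<Longrightarrow> Y 0 p e' \<Longrightarrow> e = e'"
    "(A p 2 \<and> number A (p + 1) e) \<or> (A p 3 \<and> A (p + 1) 2 \<and> number A (p + 2) e) \<or>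
       ((A p 4 \<or> A p 5) \<and> (\<exists>q \<le> K. Y 0 (p + 1) q \<and> Y 0 q e))"
    if "Y 0 p e" "p \<le> K" "e \<le> K" for p e
    using chk'(1) that unfolding check_parse_def by (auto simp: less_Suc_eq_le)
  have links: "A p 2 \<and> A q 3" "\<And>e. e \<le> K \<Longrightarrow> 0 < p \<Longrightarrow> Y 0 (p - 1) e \<Longrightarrow> \<not> A (p - 1) 3"
    "\<And>q'. q' \<le> K \<Longrightarrow> Y 2 p q' \<Longrightarrow> q = q'" "\<And>p'. p' \<le> K \<Longrightarrow> Y 2 p' q \<Longrightarrow> p = p'"
    "\<And>e e'. e \<le> K \<Longrightarrow> e' \<le> K \<Longrightarrow> Y 0 p e \<Longrightarrow> Y 0 q e' \<Longrightarrow> e' + p = q + e + 1 \<and>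
        (\<forall>i \<le> K. p + 1 + i < e \<longrightarrow> (A (p + 1 + i) 1 \<longleftrightarrow> A (q + 2 + i) 1))"
    if "Y 2 p q" "p \<le> K" "q \<le> K" for p q
    using chk'(3) that unfolding check_links_def by (auto simp: less_Suc_eq_le)
  have nlab_linked: "nlab q = p" if "Y 2 p q" "p \<le> K" "q \<le> K" for p q
  proof -
    have "nlab q = (SOME p. p \<le> K \<and> Y 2 p q)" using that by (auto simp: nlab_def)
    moreover have "(SOME p. p \<le> K \<and> Y 2 p q) = p" 
      by (rule some_equality) (use that links(4)[OF that] in blast)+
    ultimately show ?thesis by simp
  qed
  have nlab_linked_some: "(SOME p. p \<le> K \<and> Y 2 p q) \<le> K \<and> Y 2 (SOME p. p \<le> K \<and> Y 2 p q) q"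
    if "\<exists>p \<le> K. Y 2 p q" for q
    by (rule someI_ex) (use that in blast)
  have nlab_cases: "(nlab q \<le> K \<and> Y 2 (nlab q) q) \<or> nlab q = K + 1 + q" for q
  proof (cases "\<exists>p \<le> K. Y 2 p q")
    case True
    then show ?thesis using nlab_linked_some[of q] by (simp add: nlab_def)
  next
    case False
    then have "nlab q = K + 1 + q" unfolding nlab_def by (rule if_not_P)
    then show ?thesis by simp
  qed
  have nlab_inj: "q = q'" if "nlab q = nlab q'" "q \<le> K" "q' \<le> K" for q q'
  proof (cases "nlab q \<le> K")
    case True
    then have "Y 2 (nlab q) q" "Y 2 (nlab q) q'" using nlab_cases[of q] nlab_cases[of q'] that(1) by auto
    then show ?thesis using links(3)[of "nlab q" q q'] True that by blast
  next
    case False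
    then have "nlab q = K + 1 + q" using nlab_cases[of q] by blast
    moreover have "nlab q' = K + 1 + q'" using False nlab_cases[of q'] that(1) by (metis)
    ultimately have "nlab q = K + 1 + q" "nlab q' = K + 1 + q'" .
    with that(1) have "K + 1 + q = K + 1 + q'" by (simp only:)
    then show ?thesis by simp
  qed
  have A_eq: "A = (\<lambda>i a. i < length x \<and> x ! i = a)" by (intro ext) (simp add: A_def)
  have num: "\<exists>a. binary a = slice x s e" if "number A s e" for s e
    by (rule conjunct2[OF number_slice[OF that[unfolded A_eq]]])
  have \<sigma>_pos: "binary (\<sigma> p) = slice x (p + 1) e" if "Y 0 p e" "p \<le> K" "e \<le> K" "A p 2" for p e
  proof -
    have "number A (p + 1) e" using parse(3)[OF that(1-3)] that(4) by (auto simp: A_def)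
    then have "\<exists>a. \<exists>e \<le> K. Y 0 p e \<and> binary a = slice x (p + 1) e" using num that by blast
    from someI_ex[OF this] show ?thesis using parse(2)[OF that(1-3)] that(2) unfolding \<sigma>_def by auto
  qed
  have \<sigma>_neg: "binary (\<sigma> (nlab q)) = slice x (q + 2) e"
    if q: "Y 0 q e" "q \<le> K" "e \<le> K" "A q 3" and pos: "\<And>p. Y 2 p q \<Longrightarrow> p \<le> K \<Longrightarrow> \<exists>e \<le> K. Y 0 p e" for q e
  proof -
    have n: "number A (q + 2) e" using parse(3)[OF q(1-3)] q(4) by (auto simp: A_def)
    from nlab_cases[of q] show ?thesis
    proof
      assume l: "nlab q \<le> K \<and> Y 2 (nlab q) q"
      define p where "p = nlab q"
      obtain e' where e': "e' \<le> K" "Y 0 p e'" using pos l by (auto simp: p_def)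
      have p: "A p 2" "p \<le> K" using links(1)[of p q] l q by (auto simp: p_def)
      have "e + p = q + e' + 1" and eq: "\<And>i. i \<le> K \<Longrightarrow> p + 1 + i < e' \<Longrightarrow> A (p + 1 + i) 1 \<longleftrightarrow> A (q + 2 + i) 1"
        using links(5)[of p q e' e] l e' q by (auto simp: p_def)
      have n': "number A (p + 1) e'" using parse(3)[OF e'(2) p(2) e'(1)] p(1) by (auto simp: A_def)
      have "slice x (p + 1) e' = slice x (q + 2) e"
      proof (rule nth_equalityI)
        show "length (slice x (p + 1) e') = length (slice x (q + 2) e)"
          using e' q \<open>e + p = q + e' + 1\<close> by (simp add: length_slice K_def)
        fix i assume "i < length (slice x (p + 1) e')"
        then have i: "p + 1 + i < e'" "q + 2 + i < e" using e' \<open>e + p = q + e' + 1\<close> by (auto simp: length_slice K_def)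
        have "A (p + 1 + i) 0 \<or> A (p + 1 + i) 1" "A (q + 2 + i) 0 \<or> A (q + 2 + i) 1"
          using n n' i unfolding number_def by (meson le_add1)+
        then have "x ! (p + 1 + i) = x ! (q + 2 + i)" using eq[of i] i e'(1) by (auto simp: A_def)
        moreover have "i < e' - (p + 1)" "i < e - (q + 2)" using i by auto
        ultimately show "slice x (p + 1) e' ! i = slice x (q + 2) e ! i"
          using e' q by (simp add: nth_slice K_def)
      qed
      then show ?thesis using \<sigma>_pos[OF e'(2) p(2) e'(1) p(1)] by (simp add: p_def)
    next
      assume l: "nlab q = K + 1 + q"
      have "\<exists>a. \<exists>e \<le> K. Y 0 q e \<and> binary a = slice x (q + 2) e" using num[OF n] q by blast
      from someI_ex[OF this] show ?thesis using parse(2)[OF q(1-3)] l unfolding \<sigma>_def by auto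
    qed
  qed
  \<comment> \<open>Links refer to letters of the word, not to intervals. It has to be shown that a
    linked letter \<open>2\<close> does start an interval; only then do the conditions of
    \<open>check_links\<close> on the names apply to it.\<close>
  define leafpos where "leafpos p e \<longleftrightarrow> (\<forall>i. p \<le> i \<longrightarrow> i < e \<longrightarrow>
     (A i 2 \<and> \<not> (\<exists>e' \<le> K. 0 < i \<and> Y 0 (i - 1) e' \<and> A (i - 1) 3) \<longrightarrow> (\<exists>e' \<le> K. Y 0 i e')))" for p e
  have leaves: "leafpos p e" if "Y 0 p e" "p \<le> K" "e \<le> K" for p e
    using that
  proof (induction "e - p" arbitrary: p e rule: less_induct)
    case less
    note e = less.prems
    from parse(3)[OF e] consider "A p 2" "number A (p + 1) e" | "A p 3" "A (p + 1) 2" "number A (p + 2) e"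
      | q where "A p 4 \<or> A p 5" "q \<le> K" "Y 0 (p + 1) q" "Y 0 q e" by blast
    then show ?case
    proof cases
      case 1
      have "i = p" if "p \<le> i" "i < e" "A i 2" for i
        using 1(2) that unfolding number_def A_def by (cases "i = p") force+
      then show ?thesis unfolding leafpos_def using e by blast
    next
      case 2
      have "i = p + 1" if "p \<le> i" "i < e" "A i 2" for i
        using 2 that unfolding number_def A_def by (cases "i = p"; cases "i = p + 1") force+
      then show ?thesis unfolding leafpos_def using e 2(1) by force
    next
      case 3
      have pq: "p + 1 < q" "p + 1 \<le> K" using parse(1)[OF 3(3) _ 3(2)] 3(1) by (auto simp: A_def K_def)
      have qe: "q < e" using parse(1)[OF 3(4) 3(2) e(3)] .
      have "leafpos (p + 1) q" "leafpos q e"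
        using less.hyps[OF _ 3(3)] less.hyps[OF _ 3(4)] pq qe 3(2) e(3) by auto
      moreover have "\<not> A p 2" using 3(1) by (auto simp: A_def)
      ultimately show ?thesis unfolding leafpos_def by (metis Suc_eq_plus1 le_eq_less_or_eq not_less not_less_eq_eq)
    qed
  qed
  have root: "Y 0 0 K" using chk'(1) unfolding check_parse_def by blast
  have pos_parsed: "\<exists>e \<le> K. Y 0 p e" if "Y 2 p q" "p \<le> K" "q \<le> K" for p q
    using leaves[OF root] links(1,2)[OF that] unfolding leafpos_def A_def K_def by auto
  \<comment> \<open>The last clause is a converse to the bounds on the labels: no linked position in
    the interval is missed. At the root it gives both literals of every axiom, as
    \<open>block\<close> demands.\<close>
  define spec where "spec p e f \<longleftrightarrow> encode (erase \<sigma> f) = slice x p e \<and> distinct (posl f) \<and> distinct (negl f) \<and>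
     distinct (ranks f) \<and> heap f \<and> follows D L f \<and>
     set (posl f) \<subseteq> {p..<e} \<and> set (negl f) \<subseteq> nlab ` {p..<e} \<and>
     (\<forall>r \<in> set (ranks f). r \<le> K \<and> (\<exists>u. p \<le> u \<and> u < e \<and> Y 1 r u)) \<and>
     (\<forall>i q. Y 2 i q \<and> i \<le> K \<and> q \<le> K \<longrightarrow> (p \<le> i \<and> i < e \<longrightarrow> i \<in> set (posl f)) \<and> (p \<le> q \<and> q < e \<longrightarrow> i \<in> set (negl f)))"
    for p e f
  have spec_pos: "set (posl f) \<subseteq> {p..<e}" and spec_neg: "set (negl f) \<subseteq> nlab ` {p..<e}"
    and spec_ranks: "\<And>r. r \<in> set (ranks f) \<Longrightarrow> r \<le> K \<and> (\<exists>u. p \<le> u \<and> u < e \<and> Y 1 r u)"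
    and spec_occ: "\<And>i q. Y 2 i q \<Longrightarrow> i \<le> K \<Longrightarrow> q \<le> K \<Longrightarrow>
      (p \<le> i \<and> i < e \<longrightarrow> i \<in> set (posl f)) \<and> (p \<le> q \<and> q < e \<longrightarrow> i \<in> set (negl f))"
    and spec_dist: "distinct (posl f)" "distinct (negl f)" "distinct (ranks f)"
    and spec_enc: "encode (erase \<sigma> f) = slice x p e"
    and spec_heap: "heap f" "follows D L f"
    if "spec p e f" for p e f
    using that unfolding spec_def by blast+
  have "\<exists>f. spec p e f" if "Y 0 p e" "p \<le> K" "e \<le> K" for p e
    using that
  proof (induction "e - p" arbitrary: p e rule: less_induct)
    case less
    note e = less.prems
    have pe: "p < e" using parse(1)[OF e] .
    from parse(3)[OF e] consider "A p 2" "number A (p + 1) e" | "A p 3" "A (p + 1) 2" "number A (p + 2) e"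
      | m where "A p 4 \<or> A p 5" "m \<le> K" "Y 0 (p + 1) m" "Y 0 m e" by blast
    then show ?case
    proof cases
      case 1
      have only: "i = p" if "p \<le> i" "i < e" "A i 2 \<or> A i 3" for i
        using 1(2) that unfolding number_def A_def by (cases "i = p") force+
      have "x ! p = 2" using 1(1) by (simp add: A_def)
      then have "encode (erase \<sigma> (LAtom p)) = slice x p e"
        using \<sigma>_pos[OF e 1(1)] pe e by (simp add: slice_Cons K_def)
      moreover have "q \<noteq> p" if "A q 3" for q using that 1(1) by (auto simp: A_def)
      ultimately have "spec p e (LAtom p)" unfolding spec_def
        using pe links(1) only by auto
      then show ?thesis by blast
    next
      case 2
      have only: "i = p" if "p \<le> i" "i < e" "A i 3" for i
        using 2 that unfolding number_def A_def by (cases "i = p"; cases "i = p + 1") force+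
      have only': "i = p + 1" if "p \<le> i" "i < e" "A i 2" for i
        using 2 that unfolding number_def A_def by (cases "i = p"; cases "i = p + 1") force+
      have pe2: "p + 2 < e" using 2(3) by (simp add: number_def)
      have "x ! p = 3" "x ! (p + 1) = 2" using 2 by (auto simp: A_def)
      then have "encode (erase \<sigma> (LNeg (nlab p))) = slice x p e"
        using \<sigma>_neg[OF e 2(1)] pos_parsed e pe2 by (simp add: slice_Cons K_def)
      moreover have "\<not> (p \<le> i \<and> i < e)" if "Y 2 i q" "i \<le> K" "q \<le> K" for i q
        using only'[of i] links(1,2)[OF that] 2(1) e by fastforce
      moreover have "i = nlab p" if "Y 2 i q" "i \<le> K" "q \<le> K" "p \<le> q" "q < e" for i q
        using only[of q] links(1)[OF that(1-3)] nlab_linked[OF that(1-3)] that by auto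
      ultimately have "spec p e (LNeg (nlab p))" unfolding spec_def
        using pe by auto
      then show ?thesis by blast
    next
      case 3
      have pm: "p + 1 < m" "p + 1 \<le> K" using parse(1)[OF 3(3) _ 3(2)] 3(1) by (auto simp: A_def K_def)
      have me: "m < e" using parse(1)[OF 3(4) 3(2) e(3)] .
      have smaller: "m - (p + 1) < e - p" "e - m < e - p" using pm me by linarith+
      obtain f where f: "spec (p + 1) m f" using less.hyps[OF smaller(1) 3(3) pm(2) 3(2)] by blast
      obtain g where g: "spec m e g" using less.hyps[OF smaller(2) 3(4) 3(2) e(3)] by blast
      have enc: "slice x p e = x ! p # encode (erase \<sigma> f) @ encode (erase \<sigma> g)"
      proof -
        have "slice x (p + 1) e = slice x (p + 1) m @ slice x m e" using pm me by (intro slice_append) auto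
        then show ?thesis using spec_enc[OF f] spec_enc[OF g] pe e unfolding K_def by (simp add: slice_Cons)
      qed
      have neg_disj: "nlab ` {p + 1..<m} \<inter> nlab ` {m..<e} = {}"
        using nlab_inj me e by fastforce
      have fg: "distinct (posl f @ posl g)" "distinct (negl f @ negl g)"
      proof -
        have "{p + 1..<m} \<inter> {m..<e} = {}" by auto
        then show "distinct (posl f @ posl g)"
          using spec_dist(1)[OF f] spec_dist(1)[OF g] spec_pos[OF f] spec_pos[OF g] by (simp, blast)
        show "distinct (negl f @ negl g)"
          using Int_mono[OF spec_neg[OF f] spec_neg[OF g]] spec_dist(2)[OF f] spec_dist(2)[OF g]
          unfolding neg_disj by simp
      qed
      have occ: "(p \<le> i \<and> i < e \<longrightarrow> i \<in> set (posl f) \<union> set (posl g)) \<and> (p \<le> q \<and> q < e \<longrightarrow> i \<in> set (negl f) \<union> set (negl g))"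
        if "Y 2 i q" "i \<le> K" "q \<le> K" for i q
      proof -
        have "A i 2" "A q 3" using links(1)[OF that] by blast+
        then have "i \<noteq> p" "q \<noteq> p" using 3(1) by (auto simp: A_def)
        then have "p \<le> i \<and> i < e \<longrightarrow> (p + 1 \<le> i \<and> i < m) \<or> (m \<le> i \<and> i < e)"
          "p \<le> q \<and> q < e \<longrightarrow> (p + 1 \<le> q \<and> q < m) \<or> (m \<le> q \<and> q < e)" by linarith+
        then show ?thesis using spec_occ[OF f that] spec_occ[OF g that] by blast
      qed
      have sets: "set (posl f @ posl g) \<subseteq> {p..<e}" "set (negl f @ negl g) \<subseteq> nlab ` {p..<e}"
      proof -
        have sub: "{p + 1..<m} \<subseteq> {p..<e}" "{m..<e} \<subseteq> {p..<e}" using pm me by auto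
        show "set (posl f @ posl g) \<subseteq> {p..<e}"
          using spec_pos[OF f] spec_pos[OF g] sub by auto
        show "set (negl f @ negl g) \<subseteq> nlab ` {p..<e}"
          using spec_neg[OF f] spec_neg[OF g] image_mono[OF sub(1), of nlab] image_mono[OF sub(2), of nlab]
          unfolding set_append by (meson Un_least order_trans)
      qed
      have U: "r \<le> K" "\<exists>u. p < u \<and> u < e \<and> Y 1 r u" if "r \<in> set (ranks f) \<union> set (ranks g)" for r
      proof -
        from that show "r \<le> K" using spec_ranks[OF f, of r] spec_ranks[OF g, of r] by blast
        from that show "\<exists>u. p < u \<and> u < e \<and> Y 1 r u"
        proof
          assume "r \<in> set (ranks f)"
          then obtain u where "p + 1 \<le> u" "u < m" "Y 1 r u" using spec_ranks[OF f] by blast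
          then show ?thesis using me by (intro exI[of _ u]) auto
        next
          assume "r \<in> set (ranks g)"
          then obtain u where "m \<le> u" "u < e" "Y 1 r u" using spec_ranks[OF g] by blast
          then show ?thesis using pm by (intro exI[of _ u]) auto
        qed
      qed
      have Uf: "\<exists>u. u < m \<and> Y 1 r u" if "r \<in> set (ranks f)" for r
        using spec_ranks[OF f that] by blast
      have Ug: "\<exists>u. m \<le> u \<and> u < e \<and> Y 1 r u" if "r \<in> set (ranks g)" for r
        using spec_ranks[OF g that] by blast
      have rank_unique: "u = u'" if "Y 1 r u" "Y 1 r u'" "r \<le> K" "u \<le> K" "u' \<le> K" for r u u'
        using chk'(2) that unfolding check_ranks_def by (auto simp: less_Suc_eq_le)
      have dr: "distinct (ranks f @ ranks g)"
      proof -
        have "r \<notin> set (ranks g)" if rf: "r \<in> set (ranks f)" for r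
        proof
          assume rg: "r \<in> set (ranks g)"
          obtain u where "u < m" "Y 1 r u" using Uf[OF rf] by blast
          moreover obtain u' where "m \<le> u'" "u' < e" "Y 1 r u'" using Ug[OF rg] by blast
          moreover have "r \<le> K" using U(1) rf by blast
          ultimately show False using rank_unique[of r u u'] me e by simp
        qed
        then show ?thesis using spec_dist(3)[OF f] spec_dist(3)[OF g] by auto
      qed
      have U': "\<forall>s \<in> set (ranks f @ ranks g). s \<le> K \<and> (\<exists>u. p \<le> u \<and> u < e \<and> Y 1 s u)"
      proof
        fix s assume "s \<in> set (ranks f @ ranks g)"
        then have s: "s \<in> set (ranks f) \<union> set (ranks g)" by simp
        obtain u where "p < u" "u < e" "Y 1 s u" using U(2)[OF s] by blast
        then show "s \<le> K \<and> (\<exists>u. p \<le> u \<and> u < e \<and> Y 1 s u)"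
          using U(1)[OF s] by (intro conjI exI[of _ u]) auto
      qed
      have occ': "\<forall>i q. Y 2 i q \<and> i \<le> K \<and> q \<le> K \<longrightarrow>
          (p \<le> i \<and> i < e \<longrightarrow> i \<in> set (posl f @ posl g)) \<and> (p \<le> q \<and> q < e \<longrightarrow> i \<in> set (negl f @ negl g))"
        using occ unfolding set_append by blast
      from 3(1) show ?thesis
      proof
        assume "A p 5"
        then have "x ! p = 5" by (simp add: A_def)
        have "spec p e (LDisj f g)"
          unfolding spec_def erase.simps encode.simps posl.simps negl.simps ranks.simps heap.simps follows.simps
          by (intro conjI fg dr spec_heap[OF f] spec_heap[OF g] sets U' occ') (simp add: enc \<open>x ! p = 5\<close>)
        then show ?thesis by blast
      next
        assume p4: "A p 4"
        then have "x ! p = 4" by (simp add: A_def)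
        have pe': "p < K + 1" "e < K + 1" "m < K + 1" using e 3(2) by auto
        have rk: "(\<exists>r < K + 1. Y 1 r p) \<and>
          (\<forall>r < K + 1. \<forall>u' < K + 1. \<forall>r' < K + 1. Y 1 r p \<and> p < u' \<and> u' < e \<and> Y 1 r' u' \<longrightarrow> r' < r)"
          using conjunct2[OF chk'(2)[unfolded check_ranks_def], THEN spec, THEN mp, OF pe'(1),
            THEN spec, THEN mp, OF pe'(2), THEN mp, OF conjI[OF e(1) p4]] .
        then obtain r where r': "r < K + 1" "Y 1 r p" by blast
        then have r: "r \<le> K" "Y 1 r p" by auto
        have lt: "s < r" if s: "s \<in> set (ranks f) \<union> set (ranks g)" for s
        proof -
          obtain u where u: "p < u" "u < e" "Y 1 s u" using U(2)[OF s] by blast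
          then show ?thesis using rk[THEN conjunct2, rule_format, of r u s] r' U(1)[OF s] pe' by simp
        qed
        have sides: "(p < i \<and> i < m \<or> p < q \<and> q < m \<longrightarrow> Y 3 i r) \<and>
            (m \<le> i \<and> i < e \<or> m \<le> q \<and> q < e \<longrightarrow> \<not> Y 3 i r \<and> Y 4 i r)"
          if "Y 2 i q" "i \<le> K" "q \<le> K" for i q
        proof -
          have iq: "i < K + 1" "q < K + 1" using that by auto
          have "Y 0 p e \<and> A p 4 \<and> Y 0 (p + 1) m \<and> Y 0 m e \<and> Y 1 r p \<and> Y 2 i q"
            using e(1) p4 3(3,4) r that by blast
          from chk'(4)[unfolded check_sides_def, THEN spec, THEN mp, OF pe'(1), THEN spec, THEN mp, OF pe'(3),
              THEN spec, THEN mp, OF pe'(2), THEN spec, THEN mp, OF r'(1), THEN spec, THEN mp, OF iq(1),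
              THEN spec, THEN mp, OF iq(2), THEN mp, OF this]
          show ?thesis .
        qed
        \<comment> \<open>\<open>follows\<close> speaks about labels, \<open>check_sides\<close>
          about positions. A label of \<open>L\<close> that occurs in a conjunct has one of its two
          linked positions inside the interval of this conjunct.\<close>
        have L: "\<exists>q \<le> K. Y 2 l q \<and> (l \<in> {a..<b} \<or> q \<in> {a..<b})"
          if l: "l \<in> L" "l \<in> labs h" "spec a b h" "b \<le> K" for l a b h
        proof -
          obtain q where q: "q \<le> K" "Y 2 l q" "l \<le> K" using l(1) by (auto simp: L_def)
          from l(2) spec_pos[OF l(3)] spec_neg[OF l(3)]
          consider "l \<in> {a..<b}" | q' where "q' \<in> {a..<b}" "l = nlab q'"
            unfolding labs_def by blast
          then show ?thesis
          proof cases
            case 2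
            then have "Y 2 l q'" using nlab_cases[of q'] q(3) by auto
            then show ?thesis using 2 l(4) by (intro exI[of _ q']) auto
          qed (use q in blast)
        qed
        have "D l r = 1" if l: "l \<in> L \<inter> labs f" for l
        proof -
          obtain q where "q \<le> K" "Y 2 l q" "l \<in> {p + 1..<m} \<or> q \<in> {p + 1..<m}" using L[of l f "p + 1" m] l f 3(2) by auto
          then have "Y 3 l r" using sides[of l q] l by (auto simp: L_def)
          then show ?thesis by (simp add: D_def)
        qed
        moreover have "D l r = 2" if l: "l \<in> L \<inter> labs g" for l
        proof -
          obtain q where "q \<le> K" "Y 2 l q" "l \<in> {m..<e} \<or> q \<in> {m..<e}" using L[of l g m e] l g e by auto
          then have "\<not> Y 3 l r \<and> Y 4 l r" using sides[of l q] l by (auto simp: L_def)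
          then show ?thesis by (simp add: D_def)
        qed
        moreover have "distinct (r # ranks f @ ranks g)" using dr lt by auto
        moreover have U'': "\<forall>s \<in> set (r # ranks f @ ranks g). s \<le> K \<and> (\<exists>u. p \<le> u \<and> u < e \<and> Y 1 s u)"
          using U' r pe by auto
        ultimately have "spec p e (LConj r f g)"
          unfolding spec_def erase.simps encode.simps posl.simps negl.simps ranks.simps heap.simps follows.simps
          by (intro conjI fg spec_heap[OF f] spec_heap[OF g] sets occ' U'') (simp_all add: enc \<open>x ! p = 4\<close> lt)
        then show ?thesis by blast
      qed
    qed
  qed
  then obtain f where f: "spec 0 K f" using root by blast
  have "certificate D [f] [L] (K + 1)"
  proof -
    obtain p q where "p \<le> K" "q \<le> K" "Y 2 p q"
      using chk'(3) unfolding check_links_def by (auto simp: less_Suc_eq_le)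
    then have "L \<noteq> {}" by (auto simp: L_def)
    moreover have "l \<in> set (posl f) \<and> l \<in> set (negl f)" if "l \<in> L" for l
    proof -
      obtain q where q: "l \<le> K" "q \<le> K" "Y 2 l q" using \<open>l \<in> L\<close> by (auto simp: L_def)
      then have "l < K" "q < K" using links(1)[of l q] by (auto simp: A_def K_def)
      then show ?thesis using f q unfolding spec_def by blast
    qed
    moreover have "split_closed D (K + 1) L"
      unfolding split_closed_def
    proof (intro ballI allI impI conjI)
      fix l r assume l: "l \<in> L" and r: "r < K + 1"
      obtain q where q: "l < K + 1" "q < K + 1" "Y 2 l q"
        using l by (auto simp: L_def less_Suc_eq_le)
      have sp: "(Y 3 l r \<longrightarrow> (\<exists>p' < K + 1. \<exists>q' < K + 1. Y 2 p' q' \<and> \<not> Y 3 p' r \<and> Y 4 p' r \<and>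
        (\<forall>s < K + 1. r < s \<longrightarrow> (Y 3 l s \<longleftrightarrow> Y 3 p' s) \<and> (Y 4 l s \<longleftrightarrow> Y 4 p' s)))) \<and>
      (\<not> Y 3 l r \<and> Y 4 l r \<longrightarrow> (\<exists>p' < K + 1. \<exists>q' < K + 1. Y 2 p' q' \<and> Y 3 p' r \<and>
        (\<forall>s < K + 1. r < s \<longrightarrow> (Y 3 l s \<longleftrightarrow> Y 3 p' s) \<and> (Y 4 l s \<longleftrightarrow> Y 4 p' s))))"
        using chk'(5)[unfolded check_split_def, THEN spec, THEN mp, OF q(1), THEN spec, THEN mp, OF q(2),
          THEN spec, THEN mp, OF r, THEN mp, OF q(3)] .
      { assume "D l r = 1"
        then have "Y 3 l r" by (auto simp: D_def split: if_splits)
        then obtain p' q' where "p' < K + 1" "q' < K + 1" "Y 2 p' q'" "\<not> Y 3 p' r" "Y 4 p' r"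
          "\<forall>s < K + 1. r < s \<longrightarrow> (Y 3 l s \<longleftrightarrow> Y 3 p' s) \<and> (Y 4 l s \<longleftrightarrow> Y 4 p' s)" using sp by blast
        then show "\<exists>k \<in> L. (\<forall>s. r < s \<and> s < K + 1 \<longrightarrow> D k s = D l s) \<and> D k r = 2"
          by (intro bexI[of _ p']) (auto simp: D_def L_def less_Suc_eq_le) }
      { assume "D l r = 2"
        then have "\<not> Y 3 l r \<and> Y 4 l r" by (auto simp: D_def split: if_splits)
        then obtain p' q' where "p' < K + 1" "q' < K + 1" "Y 2 p' q'" "Y 3 p' r"
          "\<forall>s < K + 1. r < s \<longrightarrow> (Y 3 l s \<longleftrightarrow> Y 3 p' s) \<and> (Y 4 l s \<longleftrightarrow> Y 4 p' s)" using sp by blast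
        then show "\<exists>k \<in> L. (\<forall>s. r < s \<and> s < K + 1 \<longrightarrow> D k s = D l s) \<and> D k r = 1"
          by (intro bexI[of _ p']) (auto simp: D_def L_def less_Suc_eq_le) }
    qed
    ultimately show ?thesis using f unfolding certificate_def block_def spec_def by (auto simp: less_Suc_eq_le)
  qed
  then have "CL5m_provable (erase \<sigma> f)" by (rule certificate_provable)
  moreover have "encode (erase \<sigma> f) = x" using f by (simp add: spec_def slice_def K_def)
  ultimately show ?thesis by blast
qed

section \<open>A provable formula passes the check\<close>

definition width :: "(nat \<Rightarrow> nat) \<Rightarrow> lformula \<Rightarrow> nat" where
  "width \<sigma> f = length (encode (erase \<sigma> f))"

lemma width_simps [simp]:
  "width \<sigma> (LAtom l) = Suc (length (binary (\<sigma> l)))"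
  "width \<sigma> (LNeg l) = Suc (Suc (length (binary (\<sigma> l))))"
  "width \<sigma> (LConj r A B) = Suc (width \<sigma> A + width \<sigma> B)"
  "width \<sigma> (LDisj A B) = Suc (width \<sigma> A + width \<sigma> B)"
  by (simp_all add: width_def)

lemma width_pos: "0 < width \<sigma> f"
  by (cases f) auto

text \<open>Occurrences of subformulas with the positions at which their encodings start. With
  \<open>width\<close> these pairs are the intervals of the parse.\<close>

fun nodes :: "(nat \<Rightarrow> nat) \<Rightarrow> nat \<Rightarrow> lformula \<Rightarrow> (nat \<times> lformula) set" where
  "nodes \<sigma> k (LAtom l) = {(k, LAtom l)}"
| "nodes \<sigma> k (LNeg l) = {(k, LNeg l)}"
| "nodes \<sigma> k (LConj r A B) =
     insert (k, LConj r A B) (nodes \<sigma> (k + 1) A \<union> nodes \<sigma> (k + 1 + width \<sigma> A) B)"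
| "nodes \<sigma> k (LDisj A B) =
     insert (k, LDisj A B) (nodes \<sigma> (k + 1) A \<union> nodes \<sigma> (k + 1 + width \<sigma> A) B)"

lemma nodes_self: "(k, f) \<in> nodes \<sigma> k f"
  by (cases f) auto

lemma nodes_range: "(p, g) \<in> nodes \<sigma> k f \<Longrightarrow> k \<le> p \<and> p + width \<sigma> g \<le> k + width \<sigma> f"
  by (induction f arbitrary: k) fastforce+

lemma nodes_trans: "(p, g) \<in> nodes \<sigma> k f \<Longrightarrow> nodes \<sigma> p g \<subseteq> nodes \<sigma> k f"
proof (induction f arbitrary: k)
  case (LConj r A B)
  from LConj.prems consider "p = k" "g = LConj r A B" | "(p, g) \<in> nodes \<sigma> (k + 1) A"
    | "(p, g) \<in> nodes \<sigma> (k + 1 + width \<sigma> A) B" by auto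
  then show ?case
  proof cases
    case 2
    from LConj.IH(1)[OF this] show ?thesis by auto
  next
    case 3
    from LConj.IH(2)[OF this] show ?thesis by auto
  qed simp
next
  case (LDisj A B)
  from LDisj.prems consider "p = k" "g = LDisj A B" | "(p, g) \<in> nodes \<sigma> (k + 1) A"
    | "(p, g) \<in> nodes \<sigma> (k + 1 + width \<sigma> A) B" by auto
  then show ?case
  proof cases
    case 2
    from LDisj.IH(1)[OF this] show ?thesis by auto
  next
    case 3
    from LDisj.IH(2)[OF this] show ?thesis by auto
  qed simp
qed auto

lemma nodes_children:
  assumes "(p, LConj r A B) \<in> nodes \<sigma> k f \<or> (p, LDisj A B) \<in> nodes \<sigma> k f"
  shows "(p + 1, A) \<in> nodes \<sigma> k f" "(p + 1 + width \<sigma> A, B) \<in> nodes \<sigma> k f"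
  using assms nodes_trans[of p "LConj r A B" \<sigma> k f] nodes_trans[of p "LDisj A B" \<sigma> k f]
    nodes_self[of "p + 1" A \<sigma>] nodes_self[of "p + 1 + width \<sigma> A" B \<sigma>]
  by auto

lemma slice_mid:
  assumes "slice x k e = u @ v @ w"
  shows "slice x (k + length u) (k + length u + length v) = v"
proof -
  have "drop k x = (u @ v @ w) @ drop (e - k) (drop k x)"
    using assms unfolding slice_def by (metis append_take_drop_id)
  then have "drop (k + length u) x = v @ w @ drop (e - k) (drop k x)"
    by (metis add.commute append.assoc append_eq_conv_conj drop_drop)
  then show ?thesis by (simp add: slice_def)
qed

lemma nodes_slice:
  "(p, g) \<in> nodes \<sigma> k f \<Longrightarrow> slice x k (k + width \<sigma> f) = encode (erase \<sigma> f) \<Longrightarrow>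
   slice x p (p + width \<sigma> g) = encode (erase \<sigma> g)"
proof (induction f arbitrary: k)
  case (LConj r A B)
  have "slice x (k + 1) (k + 1 + width \<sigma> A) = encode (erase \<sigma> A)"
    using slice_mid[of x k _ "[4]" "encode (erase \<sigma> A)" "encode (erase \<sigma> B)"] LConj.prems(2)
    by (simp add: width_def)
  moreover have "slice x (k + 1 + width \<sigma> A) (k + 1 + width \<sigma> A + width \<sigma> B) = encode (erase \<sigma> B)"
    using slice_mid[of x k _ "4 # encode (erase \<sigma> A)" "encode (erase \<sigma> B)" "[]"] LConj.prems(2)
    by (simp add: width_def add.assoc)
  ultimately show ?case using LConj by auto
next
  case (LDisj A B)
  have "slice x (k + 1) (k + 1 + width \<sigma> A) = encode (erase \<sigma> A)"
    using slice_mid[of x k _ "[5]" "encode (erase \<sigma> A)" "encode (erase \<sigma> B)"] LDisj.prems(2)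
    by (simp add: width_def)
  moreover have "slice x (k + 1 + width \<sigma> A) (k + 1 + width \<sigma> A + width \<sigma> B) = encode (erase \<sigma> B)"
    using slice_mid[of x k _ "5 # encode (erase \<sigma> A)" "encode (erase \<sigma> B)" "[]"] LDisj.prems(2)
    by (simp add: width_def add.assoc)
  ultimately show ?case using LDisj by auto
qed auto

text \<open>The intervals of two subformulas are nested or disjoint, so inside the interval of
  \<open>h\<close> there are only starts of subformulas of \<open>h\<close>.\<close>

lemma nodes_local:
  "(u, h) \<in> nodes \<sigma> k f \<Longrightarrow> (p, g) \<in> nodes \<sigma> k f \<Longrightarrow> u \<le> p \<Longrightarrow> p < u + width \<sigma> h \<Longrightarrow>
   (p, g) \<in> nodes \<sigma> u h"
proof (induction f arbitrary: k)
  case (LConj r A B)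
  then show ?case
    using nodes_range[of u h \<sigma> "k + 1" A] nodes_range[of p g \<sigma> "k + 1" A]
      nodes_range[of u h \<sigma> "k + 1 + width \<sigma> A" B] nodes_range[of p g \<sigma> "k + 1 + width \<sigma> A" B]
      width_pos[of \<sigma> g]
    by (auto simp: add.commute[of k])
next
  case (LDisj A B)
  then show ?case
    using nodes_range[of u h \<sigma> "k + 1" A] nodes_range[of p g \<sigma> "k + 1" A]
      nodes_range[of u h \<sigma> "k + 1 + width \<sigma> A" B] nodes_range[of p g \<sigma> "k + 1 + width \<sigma> A" B]
      width_pos[of \<sigma> g]
    by (auto simp: add.commute[of k])
qed auto

lemma nodes_root: "(k, g) \<in> nodes \<sigma> k f \<Longrightarrow> g = f"
  by (cases f) (auto dest: nodes_range)

lemma nodes_unique: "(p, g) \<in> nodes \<sigma> k f \<Longrightarrow> (p, h) \<in> nodes \<sigma> k f \<Longrightarrow> g = h"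
  using nodes_local[of p h \<sigma> k f p g] nodes_root[of p g \<sigma> h] width_pos[of \<sigma> h] by simp

lemma nodes_inherit:
  "(p, g) \<in> nodes \<sigma> k f \<Longrightarrow> set (posl g) \<subseteq> set (posl f) \<and> set (negl g) \<subseteq> set (negl f) \<and>
     set (ranks g) \<subseteq> set (ranks f) \<and> (heap f \<longrightarrow> heap g) \<and> (follows D L f \<longrightarrow> follows D L g)"
  by (induction f arbitrary: k) (auto, blast+)?

lemma ex_pos: "l \<in> set (posl f) \<Longrightarrow> \<exists>p. (p, LAtom l) \<in> nodes \<sigma> k f"
  by (induction f arbitrary: k) auto

lemma ex_neg: "l \<in> set (negl f) \<Longrightarrow> \<exists>p. (p, LNeg l) \<in> nodes \<sigma> k f"
  by (induction f arbitrary: k) auto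

lemma unique_pos:
  "distinct (posl f) \<Longrightarrow> (p, LAtom l) \<in> nodes \<sigma> k f \<Longrightarrow> (q, LAtom l) \<in> nodes \<sigma> k f \<Longrightarrow> p = q"
proof (induction f arbitrary: k)
  case (LConj r A B)
  have "\<And>p k. (p, LAtom l) \<in> nodes \<sigma> k A \<Longrightarrow> l \<in> set (posl A)" "\<And>p k. (p, LAtom l) \<in> nodes \<sigma> k B \<Longrightarrow> l \<in> set (posl B)"
    using nodes_inherit by fastforce+
  then show ?case using LConj by (simp, blast)
next
  case (LDisj A B)
  have "\<And>p k. (p, LAtom l) \<in> nodes \<sigma> k A \<Longrightarrow> l \<in> set (posl A)" "\<And>p k. (p, LAtom l) \<in> nodes \<sigma> k B \<Longrightarrow> l \<in> set (posl B)"
    using nodes_inherit by fastforce+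
  then show ?case using LDisj by (simp, blast)
qed auto

lemma unique_neg:
  "distinct (negl f) \<Longrightarrow> (p, LNeg l) \<in> nodes \<sigma> k f \<Longrightarrow> (q, LNeg l) \<in> nodes \<sigma> k f \<Longrightarrow> p = q"
proof (induction f arbitrary: k)
  case (LConj r A B)
  have "\<And>p k. (p, LNeg l) \<in> nodes \<sigma> k A \<Longrightarrow> l \<in> set (negl A)" "\<And>p k. (p, LNeg l) \<in> nodes \<sigma> k B \<Longrightarrow> l \<in> set (negl B)"
    using nodes_inherit by fastforce+
  then show ?case using LConj by (simp, blast)
next
  case (LDisj A B)
  have "\<And>p k. (p, LNeg l) \<in> nodes \<sigma> k A \<Longrightarrow> l \<in> set (negl A)" "\<And>p k. (p, LNeg l) \<in> nodes \<sigma> k B \<Longrightarrow> l \<in> set (negl B)"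
    using nodes_inherit by fastforce+
  then show ?case using LDisj by (simp, blast)
qed auto

lemma unique_rank:
  "distinct (ranks f) \<Longrightarrow> (p, LConj r C E) \<in> nodes \<sigma> k f \<Longrightarrow> (q, LConj r C' E') \<in> nodes \<sigma> k f \<Longrightarrow> p = q"
proof (induction f arbitrary: k)
  case (LConj s A B)
  have "\<And>p k C E. (p, LConj r C E) \<in> nodes \<sigma> k A \<Longrightarrow> r \<in> set (ranks A)"
    "\<And>p k C E. (p, LConj r C E) \<in> nodes \<sigma> k B \<Longrightarrow> r \<in> set (ranks B)"
    using nodes_inherit by fastforce+
  then show ?case using LConj by (simp, blast)
next
  case (LDisj A B)
  have "\<And>p k C E. (p, LConj r C E) \<in> nodes \<sigma> k A \<Longrightarrow> r \<in> set (ranks A)"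
    "\<And>p k C E. (p, LConj r C E) \<in> nodes \<sigma> k B \<Longrightarrow> r \<in> set (ranks B)"
    using nodes_inherit by fastforce+
  then show ?case using LDisj by (simp, blast)
qed auto

lemma ranks_width: "length (ranks f) \<le> width \<sigma> f"
  by (induction f) auto

lemma slice_nth:
  assumes "slice x p e = ds" "p + i < e" "e \<le> length x"
  shows "x ! (p + i) = ds ! i"
  using nth_slice[of e x i p] assms by simp

lemma number_complete:
  assumes "slice x s e = binary a" "e \<le> length x"
  shows "number (\<lambda>i a. i < length x \<and> x ! i = a) s e"
proof -
  have len: "length (binary a) = e - s" using length_slice[OF assms(2), of s] assms(1) by simp
  have s: "s < e" using len binary_not_Nil[of a] by (cases "s < e") auto
  have nth: "x ! i = binary a ! (i - s)" if "s \<le> i" "i < e" for i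
    using slice_nth[OF assms(1) _ assms(2), of "i - s"] that by simp
  have "x ! i = 0 \<or> x ! i = 1" if "s \<le> i" "i < e" for i
    using binary_digits[of "binary a ! (i - s)" a] nth[OF that] that len by simp
  moreover have "x ! s = 1 \<or> e = s + 1"
    using binary_leading[of a] nth[of s] s len binary_not_Nil[of a] by (auto simp: hd_conv_nth)
  ultimately show ?thesis using assms(2) s by (auto simp: number_def)
qed

text \<open>All five relations are read off from a certificate, with labels replaced by the
  positions of their literals. The final bounds make the relations fit into a table of polynomial
  size.\<close>

lemma check_complete:
  assumes "CL5m_provable F"
  shows "\<exists>Y. check (\<lambda>i a. i < length (encode F) \<and> encode F ! i = a) (length (encode F)) Y \<and>
    (\<forall>t i j. Y t i j \<longrightarrow> t < 5 \<and> i < length (encode F) + 1 \<and> j < length (encode F) + 1)"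
proof -
  obtain \<sigma> D f L where f: "erase \<sigma> f = F" and cert: "certificate D [f] [L] (length (ranks f))"
    using provable_certificate[OF assms] by metis
  define x where "x = encode F"
  define K where "K = length x"
  define R where "R = length (ranks f)"
  define A where "A i a \<longleftrightarrow> i < length x \<and> x ! i = a" for i a
  define N where "N = nodes \<sigma> 0 f"
  have wf: "width \<sigma> f = K" by (simp add: width_def f K_def x_def)
  have RK: "R \<le> K" using ranks_width[of f \<sigma>] wf by (simp add: R_def)
  have dist: "distinct (posl f)" "distinct (negl f)" "distinct (ranks f)" and heap: "heap f"
    and rank_less: "\<And>r. r \<in> set (ranks f) \<Longrightarrow> r < R" and follows: "follows D L f"
    and L: "L \<noteq> {}" "split_closed D R L" "\<And>l. l \<in> L \<Longrightarrow> l \<in> set (posl f) \<and> l \<in> set (negl f)"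
    using cert by (auto simp: certificate_def block_def R_def)
  have range: "p + width \<sigma> g \<le> K" "p < p + width \<sigma> g" if "(p, g) \<in> N" for p g
    using nodes_range[of p g \<sigma> 0 f] that wf width_pos[of \<sigma> g] by (auto simp: N_def)
  have sl: "slice x p (p + width \<sigma> g) = encode (erase \<sigma> g)" if "(p, g) \<in> N" for p g
    using nodes_slice[of p g \<sigma> 0 f x] that wf by (simp add: N_def slice_def K_def x_def f)
  have A_eq: "A = (\<lambda>i a. i < length x \<and> x ! i = a)" by (intro ext) (simp add: A_def)
  have letters: "A p 2 \<and> number A (p + 1) (p + width \<sigma> (LAtom l))" if "(p, LAtom l) \<in> N" for p l
  proof -
    have *: "slice x p (p + width \<sigma> (LAtom l)) = 2 # binary (\<sigma> l)" using sl[OF that] by simp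
    have "slice x (p + 1) (p + width \<sigma> (LAtom l)) = binary (\<sigma> l)"
      using slice_mid[of x p _ "[2]" "binary (\<sigma> l)" "[]"] * by simp
    then have "number A (p + 1) (p + width \<sigma> (LAtom l))"
      unfolding A_eq by (rule number_complete) (use range[OF that] in \<open>simp add: K_def\<close>)
    then show ?thesis using slice_nth[OF *, of 0] range[OF that] by (simp add: A_def K_def)
  qed
  have lettersn: "A p 3 \<and> A (p + 1) 2 \<and> number A (p + 2) (p + width \<sigma> (LNeg l))" if "(p, LNeg l) \<in> N" for p l
  proof -
    have *: "slice x p (p + width \<sigma> (LNeg l)) = 3 # 2 # binary (\<sigma> l)" using sl[OF that] by simp
    have "slice x (p + 2) (p + width \<sigma> (LNeg l)) = binary (\<sigma> l)"
      using slice_mid[of x p _ "[3, 2]" "binary (\<sigma> l)" "[]"] * by simp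
    then have "number A (p + 2) (p + width \<sigma> (LNeg l))"
      unfolding A_eq by (rule number_complete) (use range[OF that] in \<open>simp add: K_def\<close>)
    then show ?thesis using slice_nth[OF *, of 0] slice_nth[OF *, of 1] range[OF that] by (simp add: A_def K_def)
  qed
  have letterc: "A p 4" if "(p, LConj r B C) \<in> N" for p r B C
    using slice_nth[OF sl[OF that], of 0] range[OF that] by (simp add: A_def K_def)
  have letterd: "A p 5" if "(p, LDisj B C) \<in> N" for p B C
    using slice_nth[OF sl[OF that], of 0] range[OF that] by (simp add: A_def K_def)
  have conj_node: "\<exists>r B C. g = LConj r B C" if "(p, g) \<in> N" "A p 4" for p g
    using that letters[of p] lettersn[of p] letterd[of p] by (cases g) (auto simp: A_def)
  have neg_node: "\<exists>l. g = LNeg l" if "(p, g) \<in> N" "A p 3" for p g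
    using that letters[of p] letterc[of p] letterd[of p] by (cases g) (auto simp: A_def)
  have children: "(p + 1, B) \<in> N" "(p + 1 + width \<sigma> B, C) \<in> N"
    if "(p, LConj r B C) \<in> N \<or> (p, LDisj B C) \<in> N" for p r B C
    using nodes_children[OF that[unfolded N_def]] by (simp_all add: N_def)
  have unique: "g = h" if "(p, g) \<in> N" "(p, h) \<in> N" for p g h
    using nodes_unique that unfolding N_def by blast
  have upos: "p = q" if "(p, LAtom l) \<in> N" "(q, LAtom l) \<in> N" for p q l
    using unique_pos[OF dist(1)] that unfolding N_def by blast
  have uneg: "p = q" if "(p, LNeg l) \<in> N" "(q, LNeg l) \<in> N" for p q l
    using unique_neg[OF dist(2)] that unfolding N_def by blast
  have urank: "p = q" if "(p, LConj r B C) \<in> N" "(q, LConj r B' C') \<in> N" for p q r B C B' C'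
    using unique_rank[OF dist(3)] that unfolding N_def by blast
  have inherit: "set (ranks g) \<subseteq> set (ranks f) \<and> heap g \<and> follows D L g" if "(p, g) \<in> N" for p g
    using nodes_inherit[of p g \<sigma> 0 f D L] that heap follows by (simp add: N_def)
  have local: "(p, g) \<in> nodes \<sigma> u h" if "(u, h) \<in> N" "(p, g) \<in> N" "u \<le> p" "p < u + width \<sigma> h" for u h p g
    using nodes_local that unfolding N_def by blast
  define E where "E p e \<longleftrightarrow> (\<exists>g. (p, g) \<in> N \<and> e = p + width \<sigma> g)" for p e
  have E_I: "E p e" if "(p, g) \<in> N" "e = p + width \<sigma> g" for p e g using that unfolding E_def by blast
  define U where "U r u \<longleftrightarrow> (\<exists>B C. (u, LConj r B C) \<in> N)" for r u
  define Lk where "Lk p q \<longleftrightarrow> (\<exists>l \<in> L. (p, LAtom l) \<in> N \<and> (q, LNeg l) \<in> N)" for p q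
  \<comment> \<open>An axiom is now named by the position of its positive literal. This is
    unambiguous because positive literals have distinct labels.\<close>
  define D1 where "D1 p r \<longleftrightarrow> r < R \<and> (\<exists>l. (p, LAtom l) \<in> N \<and> D l r = 1)" for p r
  define D2 where "D2 p r \<longleftrightarrow> r < R \<and> (\<exists>l. (p, LAtom l) \<in> N \<and> D l r = 2)" for p r
  define Y where "Y t i j = (if t = 0 then E i j else if t = 1 then U i j else if t = 2 then Lk i j
     else if t = 3 then D1 i j else if t = 4 then D2 i j else False)" for t i j :: nat
  have Y: "Y 0 = E" "Y 1 = U" "Y 2 = Lk" "Y 3 = D1" "Y 4 = D2" by (simp_all add: Y_def fun_eq_iff)
  have D12: "D1 p r \<longleftrightarrow> r < R \<and> D l r = 1" "D2 p r \<longleftrightarrow> r < R \<and> D l r = 2" if "(p, LAtom l) \<in> N" for p l r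
    using unique[OF that] that unfolding D1_def D2_def by blast+
  have link: "\<exists>p \<le> K. \<exists>q \<le> K. (p, LAtom l) \<in> N \<and> Lk p q" if l: "l \<in> L" for l
  proof -
    obtain p q where "(p, LAtom l) \<in> N" "(q, LNeg l) \<in> N"
      using ex_pos[of l f \<sigma> 0] ex_neg[of l f \<sigma> 0] L(3)[OF l] by (auto simp: N_def)
    moreover have "p \<le> K" "q \<le> K" using range[OF calculation(1)] range[OF calculation(2)] by linarith+
    ultimately show ?thesis using l unfolding Lk_def by blast
  qed
  have "check_parse A K Y"
    unfolding check_parse_def Y
  proof (intro conjI allI impI)
    have "(0, f) \<in> N" by (simp add: N_def nodes_self)
    then show "E 0 K" using wf by (auto simp: E_def)
    fix p e assume "E p e"
    then obtain g where g: "(p, g) \<in> N" "e = p + width \<sigma> g" by (auto simp: E_def)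
    show "p < e" using range[OF g(1)] g(2) by simp
    show "e = e'" if e': "E p e'" for e'
    proof -
      obtain h where "(p, h) \<in> N" "e' = p + width \<sigma> h" using e' unfolding E_def by blast
      then show ?thesis using unique[OF g(1), of h] g(2) by simp
    qed
    show "(A p 2 \<and> number A (p + 1) e) \<or> (A p 3 \<and> A (p + 1) 2 \<and> number A (p + 2) e) \<or>
       ((A p 4 \<or> A p 5) \<and> (\<exists>q < K + 1. E (p + 1) q \<and> E q e))"
    proof (cases g)
      case (LAtom l)
      then show ?thesis using letters g by blast
    next
      case (LNeg l)
      then show ?thesis using lettersn g by blast
    next
      case (LConj r B C)
      have c: "(p + 1, B) \<in> N" "(p + 1 + width \<sigma> B, C) \<in> N" using children[of p r B C] g LConj by auto
      have "E (p + 1) (p + 1 + width \<sigma> B)" "E (p + 1 + width \<sigma> B) e"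
        by (rule E_I[OF c(1)], simp) (rule E_I[OF c(2)], simp add: g LConj)
      moreover have "p + 1 + width \<sigma> B < K + 1" using range(1)[OF c(1)] by simp
      moreover have "A p 4" using letterc g LConj by blast
      ultimately show ?thesis by blast
    next
      case (LDisj B C)
      have c: "(p + 1, B) \<in> N" "(p + 1 + width \<sigma> B, C) \<in> N" using children[of p _ B C] g LDisj by auto
      have "E (p + 1) (p + 1 + width \<sigma> B)" "E (p + 1 + width \<sigma> B) e"
        by (rule E_I[OF c(1)], simp) (rule E_I[OF c(2)], simp add: g LDisj)
      moreover have "p + 1 + width \<sigma> B < K + 1" using range(1)[OF c(1)] by simp
      moreover have "A p 5" using letterd g LDisj by blast
      ultimately show ?thesis by blast
    qed
  qed
  moreover have "check_ranks A K Y"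
    unfolding check_ranks_def Y
  proof (intro conjI allI impI)
    show "u = u'" if "U r u \<and> U r u'" for r u u' using that urank unfolding U_def by blast
    fix u e assume "E u e \<and> A u 4"
    then obtain r B C where u: "(u, LConj r B C) \<in> N" "e = u + width \<sigma> (LConj r B C)"
      using conj_node unfolding E_def by blast
    have "r < R" using inherit[OF u(1)] rank_less by auto
    then show "\<exists>r < K + 1. U r u" using RK u unfolding U_def by (intro exI[of _ r]) auto
    fix s u' r' assume *: "U s u \<and> u < u' \<and> u' < e \<and> U r' u'"
    then have "s = r" using unique[OF u(1)] unfolding U_def by blast
    obtain B' C' where u': "(u', LConj r' B' C') \<in> N" using * unfolding U_def by blast
    have "(u', LConj r' B' C') \<in> nodes \<sigma> u (LConj r B C)" using local[OF u(1) u'] * u(2) by simp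
    then have "(u', LConj r' B' C') \<in> nodes \<sigma> (u + 1) B \<union> nodes \<sigma> (u + 1 + width \<sigma> B) C" using * by auto
    then have "r' \<in> set (ranks B) \<union> set (ranks C)" using nodes_inherit by fastforce
    then show "r' < s" using inherit[OF u(1)] \<open>s = r\<close> by auto
  qed
  moreover have "check_links A K Y"
    unfolding check_links_def Y
  proof (intro conjI allI impI)
    show "\<exists>p < K + 1. \<exists>q < K + 1. Lk p q" using L(1) link by (fastforce simp: less_Suc_eq_le)
    fix p q assume "Lk p q"
    then obtain l where l: "l \<in> L" "(p, LAtom l) \<in> N" "(q, LNeg l) \<in> N" unfolding Lk_def by blast
    show "A p 2" using letters[OF l(2)] by blast
    show "A q 3" using lettersn[OF l(3)] by blast
    \<comment> \<open>If a negative literal started at \<open>p - 1\<close>, then the literal at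
      \<open>p\<close> would start inside its interval and be its subformula, but a literal has no
      proper subformulas.\<close>
    show "\<not> (\<exists>e < K + 1. 0 < p \<and> E (p - 1) e \<and> A (p - 1) 3)"
    proof
      assume "\<exists>e < K + 1. 0 < p \<and> E (p - 1) e \<and> A (p - 1) 3"
      then obtain k where k: "(p - 1, LNeg k) \<in> N" "0 < p" using neg_node unfolding E_def by blast
      have "(p, LAtom l) \<in> nodes \<sigma> (p - 1) (LNeg k)" using local[OF k(1) l(2)] k(2) by simp
      then show False using k(2) by simp
    qed
    show "q = q'" if "Lk p q'" for q'
      using that unique[OF l(2)] uneg[OF l(3)] unfolding Lk_def by blast
    show "p = p'" if "Lk p' q" for p'
      using that unique[OF l(3)] upos[OF l(2)] unfolding Lk_def by blast
    fix e e' assume e: "E p e \<and> E q e'"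
    have e1: "e = p + width \<sigma> (LAtom l)" and e2: "e' = q + width \<sigma> (LNeg l)"
      using e unique[OF l(2)] unique[OF l(3)] unfolding E_def by blast+
    then show "e' + p = q + e + 1" by simp
    fix i assume i: "p + 1 + i < e"
    have s1: "slice x p e = 2 # binary (\<sigma> l)" using sl[OF l(2)] e1 by simp
    have s2: "slice x q e' = 3 # 2 # binary (\<sigma> l)" using sl[OF l(3)] e2 by simp
    have b: "e \<le> length x" "e' \<le> length x" using range[OF l(2)] range[OF l(3)] e1 e2 by (simp_all add: K_def)
    have i2: "q + 2 + i < e'" using i e1 e2 by simp
    have "x ! (p + (1 + i)) = (2 # binary (\<sigma> l)) ! (1 + i)" by (rule slice_nth[OF s1 _ b(1)]) (use i in simp)
    moreover have "x ! (q + (2 + i)) = (3 # 2 # binary (\<sigma> l)) ! (2 + i)" by (rule slice_nth[OF s2 _ b(2)]) (use i2 in simp)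
    ultimately have "x ! (p + 1 + i) = x ! (q + 2 + i)" by (simp add: add.assoc)
    then show "A (p + 1 + i) 1 \<longleftrightarrow> A (q + 2 + i) 1" using i i2 b by (simp add: A_def)
  qed
  moreover have "check_sides A K Y"
    unfolding check_sides_def Y
  proof (intro allI impI)
    fix u m e r p q assume *: "E u e \<and> A u 4 \<and> E (u + 1) m \<and> E m e \<and> U r u \<and> Lk p q"
    then obtain B C where u: "(u, LConj r B C) \<in> N" unfolding U_def by blast
    have e: "e = u + width \<sigma> (LConj r B C)" using * unique[OF u] unfolding E_def by blast
    have ch: "(u + 1, B) \<in> N" "(u + 1 + width \<sigma> B, C) \<in> N" using children[of u r B C] u by auto
    have m: "m = u + 1 + width \<sigma> B" using * unique[OF ch(1)] unfolding E_def by blast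
    have r: "r < R" using inherit[OF u] rank_less by auto
    obtain l where l: "l \<in> L" "(p, LAtom l) \<in> N" "(q, LNeg l) \<in> N" using * unfolding Lk_def by blast
    have fo: "l \<in> labs B \<Longrightarrow> D l r = 1" "l \<in> labs C \<Longrightarrow> D l r = 2" using inherit[OF u] l(1) by auto
    have inB: "l \<in> labs B" if "(u < p \<and> p < m) \<or> (u < q \<and> q < m)"
    proof -
      have "(p, LAtom l) \<in> nodes \<sigma> (u + 1) B \<or> (q, LNeg l) \<in> nodes \<sigma> (u + 1) B"
        using that local[OF ch(1) l(2)] local[OF ch(1) l(3)] m by auto
      then show ?thesis using nodes_inherit unfolding labs_def by fastforce
    qed
    have inC: "l \<in> labs C" if "(m \<le> p \<and> p < e) \<or> (m \<le> q \<and> q < e)"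
    proof -
      have "(p, LAtom l) \<in> nodes \<sigma> m C \<or> (q, LNeg l) \<in> nodes \<sigma> m C"
        using that local[OF ch(2) l(2)] local[OF ch(2) l(3)] m e by auto
      then show ?thesis using nodes_inherit unfolding labs_def by fastforce
    qed
    show "((u < p \<and> p < m) \<or> (u < q \<and> q < m) \<longrightarrow> D1 p r) \<and>
      ((m \<le> p \<and> p < e) \<or> (m \<le> q \<and> q < e) \<longrightarrow> \<not> D1 p r \<and> D2 p r)"
      using inB inC fo D12[OF l(2)] r by auto
  qed
  moreover have "check_split A K Y"
    unfolding check_split_def Y
  proof (intro allI impI conjI)
    fix p q r assume "Lk p q"
    then obtain l where l: "l \<in> L" "(p, LAtom l) \<in> N" "(q, LNeg l) \<in> N" unfolding Lk_def by blast
    have transfer: "\<exists>p' < K + 1. \<exists>q' < K + 1. Lk p' q' \<and> (p', LAtom k) \<in> N \<and>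
        (\<forall>s < K + 1. r < s \<longrightarrow> (D1 p s \<longleftrightarrow> D1 p' s) \<and> (D2 p s \<longleftrightarrow> D2 p' s))"
      if k: "k \<in> L" "\<forall>s. r < s \<and> s < R \<longrightarrow> D k s = D l s" for k
    proof -
      obtain p' q' where p': "p' \<le> K" "q' \<le> K" "(p', LAtom k) \<in> N" "Lk p' q'" using link[OF k(1)] by blast
      have "(D1 p s \<longleftrightarrow> D1 p' s) \<and> (D2 p s \<longleftrightarrow> D2 p' s)" if "r < s" for s
        using k(2) that D12[OF p'(3)] D12[OF l(2)] by auto
      then show ?thesis using p' by (intro exI[of _ p'] exI[of _ q'] conjI) auto
    qed
    have sc: "r < R \<Longrightarrow> D l r = 1 \<Longrightarrow> \<exists>k \<in> L. (\<forall>s. r < s \<and> s < R \<longrightarrow> D k s = D l s) \<and> D k r = 2"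
      "r < R \<Longrightarrow> D l r = 2 \<Longrightarrow> \<exists>k \<in> L. (\<forall>s. r < s \<and> s < R \<longrightarrow> D k s = D l s) \<and> D k r = 1"
      using L(2) l(1) unfolding split_closed_def by blast+
    { assume "D1 p r"
      then have r: "r < R" "D l r = 1" using D12[OF l(2)] by auto
      obtain k where k: "k \<in> L" "\<forall>s. r < s \<and> s < R \<longrightarrow> D k s = D l s" "D k r = 2" using sc(1)[OF r] by blast
      show "\<exists>p' < K + 1. \<exists>q' < K + 1. Lk p' q' \<and> \<not> D1 p' r \<and> D2 p' r \<and>
        (\<forall>s < K + 1. r < s \<longrightarrow> (D1 p s \<longleftrightarrow> D1 p' s) \<and> (D2 p s \<longleftrightarrow> D2 p' s))"
        using transfer[OF k(1,2)] D12 k(3) r(1) by (metis numeral_eq_one_iff semiring_norm(85)) }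
    { assume "\<not> D1 p r \<and> D2 p r"
      then have r: "r < R" "D l r = 2" using D12[OF l(2)] by auto
      obtain k where k: "k \<in> L" "\<forall>s. r < s \<and> s < R \<longrightarrow> D k s = D l s" "D k r = 1" using sc(2)[OF r] by blast
      show "\<exists>p' < K + 1. \<exists>q' < K + 1. Lk p' q' \<and> D1 p' r \<and>
        (\<forall>s < K + 1. r < s \<longrightarrow> (D1 p s \<longleftrightarrow> D1 p' s) \<and> (D2 p s \<longleftrightarrow> D2 p' s))"
        using transfer[OF k(1,2)] D12 k(3) r(1) by metis }
  qed
  ultimately have "check A K Y" by (simp add: check_def)
  moreover have "t < 5 \<and> i < K + 1 \<and> j < K + 1" if y: "Y t i j" for t i j
  proof -
    have pos: "(p, g) \<in> N \<Longrightarrow> p < K + 1" for p g using range[of p g] by simp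
    have "r < K + 1" if "U r u" for r u
    proof -
      from that obtain B C where "(u, LConj r B C) \<in> N" unfolding U_def by blast
      then have "r < R" using inherit rank_less by fastforce
      then show ?thesis using RK by simp
    qed
    then have U: "r < K + 1 \<and> u < K + 1" if "U r u" for r u
      using that pos unfolding U_def by blast
    have E: "p < K + 1 \<and> e < K + 1" if "E p e" for p e
    proof -
      from that obtain g where g: "(p, g) \<in> N" "e = p + width \<sigma> g" unfolding E_def by blast
      then show ?thesis using range[OF g(1)] by simp
    qed
    have Lk: "p < K + 1 \<and> q < K + 1" if "Lk p q" for p q
      using that pos unfolding Lk_def by blast
    have D: "p < K + 1 \<and> r < K + 1" if "D1 p r \<or> D2 p r" for p r
    proof -
      from that obtain l where "(p, LAtom l) \<in> N" "r < R" unfolding D1_def D2_def by blast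
      then show ?thesis using pos RK by auto
    qed
    from y consider "t = 0" "E i j" | "t = 1" "U i j" | "t = 2" "Lk i j" | "t = 3" "D1 i j" | "t = 4" "D2 i j"
      unfolding Y_def by (auto split: if_splits)
    then show ?thesis
      using U E Lk D[OF disjI1] D[OF disjI2] by cases simp_all
  qed
  ultimately show ?thesis unfolding A_eq K_def x_def by blast
qed

section \<open>Certificates as words and the polynomial-time verifier\<close>

definition table :: "nat list \<Rightarrow> nat \<Rightarrow> nat \<Rightarrow> nat \<Rightarrow> nat \<Rightarrow> bool" where
  "table w K t i j \<longleftrightarrow> i < K + 1 \<and> j < K + 1 \<and>
     (K + 1 + ((t * (K + 1) + i) * (K + 1) + j) < length w \<and> w ! (K + 1 + ((t * (K + 1) + i) * (K + 1) + j)) = 1)"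

text \<open>The separator \<open>6\<close> is not a letter of encoded formulas, so its first
  position \<open>K\<close> is the length of the formula. The restriction to \<open>i < K\<close>
  keeps the letters of the certificate from being read as part of the formula.\<close>

definition check_word :: "nat list \<Rightarrow> bool" where
  "check_word w \<longleftrightarrow> (\<exists>K < length w. (K < length w \<and> w ! K = 6) \<and> (\<forall>i < K. \<not> (i < length w \<and> w ! i = 6)) \<and>
     check (\<lambda>i a. i < K \<and> (i < length w \<and> w ! i = a)) K (table w K))"

text \<open>All quantifiers of the check are bounded, so the closure rules for decidable predicates
  apply following the syntax of the condition.\<close>

lemma decidable_check_word: "decidable n (\<lambda>w. w) [] check_word"
proof -
  have "decidable n (\<lambda>w. w) [] (\<lambda>w. check_word w)"
    unfolding check_word_def check_def check_parse_def check_ranks_def check_links_def check_sides_def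
      check_split_def number_def table_def
    by ((rule decidable_letter decidable_and decidable_or decidable_not decidable_imp decidable_ex decidable_all
      decidable_less decidable_le decidable_iff decidable_eq num_add num_mult num_diff num_const num_length_input
      | (rule num_var, simp; fail))+)
  then show ?thesis .
qed

lemma poly_time_computable_cong:
  "(\<And>x. x \<in> lists {..<n} \<Longrightarrow> f x = g x) \<Longrightarrow> poly_time_computable n f \<Longrightarrow> poly_time_computable n g"
  unfolding poly_time_computable_def by (simp only: cong: ball_cong)

text \<open>The seven letters are the six letters of formulas and the separator
  \<open>6\<close>.\<close>

lemma in_P_check: "in_P 7 {w \<in> lists {..<7}. check_word w}"
proof -
  have "emits 7 (\<lambda>w. w) [] (\<lambda>w. if check_word w then [1] else [0])"
    by (intro emits_if_decidable decidable_check_word emits_letter)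
  from poly_time_computable_cong[OF _ poly_time_computable_emits[OF this]]
  have "poly_time_computable 7 (\<lambda>x. if x \<in> {w \<in> lists {..<7}. check_word w} then [1] else [0])"
    by simp
  then show ?thesis unfolding in_P_def by blast
qed

theorem in_NP_provable: "in_NP 6 (encode ` {F. CL5m_provable F})"
proof -
  \<comment> \<open>The size of five binary relations on the \<open>K + 1\<close> positions, the end
    of the word included.\<close>
  define p :: "nat poly" where "p = [:5:] * ([:1, 1:] * [:1, 1:])"
  have p: "poly p k = 5 * ((k + 1) * (k + 1))" for k by (simp add: p_def algebra_simps)
  have "x \<in> encode ` {F. CL5m_provable F} \<longleftrightarrow>
      (\<exists>y \<in> lists {..<7}. length y \<le> poly p (length x) \<and> x @ [6] @ y \<in> {w \<in> lists {..<7}. check_word w})"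
    if x: "x \<in> lists {..<6}" for x
  proof
    assume "x \<in> encode ` {F. CL5m_provable F}"
    then obtain F where F: "x = encode F" "CL5m_provable F" by auto
    define K where "K = length x"
    obtain Y where chk: "check (\<lambda>i a. i < length x \<and> x ! i = a) K Y"
      and bnd: "\<And>t i j. Y t i j \<Longrightarrow> t < 5 \<and> i < K + 1 \<and> j < K + 1"
      using check_complete[OF F(2)] unfolding K_def F(1) by blast
    \<comment> \<open>The five matrices are written one after the other and row by row, so the
      relation, the row and the column are obtained from \<open>m\<close> by division by
      \<open>K + 1\<close>. This inverts the indexing in \<open>table\<close>.\<close>
    define y where "y = map (\<lambda>m. if Y (m div ((K + 1) * (K + 1))) (m div (K + 1) mod (K + 1)) (m mod (K + 1)) then 1 else 0 :: nat)
      [0..<5 * ((K + 1) * (K + 1))]"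
    define w where "w = x @ [6] @ y"
    have y: "y \<in> lists {..<7}" by (auto simp: y_def)
    have len: "length y = 5 * ((K + 1) * (K + 1))" by (simp add: y_def)
    have w: "w \<in> lists {..<7}" using x y unfolding w_def by (auto intro: less_trans)
    have "table w K t i j = Y t i j" for t i j
    proof (cases "i < K + 1 \<and> j < K + 1")
      case ij: True
      define m where "m = (t * (K + 1) + i) * (K + 1) + j"
      have m1: "m div (K + 1) = t * (K + 1) + i" "m mod (K + 1) = j" using ij by (simp_all add: m_def div_mult_self3 del: mult_Suc_right)
      have m2: "m div ((K + 1) * (K + 1)) = t" "m div (K + 1) mod (K + 1) = i"
        unfolding div_mult2_eq m1(1) using ij by (simp_all del: mult_Suc_right)
      show ?thesis
      proof (cases "t < 5")
        case True
        have "m < 5 * ((K + 1) * (K + 1))"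
        proof -
          have "t * (K + 1) + i < 5 * (K + 1)"
          proof -
            have "t * (K + 1) + i < (t + 1) * (K + 1)" using ij by simp
            also have "\<dots> \<le> 5 * (K + 1)" using True by (intro mult_le_mono1) simp
            finally show ?thesis .
          qed
          then have "Suc (t * (K + 1) + i) * (K + 1) \<le> 5 * (K + 1) * (K + 1)" by (intro mult_le_mono1) simp
          then show ?thesis using ij unfolding m_def by (simp add: algebra_simps)
        qed
        then show ?thesis using ij m1(2) m2 len unfolding table_def m_def[symmetric] w_def
          by (simp add: nth_append K_def[symmetric] y_def del: mult_Suc_right)
      next
        \<comment> \<open>Only five matrices are stored: for a larger \<open>t\<close> the index
          lies beyond the end of the word, where \<open>table\<close> is false.\<close>
        case False
        then have "\<not> Y t i j" using bnd by blast
        moreover have "5 * ((K + 1) * (K + 1)) \<le> m"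
        proof -
          have "5 * ((K + 1) * (K + 1)) \<le> t * ((K + 1) * (K + 1))" using False by (intro mult_le_mono1) simp
          then show ?thesis unfolding m_def by (simp add: algebra_simps)
        qed
        ultimately show ?thesis unfolding table_def m_def[symmetric] w_def by (simp add: len K_def[symmetric])
      qed
    next
      case False
      then show ?thesis using bnd unfolding table_def by blast
    qed
    then have T: "table w K = Y" by (intro ext)
    have A: "(\<lambda>i a. i < K \<and> (i < length w \<and> w ! i = a)) = (\<lambda>i a. i < length x \<and> x ! i = a)"
      by (auto simp: fun_eq_iff w_def K_def nth_append)
    have "check_word w" unfolding check_word_def
    proof (intro exI[of _ K] conjI)
      show "\<forall>i < K. \<not> (i < length w \<and> w ! i = 6)"
      proof (intro allI impI)
        fix i assume "i < K"
        then have "x ! i \<in> {..<6}" using x unfolding K_def by (metis in_lists_conv_set nth_mem)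
        then show "\<not> (i < length w \<and> w ! i = 6)" using \<open>i < K\<close> by (simp add: w_def K_def nth_append)
      qed
      show "check (\<lambda>i a. i < K \<and> (i < length w \<and> w ! i = a)) K (table w K)"
        unfolding A T by (rule chk)
    qed (simp_all add: w_def K_def)
    then show "\<exists>y \<in> lists {..<7}. length y \<le> poly p (length x) \<and> x @ [6] @ y \<in> {w \<in> lists {..<7}. check_word w}"
      using y len w unfolding w_def by (intro bexI[of _ y]) (auto simp: p K_def)
  next
    assume "\<exists>y \<in> lists {..<7}. length y \<le> poly p (length x) \<and> x @ [6] @ y \<in> {w \<in> lists {..<7}. check_word w}"
    then obtain y where "check_word (x @ [6] @ y)" by blast
    then obtain K where K: "(x @ [6] @ y) ! K = 6" "\<forall>i < K. \<not> (i < length (x @ [6] @ y) \<and> (x @ [6] @ y) ! i = 6)"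
      "K < length (x @ [6] @ y)"
      "check (\<lambda>i a. i < K \<and> (i < length (x @ [6] @ y) \<and> (x @ [6] @ y) ! i = a)) K (table (x @ [6] @ y) K)"
      unfolding check_word_def by blast
    \<comment> \<open>The certificate may contain the letter \<open>6\<close> as well, but the first
      one is the separator, because \<open>x\<close> contains none.\<close>
    have "K = length x"
    proof (rule antisym)
      show "K \<le> length x"
      proof (rule ccontr)
        assume "\<not> K \<le> length x"
        then show False using K(2) by (auto dest!: spec[of _ "length x"])
      qed
      show "length x \<le> K"
      proof (rule ccontr)
        assume "\<not> length x \<le> K"
        then have "x ! K = 6" using K(1) by (simp add: nth_append)
        moreover have "x ! K \<in> set x" using \<open>\<not> length x \<le> K\<close> by (intro nth_mem) simp
        ultimately show False using x by auto
      qed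
    qed
    then have "(\<lambda>i a. i < K \<and> (i < length (x @ [6] @ y) \<and> (x @ [6] @ y) ! i = a)) = (\<lambda>i a. i < length x \<and> x ! i = a)"
      by (auto simp: fun_eq_iff nth_append)
    with K(4) \<open>K = length x\<close> have "check (\<lambda>i a. i < length x \<and> x ! i = a) (length x) (table (x @ [6] @ y) (length x))"
      by (simp only:)
    from check_sound[OF this] show "x \<in> encode ` {F. CL5m_provable F}" by blast
  qed
  then show ?thesis
    unfolding in_NP_def using in_P_check encode_letters by blast
qed

section \<open>Constraint formulas\<close>

text \<open>Constraints on variables with numerical values. There is no negation: the literal
  \<open>X = v\<close> becomes a positive atom, whose negation has to be supplied by the gadget of
  \<open>X\<close>.\<close>

datatype cf = Tru | Fls | Lit nat nat | And cf cf | Or cf cf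

fun cval :: "(nat \<Rightarrow> nat) \<Rightarrow> cf \<Rightarrow> bool" where
  "cval \<alpha> Tru \<longleftrightarrow> True"
| "cval \<alpha> Fls \<longleftrightarrow> False"
| "cval \<alpha> (Lit X v) \<longleftrightarrow> \<alpha> X = v"
| "cval \<alpha> (And A B) \<longleftrightarrow> cval \<alpha> A \<and> cval \<alpha> B"
| "cval \<alpha> (Or A B) \<longleftrightarrow> cval \<alpha> A \<or> cval \<alpha> B"

definition orl :: "nat \<Rightarrow> (nat \<Rightarrow> cf) \<Rightarrow> cf" where
  "orl k h = foldr Or (map h [0..<k]) Fls"

definition andl :: "nat \<Rightarrow> (nat \<Rightarrow> cf) \<Rightarrow> cf" where
  "andl k h = foldr And (map h [0..<k]) Tru"

lemma cval_foldr:
  "cval \<alpha> (foldr Or Gs G) \<longleftrightarrow> (\<exists>H \<in> set Gs. cval \<alpha> H) \<or> cval \<alpha> G"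
  "cval \<alpha> (foldr And Gs G) \<longleftrightarrow> (\<forall>H \<in> set Gs. cval \<alpha> H) \<and> cval \<alpha> G"
  by (induction Gs) auto

lemma cval_orl [simp]: "cval \<alpha> (orl k h) \<longleftrightarrow> (\<exists>i<k. cval \<alpha> (h i))"
  and cval_andl [simp]: "cval \<alpha> (andl k h) \<longleftrightarrow> (\<forall>i<k. cval \<alpha> (h i))"
  by (auto simp: orl_def andl_def cval_foldr)

lemma cval_if [simp]: "cval \<alpha> (if b then G else H) \<longleftrightarrow> (if b then cval \<alpha> G else cval \<alpha> H)"
  by simp

text \<open>The index \<open>1\<dots>10\<dots>0\<close> (in binary) makes names polynomially long and easy to write.\<close>

definition name :: "nat \<Rightarrow> nat \<Rightarrow> nat" where
  "name X w = (2 ^ Suc X - 1) * 2 ^ w"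

lemma binary_double: "0 < a \<Longrightarrow> binary (2 * a) = binary a @ [0]" "0 < a \<Longrightarrow> binary (Suc (2 * a)) = binary a @ [1]"
  by (subst binary_simps(2); simp)+

lemma one_less_two_power: "Suc 0 < 2 ^ Suc X"
  using one_less_power[of "2::nat" "Suc X"] by simp

lemma binary_name: "binary (name X w) = replicate (Suc X) 1 @ replicate w 0"
proof -
  have "binary (2 ^ Suc X - 1) = replicate (Suc X) 1"
  proof (induction X)
    case (Suc X)
    have "(2::nat) ^ Suc (Suc X) - 1 = Suc (2 * (2 ^ Suc X - 1))"
      by (cases "(2::nat) ^ X") auto
    moreover have "0 < (2::nat) ^ Suc X - 1" using one_less_two_power[of X] by simp
    ultimately show ?case using Suc by (simp only: binary_double) (simp add: replicate_append_same)
  qed (simp add: binary_simps)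
  moreover have "0 < name X w" for w using one_less_two_power[of X] by (simp add: name_def)
  ultimately show ?thesis
  proof (induction w)
    case (Suc w)
    have "name X (Suc w) = 2 * name X w" by (simp add: name_def)
    then show ?case using Suc by (simp only: binary_double) (simp add: replicate_append_same)
  qed (simp add: name_def)
qed

lemma name_inj [simp]: "name X w = name Y v \<longleftrightarrow> X = Y \<and> w = v"
proof
  assume "name X w = name Y v"
  then have *: "replicate (Suc X) (1::nat) @ replicate w 0 = replicate (Suc Y) 1 @ replicate v 0"
    unfolding binary_name[symmetric] by simp
  have "filter ((=) 1) (replicate (Suc X) (1::nat) @ replicate w 0) = replicate (Suc X) 1" for X w by simp
  with * have "replicate (Suc X) (1::nat) = replicate (Suc Y) 1" by metis
  then have "X = Y" by (metis length_replicate Suc_inject)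
  with * show "X = Y \<and> w = v" by (metis length_replicate append_same_eq same_append_eq)
qed simp

lemma name_pos [simp]: "name X w \<noteq> 0" "0 \<noteq> name X w"
  using one_less_two_power[of X] by (simp_all add: name_def)

text \<open>Formulas have no constants. The atom \<open>0\<close>, which differs from all names,
  represents falsity, and its excluded middle represents truth. The shift by \<open>Suc\<close>
  reserves \<open>name X 0\<close> for the choice of the value.\<close>

fun cform :: "cf \<Rightarrow> formula" where
  "cform Tru = Disj (Atom 0) (NegAtom 0)"
| "cform Fls = Atom 0"
| "cform (Lit X v) = Atom (name X (Suc v))"
| "cform (And A B) = Conj (cform A) (cform B)"
| "cform (Or A B) = Disj (cform A) (cform B)"

text \<open>
  The only \<open>NegAtom (name X 0)\<close> can be linked with one occurrence of \<open>Atom (name X 0)\<close>. This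
  chooses the value \<open>v\<close> for which literals \<open>NegAtom (name X (Suc v))\<close> become available.
\<close>

definition gadget :: "nat \<Rightarrow> nat \<Rightarrow> formula" where
  "gadget N X = Disj (NegAtom (name X 0))
     (foldr Disj (map (\<lambda>v. Conj (Atom (name X 0))
        (foldr Disj (map (\<lambda>_. NegAtom (name X (Suc v))) [0..<N]) (Atom 0))) [0..<N]) (Atom 0))"

text \<open>As indices and values occur in unary in the names, the length \<open>N\<close> of the
  encoding exceeds the indices and values of all literals of \<open>G\<close>; it also bounds the
  number of literals. So one number serves as the number of variables, of values and of
  copies.\<close>

definition choice_formula :: "cf \<Rightarrow> formula" where
  "choice_formula G = (let N = length (encode (cform G)) in foldr Disj (map (gadget N) [0..<N]) (cform G))"

section \<open>Solvable constraints have provable choice formulas\<close>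

lemma sequent_foldr_Disj: "CL5.sequent (Fs @ P) \<Longrightarrow> CL5.sequent (foldr Disj Fs G # P)"
proof (induction Fs arbitrary: P)
  case Nil
  then show ?case by (simp add: CL5.sequent_weaken)
next
  case (Cons F Fs)
  have "CL5.sequent (Fs @ F # P)" using Cons.prems by (rule CL5.sequent_perm[rotated]) simp
  then have "CL5.sequent (F # foldr Disj Fs G # P)" by (rule CL5.sequent_perm[rotated, OF Cons.IH]) simp
  then show ?case by (simp add: CL5.sequent_disj)
qed

lemma sequent_foldr_member:
  assumes "CL5.sequent (F # P)" "F \<in> set Fs"
  shows "CL5.sequent (foldr Disj Fs G # P)"
proof -
  obtain Gs Hs where "Fs = Gs @ F # Hs" using split_list[OF assms(2)] by blast
  then have "mset (F # P) \<subseteq># mset (Fs @ P)" by simp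
  from CL5.sequent_weaken_mset[OF assms(1) this] show ?thesis by (rule sequent_foldr_Disj)
qed

text \<open>Only the branch of \<open>w\<close> is used, and the other branches are weakened away.
  The literal \<open>NegAtom (name X 0)\<close> is spent on the first conjunct of this branch, and
  its second conjunct releases \<open>N\<close> copies of the chosen literal.\<close>

lemma sequent_gadget:
  assumes "CL5.sequent (replicate N (NegAtom (name X (Suc w))) @ P)" "w < N"
  shows "CL5.sequent (gadget N X # P)"
proof -
  define B where "B v = foldr Disj (map (\<lambda>_. NegAtom (name X (Suc v))) [0..<N]) (Atom 0)" for v
  have "CL5.sequent (B w # P)"
    unfolding B_def by (rule sequent_foldr_Disj) (use assms(1) in \<open>simp add: map_replicate_const\<close>)
  moreover have "CL5.sequent (Atom (name X 0) # [NegAtom (name X 0)])"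
    using CL5.sequent_identity[of "NegAtom (name X 0)"] by simp
  ultimately have "CL5.sequent (Conj (Atom (name X 0)) (B w) # [NegAtom (name X 0)] @ P)"
    by (rule CL5.sequent_conj[rotated])
  then have "CL5.sequent (foldr Disj (map (\<lambda>v. Conj (Atom (name X 0)) (B v)) [0..<N]) (Atom 0) # [NegAtom (name X 0)] @ P)"
    by (rule sequent_foldr_member) (use assms(2) in auto)
  then have "CL5.sequent (NegAtom (name X 0) # foldr Disj (map (\<lambda>v. Conj (Atom (name X 0)) (B v)) [0..<N]) (Atom 0) # P)"
    by (rule CL5.sequent_perm[rotated]) simp
  then show ?thesis unfolding gadget_def B_def by (rule CL5.sequent_disj)
qed

text \<open>If \<open>\<alpha> X\<close> is not below \<open>N\<close>, then the gadget has no
  branch for this value and is weakened away as a whole.\<close>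

lemma sequent_gadgets:
  assumes "CL5.sequent (concat (map (\<lambda>X. if \<alpha> X < N then replicate N (NegAtom (name X (Suc (\<alpha> X)))) else []) Xs) @ F # P)"
  shows "CL5.sequent (foldr Disj (map (gadget N) Xs) F # P)"
  using assms
proof (induction Xs arbitrary: P)
  case (Cons X Xs)
  let ?R = "concat (map (\<lambda>X. if \<alpha> X < N then replicate N (NegAtom (name X (Suc (\<alpha> X)))) else []) Xs)"
  have "CL5.sequent (gadget N X # ?R @ F # P)"
  proof (cases "\<alpha> X < N")
    case True
    then show ?thesis using Cons.prems sequent_gadget by simp
  next
    case False
    then show ?thesis using Cons.prems by (simp add: CL5.sequent_weaken)
  qed
  then have "CL5.sequent (?R @ F # gadget N X # P)" by (rule CL5.sequent_perm[rotated]) simp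
  from Cons.IH[OF this] have "CL5.sequent (gadget N X # foldr Disj (map (gadget N) Xs) F # P)"
    by (rule CL5.sequent_perm[rotated]) simp
  then show ?case by (simp add: CL5.sequent_disj)
qed simp

text \<open>\<open>Xs\<close> lists the consumed literals with repetitions: without contraction, a
  conjunction consumes the literals of both parts, while a disjunction needs only one side. The
  bounds show that the supply of the gadgets covers the demand.\<close>

lemma sequent_cform:
  "cval \<alpha> G \<Longrightarrow> \<exists>Xs. CL5.sequent (cform G # map (\<lambda>X. NegAtom (name X (Suc (\<alpha> X)))) Xs) \<and>
     length Xs \<le> length (encode (cform G)) \<and> (\<forall>X \<in> set Xs. X + \<alpha> X < length (encode (cform G)))"
proof (induction G)
  case Tru
  have "CL5.sequent [Disj (Atom 0) (NegAtom 0)]"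
    using CL5.sequent_identity[of "NegAtom 0"] CL5.sequent_disj[of "Atom 0" "NegAtom 0" "[]"] by simp
  then show ?case by (intro exI[of _ "[]"]) simp
next
  case (Lit X v)
  have "CL5.sequent [Atom (name X (Suc v)), NegAtom (name X (Suc v))]"
    using CL5.sequent_identity[of "NegAtom (name X (Suc v))"] by simp
  then show ?case using Lit by (intro exI[of _ "[X]"]) (simp add: binary_name)
next
  case (And A B)
  then obtain Xs Ys where *: "CL5.sequent (cform A # map (\<lambda>X. NegAtom (name X (Suc (\<alpha> X)))) Xs)"
    "length Xs \<le> length (encode (cform A))" "\<forall>X \<in> set Xs. X + \<alpha> X < length (encode (cform A))"
    "CL5.sequent (cform B # map (\<lambda>X. NegAtom (name X (Suc (\<alpha> X)))) Ys)"
    "length Ys \<le> length (encode (cform B))" "\<forall>X \<in> set Ys. X + \<alpha> X < length (encode (cform B))"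
    by auto
  show ?case using CL5.sequent_conj[OF *(1,4)] *(2,3,5,6)
    by (intro exI[of _ "Xs @ Ys"]) (auto intro: less_SucI trans_less_add1 trans_less_add2)
next
  case (Or A B)
  then consider "cval \<alpha> A" | "cval \<alpha> B" by auto
  then show ?case
  proof cases
    case 1
    then obtain Xs where *: "CL5.sequent (cform A # map (\<lambda>X. NegAtom (name X (Suc (\<alpha> X)))) Xs)"
      "length Xs \<le> length (encode (cform A))" "\<forall>X \<in> set Xs. X + \<alpha> X < length (encode (cform A))"
      using Or.IH(1) by auto
    have "CL5.sequent (cform A # cform B # map (\<lambda>X. NegAtom (name X (Suc (\<alpha> X)))) Xs)"
      by (rule CL5.sequent_perm[OF _ CL5.sequent_weaken[OF *(1), of "cform B"]]) simp
    from CL5.sequent_disj[OF this] show ?thesis using *(2,3)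
      by (intro exI[of _ Xs]) (auto intro: less_SucI trans_less_add1)
  next
    case 2
    then obtain Xs where *: "CL5.sequent (cform B # map (\<lambda>X. NegAtom (name X (Suc (\<alpha> X)))) Xs)"
      "length Xs \<le> length (encode (cform B))" "\<forall>X \<in> set Xs. X + \<alpha> X < length (encode (cform B))"
      using Or.IH(2) by auto
    have "CL5.sequent (cform A # cform B # map (\<lambda>X. NegAtom (name X (Suc (\<alpha> X)))) Xs)"
      by (rule CL5.sequent_weaken[OF *(1)])
    from CL5.sequent_disj[OF this] show ?thesis using *(2,3)
      by (intro exI[of _ Xs]) (auto intro: less_SucI trans_less_add2)
  qed
qed simp

lemma choice_formula_provable:
  assumes "cval \<alpha> G"
  shows "CL5m_provable (choice_formula G)"
proof -
  define N where "N = length (encode (cform G))"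
  define p where "p X = NegAtom (name X (Suc (\<alpha> X)))" for X
  let ?R = "concat (map (\<lambda>X. if \<alpha> X < N then replicate N (p X) else []) [0..<N])"
  obtain Xs where Xs: "CL5.sequent (cform G # map p Xs)" "length Xs \<le> N" "\<forall>X \<in> set Xs. X + \<alpha> X < N"
    using sequent_cform[OF assms] unfolding N_def p_def by blast
  \<comment> \<open>A consumed literal occurs at most \<open>length Xs \<le> N\<close> times, and
    the gadget of its variable supplies \<open>N\<close> copies.\<close>
  have "mset (map p Xs) \<subseteq># mset ?R"
  proof (rule mset_subset_eqI)
    fix F
    show "count (mset (map p Xs)) F \<le> count (mset ?R) F"
    proof (cases "F \<in> p ` set Xs")
      case True
      then obtain X where X: "X \<in> set Xs" "F = p X" by auto
      then have lt: "X < N" "\<alpha> X < N" using Xs(3) by auto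
      have "count (mset (map p Xs)) F \<le> N" using Xs(2) by (metis count_le_size le_trans length_map size_mset)
      also have "\<dots> = count (mset (replicate N (p X))) F" by (simp add: X(2))
      also have "\<dots> \<le> count (mset ?R) F"
      proof -
        have "[0..<N] = [0..<X] @ X # [Suc X..<N]" using lt(1) by (metis upt_add_eq_append upt_conv_Cons less_imp_le_nat le0 le_add_diff_inverse)
        then show ?thesis using lt(2) by simp
      qed
      finally show ?thesis .
    next
      case False
      then have "count (mset (map p Xs)) F = 0" by (simp add: not_in_iff[symmetric])
      then show ?thesis by linarith
    qed
  qed
  then have "CL5.sequent (?R @ [cform G])"
    by (intro CL5.sequent_weaken_mset[OF Xs(1)]) simp
  from sequent_gadgets[OF this[unfolded p_def]] show ?thesis
    by (simp add: choice_formula_def Let_def N_def CL5m_provable_def CL5.sequent_def lessThan_Suc)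
qed

section \<open>Provable choice formulas have solvable constraints\<close>

lemma erase_Disj:
  assumes "erase \<sigma> x = Disj F G"
  obtains y z where "x = LDisj y z" "erase \<sigma> y = F" "erase \<sigma> z = G"
  using assms by (cases x) auto

lemma erase_Conj:
  assumes "erase \<sigma> x = Conj F G"
  obtains r y z where "x = LConj r y z" "erase \<sigma> y = F" "erase \<sigma> z = G"
  using assms by (cases x) auto

lemma erase_Atom:
  assumes "erase \<sigma> x = Atom a"
  obtains l where "x = LAtom l" "\<sigma> l = a"
  using assms by (cases x) auto

lemma erase_NegAtom:
  assumes "erase \<sigma> x = NegAtom a"
  obtains l where "x = LNeg l" "\<sigma> l = a"
  using assms by (cases x) auto

lemma holds_branches:
  assumes "erase \<sigma> y = foldr Disj (map (\<lambda>w. Conj (Atom a) (B w)) ws) (Atom 0)" "holds v y"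
  shows "\<exists>l \<in> set (posl y). v l \<and> (\<sigma> l = a \<or> \<sigma> l = 0)"
  using assms
proof (induction ws arbitrary: y)
  case (Cons w ws)
  then obtain r k b z where y: "y = LDisj (LConj r (LAtom k) b) z" "\<sigma> k = a"
    "erase \<sigma> z = foldr Disj (map (\<lambda>w. Conj (Atom a) (B w)) ws) (Atom 0)"
    by (auto elim!: erase_Disj erase_Conj erase_Atom)
  then show ?case using Cons.IH[of z] Cons.prems(2) by auto
qed (auto elim: erase_Atom)

lemma not_holds_literals:
  assumes "erase \<sigma> y = foldr Disj (map (\<lambda>_. NegAtom p) ws) (Atom 0)" "\<And>l. \<sigma> l = p \<Longrightarrow> v l" "\<And>l. \<sigma> l = 0 \<Longrightarrow> \<not> v l"
  shows "\<not> holds v y"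
  using assms(1)
proof (induction ws arbitrary: y)
  case (Cons w ws)
  then show ?case using assms(2) by (auto elim!: erase_Disj erase_NegAtom)
qed (use assms(3) in \<open>auto elim: erase_Atom\<close>)

text \<open>Each branch needs a true occurrence of the guard \<open>a\<close>. Only the one with
  label \<open>k\<close> can be true, and positive labels are distinct, so at most one branch has a
  true guard. If there is one, \<open>w\<close> is its value, and the branch fails because its
  second conjunct consists of false literals. The choice of \<open>w\<close> does not depend on
  \<open>v\<close>.\<close>

lemma not_holds_branches:
  assumes "erase \<sigma> y = foldr Disj (map (\<lambda>w. Conj (Atom a) (foldr Disj (map (\<lambda>_. NegAtom (p w)) us) (Atom 0))) ws) (Atom 0)"
    and "distinct (posl y)"
  shows "\<exists>w. \<forall>v. (\<forall>l. \<sigma> l = p w \<longrightarrow> v l) \<longrightarrow> (\<forall>l. \<sigma> l = 0 \<longrightarrow> \<not> v l) \<longrightarrow> (\<forall>l. \<sigma> l = a \<longrightarrow> v l \<longrightarrow> l = k) \<longrightarrow> \<not> holds v y"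
  using assms
proof (induction ws arbitrary: y)
  case (Cons w ws)
  then obtain r l b z where y: "y = LDisj (LConj r (LAtom l) b) z" "\<sigma> l = a"
    "erase \<sigma> b = foldr Disj (map (\<lambda>_. NegAtom (p w)) us) (Atom 0)"
    "erase \<sigma> z = foldr Disj (map (\<lambda>w. Conj (Atom a) (foldr Disj (map (\<lambda>_. NegAtom (p w)) us) (Atom 0))) ws) (Atom 0)"
    by (auto elim!: erase_Disj erase_Conj erase_Atom)
  show ?case
  proof (cases "l = k")
    case True
    show ?thesis
    proof (intro exI[of _ w] allI impI)
      fix v assume v: "\<forall>l. \<sigma> l = p w \<longrightarrow> v l" "\<forall>l. \<sigma> l = 0 \<longrightarrow> \<not> v l" "\<forall>l. \<sigma> l = a \<longrightarrow> v l \<longrightarrow> l = k"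
      have "\<not> holds v b" using not_holds_literals[OF y(3)] v by blast
      moreover have "\<not> holds v z"
      proof
        assume "holds v z"
        from holds_branches[OF y(4) this] obtain j where "j \<in> set (posl z)" "j = k" using v by blast
        then show False using Cons.prems(2) True y(1) by simp
      qed
      ultimately show "\<not> holds v y" by (simp add: y(1))
    qed
  next
    case False
    obtain w' where w': "\<forall>v. (\<forall>l. \<sigma> l = p w' \<longrightarrow> v l) \<longrightarrow> (\<forall>l. \<sigma> l = 0 \<longrightarrow> \<not> v l) \<longrightarrow> (\<forall>l. \<sigma> l = a \<longrightarrow> v l \<longrightarrow> l = k) \<longrightarrow> \<not> holds v z"
      using Cons.IH[OF y(4)] Cons.prems(2) y(1) by auto
    show ?thesis
      by (rule exI[of _ w']) (use w' False y(1,2) in auto)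
  qed
qed (auto elim: erase_Atom)

text \<open>\<open>k\<close> is the label of the literal \<open>NegAtom (name X 0)\<close>. Making
  this label true refutes that literal and enables at most one branch, whose value is
  \<open>w\<close>.\<close>

lemma not_holds_gadget:
  assumes "erase \<sigma> y = gadget N X" "distinct (posl y)"
  shows "\<exists>k w. \<forall>v. (\<forall>l. \<sigma> l = name X (Suc w) \<longrightarrow> v l) \<longrightarrow> (\<forall>l. \<sigma> l = 0 \<longrightarrow> \<not> v l) \<longrightarrow>
    (\<forall>l. \<sigma> l = name X 0 \<longrightarrow> (v l \<longleftrightarrow> l = k)) \<longrightarrow> \<not> holds v y"
proof -
  obtain k z where y: "y = LDisj (LNeg k) z" "\<sigma> k = name X 0"
    and z: "erase \<sigma> z = foldr Disj (map (\<lambda>v. Conj (Atom (name X 0))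
        (foldr Disj (map (\<lambda>_. NegAtom (name X (Suc v))) [0..<N]) (Atom 0))) [0..<N]) (Atom 0)"
    using assms(1) unfolding gadget_def by (auto elim!: erase_Disj erase_NegAtom)
  have "distinct (posl z)" using assms(2) y(1) by simp
  from not_holds_branches[OF z this, of k] obtain w where
    w: "\<forall>v. (\<forall>l. \<sigma> l = name X (Suc w) \<longrightarrow> v l) \<longrightarrow> (\<forall>l. \<sigma> l = 0 \<longrightarrow> \<not> v l) \<longrightarrow>
      (\<forall>l. \<sigma> l = name X 0 \<longrightarrow> v l \<longrightarrow> l = k) \<longrightarrow> \<not> holds v z" by blast
  show ?thesis by (rule exI[of _ k], rule exI[of _ w]) (use w y in simp)
qed

lemma erase_foldr_Disj:
  assumes "erase \<sigma> x = foldr Disj (map F Xs) G" "distinct (posl x)" "distinct Xs"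
  obtains Y z where "\<And>X. X \<in> set Xs \<Longrightarrow> erase \<sigma> (Y X) = F X \<and> distinct (posl (Y X))" "erase \<sigma> z = G"
    "\<And>v. holds v x \<Longrightarrow> (\<exists>X \<in> set Xs. holds v (Y X)) \<or> holds v z"
  using assms
proof (induction Xs arbitrary: x thesis)
  case (Cons X Xs)
  obtain y x' where x: "x = LDisj y x'" "erase \<sigma> y = F X" "erase \<sigma> x' = foldr Disj (map F Xs) G"
    using Cons.prems(2) by (auto elim: erase_Disj)
  obtain Y z where Y: "\<And>X. X \<in> set Xs \<Longrightarrow> erase \<sigma> (Y X) = F X \<and> distinct (posl (Y X))" "erase \<sigma> z = G"
    "\<And>v. holds v x' \<Longrightarrow> (\<exists>X \<in> set Xs. holds v (Y X)) \<or> holds v z"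
    by (rule Cons.IH[OF _ x(3)]) (use Cons.prems(3,4) x(1) in auto)
  show ?case
  proof (rule Cons.prems(1)[of "Y(X := y)" z])
    show "(\<exists>W \<in> set (X # Xs). holds v ((Y(X := y)) W)) \<or> holds v z" if "holds v x" for v
      using that Y(3)[of v] Cons.prems(4) x(1) by fastforce
  qed (use Y(1,2) Cons.prems(3) x in auto)
qed auto

lemma cval_if_holds:
  assumes "erase \<sigma> z = cform G" "holds v z" "\<And>l. \<sigma> l = 0 \<Longrightarrow> \<not> v l"
    and "\<And>l X w. \<sigma> l = name X (Suc w) \<Longrightarrow> v l \<Longrightarrow> \<alpha> X = w"
  shows "cval \<alpha> G"
  using assms(1,2)
proof (induction G arbitrary: z)
  case (And A B)
  obtain r y z' where "z = LConj r y z'" "erase \<sigma> y = cform A" "erase \<sigma> z' = cform B"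
    using And.prems(1) by (auto elim: erase_Conj)
  then show ?case using And by auto
next
  case (Or A B)
  obtain y z' where "z = LDisj y z'" "erase \<sigma> y = cform A" "erase \<sigma> z' = cform B"
    using Or.prems(1) by (auto elim: erase_Disj)
  then show ?case using Or by auto
qed (use assms(3,4) in \<open>auto elim!: erase_Atom\<close>)

text \<open>The formula is true under all valuations of its labels. A valuation that refutes every
  gadget must therefore satisfy the constraint, and it makes at most one value of each variable
  available.\<close>

lemma choice_formula_sound:
  assumes "CL5m_provable (choice_formula G)"
  shows "\<exists>\<alpha>. cval \<alpha> G"
proof -
  define N where "N = length (encode (cform G))"
  obtain \<sigma> D x L where x: "erase \<sigma> x = choice_formula G" "certificate D [x] [L] (length (ranks x))" "\<And>v. holds v x"
    by (rule provable_certificate[OF assms]) blast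
  have d: "distinct (posl x)" using x(2) by (simp add: certificate_def)
  have e: "erase \<sigma> x = foldr Disj (map (gadget N) [0..<N]) (cform G)"
    using x(1) by (simp add: choice_formula_def Let_def N_def)
  obtain Y z where Y: "\<And>X. X \<in> set [0..<N] \<Longrightarrow> erase \<sigma> (Y X) = gadget N X \<and> distinct (posl (Y X))"
    and z: "erase \<sigma> z = cform G" "\<And>v. holds v x \<Longrightarrow> (\<exists>X \<in> set [0..<N]. holds v (Y X)) \<or> holds v z"
    by (rule erase_foldr_Disj[OF e d distinct_upt]) blast
  define Q where "Q X k w \<longleftrightarrow> (\<forall>v. (\<forall>l. \<sigma> l = name X (Suc w) \<longrightarrow> v l) \<longrightarrow> (\<forall>l. \<sigma> l = 0 \<longrightarrow> \<not> v l) \<longrightarrow>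
    (\<forall>l. \<sigma> l = name X 0 \<longrightarrow> (v l \<longleftrightarrow> l = k)) \<longrightarrow> \<not> holds v (Y X))" for X k w
  have "\<forall>X. \<exists>k w. X \<in> set [0..<N] \<longrightarrow> Q X k w"
    using not_holds_gadget Y unfolding Q_def by blast
  then obtain \<kappa> \<alpha> where Q: "\<And>X. X \<in> set [0..<N] \<Longrightarrow> Q X (\<kappa> X) (\<alpha> X)" by metis
  \<comment> \<open>Among the occurrences of \<open>name X 0\<close> just the one linked in the
    gadget is true, and among the names of values exactly the one of \<open>\<alpha> X\<close>. The
    atom \<open>0\<close> is not a name, so it is false.\<close>
  define v where "v l \<longleftrightarrow> (\<exists>X. \<sigma> l = name X 0 \<and> l = \<kappa> X \<or> \<sigma> l = name X (Suc (\<alpha> X)))" for l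
  have "\<not> holds v (Y X)" if "X \<in> set [0..<N]" for X
    by (rule Q[OF that, unfolded Q_def, rule_format]) (auto simp: v_def)
  then have "holds v z" using z(2)[OF x(3)] by blast
  with z(1) have "cval \<alpha> G" by (rule cval_if_holds) (auto simp: v_def)
  then show ?thesis by blast
qed

theorem choice_formula_iff: "CL5m_provable (choice_formula G) \<longleftrightarrow> (\<exists>\<alpha>. cval \<alpha> G)"
  using choice_formula_provable choice_formula_sound by blast

section \<open>Writing constraint formulas\<close>

lemma emits_replicate: "num n X vs g \<Longrightarrow> emits n X vs (\<lambda>e. replicate (g e) a)"
proof -
  assume "num n X vs g"
  then have "emits n X vs (\<lambda>e. concat (map (\<lambda>i. [a]) [0..<g e]))"
    by (rule emits_concat) (rule emits_letter)
  moreover have "concat (map (\<lambda>i. [a]) [0..<k]) = replicate k a" for k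
    by (induction k) (simp_all add: replicate_append_same)
  ultimately show ?thesis by simp
qed

lemma emits_Cons: "emits n X vs f \<Longrightarrow> emits n X vs (\<lambda>e. a # f e)"
  using emits_append[OF emits_letter] by simp

definition writes :: "nat \<Rightarrow> ('e \<Rightarrow> nat list) \<Rightarrow> ('e \<Rightarrow> nat) list \<Rightarrow> ('e \<Rightarrow> formula) \<Rightarrow> bool" where
  "writes n X vs F \<longleftrightarrow> emits n X vs (\<lambda>e. encode (F e))"

lemma writes_Atom_0: "writes n X vs (\<lambda>e. Atom 0)" "writes n X vs (\<lambda>e. NegAtom 0)"
  by (simp_all add: writes_def binary_simps emits_Cons emits_Nil)

lemma writes_name:
  assumes "num n X vs f" "num n X vs g"
  shows "writes n X vs (\<lambda>e. Atom (name (f e) (g e)))" "writes n X vs (\<lambda>e. NegAtom (name (f e) (g e)))"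
  using assms by (simp_all add: writes_def binary_name emits_Cons emits_append emits_replicate)

lemma writes_Conj: "writes n X vs F \<Longrightarrow> writes n X vs G \<Longrightarrow> writes n X vs (\<lambda>e. Conj (F e) (G e))"
  and writes_Disj: "writes n X vs F \<Longrightarrow> writes n X vs G \<Longrightarrow> writes n X vs (\<lambda>e. Disj (F e) (G e))"
  by (simp_all add: writes_def emits_Cons emits_append)

text \<open>In Polish notation a right-nested connective is a plain concatenation in which the
  connective precedes each part but the last, so the concatenation loop writes it.\<close>

lemma writes_foldr:
  assumes g: "num n X vs g"
    and F: "writes n (\<lambda>p. X (fst p)) (map (\<lambda>v p. v (fst p)) vs @ [snd]) (\<lambda>p. F (fst p) (snd p))"
    and G: "writes n X vs G"
  shows "writes n X vs (\<lambda>e. foldr Disj (map (F e) [0..<g e]) (G e))"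
    and "writes n X vs (\<lambda>e. foldr Conj (map (F e) [0..<g e]) (G e))"
proof -
  have "encode (foldr Disj Fs H) = concat (map (\<lambda>F. 5 # encode F) Fs) @ encode H"
    "encode (foldr Conj Fs H) = concat (map (\<lambda>F. 4 # encode F) Fs) @ encode H" for Fs H
    by (induction Fs) auto
  moreover have "emits n X vs (\<lambda>e. concat (map (\<lambda>i. a # encode (F e i)) [0..<g e]) @ encode (G e))" for a
    using G F by (intro emits_append emits_concat[OF g] emits_Cons) (simp_all add: writes_def)
  ultimately show "writes n X vs (\<lambda>e. foldr Disj (map (F e) [0..<g e]) (G e))"
    "writes n X vs (\<lambda>e. foldr Conj (map (F e) [0..<g e]) (G e))"
    by (simp_all add: writes_def comp_def)
qed

lemma num_lift:
  "num n X vs f \<Longrightarrow> num n (\<lambda>p. X (fst p)) (map (\<lambda>v p. v (fst p)) vs @ [snd]) (\<lambda>p. f (fst p))"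
  unfolding num_def by (rule emits_lift)

lemma num_Suc: "num n X vs f \<Longrightarrow> num n X vs (\<lambda>e. Suc (f e))"
  using num_add[OF num_1] by simp

lemma writes_choice_formula:
  assumes G: "writes n X vs (\<lambda>e. cform (G e))"
  shows "writes n X vs (\<lambda>e. choice_formula (G e))"
proof -
  define N where "N e = length (encode (cform (G e)))" for e
  \<comment> \<open>\<open>N\<close> is obtained by writing the encoded constraint on a scratch
    stack and measuring it.\<close>
  have N: "num n X vs N" using num_length G unfolding N_def writes_def by blast
  show ?thesis unfolding choice_formula_def Let_def gadget_def N_def[symmetric]
    by (intro writes_foldr(1) writes_Disj writes_name writes_Conj writes_Atom_0 num_lift N num_Suc G num_const num_var)
      auto
qed

lemma writes_Tru: "writes n X vs (\<lambda>e. cform Tru)"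
  and writes_Fls: "writes n X vs (\<lambda>e. cform Fls)"
  by (simp_all add: writes_Disj writes_Atom_0)

lemma writes_Lit: "num n X vs f \<Longrightarrow> num n X vs g \<Longrightarrow> writes n X vs (\<lambda>e. cform (Lit (f e) (g e)))"
  by (simp add: writes_name num_Suc)

lemma writes_And:
  "writes n X vs (\<lambda>e. cform (G e)) \<Longrightarrow> writes n X vs (\<lambda>e. cform (H e)) \<Longrightarrow> writes n X vs (\<lambda>e. cform (And (G e) (H e)))"
  by (simp add: writes_Conj)

lemma writes_Or:
  "writes n X vs (\<lambda>e. cform (G e)) \<Longrightarrow> writes n X vs (\<lambda>e. cform (H e)) \<Longrightarrow> writes n X vs (\<lambda>e. cform (Or (G e) (H e)))"
  by (simp add: writes_Disj)

lemma cform_foldr: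
  "cform (foldr Or Gs G) = foldr Disj (map cform Gs) (cform G)"
  "cform (foldr And Gs G) = foldr Conj (map cform Gs) (cform G)"
  by (induction Gs) auto

lemma writes_orl:
  assumes "num n X vs g"
    "writes n (\<lambda>p. X (fst p)) (map (\<lambda>v p. v (fst p)) vs @ [snd]) (\<lambda>p. cform (h (fst p) (snd p)))"
  shows "writes n X vs (\<lambda>e. cform (orl (g e) (h e)))"
  using writes_foldr(1)[OF assms writes_Fls] by (simp add: orl_def cform_foldr comp_def)

lemma writes_andl:
  assumes "num n X vs g"
    "writes n (\<lambda>p. X (fst p)) (map (\<lambda>v p. v (fst p)) vs @ [snd]) (\<lambda>p. cform (h (fst p) (snd p)))"
  shows "writes n X vs (\<lambda>e. cform (andl (g e) (h e)))"
  using writes_foldr(2)[OF assms writes_Tru] by (simp add: andl_def cform_foldr comp_def)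

text \<open>Here \<open>k\<close> is a constant of the machine rather than a function of the input.
  Each disjunct has a program of its own, so it may depend on \<open>c\<close> in any way, for
  example through the transition function.\<close>

lemma writes_orl_const:
  assumes "\<And>c. c < k \<Longrightarrow> writes n X vs (\<lambda>e. cform (h c e))"
  shows "writes n X vs (\<lambda>e. cform (orl k (\<lambda>c. h c e)))"
proof -
  have "set cs \<subseteq> {..<k} \<Longrightarrow> writes n X vs (\<lambda>e. cform (foldr Or (map (\<lambda>c. h c e) cs) Fls))" for cs
    by (induction cs) (use assms in \<open>auto simp: writes_Disj writes_Atom_0\<close>)
  moreover have "set [0..<k] \<subseteq> {..<k}" by auto
  ultimately show ?thesis unfolding orl_def by blast
qed

lemma writes_andl_const:
  assumes "\<And>c. c < k \<Longrightarrow> writes n X vs (\<lambda>e. cform (h c e))"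
  shows "writes n X vs (\<lambda>e. cform (andl k (\<lambda>c. h c e)))"
proof -
  have "set cs \<subseteq> {..<k} \<Longrightarrow> writes n X vs (\<lambda>e. cform (foldr And (map (\<lambda>c. h c e) cs) Tru))" for cs
    by (induction cs) (use assms in \<open>auto simp: writes_Conj writes_Disj writes_Atom_0\<close>)
  moreover have "set [0..<k] \<subseteq> {..<k}" by auto
  ultimately show ?thesis unfolding andl_def by blast
qed

lemma writes_if:
  assumes "decidable n X vs P" "writes n X vs (\<lambda>e. cform (G e))" "writes n X vs (\<lambda>e. cform (H e))"
  shows "writes n X vs (\<lambda>e. cform (if P e then G e else H e))"
proof -
  have "encode (cform (if P e then G e else H e)) = (if P e then encode (cform (G e)) else encode (cform (H e)))" for e
    by simp
  then show ?thesis using emits_if_decidable[OF assms(1)] assms(2,3) unfolding writes_def by presburger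
qed

section \<open>Tableaux\<close>

fun shift :: "move \<Rightarrow> nat \<Rightarrow> nat" where
  "shift Left i = i - 1"
| "shift Stay i = i"
| "shift Right i = Suc i"

text \<open>\<open>M\<close> is meant to decide the verifying language over \<open>m\<close> letters
  in time \<open>q\<close>, and \<open>p\<close> to bound the length of certificates. By
  \<open>n < m\<close> the separator is one of the letters of that language.\<close>

locale verifier =
  fixes M :: tm and n m :: nat and p q :: "nat poly"
  assumes wf: "wf_tm M" and n: "n < m" and m: "m < symbols M"
begin

text \<open>
  The window of a tape consists of the cells at distance at most \<open>center k + 1\<close> from the origin,
  which is the cell number \<open>center k\<close> of the window.
\<close>

definition duration :: "nat \<Rightarrow> nat" where
  "duration k = poly q (k + 1 + poly p k)"

text \<open>Larger than the duration of the run and than the length of the input with separator and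
  certificate. Hence neither the heads nor the written words come near the border of the
  window.\<close>

definition center :: "nat \<Rightarrow> nat" where
  "center k = duration k + k + poly p k + 5"

definition window :: "nat \<Rightarrow> nat" where
  "window k = 2 * center k + 3"

text \<open>Variables are numbered in mixed radix by time, cell and kind \<open>c\<close>. Kind
  \<open>0\<close> is for the row, the next \<open>tapes M\<close> kinds are for the heads and the
  last ones for the cells; rows and heads use only the cell number \<open>0\<close>.\<close>

definition var :: "nat \<Rightarrow> nat \<Rightarrow> nat \<Rightarrow> nat \<Rightarrow> nat" where
  "var k t i c = (t * window k + i) * (2 * tapes M + 1) + c"

definition row_var :: "nat \<Rightarrow> nat \<Rightarrow> nat" where
  "row_var k t = var k t 0 0"

definition head_var :: "nat \<Rightarrow> nat \<Rightarrow> nat \<Rightarrow> nat" where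
  "head_var k t j = var k t 0 (Suc j)"

definition cell_var :: "nat \<Rightarrow> nat \<Rightarrow> nat \<Rightarrow> nat \<Rightarrow> nat" where
  "cell_var k t j i = var k t i (Suc (tapes M + j))"

text \<open>A row is a possible argument of the transition function. A single variable that ranges
  over rows makes a step of the machine a case distinction on one value, with a number of cases that
  depends on the machine only.\<close>

definition rows :: "(nat \<times> nat list) list" where
  "rows = List.product [0..<states M] (List.n_lists (tapes M) [0..<symbols M])"

text \<open>A halting row is given the action that changes nothing, so that a halted configuration
  is repeated until the last line of the tableau.\<close>

definition action :: "nat \<times> nat list \<Rightarrow> nat \<times> (nat \<times> move) list" where
  "action r = (case delta M (fst r) (snd r) of None \<Rightarrow> (fst r, map (\<lambda>s. (s, Stay)) (snd r)) | Some a \<Rightarrow> a)"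

text \<open>
  The cells after the separator \<open>n\<close> are guessed. They hold a word because a blank can only be
  followed by a blank.
\<close>

definition input_cell :: "nat list \<Rightarrow> nat \<Rightarrow> cf" where
  "input_cell x i =
     (if i < center (length x) then Lit (cell_var (length x) 0 0 i) 0
      else if i < center (length x) + length x then
        orl n (\<lambda>a. if i - center (length x) < length x \<and> x ! (i - center (length x)) = a
          then Lit (cell_var (length x) 0 0 i) (Suc a) else Fls)
      else if i = center (length x) + length x then Lit (cell_var (length x) 0 0 i) (Suc n)
      else if i < center (length x) + length x + 1 + poly p (length x) then
        Or (orl m (\<lambda>a. Lit (cell_var (length x) 0 0 i) (Suc a)))
           (And (Lit (cell_var (length x) 0 0 i) 0) (Lit (cell_var (length x) 0 0 (Suc i)) 0))
      else Lit (cell_var (length x) 0 0 i) 0)"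

definition state_is :: "nat \<Rightarrow> nat \<Rightarrow> nat \<Rightarrow> cf" where
  "state_is k t s = orl (length rows) (\<lambda>c. if fst (rows ! c) = s then Lit (row_var k t) c else Fls)"

definition starts :: "nat list \<Rightarrow> cf" where
  "starts x = And (state_is (length x) 0 0) (andl (tapes M) (\<lambda>j.
     And (Lit (head_var (length x) 0 j) (center (length x)))
       (andl (window (length x)) (\<lambda>i. if j = 0 then input_cell x i else Lit (cell_var (length x) 0 j i) 0))))"

definition reads :: "nat \<Rightarrow> nat \<Rightarrow> nat list \<Rightarrow> cf" where
  "reads k t ss = andl (tapes M) (\<lambda>j. orl (window k) (\<lambda>i.
     And (Lit (head_var k t j) i) (Lit (cell_var k t j i) (ss ! j))))"

definition acts :: "nat \<Rightarrow> nat \<Rightarrow> (nat \<times> move) list \<Rightarrow> cf" where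
  "acts k t as = andl (tapes M) (\<lambda>j. And
     (orl (window k) (\<lambda>i. And (Lit (head_var k t j) i)
       (And (Lit (head_var k (Suc t) j) (shift (snd (as ! j)) i)) (Lit (cell_var k (Suc t) j i) (fst (as ! j))))))
     (andl (window k) (\<lambda>i. Or (Lit (head_var k t j) i)
       (orl (symbols M) (\<lambda>a. And (Lit (cell_var k t j i) a) (Lit (cell_var k (Suc t) j i) a))))))"

definition steps :: "nat \<Rightarrow> nat \<Rightarrow> cf" where
  "steps k t = orl (length rows) (\<lambda>c. And (Lit (row_var k t) c) (And (reads k t (snd (rows ! c)))
     (if t < duration k
      then And (state_is k (Suc t) (fst (action (rows ! c)))) (acts k t (snd (action (rows ! c)))) else Tru)))"

text \<open>The output word \<open>[1]\<close> is stored as the symbol \<open>2\<close>.\<close>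

definition tableau :: "nat list \<Rightarrow> cf" where
  "tableau x = And (starts x) (And (andl (Suc (duration (length x))) (steps (length x)))
     (Lit (cell_var (length x) (duration (length x)) (tapes M - 1) (center (length x))) 2))"

section \<open>The tableau can be written in polynomial time\<close>

lemma num_tableau:
  "num N X vs (\<lambda>e. duration (length (X e)))" "num N X vs (\<lambda>e. center (length (X e)))"
  "num N X vs (\<lambda>e. window (length (X e)))"
  unfolding window_def center_def duration_def
  by (intro num_add num_mult num_const num_length_input num_poly)+

lemma num_var_tableau:
  "num N X vs t \<Longrightarrow> num N X vs i \<Longrightarrow> num N X vs (\<lambda>e. var (length (X e)) (t e) (i e) c)"
  "num N X vs t \<Longrightarrow> num N X vs (\<lambda>e. row_var (length (X e)) (t e))"
  "num N X vs t \<Longrightarrow> num N X vs (\<lambda>e. head_var (length (X e)) (t e) j)"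
  "num N X vs t \<Longrightarrow> num N X vs i \<Longrightarrow> num N X vs (\<lambda>e. cell_var (length (X e)) (t e) j (i e))"
  unfolding row_var_def head_var_def cell_var_def var_def
  by (intro num_add num_mult num_const num_tableau; assumption)+

lemma num_shift: "num N X vs f \<Longrightarrow> num N X vs (\<lambda>e. shift d (f e))"
  by (cases d) (simp_all add: num_diff num_1[simplified] num_const num_Suc)

lemma writes_tableau: "writes n (\<lambda>x. x) [] (\<lambda>x. cform (tableau x))"
  unfolding tableau_def starts_def steps_def reads_def acts_def state_is_def input_cell_def
  by ((rule writes_And writes_Or writes_if writes_Lit writes_Tru writes_Fls
    decidable_const decidable_letter decidable_less decidable_eq num_tableau num_var_tableau num_shift num_Suc num_add num_diff
    num_const num_length_input num_poly writes_orl_const writes_andl_const writes_orl writes_andl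
    | (rule num_var, simp; fail))+)

end

lemma poly_nat_mono: "a \<le> b \<Longrightarrow> poly (r :: nat poly) a \<le> poly r b"
  by (induction r) (auto intro!: add_mono mult_mono)

context verifier
begin

section \<open>Assignments and runs of the machine\<close>

definition scanned :: "tape list \<Rightarrow> nat list" where
  "scanned tps = map (\<lambda>(t, h). t h) tps"

definition tidy :: "nat \<Rightarrow> config \<Rightarrow> bool" where
  "tidy t c \<longleftrightarrow> fst c < states M \<and> length (snd c) = tapes M \<and>
     (\<forall>(f, h) \<in> set (snd c). \<bar>h\<bar> \<le> int t \<and> range f \<subseteq> {..<symbols M})"

lemma step_action: "step M (s, tps) = (fst (action (s, scanned tps)), map2 act tps (snd (action (s, scanned tps))))"
proof -
  have "map2 act tps (map (\<lambda>s. (s, Stay)) (scanned tps)) = tps"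
    by (induction tps) (auto simp: scanned_def fun_eq_iff)
  then show ?thesis
    by (auto simp: step_def next_action_def action_def scanned_def[symmetric] split: option.split)
qed

lemma rows_iff: "r \<in> set rows \<longleftrightarrow> fst r < states M \<and> length (snd r) = tapes M \<and> set (snd r) \<subseteq> {..<symbols M}"
  by (cases r) (auto simp: rows_def set_n_lists)

lemma scanned_row: "tidy t (s, tps) \<Longrightarrow> (s, scanned tps) \<in> set rows"
  unfolding rows_iff tidy_def scanned_def by fastforce

lemma action_wf:
  assumes "r \<in> set rows"
  shows "fst (action r) < states M" "length (snd (action r)) = tapes M" "\<forall>(s, d) \<in> set (snd (action r)). s < symbols M"
proof -
  have r: "fst r < states M" "length (snd r) = tapes M" "set (snd r) \<subseteq> {..<symbols M}"
    using assms by (simp_all add: rows_iff)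
  have "fst (action r) < states M \<and> length (snd (action r)) = tapes M \<and> (\<forall>(s, d) \<in> set (snd (action r)). s < symbols M)"
  proof (cases "delta M (fst r) (snd r)")
    case None
    then show ?thesis using r by (auto simp: action_def)
  next
    case (Some a)
    then show ?thesis using r wf unfolding action_def wf_tm_def by (cases a) simp
  qed
  then show "fst (action r) < states M" "length (snd (action r)) = tapes M" "\<forall>(s, d) \<in> set (snd (action r)). s < symbols M"
    by auto
qed

lemma offset_bound: "\<bar>offset d\<bar> \<le> 1"
  by (cases d) auto

lemma act_tidy:
  assumes "\<bar>h\<bar> \<le> int t" "range f \<subseteq> {..<symbols M}" "s < symbols M"
  shows "\<bar>snd (act (f, h) (s, d))\<bar> \<le> int (Suc t)" "range (fst (act (f, h) (s, d))) \<subseteq> {..<symbols M}"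
  using assms offset_bound[of d] by auto

lemma tidy_step:
  assumes "tidy t c"
  shows "tidy (Suc t) (step M c)"
proof -
  obtain s tps where c: "c = (s, tps)" by (cases c)
  define a where "a = action (s, scanned tps)"
  have a: "fst a < states M" "length (snd a) = tapes M" "\<forall>(s, d) \<in> set (snd a). s < symbols M"
    using action_wf[OF scanned_row] assms unfolding a_def c by blast+
  have "\<bar>snd u\<bar> \<le> int (Suc t) \<and> range (fst u) \<subseteq> {..<symbols M}" if u: "u \<in> set (map2 act tps (snd a))" for u
  proof -
    from u obtain v b where vb: "(v, b) \<in> set (zip tps (snd a))" "u = act v b" by auto
    obtain f h where v: "v = (f, h)" by (cases v)
    obtain s' d where b: "b = (s', d)" by (cases b)
    have in_sets: "v \<in> set tps" "b \<in> set (snd a)" using vb(1) by (auto dest: set_zip_leftD set_zip_rightD)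
    have "\<forall>(f, h) \<in> set tps. \<bar>h\<bar> \<le> int t \<and> range f \<subseteq> {..<symbols M}"
      using assms unfolding c tidy_def by simp
    from bspec[OF this in_sets(1)] bspec[OF a(3) in_sets(2)]
    have "\<bar>h\<bar> \<le> int t" "range f \<subseteq> {..<symbols M}" "s' < symbols M" by (simp_all add: v b)
    from act_tidy[OF this] show ?thesis unfolding vb(2) v b by blast
  qed
  then have *: "\<forall>(f, h) \<in> set (map2 act tps (snd a)). \<bar>h\<bar> \<le> int (Suc t) \<and> range f \<subseteq> {..<symbols M}"
    unfolding case_prod_beta by blast
  have "length (map2 act tps (snd a)) = tapes M" using a(2) assms by (simp add: c tidy_def)
  then show ?thesis
    unfolding tidy_def c step_action a_def[symmetric] fst_conv snd_conv using a(1) * by blast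
qed

lemma tidy_init: "w \<in> lists {..<m} \<Longrightarrow> tidy 0 (init M w)"
proof -
  assume w: "w \<in> lists {..<m}"
  have "contents w i < symbols M" for i
  proof (cases "0 \<le> i \<and> i < int (length w)")
    case True
    then have "w ! nat i \<in> set w" by (intro nth_mem) linarith
    then show ?thesis using True w m by (auto simp: contents_def)
  qed (use m in \<open>auto simp: contents_def\<close>)
  moreover have "contents [] i < symbols M" for i using m by (simp add: contents_def)
  ultimately show ?thesis using wf by (auto simp: tidy_def init_def wf_tm_def)
qed

definition run :: "nat list \<Rightarrow> nat \<Rightarrow> config" where
  "run w t = (step M ^^ t) (init M w)"

lemma run_Suc: "run w (Suc t) = step M (run w t)"
  by (simp add: run_def)

lemma tidy_run: "w \<in> lists {..<m} \<Longrightarrow> tidy t (run w t)"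
  by (induction t) (simp_all add: run_def tidy_init tidy_step)

definition content_at :: "nat \<Rightarrow> config \<Rightarrow> nat \<Rightarrow> nat \<Rightarrow> nat" where
  "content_at k c j i = fst (snd c ! j) (int i - int (center k))"

definition head_at :: "nat \<Rightarrow> config \<Rightarrow> nat \<Rightarrow> nat" where
  "head_at k c j = nat (snd (snd c ! j) + int (center k))"

text \<open>Of the row variable only the state is prescribed here. Its scanned symbols are fixed by
  the constraint \<open>reads\<close> for the same time, as they depend on heads and cells.\<close>

definition describes :: "nat \<Rightarrow> (nat \<Rightarrow> nat) \<Rightarrow> nat \<Rightarrow> config \<Rightarrow> bool" where
  "describes k \<alpha> t c \<longleftrightarrow> \<alpha> (row_var k t) < length rows \<and> fst (rows ! \<alpha> (row_var k t)) = fst c \<and>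
     (\<forall>j < tapes M. \<alpha> (head_var k t j) = head_at k c j \<and> (\<forall>i < window k. \<alpha> (cell_var k t j i) = content_at k c j i))"

lemma head_window:
  assumes "tidy t c" "t \<le> duration k" "j < tapes M"
  shows "int (head_at k c j) = snd (snd c ! j) + int (center k)" "0 < head_at k c j" "Suc (head_at k c j) < window k"
proof -
  have "\<bar>snd (snd c ! j)\<bar> \<le> int t"
    using assms(1,3) nth_mem[of j "snd c"] unfolding tidy_def by fastforce
  moreover have "t < center k" using assms(2) by (simp add: center_def)
  moreover from calculation show "int (head_at k c j) = snd (snd c ! j) + int (center k)"
    unfolding head_at_def by linarith
  ultimately show "0 < head_at k c j" "Suc (head_at k c j) < window k" unfolding window_def by linarith+
qed

lemma content_at_head:
  assumes "tidy t c" "t \<le> duration k" "j < tapes M"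
  shows "content_at k c j (head_at k c j) = scanned (snd c) ! j"
  using head_window(1)[OF assms] assms(1,3) by (simp add: content_at_def scanned_def tidy_def case_prod_beta)

lemma step_at:
  assumes c: "tidy t c" and t: "t \<le> duration k" and j: "j < tapes M" and a: "a = snd (action (fst c, scanned (snd c))) ! j"
  shows "head_at k (step M c) j = shift (snd a) (head_at k c j)"
    and "content_at k (step M c) j i = (if i = head_at k c j then fst a else content_at k c j i)"
proof -
  obtain s tps where st: "c = (s, tps)" by (cases c)
  obtain f h where fh: "tps ! j = (f, h)" by (cases "tps ! j")
  obtain s' d where a': "a = (s', d)" by (cases a)
  have "length (snd (action (s, scanned tps))) = tapes M" "length tps = tapes M"
    using action_wf(2)[OF scanned_row] c unfolding st by (auto simp: tidy_def)
  moreover have "snd (action (s, scanned tps)) ! j = (s', d)" using a a' by (simp add: st)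
  ultimately have new: "snd (step M c) ! j = (f(h := s'), h + offset d)"
    using j fh by (simp add: st step_action)
  have hd: "int (head_at k c j) = h + int (center k)" "0 < head_at k c j"
    using head_window[OF c t j] by (simp_all add: st fh)
  show "head_at k (step M c) j = shift (snd a) (head_at k c j)"
  proof -
    have "int (shift d (head_at k c j)) = int (head_at k c j) + offset d"
      using hd(2) by (cases d) (auto simp: of_nat_diff)
    then have "nat (h + offset d + int (center k)) = shift d (head_at k c j)" using hd(1) by linarith
    then show ?thesis by (simp add: head_at_def new a')
  qed
  have "int i - int (center k) = h \<longleftrightarrow> i = head_at k c j" using hd(1) by linarith
  then show "content_at k (step M c) j i = (if i = head_at k c j then fst a else content_at k c j i)"
    using a' fh by (cases "i = head_at k c j") (simp_all add: content_at_def new, simp add: st)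
qed

lemma describes_reads:
  assumes "describes k \<alpha> t c" "tidy t c" "t \<le> duration k" "length ss = tapes M"
  shows "cval \<alpha> (reads k t ss) \<longleftrightarrow> ss = scanned (snd c)"
proof -
  have "(\<exists>i < window k. \<alpha> (head_var k t j) = i \<and> \<alpha> (cell_var k t j i) = ss ! j) \<longleftrightarrow> ss ! j = scanned (snd c) ! j"
    if j: "j < tapes M" for j
  proof -
    have "head_at k c j < window k" using head_window(3)[OF assms(2,3) j] by simp
    then show ?thesis using assms(1) j content_at_head[OF assms(2,3) j] unfolding describes_def by auto
  qed
  moreover have "length (scanned (snd c)) = tapes M" using assms(2) by (simp add: tidy_def scanned_def)
  ultimately show ?thesis using assms(4) by (auto simp: reads_def list_eq_iff_nth_eq)
qed

lemma describes_acts: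
  assumes "describes k \<alpha> t c" "tidy t c" "t \<le> duration k" "as = snd (action (fst c, scanned (snd c)))"
  shows "cval \<alpha> (acts k t as) \<longleftrightarrow>
    (\<forall>j < tapes M. \<alpha> (head_var k (Suc t) j) = head_at k (step M c) j \<and>
      (\<forall>i < window k. \<alpha> (cell_var k (Suc t) j i) = content_at k (step M c) j i))"
proof -
  have "(\<exists>i < window k. \<alpha> (head_var k t j) = i \<and> \<alpha> (head_var k (Suc t) j) = shift (snd (as ! j)) i \<and>
        \<alpha> (cell_var k (Suc t) j i) = fst (as ! j)) \<and>
      (\<forall>i < window k. \<alpha> (head_var k t j) = i \<or>
        (\<exists>a < symbols M. \<alpha> (cell_var k t j i) = a \<and> \<alpha> (cell_var k (Suc t) j i) = a)) \<longleftrightarrow>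
    \<alpha> (head_var k (Suc t) j) = head_at k (step M c) j \<and>
      (\<forall>i < window k. \<alpha> (cell_var k (Suc t) j i) = content_at k (step M c) j i)"
    if j: "j < tapes M" for j
  proof -
    have hw: "head_at k c j < window k" using head_window(3)[OF assms(2,3) j] by simp
    have \<alpha>: "\<alpha> (head_var k t j) = head_at k c j" "\<And>i. i < window k \<Longrightarrow> \<alpha> (cell_var k t j i) = content_at k c j i"
      using assms(1) j unfolding describes_def by auto
    have "snd c ! j \<in> set (snd c)" using assms(2) j by (simp add: tidy_def)
    then have lt: "content_at k c j i < symbols M" for i
      using assms(2) unfolding tidy_def content_at_def by fastforce
    note st = step_at[OF assms(2,3) j, of "as ! j", unfolded assms(4), OF refl, folded assms(4)]
    show ?thesis using hw \<alpha> lt by (auto simp: st)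
  qed
  then show ?thesis by (simp add: acts_def)
qed

lemma cval_state_is:
  "cval \<alpha> (state_is k t s) \<longleftrightarrow> \<alpha> (row_var k t) < length rows \<and> fst (rows ! \<alpha> (row_var k t)) = s"
  by (auto simp: state_is_def)

lemma describes_steps:
  assumes d: "describes k \<alpha> t c" and c: "tidy t c" and t: "t \<le> duration k"
  shows "cval \<alpha> (steps k t) \<longleftrightarrow> rows ! \<alpha> (row_var k t) = (fst c, scanned (snd c)) \<and>
    (t < duration k \<longrightarrow> describes k \<alpha> (Suc t) (step M c))"
proof -
  define r where "r = rows ! \<alpha> (row_var k t)"
  have r: "\<alpha> (row_var k t) < length rows" "fst r = fst c" using d by (simp_all add: describes_def r_def)
  then have "r \<in> set rows" by (simp add: r_def)
  then have len: "length (snd r) = tapes M" by (simp add: rows_iff)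
  have "cval \<alpha> (steps k t) \<longleftrightarrow> cval \<alpha> (reads k t (snd r)) \<and> (t < duration k \<longrightarrow>
      cval \<alpha> (state_is k (Suc t) (fst (action r))) \<and> cval \<alpha> (acts k t (snd (action r))))"
    using r(1) by (auto simp: steps_def r_def)
  also have "cval \<alpha> (reads k t (snd r)) \<longleftrightarrow> r = (fst c, scanned (snd c))"
    using describes_reads[OF d c t len] r(2) by (simp add: prod_eq_iff)
  finally show ?thesis
    unfolding r_def[symmetric] cval_state_is describes_def
    using describes_acts[OF d c t] by (auto simp: step_action[of "fst c" "snd c", simplified])
qed

lemma describes_run:
  assumes "w \<in> lists {..<m}" "describes k \<alpha> 0 (run w 0)" "\<And>t. t \<le> duration k \<Longrightarrow> cval \<alpha> (steps k t)"
  shows "t \<le> duration k \<Longrightarrow> describes k \<alpha> t (run w t)"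
proof (induction t)
  case (Suc t)
  then have "describes k \<alpha> t (run w t)" by simp
  from describes_steps[OF this tidy_run[OF assms(1)]] assms(3)[of t] Suc.prems show ?case
    by (simp add: run_Suc)
qed (rule assms(2))

text \<open>The first blank \<open>L\<close> ends the word: before it all cells hold letters, and
  after it blanks propagate to the right up to the cell \<open>l\<close>, beyond which all cells are
  blank anyway.\<close>

lemma guessed_word:
  assumes "\<And>j. j < l \<Longrightarrow> (\<exists>a < m. b j = Suc a) \<or> b j = 0 \<and> b (Suc j) = 0" "\<And>j. l \<le> j \<Longrightarrow> j < l' \<Longrightarrow> b j = 0" "l < l'"
  shows "\<exists>y \<in> lists {..<m}. length y \<le> l \<and> (\<forall>j < l'. b j = (if j < length y then Suc (y ! j) else 0))"
proof -
  define L where "L = (LEAST j. b j = 0)"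
  have 0: "b l = 0" using assms(2,3) by simp
  then have L: "b L = 0" "L \<le> l" unfolding L_def by (rule LeastI, rule Least_le)
  have lt: "\<exists>a < m. b j = Suc a" if "j < L" for j
    using not_less_Least[of j "\<lambda>j. b j = 0"] that assms(1)[of j] L(2) by (auto simp: L_def)
  have ge: "b (L + i) = 0" if "L + i < l'" for i
    using that
  proof (induction i)
    case (Suc i)
    then show ?case using assms(1)[of "L + i"] assms(2)[of "Suc (L + i)"] by (cases "L + i < l") auto
  qed (simp add: L(1))
  show ?thesis
  proof (rule bexI[of _ "map (\<lambda>j. b j - 1) [0..<L]"], intro conjI allI impI)
    fix j assume "j < l'"
    then show "b j = (if j < length (map (\<lambda>j. b j - 1) [0..<L]) then Suc (map (\<lambda>j. b j - 1) [0..<L] ! j) else 0)"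
      using lt[of j] ge[of "j - L"] by auto
  qed (use L(2) lt in fastforce)+
qed

lemma center_window: "center k + k + 1 + poly p k < window k" "center k < window k"
  by (simp_all add: window_def center_def)

lemma contents_input:
  "contents (x @ [n] @ y) (int i - int c) =
    (if i < c then 0 else if i < c + length x then Suc (x ! (i - c)) else if i = c + length x then Suc n
     else if i - (c + length x + 1) < length y then Suc (y ! (i - (c + length x + 1))) else 0)"
proof (cases "i < c")
  case False
  define z where "z = i - c"
  have i: "i = c + z" using False by (simp add: z_def)
  have "contents (x @ [n] @ y) (int z) = (if z < length x + 1 + length y then Suc ((x @ [n] @ y) ! z) else 0)"
    by (auto simp: contents_def)
  then show ?thesis by (auto simp: i nth_append nth_Cons')
qed (simp add: contents_def)

lemma input_cells:
  assumes x: "x \<in> lists {..<n}" and k: "k = length x"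
  shows "(\<forall>i < window k. cval \<alpha> (input_cell x i)) \<longleftrightarrow>
    (\<exists>y \<in> lists {..<m}. length y \<le> poly p k \<and>
      (\<forall>i < window k. \<alpha> (cell_var k 0 0 i) = contents (x @ [n] @ y) (int i - int (center k))))"
    (is "?L \<longleftrightarrow> ?R")
proof
  define s where "s = center k + k + 1"
  define b where "b j = \<alpha> (cell_var k 0 0 (s + j))" for j
  assume L: ?L
  have sw: "s + poly p k < window k" using center_window(1) by (simp add: s_def)
  have "(\<exists>a < m. b j = Suc a) \<or> b j = 0 \<and> b (Suc j) = 0" if "j < poly p k" for j
    using L[rule_format, of "s + j"] sw that by (auto simp: input_cell_def k[symmetric] s_def b_def)
  moreover have "b j = 0" if "poly p k \<le> j" "j < window k - s" for j
    using L[rule_format, of "s + j"] that by (auto simp: input_cell_def k[symmetric] s_def b_def)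
  moreover have "poly p k < window k - s" using sw by simp
  ultimately obtain y where y: "y \<in> lists {..<m}" "length y \<le> poly p k"
    "\<forall>j < window k - s. b j = (if j < length y then Suc (y ! j) else 0)"
    using guessed_word[of "poly p k" b "window k - s"] by blast
  have "\<alpha> (cell_var k 0 0 i) = contents (x @ [n] @ y) (int i - int (center k))" if i: "i < window k" for i
  proof (cases "s \<le> i")
    case True
    then have "b (i - s) = (if i - s < length y then Suc (y ! (i - s)) else 0)" using y(3) i by simp
    then show ?thesis using True unfolding contents_input b_def by (simp add: s_def k[symmetric])
  next
    case False
    then show ?thesis using L[rule_format, OF i] unfolding contents_input
      by (auto simp: input_cell_def k[symmetric] s_def split: if_splits)
  qed
  then show ?R using y(1,2) by blast
next
  assume ?R
  then obtain y where y: "y \<in> lists {..<m}" "length y \<le> poly p k"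
    and *: "\<And>i. i < window k \<Longrightarrow> \<alpha> (cell_var k 0 0 i) = contents (x @ [n] @ y) (int i - int (center k))"
    by blast
  have xn: "x ! i < n" if "i < k" for i using x nth_mem[of i x] that by (auto simp: k)
  have ym: "y ! i < m" if "i < length y" for i using y(1) nth_mem[of i y] that by auto
  show ?L
  proof (intro allI impI)
    fix i assume i: "i < window k"
    note cell = *[OF i, unfolded contents_input]
    consider "i < center k" | "center k \<le> i" "i < center k + k" | "i = center k + k"
      | "center k + k < i" "i < center k + k + 1 + poly p k" | "center k + k + 1 + poly p k \<le> i" by linarith
    then show "cval \<alpha> (input_cell x i)"
    proof cases
      case 2
      then have "i - center k < k" by simp
      then show ?thesis using 2 cell xn by (simp add: input_cell_def k[symmetric])
    next
      case 4
      define j where "j = i - (center k + k + 1)"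
      have j: "i = center k + k + 1 + j" using 4 by (simp add: j_def)
      have "Suc i < window k" using 4 center_window(1)[of k] by linarith
      note next_cell = *[OF this, unfolded contents_input]
      show ?thesis
      proof (cases "j < length y")
        case True
        then have "\<alpha> (cell_var k 0 0 i) = Suc (y ! j)" using cell by (simp add: j k[symmetric])
        then show ?thesis using 4 ym[OF True] by (simp add: input_cell_def k[symmetric])
      next
        case False
        then have "\<alpha> (cell_var k 0 0 i) = 0" "\<alpha> (cell_var k 0 0 (Suc i)) = 0"
          using cell next_cell by (simp_all add: j k[symmetric])
        then show ?thesis using 4 by (simp add: input_cell_def k[symmetric])
      qed
    next
      case 5
      then have "\<not> i - (center k + k + 1) < length y" using y(2) by linarith
      then show ?thesis using 5 cell by (simp add: input_cell_def k[symmetric])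
    qed (use cell in \<open>simp_all add: input_cell_def k[symmetric]\<close>)
  qed
qed

lemma describes_init:
  "describes k \<alpha> 0 (run w 0) \<longleftrightarrow> cval \<alpha> (state_is k 0 0) \<and> (\<forall>j < tapes M. \<alpha> (head_var k 0 j) = center k \<and>
     (\<forall>i < window k. \<alpha> (cell_var k 0 j i) = (if j = 0 then contents w (int i - int (center k)) else 0)))"
proof -
  have "snd (run w 0) ! j = (contents (if j = 0 then w else []), 0)" if "j < tapes M" for j
    using that by (auto simp: run_def init_def nth_Cons split: nat.split)
  then show ?thesis
    unfolding describes_def cval_state_is
    by (auto simp: head_at_def content_at_def contents_def run_def init_def)
qed

lemma cval_starts:
  assumes x: "x \<in> lists {..<n}" and k: "k = length x"
  shows "cval \<alpha> (starts x) \<longleftrightarrow>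
    (\<exists>y \<in> lists {..<m}. length y \<le> poly p k \<and> describes k \<alpha> 0 (run (x @ [n] @ y) 0))"
proof -
  have pos: "0 < tapes M" using wf by (simp add: wf_tm_def)
  define Q where "Q j \<longleftrightarrow> \<alpha> (head_var k 0 j) = center k \<and> (j \<noteq> 0 \<longrightarrow> (\<forall>i < window k. \<alpha> (cell_var k 0 j i) = 0))" for j
  have "cval \<alpha> (starts x) \<longleftrightarrow> cval \<alpha> (state_is k 0 0) \<and> (\<forall>j < tapes M. Q j) \<and> (\<forall>i < window k. cval \<alpha> (input_cell x i))"
    using pos unfolding starts_def Q_def k[symmetric] by auto
  moreover have "describes k \<alpha> 0 (run w 0) \<longleftrightarrow> cval \<alpha> (state_is k 0 0) \<and> (\<forall>j < tapes M. Q j) \<and>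
      (\<forall>i < window k. \<alpha> (cell_var k 0 0 i) = contents w (int i - int (center k)))" for w
    using pos unfolding describes_init Q_def by auto
  ultimately show ?thesis unfolding input_cells[OF x k] by blast
qed

lemma accepting:
  assumes "describes k \<alpha> t c" "tidy t c"
  shows "cval \<alpha> (Lit (cell_var k t (tapes M - 1) (center k)) 2) \<longleftrightarrow> fst (last (snd c)) 0 = 2"
proof -
  have "snd c \<noteq> []" "length (snd c) = tapes M" "tapes M - 1 < tapes M" using wf assms(2) by (auto simp: wf_tm_def tidy_def)
  then show ?thesis using assms(1) center_window(2)[of k] by (simp add: describes_def content_at_def last_conv_nth)
qed

lemma var_decode:
  assumes "c < 2 * tapes M + 1" "i < window k"
  shows "var k t i c mod (2 * tapes M + 1) = c" "var k t i c div (2 * tapes M + 1) mod window k = i"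
    "var k t i c div (2 * tapes M + 1) div window k = t"
proof -
  have *: "(a * b + d) div b = a" "(a * b + d) mod b = d" if "d < b" for a b d :: nat
    using that by simp_all
  show "var k t i c mod (2 * tapes M + 1) = c" "var k t i c div (2 * tapes M + 1) mod window k = i"
    "var k t i c div (2 * tapes M + 1) div window k = t"
    unfolding var_def *[OF assms(1)] *[OF assms(2)] by (rule refl)+
qed

text \<open>The assignment decodes a number into time, cell and kind and looks up the value in the
  configuration of that time. Kinds and cell numbers stay below their radices, so the decoding is
  unambiguous.\<close>

lemma describing_assignment:
  assumes "\<And>t. tidy t (cs t)"
  shows "\<exists>\<alpha>. \<forall>t. describes k \<alpha> t (cs t) \<and> rows ! \<alpha> (row_var k t) = (fst (cs t), scanned (snd (cs t)))"
proof -
  have "\<exists>r < length rows. rows ! r = (fst (cs t), scanned (snd (cs t)))" for t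
    using scanned_row[of t "fst (cs t)" "snd (cs t)"] assms by (simp add: in_set_conv_nth)
  then obtain \<rho> where \<rho>: "\<And>t. \<rho> t < length rows" "\<And>t. rows ! \<rho> t = (fst (cs t), scanned (snd (cs t)))" by metis
  define \<alpha> where "\<alpha> X = (let c = X mod (2 * tapes M + 1); i = X div (2 * tapes M + 1) mod window k;
      t = X div (2 * tapes M + 1) div window k
    in if c = 0 then \<rho> t else if c \<le> tapes M then head_at k (cs t) (c - 1) else content_at k (cs t) (c - Suc (tapes M)) i)" for X
  have \<alpha>: "\<alpha> (var k t i c) = (if c = 0 then \<rho> t else if c \<le> tapes M then head_at k (cs t) (c - 1)
      else content_at k (cs t) (c - Suc (tapes M)) i)" if "c < 2 * tapes M + 1" "i < window k" for t i c
    unfolding \<alpha>_def Let_def var_decode[OF that] ..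
  have "0 < window k" by (simp add: window_def)
  then have "\<alpha> (row_var k t) = \<rho> t" "j < tapes M \<Longrightarrow> \<alpha> (head_var k t j) = head_at k (cs t) j"
    "j < tapes M \<Longrightarrow> i < window k \<Longrightarrow> \<alpha> (cell_var k t j i) = content_at k (cs t) j i" for t j i
    unfolding row_var_def head_var_def cell_var_def by (simp_all add: \<alpha>)
  then show ?thesis using \<rho> by (intro exI[of _ \<alpha>]) (simp add: describes_def)
qed

theorem tableau_satisfiable:
  assumes x: "x \<in> lists {..<n}"
  shows "(\<exists>\<alpha>. cval \<alpha> (tableau x)) \<longleftrightarrow> (\<exists>y \<in> lists {..<m}. length y \<le> poly p (length x) \<and>
    fst (last (snd (run (x @ [n] @ y) (duration (length x))))) 0 = 2)"
proof -
  define k where "k = length x"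
  have w: "x @ [n] @ y \<in> lists {..<m}" if "y \<in> lists {..<m}" for y
    using x n that by (auto intro: less_trans)
  have tab: "cval \<alpha> (tableau x) \<longleftrightarrow> cval \<alpha> (starts x) \<and> (\<forall>t \<le> duration k. cval \<alpha> (steps k t)) \<and>
      cval \<alpha> (Lit (cell_var k (duration k) (tapes M - 1) (center k)) 2)" for \<alpha>
    by (simp add: tableau_def k_def less_Suc_eq_le)
  show ?thesis unfolding k_def[symmetric]
  proof
    assume "\<exists>\<alpha>. cval \<alpha> (tableau x)"
    then obtain \<alpha> where \<alpha>: "cval \<alpha> (starts x)" "\<And>t. t \<le> duration k \<Longrightarrow> cval \<alpha> (steps k t)"
      "cval \<alpha> (Lit (cell_var k (duration k) (tapes M - 1) (center k)) 2)"
      unfolding tab by blast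
    obtain y where y: "y \<in> lists {..<m}" "length y \<le> poly p k" "describes k \<alpha> 0 (run (x @ [n] @ y) 0)"
      using \<alpha>(1) unfolding cval_starts[OF x k_def] by blast
    have "describes k \<alpha> (duration k) (run (x @ [n] @ y) (duration k))"
      using describes_run[OF w[OF y(1)] y(3) \<alpha>(2)] by simp
    from accepting[OF this tidy_run[OF w[OF y(1)]]] \<alpha>(3) y(1,2)
    show "\<exists>y \<in> lists {..<m}. length y \<le> poly p k \<and> fst (last (snd (run (x @ [n] @ y) (duration k)))) 0 = 2" by blast
  next
    assume "\<exists>y \<in> lists {..<m}. length y \<le> poly p k \<and> fst (last (snd (run (x @ [n] @ y) (duration k)))) 0 = 2"
    then obtain y where y: "y \<in> lists {..<m}" "length y \<le> poly p k"
      "fst (last (snd (run (x @ [n] @ y) (duration k)))) 0 = 2" by blast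
    note tidy = tidy_run[OF w[OF y(1)]]
    obtain \<alpha> where \<alpha>: "\<And>t. describes k \<alpha> t (run (x @ [n] @ y) t)"
      "\<And>t. rows ! \<alpha> (row_var k t) = (fst (run (x @ [n] @ y) t), scanned (snd (run (x @ [n] @ y) t)))"
      using describing_assignment[of "run (x @ [n] @ y)" k] tidy by blast
    have "cval \<alpha> (steps k t)" if "t \<le> duration k" for t
      using describes_steps[OF \<alpha>(1) tidy that] \<alpha>(1)[of "Suc t"] \<alpha>(2) by (simp add: run_Suc)
    moreover have "cval \<alpha> (starts x)" using cval_starts[OF x k_def] y(1,2) \<alpha>(1) by blast
    ultimately show "\<exists>\<alpha>. cval \<alpha> (tableau x)" unfolding tab using accepting[OF \<alpha>(1) tidy] y(3) by blast
  qed
qed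

end

section \<open>Hardness for NP\<close>

lemma step_halted: "halted M c \<Longrightarrow> (step M ^^ t) c = c"
  by (induction t) (simp_all add: halted_def step_def)

section \<open>Unique readability of encoded formulas\<close>

lemma binary_value: "foldl (\<lambda>a d. 2 * a + d) 0 (binary a) = a"
  by (induction a rule: binary.induct) (subst binary.simps, simp)

lemma binary_inj [simp]: "binary a = binary b \<longleftrightarrow> a = b"
  by (metis binary_value)

text \<open>All letters other than digits are at least \<open>2\<close>, so a numeral can be
  recovered as the longest prefix of digits.\<close>

lemma binary_prefix:
  assumes "binary a @ u = binary b @ v" "u = [] \<or> 2 \<le> hd u" "v = [] \<or> 2 \<le> hd v"
  shows "a = b \<and> u = v"
proof -
  have "takeWhile (\<lambda>d. d < 2) (binary a @ u) = binary a" if "u = [] \<or> 2 \<le> hd u" for a u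
  proof -
    have "d < 2" if "d \<in> set (binary a)" for d using binary_digits[OF that] by auto
    then have "takeWhile (\<lambda>d. d < 2) (binary a @ u) = binary a @ takeWhile (\<lambda>d. d < 2) u" by simp
    then show ?thesis using that by (cases u) auto
  qed
  then have "binary a = binary b" using assms by metis
  then show ?thesis using assms(1) binary_value by (metis same_append_eq)
qed

lemma hd_encode: "2 \<le> hd (encode F @ u)"
  by (cases F) auto

text \<open>The words \<open>u\<close> and \<open>v\<close> must not begin with a digit, as it would
  extend a final numeral. Inside a formula this is guaranteed because no encoding begins with a
  digit. The resulting injectivity is essential: membership of a code in the problem then says that
  the encoded formula itself is provable.\<close>

lemma encode_prefix:
  "encode F @ u = encode G @ v \<Longrightarrow> u = [] \<or> 2 \<le> hd u \<Longrightarrow> v = [] \<or> 2 \<le> hd v \<Longrightarrow> F = G \<and> u = v"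
proof (induction F arbitrary: G u v)
  case (Atom a)
  then show ?case by (cases G) (auto dest: binary_prefix)
next
  case (NegAtom a)
  then show ?case by (cases G) (auto dest: binary_prefix)
next
  case (Conj A B)
  obtain A' B' where G: "G = Conj A' B'" using Conj.prems(1) by (cases G) auto
  have "encode A @ (encode B @ u) = encode A' @ (encode B' @ v)" using Conj.prems(1) by (simp add: G)
  then have "A = A' \<and> encode B @ u = encode B' @ v" using Conj.IH(1) hd_encode by blast
  then show ?case using Conj.IH(2)[OF _ Conj.prems(2,3)] by (simp add: G)
next
  case (Disj A B)
  obtain A' B' where G: "G = Disj A' B'" using Disj.prems(1) by (cases G) auto
  have "encode A @ (encode B @ u) = encode A' @ (encode B' @ v)" using Disj.prems(1) by (simp add: G)
  then have "A = A' \<and> encode B @ u = encode B' @ v" using Disj.IH(1) hd_encode by blast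
  then show ?case using Disj.IH(2)[OF _ Disj.prems(2,3)] by (simp add: G)
qed

lemma encode_inj: "inj encode"
  using encode_prefix[of _ "[]" _ "[]"] by (auto intro: injI)

lemma poly_reducible_formula:
  assumes "emits n (\<lambda>x. x) [] (\<lambda>x. encode (f x))" "\<And>x. x \<in> lists {..<n} \<Longrightarrow> x \<in> A \<longleftrightarrow> CL5m_provable (f x)"
  shows "poly_reducible n A 6 (encode ` {F. CL5m_provable F})"
  unfolding poly_reducible_def
  using poly_time_computable_emits[OF assms(1)] assms(2) encode_letters inj_image_mem_iff[OF encode_inj]
  by (intro exI[of _ "\<lambda>x. encode (f x)"]) auto

text \<open>Provides an unprovable formula as the constant value of the reduction of an empty
  problem.\<close>

lemma not_provable_Atom: "\<not> CL5m_provable (Atom a)"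
proof
  assume "CL5m_provable (Atom a)"
  then obtain \<sigma> D x L where x: "erase \<sigma> x = Atom a" "\<And>v. holds v x"
    by (rule provable_certificate) blast
  show False using x(1) x(2)[of "\<lambda>_. False"] by (cases x) auto
qed

theorem NP_hard_provable: "NP_hard 6 (encode ` {F. CL5m_provable F})"
  unfolding NP_hard_def
proof (intro allI impI)
  fix n A assume "in_NP n A"
  then obtain m B p where A: "A \<subseteq> lists {..<n}" and B: "in_P m B"
    and AB: "\<And>x. x \<in> lists {..<n} \<Longrightarrow> x \<in> A \<longleftrightarrow>
      (\<exists>y \<in> lists {..<m}. length y \<le> poly p (length x) \<and> x @ [n] @ y \<in> B)"
    unfolding in_NP_def by blast
  obtain M and q :: "nat poly" where M: "wf_tm M" "m < symbols M"
    and q: "\<And>w. w \<in> lists {..<m} \<Longrightarrow> halted M ((step M ^^ poly q (length w)) (init M w)) \<and>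
      fst (last (snd ((step M ^^ poly q (length w)) (init M w)))) = contents (if w \<in> B then [1] else [0])"
    using B unfolding in_P_def poly_time_computable_def Let_def by blast
  show "poly_reducible n A 6 (encode ` {F. CL5m_provable F})"
  proof (cases "n < m")
    case True
    interpret verifier M n m p q using M True by unfold_locales
    show ?thesis
    proof (rule poly_reducible_formula)
      show "emits n (\<lambda>x. x) [] (\<lambda>x. encode (choice_formula (tableau x)))"
        using writes_choice_formula[OF writes_tableau] unfolding writes_def .
      fix x assume x: "x \<in> lists {..<n}"
      have "x @ [n] @ y \<in> B \<longleftrightarrow> fst (last (snd (run (x @ [n] @ y) (duration (length x))))) 0 = 2"
        if y: "y \<in> lists {..<m}" "length y \<le> poly p (length x)" for y
      proof -
        define w where "w = x @ [n] @ y"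
        have w: "w \<in> lists {..<m}" using x y(1) True unfolding w_def by (auto intro: less_trans)
        \<comment> \<open>The duration is computed from the maximal length of a certificate, so for
          a shorter one the machine may halt earlier; its halted configuration is then
          repeated.\<close>
        have "poly q (length w) \<le> duration (length x)"
          unfolding duration_def w_def using y(2) by (intro poly_nat_mono) simp
        then obtain t where "duration (length x) = t + poly q (length w)" by (metis le_add_diff_inverse2)
        then have "run w (duration (length x)) = (step M ^^ poly q (length w)) (init M w)"
          using step_halted q[OF w] by (simp add: run_def funpow_add)
        then show ?thesis using q[OF w] unfolding w_def[symmetric] by (simp add: contents_def)
      qed
      then show "x \<in> A \<longleftrightarrow> CL5m_provable (choice_formula (tableau x))"
        unfolding choice_formula_iff tableau_satisfiable[OF x] AB[OF x] by blast
    qed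
  next
    \<comment> \<open>If the separator is not a letter of the verifying language, then no word
      \<open>x @ [n] @ y\<close> belongs to \<open>B\<close>. So \<open>A\<close> is empty, and a
      fixed unprovable formula is the value of the reduction everywhere.\<close>
    case False
    then have "x \<notin> A" if "x \<in> lists {..<n}" for x
      using AB[OF that] B unfolding in_P_def by auto
    then show ?thesis
      using writes_Atom_0(1)[of n "\<lambda>x. x" "[]"] not_provable_Atom
      by (intro poly_reducible_formula[of n "\<lambda>_. Atom 0"]) (simp_all add: writes_def)
  qed
qed

theorem theorem3p5: "NP_complete 6 (encode ` {F. CL5m_provable F})"
  unfolding NP_complete_def using in_NP_provable NP_hard_provable by blast

end
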